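(* Let $d\ge 1$, let $m>0$, and let $F:\mathbb{C}^{d_0}\to\mathbb{C}^{d_0}$ be smooth and vanish at least at order $2$ at $0$, where $d_0=2^{\lfloor (d+1)/2\rfloor}$. Let $s>\frac{9}{2}d+9$. Then there exist $\epsilon_0>0$ and $c>0$ such that for every $\epsilon\in(0,\epsilon_0]$ and every $\psi_0\in H^s(\mathbb{T}^d,\mathbb{C}^{d_0})$ with $\|\psi_0\|_{H^s}\le\epsilon$, the Cauchy problem $$-\mathbf{i}\sum_{\mu=0}^d\gamma^{\mu}\frac{\partial\psi}{\partial x^{\mu}}+m\psi=F(\psi),\qquad \psi(0,\cdot)=\psi_0,$$ admits a unique solution $$\psi\in C^0\big((-T_\epsilon,T_\epsilon),H^s(\mathbb{T}^d,\mathbb{C}^{d_0})\big)\cap C^1\big((-T_\epsilon,T_\epsilon),H^{s-1}(\mathbb{T}^d,\mathbb{C}^{d_0})\big)$$ with $T_\epsilon\ge c\,\epsilon^{-2}$.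
   Context: $\mathbb{T}^d=(\mathbb{R}/2\pi\mathbb{Z})^d$ is the flat torus, $\mathbf{i}$ is the imaginary unit, $x^0=t\in\mathbb{R}$ is time and $x=(x^1,\dots,x^d)\in\mathbb{T}^d$. $\lfloor x\rfloor$ is the integer part of $x$. The unknown spinor is $\psi:\mathbb{R}\times\mathbb{T}^d\to\mathbb{C}^{d_0}$ (or defined on a time subinterval). The $\gamma^\mu$, $\mu=0,\dots,d$, are the Dirac matrices: fixed complex $d_0\times d_0$ matrices with $\gamma^\mu\gamma^\nu+\gamma^\nu\gamma^\mu=2\eta^{\mu\nu}I_{d_0}$, $\eta=\mathrm{diag}(1,-1,\dots,-1)$, $\gamma^0$ Hermitian and $\gamma^1,\dots,\gamma^d$ anti-Hermitian. $H^s$ is the $L^2$-based Sobolev space. *)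

theory Defs
  imports "HOL-Analysis.Analysis"
begin

section \<open>Smooth maps between real normed spaces\<close>

text \<open>Differentiability is over the reals, also for maps between complex spaces.\<close>

fun Ck :: "nat \<Rightarrow> ('a::real_normed_vector \<Rightarrow> 'b::real_normed_vector) \<Rightarrow> bool" where
  "Ck 0 f \<longleftrightarrow> continuous_on UNIV f"
| "Ck (Suc k) f \<longleftrightarrow>
     (\<forall>x. f differentiable (at x)) \<and> (\<forall>v. Ck k (\<lambda>x. frechet_derivative f (at x) v))"

definition smooth :: "('a::real_normed_vector \<Rightarrow> 'b::real_normed_vector) \<Rightarrow> bool" where
  "smooth f \<longleftrightarrow> (\<forall>k. Ck k f)"


section \<open>Functions on the flat torus\<close>

text \<open>
  The torus has dimension \<^term>\<open>CARD('d)\<close>. A function on it is a function on \<^typ>\<open>real ^ 'd\<close>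
  that is \<open>2 \<pi>\<close>-periodic in each coordinate; elements of \<open>L\<^sup>2\<close> and \<open>H\<^sup>s\<close> are represented by
  everywhere defined functions, to be identified when they agree almost everywhere.
\<close>

definition periodic :: "(real ^ 'd \<Rightarrow> 'b) \<Rightarrow> bool" where
  "periodic u \<longleftrightarrow> (\<forall>x j. u (x + axis j (2 * pi)) = u x)"

definition cell :: "(real ^ 'd) set" where
  "cell = cbox 0 (\<chi> j. 2 * pi)"

definition L2 :: "(real ^ 'd \<Rightarrow> complex ^ 'n) set" where
  "L2 = {u. periodic u \<and> u \<in> borel_measurable lebesgue \<and>
            set_integrable lebesgue cell (\<lambda>x. (norm (u x))\<^sup>2)}"

definition fourier_coeff :: "(real ^ 'd \<Rightarrow> complex ^ 'n) \<Rightarrow> int ^ 'd \<Rightarrow> complex ^ 'n" where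
  "fourier_coeff u k =
     (1 / (2 * pi) ^ CARD('d)) *\<^sub>R
     (LINT x:cell|lebesgue. cis (- (\<Sum>j\<in>UNIV. of_int (k $ j) * x $ j)) *s u x)"

definition sobolev_weight :: "real \<Rightarrow> int ^ 'd \<Rightarrow> real" where
  "sobolev_weight s k = (1 + (\<Sum>j\<in>UNIV. (of_int (k $ j))\<^sup>2)) powr s"

text \<open>This is the usual space for \<open>s \<ge> 0\<close>; for negative \<open>s\<close> one would have to admit distributions.\<close>

definition Sobolev :: "real \<Rightarrow> (real ^ 'd \<Rightarrow> complex ^ 'n) set" where
  "Sobolev s = {u \<in> L2.
     (\<lambda>k. sobolev_weight s k * (norm (fourier_coeff u k))\<^sup>2) summable_on UNIV}"

definition Sobolev_norm :: "real \<Rightarrow> (real ^ 'd \<Rightarrow> complex ^ 'n) \<Rightarrow> real" where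
  "Sobolev_norm s u =
     sqrt (\<Sum>\<^sub>\<infinity>k\<in>UNIV. sobolev_weight s k * (norm (fourier_coeff u k))\<^sup>2)"

definition has_weak_partial ::
  "(real ^ 'd \<Rightarrow> complex ^ 'n) \<Rightarrow> 'd \<Rightarrow> (real ^ 'd \<Rightarrow> complex ^ 'n) \<Rightarrow> bool" where
  "has_weak_partial u j g \<longleftrightarrow> u \<in> L2 \<and> g \<in> L2 \<and>
     (\<forall>\<phi> :: real ^ 'd \<Rightarrow> real. smooth \<phi> \<and> periodic \<phi> \<longrightarrow>
        (LINT x:cell|lebesgue. frechet_derivative \<phi> (at x) (axis j 1) *\<^sub>R u x) =
        - (LINT x:cell|lebesgue. \<phi> x *\<^sub>R g x))"


section \<open>Curves in Sobolev spaces\<close>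

definition Sobolev_continuous_on ::
  "real \<Rightarrow> real set \<Rightarrow> (real \<Rightarrow> real ^ 'd \<Rightarrow> complex ^ 'n) \<Rightarrow> bool" where
  "Sobolev_continuous_on s I \<psi> \<longleftrightarrow>
     (\<forall>t\<in>I. \<psi> t \<in> Sobolev s) \<and>
     (\<forall>t\<in>I. ((\<lambda>\<tau>. Sobolev_norm s (\<lambda>x. \<psi> \<tau> x - \<psi> t x)) \<longlongrightarrow> 0) (at t within I))"

definition Sobolev_has_derivative_on ::
  "real \<Rightarrow> real set \<Rightarrow> (real \<Rightarrow> real ^ 'd \<Rightarrow> complex ^ 'n) \<Rightarrow>
   (real \<Rightarrow> real ^ 'd \<Rightarrow> complex ^ 'n) \<Rightarrow> bool" where
  "Sobolev_has_derivative_on s I \<psi> \<psi>' \<longleftrightarrow>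
     (\<forall>t\<in>I. \<psi> t \<in> Sobolev s \<and> \<psi>' t \<in> Sobolev s) \<and>
     (\<forall>t\<in>I. ((\<lambda>\<tau>. Sobolev_norm s (\<lambda>x. (1 / (\<tau> - t)) *\<^sub>R (\<psi> \<tau> x - \<psi> t x) - \<psi>' t x)) \<longlongrightarrow> 0)
              (at t within I))"


section \<open>The nonlinear Dirac equation\<close>

text \<open>The space-time index \<open>\<mu>\<close> ranges over \<^typ>\<open>'d option\<close>: \<^term>\<open>None\<close> is the time index \<open>0\<close>.\<close>

definition minkowski :: "'d option \<Rightarrow> 'd option \<Rightarrow> complex" where
  "minkowski \<mu> \<nu> = (if \<mu> \<noteq> \<nu> then 0 else if \<mu> = None then 1 else - 1)"

definition adjoint_matrix :: "complex ^ 'n ^ 'n \<Rightarrow> complex ^ 'n ^ 'n" where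
  "adjoint_matrix A = (\<chi> i j. cnj (A $ j $ i))"

definition dirac_matrices :: "('d::finite option \<Rightarrow> complex ^ 'n ^ 'n) \<Rightarrow> bool" where
  "dirac_matrices \<gamma> \<longleftrightarrow>
     (\<forall>\<mu> \<nu>. \<gamma> \<mu> ** \<gamma> \<nu> + \<gamma> \<nu> ** \<gamma> \<mu> = mat (2 * minkowski \<mu> \<nu>)) \<and>
     adjoint_matrix (\<gamma> None) = \<gamma> None \<and>
     (\<forall>j. adjoint_matrix (\<gamma> (Some j)) = - \<gamma> (Some j))"

text \<open>
  A solution on \<open>(-T, T)\<close> in \<open>C\<^sup>0 H\<^sup>s \<inter> C\<^sup>1 H\<^sup>s\<^sup>-\<^sup>1\<close>. The family \<open>D\<close> collects the partial derivatives:
  \<open>D None\<close> is the time derivative of the curve in \<open>H\<^sup>s\<^sup>-\<^sup>1\<close>, and \<open>D (Some j)\<close> is the weak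
  derivative in the \<open>j\<close>-th space variable. Both are determined up to null sets.
\<close>

definition dirac_solution ::
  "('d::finite option \<Rightarrow> complex ^ 'n ^ 'n) \<Rightarrow> real \<Rightarrow> (complex ^ 'n \<Rightarrow> complex ^ 'n) \<Rightarrow> real \<Rightarrow>
   real \<Rightarrow> (real ^ 'd \<Rightarrow> complex ^ 'n) \<Rightarrow> (real \<Rightarrow> real ^ 'd \<Rightarrow> complex ^ 'n) \<Rightarrow> bool" where
  "dirac_solution \<gamma> m F s T \<psi>\<^sub>0 \<psi> \<longleftrightarrow>
     Sobolev_continuous_on s {-T<..<T} \<psi> \<and>
     (\<exists>D. Sobolev_has_derivative_on (s - 1) {-T<..<T} \<psi> (D None) \<and>
          Sobolev_continuous_on (s - 1) {-T<..<T} (D None) \<and>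
          (\<forall>t\<in>{-T<..<T}. \<forall>j. has_weak_partial (\<psi> t) j (D (Some j) t)) \<and>
          (\<forall>t\<in>{-T<..<T}. AE x in lebesgue.
             (- \<i>) *s (\<Sum>\<mu>\<in>UNIV. \<gamma> \<mu> *v D \<mu> t x) + m *\<^sub>R \<psi> t x = F (\<psi> t x))) \<and>
     (AE x in lebesgue. \<psi> 0 x = \<psi>\<^sub>0 x)"

end

theory Submission imports Defs begin

text \<open>
  On the Fourier side the equation is an ordinary differential equation \<open>a' = g a + N(a)\<close> for the family
  \<open>a\<close> of Fourier coefficients, in a weighted \<open>\<ell>\<^sup>2\<close> space. Here \<open>g(k) = - i \<gamma>\<^sup>0 (\<Sum>\<^sub>j k\<^sub>j \<gamma>\<^sup>j + m)\<close>, and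
  \<open>N(a)\<close> are the coefficients of \<open>i \<gamma>\<^sup>0 F(u)\<close>, where \<open>u\<close> is the function with coefficients \<open>a\<close>. The
  Clifford relations give \<open>g(k)\<^sup>2 = - \<omega>(k)\<^sup>2\<close> with \<open>\<omega>(k)\<^sup>2 = m\<^sup>2 + \<bar>k\<bar>\<^sup>2\<close>, so that the linear flow
  \<open>cos (t \<omega>) + sin (t \<omega>) g / \<omega>\<close> is bounded on \<open>H\<^sup>s\<close> uniformly in time.

  The superposition operator \<open>N\<close> is locally Lipschitz on \<open>H\<^sup>s\<close>, and it is of the order of the square of
  the norm (\<open>composition_bound\<close>, \<open>composition_Lipschitz\<close>): by the chain rule one derivative of \<open>G(u)\<close> is
  a product of \<open>G'(u)\<close> with a derivative of \<open>u\<close>, and a product estimate allows to climb from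
  \<open>L\<^sup>2\<close> to \<open>H\<^sup>s\<close> in steps of one derivative. In terms of the profile \<open>b(t)\<close>, obtained from \<open>a(t)\<close> by
  undoing the linear flow, the equation has no unbounded terms. After truncation outside a ball it is
  globally solvable by Picard iteration (\<open>global_ode_solution\<close>).

  A direct estimate of the quadratic terms gives the time \<open>\<epsilon>\<^sup>-\<^sup>1\<close>. For \<open>\<epsilon>\<^sup>-\<^sup>2\<close> they are removed by a normal
  form: one replaces \<open>a\<close> by \<open>a - B(a, a)\<close>, where \<open>B(g a, c) + B(a, g c) - g B(a, c) = Q(a, c)\<close> and \<open>Q\<close> is
  the quadratic part of \<open>N\<close> (\<open>nf_homological\<close>). This requires division by the phases
  \<open>\<omega>(p + q) \<plusminus> \<omega>(p) \<plusminus> \<omega>(q)\<close>. Because of \<open>m > 0\<close> none of them vanishes, and their inverses are bounded by a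
  multiple of the smaller one of \<open>\<omega>(p)\<close> and \<open>\<omega>(q)\<close> (\<open>phase_bounds\<close>). The loss is one derivative on the
  factor of lower frequency, which is harmless in \<open>H\<^sup>s\<close> (\<open>nf_bound\<close>). The new unknown is driven by cubic
  terms: as long as \<open>\<parallel>b\<parallel> \<le> 2 \<epsilon>\<close>, its profile moves with speed \<open>O(\<epsilon>\<^sup>3)\<close>, hence by a small multiple of
  \<open>\<epsilon>\<close> up to the time \<open>c \<epsilon>\<^sup>-\<^sup>2\<close>, and the bound on \<open>b\<close> improves itself (\<open>long_time_solution\<close>).

  Conversely, the coefficients of an arbitrary solution satisfy the same differential equation, since
  weak derivatives may be tested with trigonometric functions (\<open>solution_coordinates\<close>). Gronwall's
  inequality identifies the coefficients of two solutions, and periodic functions with equal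
  coefficients agree almost everywhere (\<open>fourier_uniqueness\<close>).
\<close>

section \<open>Square-summable families\<close>

text \<open>A type of its own, and not a set of families, so that the general theory of Banach spaces applies:
  integration of curves, bounded bilinear maps, fixed points.\<close>

typedef (overloaded) ('k, 'v::real_normed_vector) l2 =
  "{f :: 'k \<Rightarrow> 'v. (\<lambda>k. (norm (f k))\<^sup>2) summable_on UNIV}"
  morphisms coord Abs_l2
  by (rule exI[of _ "\<lambda>_. 0"]) simp

setup_lifting type_definition_l2

lemma sqsum_iff_L2_set_bounded:
  fixes f :: "'k \<Rightarrow> 'v::real_normed_vector"
  shows "(\<lambda>k. (norm (f k))\<^sup>2) summable_on UNIV \<longleftrightarrow> (\<exists>B. \<forall>F. finite F \<longrightarrow> L2_set (\<lambda>k. norm (f k)) F \<le> B)"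
proof
  assume s: "(\<lambda>k. (norm (f k))\<^sup>2) summable_on UNIV"
  have "L2_set (\<lambda>k. norm (f k)) F \<le> sqrt (\<Sum>\<^sub>\<infinity>k. (norm (f k))\<^sup>2)" if "finite F" for F
    unfolding L2_set_def by (intro real_sqrt_le_mono finite_sum_le_infsum s that) auto
  then show "\<exists>B. \<forall>F. finite F \<longrightarrow> L2_set (\<lambda>k. norm (f k)) F \<le> B" by blast
next
  assume "\<exists>B. \<forall>F. finite F \<longrightarrow> L2_set (\<lambda>k. norm (f k)) F \<le> B"
  then obtain B where B: "\<And>F. finite F \<Longrightarrow> L2_set (\<lambda>k. norm (f k)) F \<le> B" by blast
  have "(\<Sum>k\<in>F. (norm (f k))\<^sup>2) \<le> B\<^sup>2" if "finite F" for F
    using B[OF that] by (simp add: L2_set_def real_le_lsqrt sqrt_le_D)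
  then show "(\<lambda>k. (norm (f k))\<^sup>2) summable_on UNIV"
    by (intro nonneg_bdd_above_summable_on) (auto intro!: bdd_aboveI)
qed

lemma L2_set_le_norm_l2:
  fixes f :: "'k \<Rightarrow> 'v::real_normed_vector"
  assumes "(\<lambda>k. (norm (f k))\<^sup>2) summable_on UNIV" "finite F"
  shows "L2_set (\<lambda>k. norm (f k)) F \<le> sqrt (\<Sum>\<^sub>\<infinity>k. (norm (f k))\<^sup>2)"
  unfolding L2_set_def by (intro real_sqrt_le_mono finite_sum_le_infsum assms) auto

lemma norm_l2_le_of_L2_set:
  fixes f :: "'k \<Rightarrow> 'v::real_normed_vector"
  assumes "\<And>F. finite F \<Longrightarrow> L2_set (\<lambda>k. norm (f k)) F \<le> B"
  shows "sqrt (\<Sum>\<^sub>\<infinity>k. (norm (f k))\<^sup>2) \<le> B"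
proof -
  have B0: "0 \<le> B" using assms[of "{}"] by simp
  have "(\<lambda>k. (norm (f k))\<^sup>2) summable_on UNIV"
    using assms sqsum_iff_L2_set_bounded[of f] by blast
  then have "(\<Sum>\<^sub>\<infinity>k. (norm (f k))\<^sup>2) \<le> B\<^sup>2"
  proof (rule infsum_le_finite_sums)
    fix F :: "'k set" assume "finite F"
    then show "(\<Sum>k\<in>F. (norm (f k))\<^sup>2) \<le> B\<^sup>2"
      using assms by (simp add: L2_set_def sqrt_le_D)
  qed
  then show ?thesis using B0 by (simp add: real_le_lsqrt)
qed

lemma L2_set_norm_add_le:
  fixes f g :: "'k \<Rightarrow> 'v::real_normed_vector"
  shows "L2_set (\<lambda>k. norm (f k + g k)) F \<le> L2_set (\<lambda>k. norm (f k)) F + L2_set (\<lambda>k. norm (g k)) F"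
  by (rule order_trans[OF L2_set_mono L2_set_triangle_ineq]) (auto intro: norm_triangle_ineq)

lemma sqsum_add:
  fixes f g :: "'k \<Rightarrow> 'v::real_normed_vector"
  assumes "(\<lambda>k. (norm (f k))\<^sup>2) summable_on UNIV" "(\<lambda>k. (norm (g k))\<^sup>2) summable_on UNIV"
  shows "(\<lambda>k. (norm (f k + g k))\<^sup>2) summable_on UNIV"
  unfolding sqsum_iff_L2_set_bounded
  by (rule exI[of _ "sqrt (\<Sum>\<^sub>\<infinity>k. (norm (f k))\<^sup>2) + sqrt (\<Sum>\<^sub>\<infinity>k. (norm (g k))\<^sup>2)"])
     (use L2_set_norm_add_le[of f g] L2_set_le_norm_l2[OF assms(1)] L2_set_le_norm_l2[OF assms(2)] in
      \<open>fastforce intro: order_trans add_mono\<close>)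

lemma sqsum_scaleR:
  fixes f :: "'k \<Rightarrow> 'v::real_normed_vector"
  assumes "(\<lambda>k. (norm (f k))\<^sup>2) summable_on UNIV"
  shows "(\<lambda>k. (norm (c *\<^sub>R f k))\<^sup>2) summable_on UNIV"
  using summable_on_cmult_right[OF assms, of "c\<^sup>2"] by (simp add: power_mult_distrib)

instantiation l2 :: (type, real_normed_vector) real_normed_vector
begin

lift_definition zero_l2 :: "('a, 'b) l2" is "\<lambda>_. 0" by simp
lift_definition plus_l2 :: "('a, 'b) l2 \<Rightarrow> ('a, 'b) l2 \<Rightarrow> ('a, 'b) l2" is "\<lambda>f g k. f k + g k"
  by (rule sqsum_add)
lift_definition minus_l2 :: "('a, 'b) l2 \<Rightarrow> ('a, 'b) l2 \<Rightarrow> ('a, 'b) l2" is "\<lambda>f g k. f k - g k"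
  subgoal for f g using sqsum_add[of f "\<lambda>k. - g k"] by simp done
lift_definition uminus_l2 :: "('a, 'b) l2 \<Rightarrow> ('a, 'b) l2" is "\<lambda>f k. - f k" by simp
lift_definition scaleR_l2 :: "real \<Rightarrow> ('a, 'b) l2 \<Rightarrow> ('a, 'b) l2" is "\<lambda>c f k. c *\<^sub>R f k"
  by (rule sqsum_scaleR)
lift_definition norm_l2 :: "('a, 'b) l2 \<Rightarrow> real" is "\<lambda>f. sqrt (\<Sum>\<^sub>\<infinity>k. (norm (f k))\<^sup>2)" .
definition sgn_l2 :: "('a, 'b) l2 \<Rightarrow> ('a, 'b) l2" where "sgn_l2 x = inverse (norm x) *\<^sub>R x"
definition dist_l2 :: "('a, 'b) l2 \<Rightarrow> ('a, 'b) l2 \<Rightarrow> real" where "dist_l2 x y = norm (x - y)"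
definition uniformity_l2 :: "(('a, 'b) l2 \<times> ('a, 'b) l2) filter" where
  "uniformity_l2 = (INF e\<in>{0<..}. principal {(x, y). dist x y < e})"
definition open_l2 :: "('a, 'b) l2 set \<Rightarrow> bool" where
  "open_l2 U = (\<forall>x\<in>U. eventually (\<lambda>(x', y). x' = x \<longrightarrow> y \<in> U) uniformity)"

instance
proof
  fix x y :: "('a, 'b) l2" and a b :: real
  show "(norm x = 0) = (x = 0)"
  proof transfer
    fix f :: "'a \<Rightarrow> 'b" assume s: "(\<lambda>k. (norm (f k))\<^sup>2) summable_on UNIV"
    have "f k = 0" if "(\<Sum>\<^sub>\<infinity>k. (norm (f k))\<^sup>2) = 0" for k
      using finite_sum_le_infsum[OF s, of "{k}"] that by simp
    then show "(sqrt (\<Sum>\<^sub>\<infinity>k. (norm (f k))\<^sup>2) = 0) = (f = (\<lambda>_. 0))"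
      by auto
  qed
  show "norm (x + y) \<le> norm x + norm y"
  proof transfer
    fix f g :: "'a \<Rightarrow> 'b"
    assume *: "(\<lambda>k. (norm (f k))\<^sup>2) summable_on UNIV" "(\<lambda>k. (norm (g k))\<^sup>2) summable_on UNIV"
    show "sqrt (\<Sum>\<^sub>\<infinity>k. (norm (f k + g k))\<^sup>2) \<le> sqrt (\<Sum>\<^sub>\<infinity>k. (norm (f k))\<^sup>2) + sqrt (\<Sum>\<^sub>\<infinity>k. (norm (g k))\<^sup>2)"
      by (rule norm_l2_le_of_L2_set)
        (rule order_trans[OF L2_set_norm_add_le add_mono[OF L2_set_le_norm_l2[OF *(1)] L2_set_le_norm_l2[OF *(2)]]])
  qed
  show "norm (a *\<^sub>R x) = \<bar>a\<bar> * norm x"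
    by transfer (simp add: power_mult_distrib infsum_cmult_right' real_sqrt_mult)
qed ((simp add: dist_l2_def sgn_l2_def uniformity_l2_def open_l2_def; fail) |
     (transfer; auto simp: algebra_simps; fail))+

end

lemmas coord_simps [simp] = zero_l2.rep_eq plus_l2.rep_eq minus_l2.rep_eq uminus_l2.rep_eq scaleR_l2.rep_eq

lemma norm_coord_le:
  fixes x :: "('k, 'v::real_normed_vector) l2"
  shows "norm (coord x k) \<le> norm x"
proof transfer
  fix f :: "'k \<Rightarrow> 'v" and k assume s: "(\<lambda>k. (norm (f k))\<^sup>2) summable_on UNIV"
  show "norm (f k) \<le> sqrt (\<Sum>\<^sub>\<infinity>k. (norm (f k))\<^sup>2)"
    using L2_set_le_norm_l2[OF s, of "{k}"] by (simp add: L2_set_def)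
qed

lemma bounded_linear_coord: "bounded_linear (\<lambda>x. coord x k)"
  by (rule bounded_linear_intro[where K=1]) (auto simp: norm_coord_le)

lemma l2_eqI: "(\<And>k. coord x k = coord y k) \<Longrightarrow> x = y"
  by transfer auto

lemma L2_set_coord_le: "finite F \<Longrightarrow> L2_set (\<lambda>k. norm (coord x k)) F \<le> norm x"
  by transfer (rule L2_set_le_norm_l2)

lemma norm_l2_leI: "(\<And>F. finite F \<Longrightarrow> L2_set (\<lambda>k. norm (coord x k)) F \<le> B) \<Longrightarrow> norm x \<le> B"
  by transfer (rule norm_l2_le_of_L2_set)

text \<open>
  Completeness: a Cauchy sequence converges in each coordinate, and the finite \<open>L\<^sup>2\<close> sums, being
  finite-dimensional, pass to the limit.
\<close>

instance l2 :: (type, banach) banach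
proof
  fix X :: "nat \<Rightarrow> ('a, 'b) l2" assume X: "Cauchy X"
  have c: "convergent (\<lambda>n. coord (X n) k)" for k
    using bounded_linear.Cauchy[OF bounded_linear_coord X] by (simp add: Cauchy_convergent)
  define f where "f k = lim (\<lambda>n. coord (X n) k)" for k
  have f: "(\<lambda>n. coord (X n) k) \<longlonglongrightarrow> f k" for k
    unfolding f_def using c convergent_LIMSEQ_iff by blast
  have key: "L2_set (\<lambda>k. norm (f k - coord (X n) k)) F \<le> e"
    if "\<And>p q. p \<ge> N \<Longrightarrow> q \<ge> N \<Longrightarrow> norm (X p - X q) < e" "n \<ge> N" "finite F" for e N n F
  proof (rule LIMSEQ_le_const2)
    show "(\<lambda>p. L2_set (\<lambda>k. norm (coord (X p) k - coord (X n) k)) F) \<longlonglongrightarrow> L2_set (\<lambda>k. norm (f k - coord (X n) k)) F"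
      unfolding L2_set_def by (intro tendsto_intros f)
    show "\<exists>M. \<forall>p\<ge>M. L2_set (\<lambda>k. norm (coord (X p) k - coord (X n) k)) F \<le> e"
    proof (intro exI[of _ N] allI impI)
      fix p assume "p \<ge> N"
      then have "norm (X p - X n) < e" using that by auto
      then show "L2_set (\<lambda>k. norm (coord (X p) k - coord (X n) k)) F \<le> e"
        using L2_set_coord_le[OF that(3), of "X p - X n"] by simp
    qed
  qed
  obtain N1 where N1: "\<And>p q. p \<ge> N1 \<Longrightarrow> q \<ge> N1 \<Longrightarrow> norm (X p - X q) < 1"
    using CauchyD[OF X, of 1] by auto
  have "(\<lambda>k. (norm (f k - coord (X N1) k))\<^sup>2) summable_on UNIV"
    unfolding sqsum_iff_L2_set_bounded using key[OF N1, of N1] by auto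
  moreover have "(\<lambda>k. (norm (coord (X N1) k))\<^sup>2) summable_on UNIV"
    using coord[of "X N1"] by simp
  ultimately have "(\<lambda>k. (norm (f k))\<^sup>2) summable_on UNIV"
    using sqsum_add by fastforce
  then have comp_coeff: "coord (Abs_l2 f) = f" by (simp add: Abs_l2_inverse)
  have "X \<longlonglongrightarrow> Abs_l2 f"
  proof (rule LIMSEQ_I)
    fix r :: real assume "r > 0"
    then obtain N where N: "\<And>p q. p \<ge> N \<Longrightarrow> q \<ge> N \<Longrightarrow> norm (X p - X q) < r / 2"
      using CauchyD[OF X, of "r/2"] by auto
    have "norm (Abs_l2 f - X n) \<le> r / 2" if "n \<ge> N" for n
      by (rule norm_l2_leI) (use key[OF N that] comp_coeff in simp)
    then show "\<exists>no. \<forall>n\<ge>no. norm (X n - Abs_l2 f) < r"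
      using \<open>r > 0\<close> by (intro exI[of _ N]) (force simp: norm_minus_commute)
  qed
  then show "convergent X" by (auto simp: convergent_def)
qed

definition in_l2 :: "('k \<Rightarrow> 'v::real_normed_vector) \<Rightarrow> bool" where
  "in_l2 f \<longleftrightarrow> (\<lambda>k. (norm (f k))\<^sup>2) summable_on UNIV"

lemma coord_Abs_l2: "in_l2 f \<Longrightarrow> coord (Abs_l2 f) = f"
  by (simp add: in_l2_def Abs_l2_inverse)

lemma in_l2_coord: "in_l2 (coord x)"
  using coord[of x] by (simp add: in_l2_def)

lemma norm_Abs_l2: "in_l2 f \<Longrightarrow> norm (Abs_l2 f) = sqrt (\<Sum>\<^sub>\<infinity>k. (norm (f k))\<^sup>2)"
  by (simp add: norm_l2.rep_eq coord_Abs_l2)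

lemma in_l2_le:
  assumes "\<And>k. norm (f k) \<le> norm (coord x k)"
  shows "in_l2 f" and "norm (Abs_l2 f) \<le> norm x"
proof -
  have *: "L2_set (\<lambda>k. norm (f k)) F \<le> norm x" if "finite F" for F
    by (rule order_trans[OF L2_set_mono L2_set_coord_le]) (use assms that in auto)
  then show f: "in_l2 f" unfolding in_l2_def sqsum_iff_L2_set_bounded by blast
  show "norm (Abs_l2 f) \<le> norm x"
    by (rule norm_l2_leI) (use * in \<open>simp add: coord_Abs_l2[OF f]\<close>)
qed

lemma norm_l2_mono: "(\<And>k. norm (coord x k) \<le> norm (coord y k)) \<Longrightarrow> norm x \<le> norm y"
  by (rule norm_l2_leI) (rule order_trans[OF L2_set_mono L2_set_coord_le], auto)

abbreviation in_l1 :: "('k \<Rightarrow> 'v::real_normed_vector) \<Rightarrow> bool" where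
  "in_l1 a \<equiv> (\<lambda>k. norm (a k)) summable_on UNIV"

text \<open>
  Young's inequality \<open>\<ell>\<^sup>1 * \<ell>\<^sup>2 \<subseteq> \<ell>\<^sup>2\<close>: the convolution is an absolutely convergent series, in the
  Banach space, of translates of the second factor.
\<close>

lift_definition translate :: "'k::ab_group_add \<Rightarrow> ('k, 'v::real_normed_vector) l2 \<Rightarrow> ('k, 'v) l2"
  is "\<lambda>l f k. f (k - l)"
  subgoal for l f
    by (rule summable_on_reindex_bij_witness[of UNIV "\<lambda>k. k + l" "\<lambda>k. k - l" UNIV, THEN iffD2]) auto
  done

lemma norm_translate: "norm (translate l x) = norm x"
  unfolding norm_l2.rep_eq translate.rep_eq
  by (rule arg_cong[of _ _ sqrt], rule infsum_reindex_bij_witness[of UNIV "\<lambda>k. k + l" "\<lambda>k. k - l" UNIV]) auto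

lemma Young_l1_l2:
  fixes p :: "'k::ab_group_add \<Rightarrow> real" and q :: "('k, real) l2"
  assumes p: "p summable_on UNIV" "\<And>l. 0 \<le> p l"
  shows "\<exists>r. norm r \<le> (\<Sum>\<^sub>\<infinity>l. p l) * norm q \<and>
     (\<forall>k. ((\<lambda>l. p l * coord q (k - l)) has_sum coord r k) UNIV)"
proof -
  have abs: "(\<lambda>l. p l *\<^sub>R translate l q) abs_summable_on UNIV"
    using summable_on_cmult_left[OF p(1), of "norm q"] p(2) by (simp add: norm_translate)
  define r where "r = (\<Sum>\<^sub>\<infinity>l. p l *\<^sub>R translate l q)"
  have hs: "((\<lambda>l. p l *\<^sub>R translate l q) has_sum r) UNIV"
    unfolding r_def using abs_summable_summable[OF abs] by simp
  have "norm r \<le> (\<Sum>\<^sub>\<infinity>l. norm (p l *\<^sub>R translate l q))"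
    unfolding r_def by (rule norm_infsum_bound[OF abs])
  also have "\<dots> = (\<Sum>\<^sub>\<infinity>l. p l) * norm q"
    using p(2) by (simp add: norm_translate infsum_cmult_left')
  finally show ?thesis
    using has_sum_bounded_linear[OF bounded_linear_coord hs] by (auto simp: translate.rep_eq)
qed

text \<open>A curve whose coordinates have derivatives that assemble to a continuous curve is
  differentiable: both sides are recovered from the integral of the derivative.\<close>

lemma l2_has_vector_derivative_coordwise:
  fixes x y :: "real \<Rightarrow> ('k, 'v::banach) l2"
  assumes d: "\<And>t k. t \<in> I \<Longrightarrow> ((\<lambda>t. coord (x t) k) has_vector_derivative coord (y t) k) (at t)"
    and y: "continuous_on I y" and I: "open I" "convex I" and t: "t \<in> I"
  shows "(x has_vector_derivative y t) (at t)"
proof -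
  obtain e where e: "e > 0" "cball t e \<subseteq> I" using I t open_contains_cball by blast
  define a b where "a = t - e" and "b = t + e"
  have ab: "a < t" "t < b" "{a..b} \<subseteq> I" using e by (auto simp: a_def b_def cball_eq_atLeastAtMost)
  have yc: "continuous_on {a..b} y" using y ab(3) continuous_on_subset by blast
  have eq: "x u = x a + integral {a..u} y" if u: "u \<in> {a..b}" for u
  proof (rule l2_eqI)
    fix k
    have yi: "y integrable_on {a..u}"
      by (rule integrable_continuous_real) (use yc u in \<open>auto intro: continuous_on_subset\<close>)
    have "((\<lambda>t. coord (y t) k) has_integral coord (x u) k - coord (x a) k) {a..u}"
    proof (rule fundamental_theorem_of_calculus)
      show "a \<le> u" using u by auto
      fix v assume v: "v \<in> {a..u}"
      show "((\<lambda>t. coord (x t) k) has_vector_derivative coord (y v) k) (at v within {a..u})"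
        by (rule has_vector_derivative_at_within, rule d) (use ab(3) u v in auto)
    qed
    moreover have "((\<lambda>t. coord (y t) k) has_integral coord (integral {a..u} y) k) {a..u}"
      using has_integral_linear[OF integrable_integral[OF yi] bounded_linear_coord[of k]]
      by (simp add: o_def)
    ultimately have "coord (x u) k - coord (x a) k = coord (integral {a..u} y) k"
      by (rule has_integral_unique)
    then show "coord (x u) k = coord (x a + integral {a..u} y) k"
      by (simp add: algebra_simps)
  qed
  have tab: "t \<in> {a..b}" using ab by auto
  have "((\<lambda>u. x a + integral {a..u} y) has_vector_derivative y t) (at t within {a..b})"
    using has_vector_derivative_add[OF has_vector_derivative_const integral_has_vector_derivative[OF yc tab]]
    by simp
  moreover have "at t within {a..b} = at t" using ab by (intro at_within_interior) auto
  ultimately have D: "((\<lambda>u. x a + integral {a..u} y) has_vector_derivative y t) (at t)" by simp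
  show ?thesis
    by (rule has_vector_derivative_transform_within_open[OF D, of "{a<..<b}"])
      (use ab in \<open>auto intro!: eq[symmetric]\<close>)
qed

section \<open>Differential equations in Banach spaces\<close>

text \<open>Stated for both signs of \<open>t\<close>, so that forward and backward evolution are estimated together.\<close>

lemma norm_diff_le_of_derivative_le:
  fixes G :: "real \<Rightarrow> 'a::real_normed_vector" and \<phi> \<phi>' :: "real \<Rightarrow> real"
  assumes G: "\<And>u. \<bar>u\<bar> \<le> \<bar>t\<bar> \<Longrightarrow> (G has_vector_derivative g u) (at u)"
    and \<phi>: "\<And>u. (\<phi> has_vector_derivative \<phi>' u) (at u)"
    and le: "\<And>u. \<bar>u\<bar> \<le> \<bar>t\<bar> \<Longrightarrow> norm (g u) \<le> \<phi>' \<bar>u\<bar>"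
  shows "norm (G t - G 0) \<le> \<phi> \<bar>t\<bar> - \<phi> 0"
proof -
  have pos: "norm (H t - H 0) \<le> \<phi> t - \<phi> 0"
    if t: "t > 0" and H: "\<And>u. \<bar>u\<bar> \<le> t \<Longrightarrow> (H has_vector_derivative h u) (at u)"
      and h: "\<And>u. \<bar>u\<bar> \<le> t \<Longrightarrow> norm (h u) \<le> \<phi>' \<bar>u\<bar>" for H h and t :: real
  proof (rule differentiable_bound_general[where f' = h and \<phi>' = \<phi>'])
    have "continuous (at u) H" if "u \<in> {0..t}" for u
      using H[of u] that by (intro has_vector_derivative_continuous) auto
    then show "continuous_on {0..t} H" by (simp add: continuous_at_imp_continuous_on)
    have "continuous (at u) \<phi>" for u using \<phi>[of u] by (intro has_vector_derivative_continuous)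
    then show "continuous_on {0..t} \<phi>" by (simp add: continuous_at_imp_continuous_on)
    show "norm (h u) \<le> \<phi>' u" if "0 < u" "u < t" for u using h[of u] that by simp
  qed (use t H \<phi> in auto)
  consider "t = 0" | "t > 0" | "t < 0" by linarith
  then show ?thesis
  proof cases
    case 2
    then show ?thesis using pos[of t G g] G le by simp
  next
    case 3
    have "((\<lambda>u. G (- u)) has_vector_derivative - g (- u)) (at u)" if "\<bar>u\<bar> \<le> - t" for u
    proof -
      have m: "((\<lambda>u::real. - u) has_vector_derivative - 1) (at u)"
        by (auto intro!: derivative_eq_intros)
      show ?thesis
        using vector_diff_chain_at[OF m, of G "g (- u)"] G[of "- u"] that 3 by (simp add: o_def)
    qed
    then show ?thesis using pos[of "- t" "\<lambda>u. G (- u)" "\<lambda>u. - g (- u)"] le[of "- u" for u] 3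
      by simp
  qed simp
qed

lemma continuous_antiderivative_exists:
  fixes g :: "real \<Rightarrow> 'a::banach"
  assumes g: "continuous_on UNIV g"
  shows "\<exists>G. G 0 = 0 \<and> (\<forall>t. (G has_vector_derivative g t) (at t))"
proof (rule exI[of _ "\<lambda>t. integral {0..t} g - integral {t..0} g"], intro conjI allI)
  let ?G = "\<lambda>t. integral {0..t} g - integral {t..0} g"
  show "integral {0..0} g - integral {0..0} g = 0" by simp
  fix t :: real
  define M where "M = \<bar>t\<bar> + 1"
  have tM: "t \<in> {-M..M}" "M > 0" "-M < t" "t < M" by (auto simp: M_def)
  have gi: "g integrable_on {a..b}" for a b
    using g by (intro integrable_continuous_real) (auto intro: continuous_on_subset)
  have eq: "?G u = integral {-M..u} g - integral {-M..0} g" if "u \<in> {-M..M}" for u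
  proof (cases "u \<ge> 0")
    case True
    then have "integral {u..0} g = 0" by (cases "u = 0") auto
    then show ?thesis using Henstock_Kurzweil_Integration.integral_combine[of "-M" 0 u g] gi True tM by (simp add: algebra_simps)
  next
    case False
    then have "integral {0..u} g = 0" by auto
    then show ?thesis using Henstock_Kurzweil_Integration.integral_combine[of "-M" u 0 g] gi False that by (simp add: algebra_simps)
  qed
  have "((\<lambda>u. integral {-M..u} g - integral {-M..0} g) has_vector_derivative g t - 0) (at t within {-M..M})"
    by (intro has_vector_derivative_diff integral_has_vector_derivative has_vector_derivative_const)
       (use g tM in \<open>auto intro: continuous_on_subset\<close>)
  moreover have "at t within {-M..M} = at t" using tM by (intro at_within_interior) auto
  ultimately have "((\<lambda>u. integral {-M..u} g - integral {-M..0} g) has_vector_derivative g t) (at t)" by simp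
  then show "(?G has_vector_derivative g t) (at t)"
    by (rule has_vector_derivative_transform_within_open[where S = "{-M<..<M}"])
       (use tM in \<open>auto simp del: has_vector_derivative_eq_rhs intro!: eq[symmetric]\<close>)
qed

text \<open>
  Global solvability, in both time directions at once: Picard iteration contracts in the norm
  \<open>sup\<^sub>t e\<^sup>-\<^sup>2\<^sup>L\<^sup>|\<^sup>t\<^sup>| \<parallel>b(t)\<parallel>\<close>, so that no continuation argument is needed.
\<close>

theorem global_ode_solution:
  fixes f :: "real \<Rightarrow> 'a::banach \<Rightarrow> 'a"
  assumes cont: "continuous_on UNIV (\<lambda>(t, x). f t x)"
    and lip: "\<And>t x y. norm (f t x - f t y) \<le> L * norm (x - y)" and L: "L > 0"
    and bdd: "\<And>t x. norm (f t x) \<le> B"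
  shows "\<exists>b. b 0 = b0 \<and> (\<forall>t. (b has_vector_derivative f t (b t)) (at t))"
proof -
  \<comment> \<open>The unknown is \<open>b\<close> divided by the weight \<open>w\<close>: then the space of bounded continuous functions
    carries the weighted norm.\<close>
  define w where "w t = exp (2 * L * \<bar>t\<bar>)" for t :: real
  have w: "w t > 0" "1 \<le> w t" for t using L by (auto simp: w_def)
  have wc: "continuous_on UNIV w" unfolding w_def by (intro continuous_intros)
  have fc: "continuous_on UNIV (\<lambda>t. f t (h t))" if "continuous_on UNIV h" for h
    using continuous_on_compose2[OF cont, of UNIV "\<lambda>t. (t, h t)"] continuous_on_Pair[OF continuous_on_id that]
    by simp
  have "\<exists>P. P 0 = 0 \<and> (\<forall>t. (P has_vector_derivative f t (w t *\<^sub>R apply_bcontfun g t)) (at t))" for g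
    by (intro continuous_antiderivative_exists fc continuous_intros wc continuous_on_apply_bcontfun)
  then obtain P where P0: "\<And>g. P g 0 = 0"
    and P: "\<And>g t. (P g has_vector_derivative f t (w t *\<^sub>R apply_bcontfun g t)) (at t)"
    by metis
  define \<Gamma> where "\<Gamma> g = Bcontfun (\<lambda>t. (1 / w t) *\<^sub>R (b0 + P g t))" for g
  have B0: "0 \<le> B" using order_trans[OF norm_ge_zero bdd[of 0 0]] .
  have Pc: "continuous_on UNIV (P g)" for g
    using P[of g] by (intro continuous_at_imp_continuous_on) (blast intro: has_vector_derivative_continuous)
  have "(\<lambda>t. (1 / w t) *\<^sub>R (b0 + P g t)) \<in> bcontfun" for g
  proof (rule bcontfun_normI)
    show "continuous_on UNIV (\<lambda>t. (1 / w t) *\<^sub>R (b0 + P g t))"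
      by (intro continuous_intros wc Pc) (use w in \<open>force simp: less_le\<close>)
    fix t
    have "norm (P g t - P g 0) \<le> B * \<bar>t\<bar> - B * 0"
      by (rule norm_diff_le_of_derivative_le[where g = "\<lambda>t. f t (w t *\<^sub>R apply_bcontfun g t)" and \<phi>' = "\<lambda>_. B"])
        (auto intro!: derivative_eq_intros P bdd)
    then have "norm (b0 + P g t) \<le> norm b0 + B * \<bar>t\<bar>"
      using norm_triangle_ineq[of b0 "P g t"] P0 by simp
    also have "\<dots> \<le> norm b0 * w t + B * (w t / (2 * L))"
    proof -
      have "2 * L * \<bar>t\<bar> \<le> w t" unfolding w_def using exp_ge_add_one_self[of "2 * L * \<bar>t\<bar>"] by linarith
      then have "\<bar>t\<bar> \<le> w t / (2 * L)" using L by (simp add: field_simps)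
      then show ?thesis using w(2)[of t] B0 by (intro add_mono mult_left_mono) (auto intro: mult_left_mono[of 1 "w t" "norm b0", simplified])
    qed
    finally have "norm (b0 + P g t) \<le> (norm b0 + B / (2 * L)) * w t" by (simp add: algebra_simps)
    moreover have "norm ((1 / w t) *\<^sub>R (b0 + P g t)) = norm (b0 + P g t) / w t"
      using w(1)[of t] by (simp del: scaleR_add_right)
    ultimately show "norm ((1 / w t) *\<^sub>R (b0 + P g t)) \<le> norm b0 + B / (2 * L)"
      using w(1)[of t] by (simp add: pos_divide_le_eq)
  qed
  then have \<Gamma>: "apply_bcontfun (\<Gamma> g) t = (1 / w t) *\<^sub>R (b0 + P g t)" for g t
    unfolding \<Gamma>_def by (simp add: Bcontfun_inverse)
  have "dist (\<Gamma> g) (\<Gamma> h) \<le> 1 / 2 * dist g h" for g h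
  proof -
    define d where "d = dist g h"
    have "norm (apply_bcontfun (\<Gamma> g - \<Gamma> h) t) \<le> 1 / 2 * d" for t
    proof -
      have "norm ((P g t - P h t) - (P g 0 - P h 0)) \<le> d / 2 * exp (2 * L * \<bar>t\<bar>) - d / 2 * exp (2 * L * 0)"
      proof (rule norm_diff_le_of_derivative_le[where \<phi>' = "\<lambda>u. L * d * exp (2 * L * u)"])
        fix u :: real
        show "((\<lambda>t. P g t - P h t) has_vector_derivative
            f u (w u *\<^sub>R apply_bcontfun g u) - f u (w u *\<^sub>R apply_bcontfun h u)) (at u)"
          by (intro has_vector_derivative_diff P)
        show "((\<lambda>u. d / 2 * exp (2 * L * u)) has_vector_derivative L * d * exp (2 * L * u)) (at u)"
          by (auto intro!: derivative_eq_intros simp: has_real_derivative_iff_has_vector_derivative[symmetric])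
        have "norm (f u (w u *\<^sub>R apply_bcontfun g u) - f u (w u *\<^sub>R apply_bcontfun h u))
            \<le> L * (w u * norm (apply_bcontfun g u - apply_bcontfun h u))"
          using lip[of u "w u *\<^sub>R apply_bcontfun g u" "w u *\<^sub>R apply_bcontfun h u"] w[of u]
          by (simp add: scaleR_diff_right[symmetric])
        also have "\<dots> \<le> L * (w u * d)"
          using dist_bounded[of g u h] L w[of u] by (intro mult_left_mono) (auto simp: dist_norm d_def)
        finally show "norm (f u (w u *\<^sub>R apply_bcontfun g u) - f u (w u *\<^sub>R apply_bcontfun h u))
            \<le> L * d * exp (2 * L * \<bar>u\<bar>)" by (simp add: w_def mult_ac)
      qed
      moreover have "d \<ge> 0" by (simp add: d_def)
      ultimately have *: "norm (P g t - P h t) \<le> d / 2 * w t" by (simp add: P0 w_def)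
      have "apply_bcontfun (\<Gamma> g - \<Gamma> h) t = (1 / w t) *\<^sub>R (P g t - P h t)"
        by (simp add: \<Gamma> scaleR_diff_right[symmetric])
      then have "norm (apply_bcontfun (\<Gamma> g - \<Gamma> h) t) = norm (P g t - P h t) / w t"
        using w(1)[of t] by (simp del: minus_bcontfun.rep_eq scaleR_diff_right)
      then show ?thesis using w(1)[of t] * by (simp add: pos_divide_le_eq del: minus_bcontfun.rep_eq)
    qed
    then show ?thesis unfolding d_def[symmetric] 
      using norm_bound[of "\<Gamma> g - \<Gamma> h" "1 / 2 * d"] by (simp add: dist_norm del: minus_bcontfun.rep_eq)
  qed
  then obtain g where g: "\<Gamma> g = g" using banach_fix_type[of "1/2" \<Gamma>] by auto
  define b where "b t = w t *\<^sub>R apply_bcontfun g t" for t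
  have "b = (\<lambda>t. b0 + P g t)"
    using \<Gamma>[of g] w unfolding b_def g by (auto simp: fun_eq_iff less_le)
  then have beq: "b = (\<lambda>t. b0 + P g t)" .
  have "b 0 = b0" by (simp add: beq P0)
  moreover have "(b has_vector_derivative f t (b t)) (at t)" for t
    using has_vector_derivative_add[OF has_vector_derivative_const P[of g t], of b0]
    unfolding beq[symmetric] by (simp add: b_def)
  ultimately show ?thesis by blast
qed

text \<open>Iteration of the mean value inequality bounds \<open>x\<close> by \<open>M (L\<bar>t\<bar>)\<^sup>n / n!\<close> for every \<open>n\<close>.\<close>

lemma Gronwall_zero:
  fixes x :: "real \<Rightarrow> 'a::real_normed_vector"
  assumes x: "\<And>u. \<bar>u\<bar> \<le> \<bar>t\<bar> \<Longrightarrow> (x has_vector_derivative y u) (at u)"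
    and y: "\<And>u. \<bar>u\<bar> \<le> \<bar>t\<bar> \<Longrightarrow> norm (y u) \<le> L * norm (x u)"
    and x0: "x 0 = 0" and L: "L \<ge> 0"
  shows "x t = 0"
proof -
  have "continuous (at u) x" if "u \<in> {-\<bar>t\<bar>..\<bar>t\<bar>}" for u
    using has_vector_derivative_continuous[OF x[of u]] that by auto
  then have "bounded (x ` {-\<bar>t\<bar>..\<bar>t\<bar>})"
    by (intro compact_imp_bounded compact_continuous_image continuous_at_imp_continuous_on) auto
  then obtain M where "\<forall>u\<in>{-\<bar>t\<bar>..\<bar>t\<bar>}. norm (x u) \<le> M"
    unfolding bounded_iff by auto
  then have M: "norm (x u) \<le> M" if "\<bar>u\<bar> \<le> \<bar>t\<bar>" for u
    using that by (simp add: abs_le_iff)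
  have M0: "M \<ge> 0" using order_trans[OF norm_ge_zero M[of 0]] by simp
  have *: "norm (x u) \<le> M * L ^ n / fact n * \<bar>u\<bar> ^ n" if "\<bar>u\<bar> \<le> \<bar>t\<bar>" for u n
    using that
  proof (induction n arbitrary: u)
    case 0
    then show ?case using M by simp
  next
    case (Suc n)
    have "norm (x u - x 0) \<le> M * L ^ Suc n / fact (Suc n) * \<bar>u\<bar> ^ Suc n - M * L ^ Suc n / fact (Suc n) * 0 ^ Suc n"
    proof (rule norm_diff_le_of_derivative_le[where g = y and \<phi>' = "\<lambda>u. L * (M * L ^ n / fact n * u ^ n)"])
      fix v :: real assume v: "\<bar>v\<bar> \<le> \<bar>u\<bar>"
      show "(x has_vector_derivative y v) (at v)" using x v Suc.prems by simp
      show "norm (y v) \<le> L * (M * L ^ n / fact n * \<bar>v\<bar> ^ n)"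
        using y[of v] Suc.IH[of v] v Suc.prems L by (meson mult_left_mono order_trans)
    next
      fix v :: real
      have "((\<lambda>u. M * L ^ Suc n / fact (Suc n) * u ^ Suc n) has_real_derivative
          M * L ^ Suc n / fact (Suc n) * (real (Suc n) * v ^ n)) (at v)"
        using DERIV_cmult[OF DERIV_pow[of "Suc n" v UNIV], of "M * L ^ Suc n / fact (Suc n)"] by simp
      moreover have "M * L ^ Suc n / fact (Suc n) * (real (Suc n) * v ^ n) = L * (M * L ^ n / fact n * v ^ n)"
        by (simp add: field_simps del: of_nat_Suc)
      ultimately show "((\<lambda>u. M * L ^ Suc n / fact (Suc n) * u ^ Suc n) has_vector_derivative
          L * (M * L ^ n / fact n * v ^ n)) (at v)"
        by (simp only: has_real_derivative_iff_has_vector_derivative[symmetric])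
    qed
    then show ?case using x0 by simp
  qed
  have "(\<lambda>n. M * (inverse (fact n) * (L * \<bar>t\<bar>) ^ n)) \<longlonglongrightarrow> M * 0"
    by (intro tendsto_mult tendsto_const summable_LIMSEQ_zero summable_exp)
  then have "norm (x t) \<le> M * 0"
    by (rule LIMSEQ_le_const) (use *[of t] in \<open>auto simp: power_mult_distrib field_simps\<close>)
  then show ?thesis by simp
qed

text \<open>Composition with the radial retraction onto a ball makes a locally Lipschitz map globally
  bounded and Lipschitz.\<close>

definition retract_ball :: "real \<Rightarrow> 'a::real_normed_vector \<Rightarrow> 'a" where
  "retract_ball \<rho> x = (if norm x \<le> \<rho> then x else (\<rho> / norm x) *\<^sub>R x)"

lemma norm_retract_ball: "\<rho> \<ge> 0 \<Longrightarrow> norm (retract_ball \<rho> x) \<le> \<rho>"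
  by (auto simp: retract_ball_def)

lemma retract_ball_Lipschitz:
  assumes "\<rho> > 0"
  shows "norm (retract_ball \<rho> x - retract_ball \<rho> y) \<le> 2 * norm (x - y)"
proof -
  have mixed: "norm (x - (\<rho> / norm y) *\<^sub>R y) \<le> 2 * norm (x - y)"
    if "norm x \<le> \<rho>" "\<not> norm y \<le> \<rho>" for x y :: 'a
  proof -
    have "norm (x - (\<rho> / norm y) *\<^sub>R y) \<le> norm (x - y) + norm (y - (\<rho> / norm y) *\<^sub>R y)"
      using norm_triangle_ineq[of "x - y" "y - (\<rho> / norm y) *\<^sub>R y"] by simp
    also have "y - (\<rho> / norm y) *\<^sub>R y = (1 - \<rho> / norm y) *\<^sub>R y" by (simp add: algebra_simps)
    also have "norm \<dots> = norm y - \<rho>"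
    proof -
      have "norm y > 0" using that assms by linarith
      then have "\<rho> / norm y \<le> 1" using that by (simp add: pos_divide_le_eq)
      then have "\<bar>1 - \<rho> / norm y\<bar> = 1 - \<rho> / norm y" by simp
      moreover have "(1 - \<rho> / norm y) * norm y = norm y - \<rho>"
        using \<open>norm y > 0\<close> by (simp add: field_simps)
      ultimately show ?thesis by simp
    qed
    also have "norm y - \<rho> \<le> norm (x - y)"
      using that norm_triangle_ineq2[of y x] by (simp add: norm_minus_commute)
    finally show ?thesis by simp
  qed
  have outer: "norm ((\<rho> / norm x) *\<^sub>R x - (\<rho> / norm y) *\<^sub>R y) \<le> 2 * norm (x - y)"
    if x: "\<not> norm x \<le> \<rho>" and y: "\<not> norm y \<le> \<rho>"
  proof -
    have nz: "norm x > 0" "norm y > 0" using x y assms by linarith+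
    have "(\<rho> / norm x) *\<^sub>R x - (\<rho> / norm y) *\<^sub>R y = (\<rho> / norm x) *\<^sub>R ((x - y) + ((norm y - norm x) / norm y) *\<^sub>R y)"
      using nz by (simp add: algebra_simps diff_divide_distrib scaleR_diff_left[symmetric])
    also have "norm \<dots> = \<rho> / norm x * norm ((x - y) + ((norm y - norm x) / norm y) *\<^sub>R y)"
      using assms by simp
    also have "\<dots> \<le> 1 * (norm (x - y) + norm (((norm y - norm x) / norm y) *\<^sub>R y))"
      using x assms nz by (intro mult_mono norm_triangle_ineq) (auto simp: pos_divide_le_eq)
    also have "norm (((norm y - norm x) / norm y) *\<^sub>R y) = \<bar>norm y - norm x\<bar>" using nz by simp
    also have "\<dots> \<le> norm (x - y)" using norm_triangle_ineq3[of y x] by (simp add: norm_minus_commute)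
    finally show ?thesis by simp
  qed
  show ?thesis
    using mixed[of x y] mixed[of y x] outer
    by (auto simp: retract_ball_def norm_minus_commute)
qed

section \<open>Coordinatewise one-parameter families\<close>

lemma l2_restrict_approx:
  fixes x :: "('k, 'v::real_normed_vector) l2"
  assumes "e > 0"
  shows "\<exists>z F. finite F \<and> (\<forall>k. coord z k = (if k \<in> F then coord x k else 0)) \<and> norm (x - z) < e"
proof -
  have s: "(\<lambda>k. (norm (coord x k))\<^sup>2) summable_on UNIV" using in_l2_coord[of x] by (simp add: in_l2_def)
  let ?S = "\<Sum>\<^sub>\<infinity>k. (norm (coord x k))\<^sup>2"
  have "((\<lambda>F. \<Sum>k\<in>F. (norm (coord x k))\<^sup>2) \<longlongrightarrow> ?S) (finite_subsets_at_top UNIV)"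
    using has_sum_infsum[OF s] by (simp add: has_sum_def)
  then have "\<forall>\<^sub>F F in finite_subsets_at_top UNIV. dist (\<Sum>k\<in>F. (norm (coord x k))\<^sup>2) ?S < e\<^sup>2"
    using assms by (intro tendstoD) auto
  then obtain F where F: "finite F" "dist (\<Sum>k\<in>F. (norm (coord x k))\<^sup>2) ?S < e\<^sup>2"
    unfolding eventually_finite_subsets_at_top by blast
  let ?z = "\<lambda>k. if k \<in> F then coord x k else 0"
  have z: "coord (Abs_l2 ?z) = ?z" by (intro coord_Abs_l2 in_l2_le(1)[of _ x]) auto
  have "norm (x - Abs_l2 ?z) = sqrt (\<Sum>\<^sub>\<infinity>k. (norm (coord x k - ?z k))\<^sup>2)"
    by (simp add: norm_l2.rep_eq z)
  also have "(\<Sum>\<^sub>\<infinity>k. (norm (coord x k - ?z k))\<^sup>2) = (\<Sum>\<^sub>\<infinity>k\<in>UNIV - F. (norm (coord x k))\<^sup>2)"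
    by (rule infsum_cong_neutral) auto
  also have "\<dots> = ?S - (\<Sum>k\<in>F. (norm (coord x k))\<^sup>2)"
    using infsum_Diff[OF s, of F] F(1) by simp
  also have "sqrt \<dots> < e"
    using F(2) assms by (intro real_less_lsqrt) (auto simp: dist_real_def)
  finally have "norm (x - Abs_l2 ?z) < e" .
  then show ?thesis using F(1) z by (intro exI[of _ "Abs_l2 ?z"] exI[of _ F]) simp
qed

lemma norm_l2_le_sum:
  fixes x :: "('k, 'v::real_normed_vector) l2"
  assumes "finite F" "\<And>k. k \<notin> F \<Longrightarrow> coord x k = 0"
  shows "norm x \<le> (\<Sum>k\<in>F. norm (coord x k))"
proof (rule norm_l2_leI)
  fix G :: "'k set" assume G: "finite G"
  have "L2_set (\<lambda>k. norm (coord x k)) G \<le> (\<Sum>k\<in>G. norm (coord x k))"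
    by (rule L2_set_le_sum) auto
  also have "\<dots> = (\<Sum>k\<in>G \<inter> F. norm (coord x k))"
    by (rule sum.mono_neutral_right) (use G assms in auto)
  also have "\<dots> \<le> (\<Sum>k\<in>F. norm (coord x k))"
    by (rule sum_mono2) (use assms in auto)
  finally show "L2_set (\<lambda>k. norm (coord x k)) G \<le> (\<Sum>k\<in>F. norm (coord x k))" .
qed

text \<open>Strong continuity: approximate by finitely supported vectors, on which only finitely many
  coordinates move.\<close>

lemma coordwise_flow_continuous:
  fixes U :: "real \<Rightarrow> ('k, 'v::real_normed_vector) l2 \<Rightarrow> ('k, 'v) l2"
  assumes U: "\<And>t x k. coord (U t x) k = u t k (coord x k)"
    and lin: "\<And>t k v w. u t k (v - w) = u t k v - u t k w"
    and K: "\<And>t k v. norm (u t k v) \<le> K * norm v"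
    and c: "\<And>k v. continuous_on UNIV (\<lambda>t. u t k v)"
  shows "continuous_on UNIV (\<lambda>(t, x). U t x)"
proof -
  have lip: "norm (U t x - U t y) \<le> \<bar>K\<bar> * norm (x - y)" for t x y
  proof -
    have "norm (U t x - U t y) \<le> norm (K *\<^sub>R (x - y))"
    proof (rule norm_l2_mono)
      fix k
      have "norm (coord (U t x - U t y) k) \<le> K * norm (coord x k - coord y k)"
        using K[of t k "coord x k - coord y k"] by (simp add: U lin)
      also have "\<dots> \<le> \<bar>K\<bar> * norm (coord x k - coord y k)" by (intro mult_right_mono) auto
      finally show "norm (coord (U t x - U t y) k) \<le> norm (coord (K *\<^sub>R (x - y)) k)" by simp
    qed
    then show ?thesis by simp
  qed
  have u0: "u t k 0 = 0" for t k using lin[of t k 0 0] by simp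
  have cu: "((\<lambda>t. u t k v) \<longlongrightarrow> u t0 k v) (at t0)" for t0 k v
    using c[of k v] unfolding continuous_on_def by blast
  have tc: "isCont (\<lambda>t. U t x) t0" for x t0
    unfolding isCont_def
  proof (rule LIM_I)
    fix r :: real assume r: "r > 0"
    define e where "e = r / (3 * (\<bar>K\<bar> + 1))"
    have e: "e > 0" "\<bar>K\<bar> * e < r / 3" using r by (auto simp: e_def field_simps)
    obtain z F where z: "finite F" "\<forall>k. coord z k = (if k \<in> F then coord x k else 0)" "norm (x - z) < e"
      using l2_restrict_approx[OF e(1), of x] by blast
    have "((\<lambda>t. \<Sum>k\<in>F. norm (u t k (coord z k) - u t0 k (coord z k))) \<longlongrightarrow> (\<Sum>k\<in>F. norm (u t0 k (coord z k) - u t0 k (coord z k)))) (at t0)"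
      by (intro tendsto_sum tendsto_norm tendsto_diff tendsto_const cu)
    then have "\<forall>\<^sub>F t in at t0. (\<Sum>k\<in>F. norm (u t k (coord z k) - u t0 k (coord z k))) < r / 3"
      using r by (intro order_tendstoD) auto
    then obtain d where d: "d > 0" "\<And>t. t \<noteq> t0 \<Longrightarrow> dist t t0 < d \<Longrightarrow> (\<Sum>k\<in>F. norm (u t k (coord z k) - u t0 k (coord z k))) < r / 3"
      unfolding eventually_at by auto
    show "\<exists>s>0. \<forall>t. t \<noteq> t0 \<and> norm (t - t0) < s \<longrightarrow> norm (U t x - U t0 x) < r"
    proof (intro exI conjI allI impI)
      show "d > 0" by fact
      fix t assume t: "t \<noteq> t0 \<and> norm (t - t0) < d"
      have "norm (U t z - U t0 z) \<le> (\<Sum>k\<in>F. norm (coord (U t z - U t0 z) k))"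
        by (rule norm_l2_le_sum) (use z in \<open>auto simp: U u0\<close>)
      then have 1: "norm (U t z - U t0 z) < r / 3" using d(2)[of t] t by (simp add: U dist_norm)
      have 2: "norm (U \<tau> x - U \<tau> z) < r / 3" for \<tau>
        using lip[of \<tau> x z] z(3) e(2) mult_left_mono[of "norm (x - z)" e "\<bar>K\<bar>"] by linarith
      have "U t x - U t0 x = (U t x - U t z) + (U t z - U t0 z) - (U t0 x - U t0 z)" by simp
      also have "norm \<dots> \<le> norm (U t x - U t z) + norm (U t z - U t0 z) + norm (U t0 x - U t0 z)"
        using norm_triangle_ineq4[of "(U t x - U t z) + (U t z - U t0 z)" "U t0 x - U t0 z"]
          norm_triangle_ineq[of "U t x - U t z" "U t z - U t0 z"] by linarith
      finally show "norm (U t x - U t0 x) < r" using 1 2[of t] 2[of t0] by linarith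
    qed
  qed
  have "isCont (\<lambda>(t, x). U t x) p" for p
  proof -
    obtain t0 x0 where p: "p = (t0, x0)" by force
    have "((\<lambda>q. \<bar>K\<bar> * norm (snd q - x0) + norm (U (fst q) x0 - U t0 x0)) \<longlongrightarrow> \<bar>K\<bar> * norm (snd p - x0) + norm (U t0 x0 - U t0 x0)) (at p)"
    proof (intro tendsto_intros)
      have "isCont (\<lambda>q. U (fst q) x0) p"
        using continuous_at_compose[of p fst "\<lambda>t. U t x0"] tc[of t0 x0] by (simp add: p o_def continuous_fst)
      then show "((\<lambda>q. U (fst q) x0) \<longlongrightarrow> U t0 x0) (at p)" by (simp add: isCont_def p)
    qed
    then have *: "((\<lambda>q. \<bar>K\<bar> * norm (snd q - x0) + norm (U (fst q) x0 - U t0 x0)) \<longlongrightarrow> 0) (at p)" by (simp add: p)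
    have "((\<lambda>q. U (fst q) (snd q) - U t0 x0) \<longlongrightarrow> 0) (at p)"
    proof (rule Lim_null_comparison[OF always_eventually *], rule allI)
      fix q :: "real \<times> ('k, 'v) l2"
      show "norm (U (fst q) (snd q) - U t0 x0) \<le> \<bar>K\<bar> * norm (snd q - x0) + norm (U (fst q) x0 - U t0 x0)"
        using lip[of "fst q" "snd q" x0] norm_triangle_ineq[of "U (fst q) (snd q) - U (fst q) x0" "U (fst q) x0 - U t0 x0"]
        by simp
    qed
    then have "((\<lambda>q. U (fst q) (snd q)) \<longlongrightarrow> U t0 x0) (at p)" by (rule LIM_zero_cancel)
    then show ?thesis unfolding isCont_def p by (simp add: case_prod_unfold)
  qed
  then show ?thesis by (simp add: continuous_at_imp_continuous_on)
qed

section \<open>Fourier coefficients on the torus\<close>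

lemma norm_vector_smult: "norm (c *s v) = cmod c * norm (v :: complex ^ 'n)"
  by (simp add: norm_vec_def vector_scalar_mult_def norm_mult L2_set_right_distrib)

lemma bounded_bilinear_vector_smult: "bounded_bilinear ((*s) :: complex \<Rightarrow> complex ^ 'n \<Rightarrow> complex ^ 'n)"
proof
  show "\<exists>K. \<forall>a (b :: complex ^ 'n). norm (a *s b) \<le> norm a * norm b * K"
    by (intro exI[of _ 1]) (simp add: norm_vector_smult)
qed (auto simp: vec_eq_iff algebra_simps scaleR_conv_of_real[where 'a=complex])

lemmas vsmult_continuous_on = bounded_bilinear.continuous_on[OF bounded_bilinear_vector_smult]
lemmas vsmult_linear_right = bounded_bilinear.bounded_linear_right[OF bounded_bilinear_vector_smult]
lemmas vsmult_linear_left = bounded_bilinear.bounded_linear_left[OF bounded_bilinear_vector_smult]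

text \<open>Normalisation of terms that mix complex and real scalars: all of them become complex and move
  outwards.\<close>

lemma vsmult_algebra [simp]:
  fixes v w :: "complex ^ 'n"
  shows "a *s (b *s v) = (a * b) *s v" "a *s (v + w) = a *s v + a *s w" "a *s (v - w) = a *s v - a *s w"
    "(a + b) *s v = a *s v + b *s v" "(a - b) *s v = a *s v - b *s v" "r *\<^sub>R (a *s v) = (of_real r * a) *s v"
    "a *s (r *\<^sub>R v) = (of_real r * a) *s v" "a *s (- v) = - (a *s v)" "(- a) *s v = - (a *s v)"
    "a *s (0 :: complex ^ 'n) = 0" "0 *s v = 0" "1 *s v = v"
  by (auto simp: vec_eq_iff algebra_simps scaleR_conv_of_real[where 'a=complex])

lemma vsmult_of_real: "(of_real r :: complex) *s v = r *\<^sub>R (v :: complex ^ 'n)"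
  by (simp add: vec_eq_iff scaleR_conv_of_real[where 'a=complex])

lemma vsmult_sum_right: "c *s (\<Sum>i\<in>A. f i) = (\<Sum>i\<in>A. c *s (f i :: complex ^ 'n))"
  by (simp add: bounded_bilinear.sum_right[OF bounded_bilinear_vector_smult])

lemma inner_vsmult_left: "(c *s v) \<bullet> w = v \<bullet> (cnj c *s (w :: complex ^ 'n))"
  by (simp add: inner_vec_def inner_complex_def algebra_simps)

definition freq :: "int ^ 'd \<Rightarrow> real ^ 'd" where
  "freq k = (\<chi> j. of_int (k $ j))"

definition emode :: "int ^ 'd \<Rightarrow> real ^ 'd \<Rightarrow> complex" where
  "emode k x = cis (freq k \<bullet> x)"

lemma freq_simps [simp]: "freq (k + l) = freq k + freq l" "freq (k - l) = freq k - freq l"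
    "freq (- k) = - freq k" "freq 0 = 0" "freq k $ j = of_int (k $ j)"
  by (auto simp: freq_def vec_eq_iff)

lemma emode_0 [simp]: "emode 0 x = 1" by (simp add: emode_def)

lemma emode_add: "emode (k + l) x = emode k x * emode l x"
  by (simp add: emode_def inner_left_distrib cis_mult)

lemma emode_minus: "emode (- k) x = cnj (emode k x)"
  by (simp add: emode_def cis_cnj)

lemma norm_emode [simp]: "cmod (emode k x) = 1" by (simp add: emode_def)

lemma continuous_on_emode [continuous_intros]: "continuous_on S (emode k)"
  unfolding emode_def by (intro continuous_intros)

lemma emode_shift: "emode k (x + axis j (2 * pi)) = emode k x"
proof -
  have "freq k \<bullet> axis j (2 * pi) = 2 * pi * of_int (k $ j)"
    by (simp add: inner_axis freq_def)
  then have "emode k (x + axis j (2 * pi)) = emode k x * cis (2 * pi * of_int (k $ j))"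
    by (simp add: emode_def inner_right_distrib cis_mult del: cis_multiple_2pi)
  also have "cis (2 * pi * of_int (k $ j)) = 1" by (rule cis_multiple_2pi) auto
  finally show ?thesis by simp
qed

lemma periodic_emode: "periodic (emode k)" by (simp add: periodic_def emode_shift)

lemma fourier_coeff_emode:
  "fourier_coeff u k = (1 / (2 * pi) ^ CARD('d)) *\<^sub>R (LINT x:cell|lebesgue. emode (- k) x *s u x)"
  for u :: "real ^ 'd \<Rightarrow> complex ^ 'n"
proof -
  have "emode (- k) x = cis (- (\<Sum>j\<in>UNIV. of_int (k $ j) * x $ j))" for x :: "real ^ 'd"
    by (simp add: emode_def inner_vec_def sum_negf)
  then show ?thesis by (simp add: fourier_coeff_def)
qed

subsection \<open>Periodicity\<close>

lemma periodic_shift_axis: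
  assumes "periodic u"
  shows "u (x + axis j (2 * pi * of_int n)) = u x"
proof -
  have nat: "u (y + axis j (2 * pi * real m)) = u y" for m y
  proof (induction m)
    case (Suc m)
    have "y + axis j (2 * pi * real (Suc m)) = (y + axis j (2 * pi * real m)) + axis j (2 * pi)"
      by (simp add: vec_eq_iff axis_def algebra_simps)
    then show ?case using assms Suc unfolding periodic_def by metis
  qed (simp add: axis_def vec_eq_iff zero_vec_def[symmetric])
  show ?thesis
  proof (cases "n \<ge> 0")
    case True
    then show ?thesis using nat[of x "nat n"] by simp
  next
    case False
    have "x + axis j (2 * pi * of_int n) + axis j (2 * pi * real (nat (- n))) = x"
      using False by (simp add: vec_eq_iff axis_def algebra_simps)
    then show ?thesis using nat[of "x + axis j (2 * pi * of_int n)" "nat (- n)"] by metis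
  qed
qed

lemma periodic_shift:
  assumes "periodic u"
  shows "u (x + (2 * pi) *\<^sub>R freq z) = u x"
proof -
  have "u (x + (\<Sum>j\<in>S. axis j (2 * pi * of_int (z $ j)))) = u x" if "finite S" for S
    using that
  proof (induction S arbitrary: x)
    case (insert j S)
    have "u (x + (\<Sum>j\<in>insert j S. axis j (2 * pi * of_int (z $ j))))
        = u ((x + axis j (2 * pi * of_int (z $ j))) + (\<Sum>j\<in>S. axis j (2 * pi * of_int (z $ j))))"
      using insert by (simp add: algebra_simps)
    then show ?case using insert.IH periodic_shift_axis[OF assms] by simp
  qed simp
  moreover have "(\<Sum>j\<in>UNIV. axis j (2 * pi * of_int (z $ j))) = (2 * pi) *\<^sub>R freq z"
    by (simp add: vec_eq_iff axis_def if_distrib cong: if_cong)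
  ultimately show ?thesis by (metis finite_code)
qed

lemma cell_representative: "\<exists>z. x + (2 * pi) *\<^sub>R freq z \<in> cell"
proof
  let ?z = "\<chi> j. - \<lfloor>x $ j / (2 * pi)\<rfloor>"
  have "0 \<le> x $ j - 2 * pi * of_int \<lfloor>x $ j / (2 * pi)\<rfloor> \<and> x $ j - 2 * pi * of_int \<lfloor>x $ j / (2 * pi)\<rfloor> \<le> 2 * pi" for j
  proof -
    define n where "n = \<lfloor>x $ j / (2 * pi)\<rfloor>"
    have "of_int n \<le> x $ j / (2 * pi)" "x $ j / (2 * pi) < of_int n + 1"
      unfolding n_def by (simp_all add: floor_correct)
    then show ?thesis unfolding n_def[symmetric] using pi_gt_zero
      by (simp add: pos_le_divide_eq pos_divide_less_eq algebra_simps)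
  qed
  then show "x + (2 * pi) *\<^sub>R freq ?z \<in> cell"
    by (simp add: cell_def mem_box_cart)
qed

lemma compact_cell: "compact cell" by (simp add: cell_def)

text \<open>Continuous periodic functions. On them the Lebesgue integrals in the definition of the Fourier
  coefficients are Henstock-Kurzweil integrals over the cell.\<close>

definition CP :: "(real ^ 'd \<Rightarrow> 'b::real_normed_vector) set" where
  "CP = {u. continuous_on UNIV u \<and> periodic u}"

lemma CP_bounded:
  assumes "u \<in> CP"
  shows "\<exists>B. \<forall>x. norm (u x) \<le> B"
proof -
  have "bounded (u ` cell)"
    using assms by (intro compact_imp_bounded compact_continuous_image compact_cell)
      (auto simp: CP_def intro: continuous_on_subset)
  then obtain B where B: "\<forall>x\<in>cell. norm (u x) \<le> B" by (auto simp: bounded_iff)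
  have "norm (u x) \<le> B" for x
    using cell_representative[of x] periodic_shift[of u x] assms B by (auto simp: CP_def)
  then show ?thesis by blast
qed

lemma CP_bcontfun: "u \<in> CP \<Longrightarrow> u \<in> bcontfun"
  using CP_bounded[of u] by (auto simp: CP_def intro: bcontfun_normI)

lemma CP_integrable_on: "(u :: real ^ 'd \<Rightarrow> 'b::euclidean_space) \<in> CP \<Longrightarrow> u integrable_on cell"
  unfolding cell_def CP_def by (auto intro: integrable_continuous continuous_on_subset)

lemma set_integrable_cell:
  fixes u :: "real ^ 'd \<Rightarrow> 'b::euclidean_space"
  assumes "continuous_on UNIV u"
  shows "set_integrable lebesgue cell u"
  unfolding cell_def by (intro absolutely_integrable_continuous continuous_on_subset[OF assms]) auto

lemma LINT_cell_eq_integral: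
  fixes u :: "real ^ 'd \<Rightarrow> 'b::euclidean_space"
  shows "continuous_on UNIV u \<Longrightarrow> (LINT x:cell|lebesgue. u x) = integral cell u"
  by (simp add: set_lebesgue_integral_eq_integral(2)[OF set_integrable_cell])

lemma CP_vsmult: "f \<in> CP \<Longrightarrow> g \<in> CP \<Longrightarrow> (\<lambda>x. f x *s (g x :: complex ^ 'n)) \<in> CP"
  by (auto simp: CP_def periodic_def intro: vsmult_continuous_on)

lemma CP_emode: "emode k \<in> CP" by (simp add: CP_def periodic_emode continuous_on_emode)

lemma CP_const: "(\<lambda>x. c) \<in> CP" by (simp add: CP_def periodic_def)

lemma CP_add: "f \<in> CP \<Longrightarrow> g \<in> CP \<Longrightarrow> (\<lambda>x. f x + g x) \<in> CP"
  by (auto simp: CP_def periodic_def intro: continuous_intros)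

lemma CP_diff: "f \<in> CP \<Longrightarrow> g \<in> CP \<Longrightarrow> (\<lambda>x. f x - g x) \<in> CP"
  by (auto simp: CP_def periodic_def intro: continuous_intros)

lemma CP_scaleR: "f \<in> CP \<Longrightarrow> g \<in> CP \<Longrightarrow> (\<lambda>x. f x *\<^sub>R g x) \<in> CP"
  by (auto simp: CP_def periodic_def intro: continuous_intros)

lemma CP_sum: "(\<And>i. i \<in> A \<Longrightarrow> f i \<in> CP) \<Longrightarrow> (\<lambda>x. \<Sum>i\<in>A. f i x) \<in> CP"
  by (auto simp: CP_def periodic_def intro: continuous_intros)

lemma CP_compose: "f \<in> CP \<Longrightarrow> continuous_on UNIV G \<Longrightarrow> (\<lambda>x. G (f x)) \<in> CP"
  by (auto simp: CP_def periodic_def intro: continuous_on_compose2)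

lemma CP_inner: "f \<in> CP \<Longrightarrow> g \<in> CP \<Longrightarrow> (\<lambda>x. f x \<bullet> g x) \<in> CP"
  by (auto simp: CP_def periodic_def intro: continuous_intros)

subsection \<open>Translation invariance and integration by parts\<close>

text \<open>Cut the shifted cell along the face of the original one and move the overhanging part back by one
  period.\<close>

lemma integral_cell_translate:
  fixes g :: "real ^ 'd \<Rightarrow> 'b::euclidean_space"
  assumes g: "g \<in> CP" and h: "0 \<le> h" "h \<le> 2 * pi"
  shows "integral cell (\<lambda>x. g (x + axis j h)) = integral cell g"
proof -
  define b :: "real ^ 'd" where "b = (\<chi> i. 2 * pi)"
  define c where "c = (\<chi> i. if i = j then h else 2 * pi)"
  have gi: "g integrable_on cbox u v" for u v
    using g by (auto simp: CP_def intro!: integrable_continuous intro: continuous_on_subset)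
  have ax: "(axis j 1 :: real ^ 'd) \<in> Basis" for j :: 'd by (simp add: Basis_real_def)
  have le: "cbox u v \<inter> {x. x \<bullet> axis j 1 \<le> r} = cbox u (\<chi> i. if i = j then min (v $ j) r else v $ i)"
    and ge: "cbox u v \<inter> {x. x \<bullet> axis j 1 \<ge> r} = cbox (\<chi> i. if i = j then max (u $ j) r else u $ i) v"
    for u v :: "real ^ 'd" and r
    using interval_split_cart[where a = u and b = v and k = j and c = r] by (simp_all add: inner_axis interval_cbox_cart)
  have eqI: "u = u' \<Longrightarrow> v = v' \<Longrightarrow> cbox u v = cbox u' v'" for u v u' v' :: "real ^ 'd" by simp
  have "integral cell (\<lambda>x. g (x + axis j h)) = integral (cbox (axis j h) (b + axis j h)) g"
    using integral_shift_cbox[of "axis j h" "axis j h" "b + axis j h" g] by (simp add: cell_def b_def)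
  also have "\<dots> = integral (cbox (axis j h) (b + axis j h) \<inter> {x. x \<bullet> axis j 1 \<le> 2 * pi}) g
       + integral (cbox (axis j h) (b + axis j h) \<inter> {x. x \<bullet> axis j 1 \<ge> 2 * pi}) g"
    by (rule integral_split[OF gi ax])
  also have "cbox (axis j h) (b + axis j h) \<inter> {x. x \<bullet> axis j 1 \<le> 2 * pi} = cbox (axis j h) b"
    unfolding le ge using h by (intro eqI) (auto simp: vec_eq_iff b_def axis_def)
  also have "cbox (axis j h) (b + axis j h) \<inter> {x. x \<bullet> axis j 1 \<ge> 2 * pi} = cbox (axis j (2 * pi)) (b + axis j h)"
    unfolding le ge using h by (intro eqI) (auto simp: vec_eq_iff b_def axis_def)
  also have "integral (cbox (axis j (2 * pi)) (b + axis j h)) g = integral (cbox 0 c) (\<lambda>x. g (x + axis j (2 * pi)))"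
  proof -
    have "b + axis j h - axis j (2 * pi) = c" by (simp add: vec_eq_iff b_def c_def axis_def)
    then show ?thesis
      using integral_shift_cbox[of "axis j (2 * pi)" "axis j (2 * pi)" "b + axis j h" g] by simp
  qed
  also have "(\<lambda>x. g (x + axis j (2 * pi))) = g" using g by (simp add: CP_def periodic_def)
  also have "cbox 0 c = cbox 0 b \<inter> {x. x \<bullet> axis j 1 \<le> h}"
    unfolding le ge using h by (intro eqI) (auto simp: vec_eq_iff b_def c_def)
  also have "cbox (axis j h) b = cbox 0 b \<inter> {x. x \<bullet> axis j 1 \<ge> h}"
    unfolding le ge using h by (intro eqI) (auto simp: vec_eq_iff b_def axis_def)
  also have "integral (cbox 0 b \<inter> {x. x \<bullet> axis j 1 \<ge> h}) g + integral (cbox 0 b \<inter> {x. x \<bullet> axis j 1 \<le> h}) g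
      = integral (cbox 0 b) g"
    using integral_split[OF gi ax, of 0 b j h] by simp
  finally show ?thesis by (simp add: cell_def b_def)
qed

lemma axis_zero: "axis j 0 = (0 :: real ^ 'd)" by (simp add: vec_eq_iff axis_def)

lemma has_vector_derivative_iff_quotient:
  fixes f :: "real \<Rightarrow> 'a::real_normed_vector"
  shows "(f has_vector_derivative v) (at t within I) \<longleftrightarrow>
    ((\<lambda>\<tau>. norm ((1 / (\<tau> - t)) *\<^sub>R (f \<tau> - f t) - v)) \<longlongrightarrow> 0) (at t within I)"
proof -
  have e: "norm ((1 / norm (\<tau> - t)) *\<^sub>R (f \<tau> - (f t + (\<tau> - t) *\<^sub>R v))) = norm ((1 / (\<tau> - t)) *\<^sub>R (f \<tau> - f t) - v)" if "\<tau> \<noteq> t" for \<tau>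
  proof -
    have "(1 / (\<tau> - t)) *\<^sub>R (f \<tau> - f t) - v = (1 / (\<tau> - t)) *\<^sub>R (f \<tau> - (f t + (\<tau> - t) *\<^sub>R v))"
      using that by (simp add: scaleR_diff_right scaleR_add_right)
    then show ?thesis by simp
  qed
  have "((\<lambda>\<tau>. norm ((1 / norm (\<tau> - t)) *\<^sub>R (f \<tau> - (f t + (\<tau> - t) *\<^sub>R v)))) \<longlongrightarrow> 0) (at t within I) \<longleftrightarrow>
      ((\<lambda>\<tau>. norm ((1 / (\<tau> - t)) *\<^sub>R (f \<tau> - f t) - v)) \<longlongrightarrow> 0) (at t within I)"
    by (rule tendsto_cong) (unfold eventually_at_filter, auto intro!: always_eventually e simp del: real_norm_def norm_scaleR)
  then show ?thesis
    unfolding has_vector_derivative_def has_derivative_within tendsto_norm_zero_iff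
    by (simp add: bounded_linear_scaleR_left)
qed

lemma has_vector_derivative_quotient:
  assumes "(f has_vector_derivative v) (at 0)"
  shows "((\<lambda>t. (f t - f 0) /\<^sub>R t) \<longlongrightarrow> v) (at 0)"
  using assms by (simp add: has_vector_derivative_iff_quotient tendsto_norm_zero_iff LIM_zero_iff inverse_eq_divide)

text \<open>The derivative is taken at the parameter \<open>0\<close>, where series and compositions are easiest to
  differentiate; a shift of the base point gives the other parameters.\<close>

definition has_partial :: "(real ^ 'd \<Rightarrow> 'b::real_normed_vector) \<Rightarrow> 'd \<Rightarrow> (real ^ 'd \<Rightarrow> 'b) \<Rightarrow> bool" where
  "has_partial g j g' \<longleftrightarrow> (\<forall>x. ((\<lambda>t. g (x + axis j t)) has_vector_derivative g' x) (at 0))"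

lemma has_partialD:
  assumes "has_partial g j g'"
  shows "((\<lambda>t. g (x + axis j t)) has_vector_derivative g' (x + axis j t)) (at t)"
proof -
  have 1: "((\<lambda>s::real. s - t) has_vector_derivative 1) (at t)"
    by (auto intro!: derivative_eq_intros)
  have "((\<lambda>s. g ((x + axis j t) + axis j s)) has_vector_derivative g' (x + axis j t)) (at (t - t))"
    using assms by (simp add: has_partial_def)
  from vector_diff_chain_at[OF 1 this]
  have "((\<lambda>s. g ((x + axis j t) + axis j (s - t))) has_vector_derivative g' (x + axis j t)) (at t)"
    by (simp add: o_def)
  moreover have "(x + axis j t) + axis j (s - t) = x + axis j s" for s
    by (simp add: vec_eq_iff axis_def)
  ultimately show ?thesis by simp
qed

text \<open>The integral of a difference quotient vanishes by translation invariance.\<close>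

lemma integral_cell_partial:
  fixes g :: "real ^ 'd \<Rightarrow> 'b::euclidean_space"
  assumes g: "g \<in> CP" "g' \<in> CP" and p: "has_partial g j g'"
  shows "integral cell g' = 0"
proof -
  obtain B where B: "\<And>x. norm (g' x) \<le> B" using CP_bounded[OF g(2)] by blast
  define f where "f n x = real (Suc n) *\<^sub>R (g (x + axis j (1 / real (Suc n))) - g x)" for n x
  have CPs: "(\<lambda>x. g (x + axis j h)) \<in> CP" for h
  proof -
    have "continuous_on UNIV (\<lambda>x. g (x + axis j h))"
      using g(1) by (auto simp: CP_def intro!: continuous_on_compose2[of UNIV g] continuous_intros)
    moreover have "periodic (\<lambda>x. g (x + axis j h))"
      unfolding periodic_def
    proof (intro allI)
      fix x :: "real ^ 'd" and i
      have "x + axis i (2 * pi) + axis j h = (x + axis j h) + axis i (2 * pi)" by (simp add: add_ac)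
      then show "g (x + axis i (2 * pi) + axis j h) = g (x + axis j h)"
        using g(1) by (simp only: CP_def periodic_def mem_Collect_eq)
    qed
    ultimately show ?thesis by (simp add: CP_def)
  qed
  have fCP: "f n \<in> CP" for n
    unfolding f_def by (intro CP_scaleR[of "\<lambda>_. real (Suc n)"] CP_const CP_diff CPs g(1))
  have "(\<lambda>n. integral cell (f n)) \<longlonglongrightarrow> integral cell g'"
  proof (rule dominated_convergence(2)[where h = "\<lambda>_. B"])
    show "f n integrable_on cell" for n by (rule CP_integrable_on[OF fCP])
    show "(\<lambda>_. B) integrable_on cell" by (rule CP_integrable_on[OF CP_const])
    show "norm (f n x) \<le> B" if "x \<in> cell" for n x
    proof -
      have "norm (g (x + axis j (1 / real (Suc n))) - g (x + axis j 0)) \<le> B * norm (1 / real (Suc n) - 0)"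
      proof (rule differentiable_bound[where S = UNIV and f = "\<lambda>t. g (x + axis j t)"])
        show "((\<lambda>t. g (x + axis j t)) has_derivative (\<lambda>h. h *\<^sub>R g' (x + axis j t))) (at t within UNIV)" for t
          using has_partialD[OF p, of x t] by (simp add: has_vector_derivative_def)
        show "onorm (\<lambda>h. h *\<^sub>R g' (x + axis j t)) \<le> B" for t
        proof (rule onorm_le)
          fix y :: real
          have "\<bar>y\<bar> * norm (g' (x + axis j t)) \<le> \<bar>y\<bar> * B" using B by (intro mult_left_mono) auto
          then show "norm (y *\<^sub>R g' (x + axis j t)) \<le> B * norm y" by (simp add: mult.commute)
        qed
      qed auto
      moreover have "axis j 0 = (0 :: real ^ 'd)" by (simp add: vec_eq_iff axis_def)
      ultimately have "real (Suc n) * norm (g (x + axis j (1 / real (Suc n))) - g x) \<le> B"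
        by (simp add: field_simps del: of_nat_Suc)
      then show ?thesis by (simp only: f_def norm_scaleR abs_of_nat)
    qed
    show "(\<lambda>n. f n x) \<longlonglongrightarrow> g' x" if "x \<in> cell" for x
    proof -
      have "((\<lambda>t. (g (x + axis j t) - g x) /\<^sub>R t) \<longlongrightarrow> g' x) (at 0)"
        using has_vector_derivative_quotient[OF p[unfolded has_partial_def, rule_format, of x]]
        by (simp add: axis_zero)
      moreover have "filterlim (\<lambda>n. 1 / real (Suc n)) (at 0) sequentially"
        using LIMSEQ_Suc[OF lim_inverse_n'] by (auto simp: filterlim_at)
      ultimately have "(\<lambda>n. (g (x + axis j (1 / real (Suc n))) - g x) /\<^sub>R (1 / real (Suc n))) \<longlonglongrightarrow> g' x"
        by (rule filterlim_compose)
      then show ?thesis by (simp add: f_def)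
    qed
  qed
  moreover have "integral cell (f n) = 0" for n
  proof -
    define h where "h = 1 / real (Suc n)"
    have "h \<le> 1" "0 \<le> h" by (simp_all add: h_def)
    then have h: "0 \<le> h" "h \<le> 2 * pi" using pi_gt3 by simp_all
    have "integral cell (\<lambda>x. g (x + axis j (1 / real (Suc n)))) = integral cell g"
      using integral_cell_translate[OF g(1) h, of j] by (simp only: h_def)
    then have "integral cell (\<lambda>x. g (x + axis j (1 / real (Suc n))) - g x) = 0"
      by (subst Henstock_Kurzweil_Integration.integral_diff)
        (simp_all only: CP_integrable_on[OF CPs] CP_integrable_on[OF g(1)] diff_self)
    then show ?thesis unfolding f_def by (simp only: integral_cmul scaleR_zero_right)
  qed
  ultimately show ?thesis by (simp add: LIMSEQ_const_iff)
qed

lemma has_partial_emode: "has_partial (emode k) j (\<lambda>x. \<i> * of_int (k $ j) * emode k x)"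
  unfolding has_partial_def
proof
  fix x
  have "((\<lambda>t. cis (freq k \<bullet> x + of_int (k $ j) * t)) has_vector_derivative (of_int (k $ j)) *\<^sub>R (\<i> * cis (freq k \<bullet> x + of_int (k $ j) * 0))) (at 0)"
    unfolding cis_conv_exp
    by (auto intro!: derivative_eq_intros has_vector_derivative_real_field simp: scaleR_conv_of_real[where 'a=complex])
  then show "((\<lambda>t. emode k (x + axis j t)) has_vector_derivative \<i> * of_int (k $ j) * emode k x) (at 0)"
    by (simp add: emode_def inner_right_distrib inner_axis mult_ac scaleR_conv_of_real[where 'a=complex])
qed

lemma has_partial_vsmult:
  fixes g :: "real ^ 'd \<Rightarrow> complex ^ 'n"
  assumes "has_partial f j f'" "has_partial g j g'"
  shows "has_partial (\<lambda>x. f x *s g x) j (\<lambda>x. f x *s g' x + f' x *s g x)"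
  unfolding has_partial_def
proof
  fix x
  have z: "axis j 0 = (0 :: real ^ 'd)" by (simp add: vec_eq_iff axis_def)
  show "((\<lambda>t. f (x + axis j t) *s g (x + axis j t)) has_vector_derivative f x *s g' x + f' x *s g x) (at 0)"
    using bounded_bilinear.has_vector_derivative[OF bounded_bilinear_vector_smult
        assms(1)[unfolded has_partial_def, rule_format, of x] assms(2)[unfolded has_partial_def, rule_format, of x]]
    by (simp add: z)
qed

lemma fourier_coeff_CP:
  fixes u :: "real ^ 'd \<Rightarrow> complex ^ 'n"
  assumes "u \<in> CP"
  shows "fourier_coeff u k = (1 / (2 * pi) ^ CARD('d)) *\<^sub>R integral cell (\<lambda>x. emode (- k) x *s u x)"
  using CP_vsmult[OF CP_emode[of "- k"] assms]
  by (simp add: fourier_coeff_emode LINT_cell_eq_integral CP_def)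

text \<open>Integration by parts: the integral of the derivative of \<open>e\<^sub>-\<^sub>k u\<close> vanishes.\<close>

lemma fourier_coeff_partial:
  fixes u :: "real ^ 'd \<Rightarrow> complex ^ 'n"
  assumes u: "u \<in> CP" "u' \<in> CP" and p: "has_partial u j u'"
  shows "fourier_coeff u' k = (\<i> * of_int (k $ j)) *s fourier_coeff u k"
proof -
  let ?e = "\<lambda>x. emode (- k) x *s u x"
  have 1: "(\<lambda>x. emode (- k) x *s u' x) \<in> CP" and 2: "?e \<in> CP"
    by (intro CP_vsmult CP_emode u)+
  have 3: "(\<lambda>x. (\<i> * of_int ((- k) $ j) * emode (- k) x) *s u x) \<in> CP"
    using CP_vsmult[OF CP_const 2, of "\<i> * of_int ((- k) $ j)"] by simp
  have "integral cell (\<lambda>x. emode (- k) x *s u' x + (\<i> * of_int ((- k) $ j) * emode (- k) x) *s u x) = 0"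
    by (rule integral_cell_partial[OF 2 CP_add[OF 1 3]]) (rule has_partial_vsmult[OF has_partial_emode p])
  then have "integral cell (\<lambda>x. emode (- k) x *s u' x) + integral cell (\<lambda>x. (\<i> * of_int ((- k) $ j) * emode (- k) x) *s u x) = 0"
    by (subst (asm) Henstock_Kurzweil_Integration.integral_add) (intro CP_integrable_on 1 3)+
  moreover have "integral cell (\<lambda>x. (\<i> * of_int ((- k) $ j) * emode (- k) x) *s u x)
      = (\<i> * of_int ((- k) $ j)) *s integral cell ?e"
    using integral_linear[OF CP_integrable_on[OF 2] vsmult_linear_right, of "\<i> * of_int ((- k) $ j)"] by (simp add: o_def)
  ultimately show ?thesis
    by (simp add: fourier_coeff_CP u add_eq_0_iff)
qed

lemma has_sum_diff:
  fixes f g :: "'i \<Rightarrow> 'v::real_normed_vector"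
  assumes "(f has_sum a) A" "(g has_sum b) A"
  shows "((\<lambda>i. f i - g i) has_sum a - b) A"
  using has_sum_add[OF assms(1) has_sum_scaleR[OF assms(2), of "- 1"]] by simp

subsection \<open>Bessel's inequality and termwise computation\<close>

lemma content_cell: "measure lborel (cell :: (real ^ 'd) set) = (2 * pi) ^ CARD('d)"
proof -
  have "(0 :: real ^ 'd) \<in> cell" by (simp add: cell_def mem_box_cart)
  then show ?thesis unfolding cell_def by (subst content_cbox_cart) (auto simp: cell_def)
qed

lemma fourier_coeff_cont:
  fixes u :: "real ^ 'd \<Rightarrow> complex ^ 'n"
  assumes "continuous_on UNIV u"
  shows "fourier_coeff u k = (1 / (2 * pi) ^ CARD('d)) *\<^sub>R integral cell (\<lambda>x. emode (- k) x *s u x)"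
  using vsmult_continuous_on[OF continuous_on_emode assms, of "- k"]
  by (simp add: fourier_coeff_emode LINT_cell_eq_integral)

lemma emode_vsmult_integrable:
  fixes u :: "real ^ 'd \<Rightarrow> complex ^ 'n"
  assumes "continuous_on UNIV u"
  shows "(\<lambda>x. emode k x *s u x) integrable_on cell"
  unfolding cell_def
  by (intro integrable_continuous continuous_on_subset[OF vsmult_continuous_on[OF continuous_on_emode assms]]) auto

lemma bounded_linear_fourier_coeff:
  "bounded_linear (\<lambda>f :: (real ^ 'd) \<Rightarrow>\<^sub>C (complex ^ 'n). fourier_coeff (apply_bcontfun f) k)"
proof (rule bounded_linear_intro[where K = 1])
  fix f g :: "(real ^ 'd) \<Rightarrow>\<^sub>C (complex ^ 'n)" and r :: real
  have c: "continuous_on UNIV (apply_bcontfun f)" for f :: "(real ^ 'd) \<Rightarrow>\<^sub>C (complex ^ 'n)" by simp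
  show "fourier_coeff (apply_bcontfun (f + g)) k = fourier_coeff (apply_bcontfun f) k + fourier_coeff (apply_bcontfun g) k"
    by (simp add: fourier_coeff_cont[OF c] fourier_coeff_cont[OF continuous_on_add[OF c c]] scaleR_add_right[symmetric]
        Henstock_Kurzweil_Integration.integral_add[symmetric] emode_vsmult_integrable[OF c] del: scaleR_add_right)
  have "integral cell (\<lambda>x. emode (- k) x *s (r *\<^sub>R apply_bcontfun f x)) = r *\<^sub>R integral cell (\<lambda>x. emode (- k) x *s apply_bcontfun f x)"
    unfolding integral_cmul[symmetric] by (intro arg_cong[where f = "integral cell"] ext) (simp add: mult.commute)
  then show "fourier_coeff (apply_bcontfun (r *\<^sub>R f)) k = r *\<^sub>R fourier_coeff (apply_bcontfun f) k"
    using fourier_coeff_cont[OF c[of "r *\<^sub>R f"], of k] fourier_coeff_cont[OF c[of f], of k] by simp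
  have "norm (integral cell (\<lambda>x. emode (- k) x *s apply_bcontfun f x)) \<le> norm f * measure lborel (cell :: (real ^ 'd) set)"
    unfolding cell_def
  proof (rule has_integral_bound)
    show "((\<lambda>x. emode (- k) x *s apply_bcontfun f x) has_integral
        integral (cbox 0 (\<chi> j. 2 * pi)) (\<lambda>x. emode (- k) x *s apply_bcontfun f x)) (cbox 0 (\<chi> j. 2 * pi))"
      using emode_vsmult_integrable[OF c] unfolding cell_def by (rule integrable_integral)
    show "norm (emode (- k) x *s apply_bcontfun f x) \<le> norm f" for x
      using norm_bounded[of f x] by (simp add: norm_vector_smult)
  qed simp
  then show "norm (fourier_coeff (apply_bcontfun f) k) \<le> norm f * 1"
    by (simp add: fourier_coeff_cont[OF c] content_cell field_simps)
qed

instance bcontfun :: (metric_space, banach) banach ..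

lemma bounded_linear_apply_bcontfun: "bounded_linear (\<lambda>f :: 'a::topological_space \<Rightarrow>\<^sub>C 'b::real_normed_vector. apply_bcontfun f x)"
  by (rule bounded_linear_intro[where K = 1]) (auto simp: norm_bounded)

text \<open>A series of continuous functions with summable sup norms converges in the Banach space of
  bounded continuous functions, on which evaluation and Fourier coefficients are bounded functionals.\<close>

lemma fourier_coeff_series:
  fixes h :: "'i \<Rightarrow> real ^ 'd \<Rightarrow> complex ^ 'n"
  assumes c: "\<And>i. continuous_on UNIV (h i)" and b: "\<And>i x. norm (h i x) \<le> b i" and s: "b summable_on UNIV"
    and u: "\<And>x. ((\<lambda>i. h i x) has_sum u x) UNIV"
  shows "continuous_on UNIV u" and "((\<lambda>i. fourier_coeff (h i) k) has_sum fourier_coeff u k) UNIV"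
proof -
  have ap: "apply_bcontfun (Bcontfun (h i)) = h i" for i
    by (intro Bcontfun_inverse bcontfun_normI[OF c b])
  have "in_l1 (\<lambda>i. Bcontfun (h i))"
    by (rule summable_on_comparison_test[OF s]) (auto intro!: norm_bound simp: ap b)
  then have S: "((\<lambda>i. Bcontfun (h i)) has_sum (\<Sum>\<^sub>\<infinity>i. Bcontfun (h i))) UNIV"
    by (rule has_sum_infsum[OF Infinite_Sum.abs_summable_summable])
  have "apply_bcontfun (\<Sum>\<^sub>\<infinity>i. Bcontfun (h i)) x = u x" for x
    using has_sum_bounded_linear[OF bounded_linear_apply_bcontfun S, of x] u[of x]
    by (intro has_sum_unique) (auto simp: ap)
  then have eq: "apply_bcontfun (\<Sum>\<^sub>\<infinity>i. Bcontfun (h i)) = u" by auto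
  show "continuous_on UNIV u" unfolding eq[symmetric] by simp
  show "((\<lambda>i. fourier_coeff (h i) k) has_sum fourier_coeff u k) UNIV"
    using has_sum_bounded_linear[OF bounded_linear_fourier_coeff S, of k] by (simp add: ap eq)
qed

lemma CP_apply_bcontfun: "u \<in> CP \<Longrightarrow> apply_bcontfun (Bcontfun u) = u"
  by (intro Bcontfun_inverse CP_bcontfun)

lemma fourier_coeff_add:
  fixes u v :: "real ^ 'd \<Rightarrow> complex ^ 'n"
  assumes "u \<in> CP" "v \<in> CP"
  shows "fourier_coeff (\<lambda>x. u x + v x) k = fourier_coeff u k + fourier_coeff v k"
  using linear_add[OF bounded_linear.linear[OF bounded_linear_fourier_coeff], of "Bcontfun u" "Bcontfun v" k]
  by (simp add: CP_apply_bcontfun assms)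

lemma fourier_coeff_diff:
  fixes u v :: "real ^ 'd \<Rightarrow> complex ^ 'n"
  assumes "u \<in> CP" "v \<in> CP"
  shows "fourier_coeff (\<lambda>x. u x - v x) k = fourier_coeff u k - fourier_coeff v k"
  using linear_diff[OF bounded_linear.linear[OF bounded_linear_fourier_coeff], of "Bcontfun u" "Bcontfun v" k]
  by (simp add: CP_apply_bcontfun assms)

lemma fourier_coeff_sum:
  fixes u :: "'i \<Rightarrow> real ^ 'd \<Rightarrow> complex ^ 'n"
  assumes "\<And>i. i \<in> A \<Longrightarrow> u i \<in> CP" "finite A"
  shows "fourier_coeff (\<lambda>x. \<Sum>i\<in>A. u i x) k = (\<Sum>i\<in>A. fourier_coeff (u i) k)"
  using assms(2,1)
proof (induction A)
  case empty
  then show ?case by (simp add: fourier_coeff_emode)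
next
  case (insert a A)
  then show ?case using fourier_coeff_add[of "u a" "\<lambda>x. \<Sum>i\<in>A. u i x" k] by (simp add: CP_sum)
qed

lemma fourier_coeff_vsmult:
  fixes u :: "real ^ 'd \<Rightarrow> complex ^ 'n"
  assumes "u \<in> CP"
  shows "fourier_coeff (\<lambda>x. c *s u x) k = c *s fourier_coeff u k"
proof -
  have c: "continuous_on UNIV u" using assms by (simp add: CP_def)
  have c': "continuous_on UNIV (\<lambda>x. c *s u x)" by (intro vsmult_continuous_on c continuous_intros)
  have "integral cell (\<lambda>x. emode (- k) x *s (c *s u x)) = integral cell ((\<lambda>v. c *s v) \<circ> (\<lambda>x. emode (- k) x *s u x))"
    by (intro arg_cong[where f = "integral cell"] ext) (simp add: mult.commute)
  also have "\<dots> = c *s integral cell (\<lambda>x. emode (- k) x *s u x)"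
    by (rule integral_linear[OF emode_vsmult_integrable[OF c] vsmult_linear_right])
  finally show ?thesis
    by (simp only: fourier_coeff_cont[OF c] fourier_coeff_cont[OF c']) (simp add: mult.commute)
qed

lemma fourier_coeff_emode_mult:
  fixes u :: "real ^ 'd \<Rightarrow> complex ^ 'n"
  shows "fourier_coeff (\<lambda>x. emode l x *s u x) k = fourier_coeff u (k - l)"
proof -
  have "emode (- k) x * emode l x = emode (- (k - l)) x" for x :: "real ^ 'd"
    by (simp add: emode_add[symmetric])
  then show ?thesis by (simp add: fourier_coeff_emode del: minus_diff_eq)
qed

text \<open>Orthogonality of the modes by integration by parts: the derivative of a constant has vanishing
  coefficients.\<close>

lemma fourier_coeff_const:
  fixes c :: "complex ^ 'n" and k :: "int ^ 'd"
  shows "fourier_coeff (\<lambda>x. c) k = (if k = 0 then c else 0)"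
proof (cases "k = 0")
  case True
  have "integral (cell :: (real ^ 'd) set) (\<lambda>x. c) = (2 * pi) ^ CARD('d) *\<^sub>R c"
    using integral_const[of 0 "\<chi> j. 2 * pi" c] content_cell[where 'd='d] by (simp add: cell_def)
  then show ?thesis using True by (simp add: fourier_coeff_cont)
next
  case False
  then obtain j where j: "k $ j \<noteq> 0" by (auto simp: vec_eq_iff)
  have "has_partial (\<lambda>x :: real ^ 'd. c) j (\<lambda>x. 0)" by (simp add: has_partial_def)
  then have "fourier_coeff (\<lambda>x :: real ^ 'd. 0 :: complex ^ 'n) k = (\<i> * of_int (k $ j)) *s fourier_coeff (\<lambda>x. c) k"
    by (rule fourier_coeff_partial[OF CP_const CP_const])
  moreover have "fourier_coeff (\<lambda>x :: real ^ 'd. 0 :: complex ^ 'n) k = 0" by (simp add: fourier_coeff_emode)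
  ultimately have "(\<i> * of_int (k $ j)) *s fourier_coeff (\<lambda>x :: real ^ 'd. c) k = 0" by simp
  then have "norm ((\<i> * of_int (k $ j)) *s fourier_coeff (\<lambda>x :: real ^ 'd. c) k) = 0" by simp
  then have "fourier_coeff (\<lambda>x :: real ^ 'd. c) k = 0" using j by (simp add: norm_vector_smult norm_mult)
  then show ?thesis using False by simp
qed

lemma fourier_coeff_mode:
  fixes c :: "complex ^ 'n" and k l :: "int ^ 'd"
  shows "fourier_coeff (\<lambda>x. emode l x *s c) k = (if k = l then c else 0)"
  by (simp add: fourier_coeff_emode_mult fourier_coeff_const)

lemma integral_inner_trig_polynomial:
  fixes u :: "real ^ 'd \<Rightarrow> complex ^ 'n"
  assumes u: "u \<in> CP" and K: "finite K"
  shows "integral cell (\<lambda>x. u x \<bullet> (\<Sum>k\<in>K. emode k x *s c k)) = (2 * pi) ^ CARD('d) * (\<Sum>k\<in>K. fourier_coeff u k \<bullet> c k)"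
proof -
  have c: "continuous_on UNIV u" using u by (simp add: CP_def)
  have e: "(\<lambda>x. emode (- k) x *s u x) integrable_on cell" for k by (rule emode_vsmult_integrable[OF c])
  have "integral cell (\<lambda>x. u x \<bullet> (\<Sum>k\<in>K. emode k x *s c k)) = integral cell (\<lambda>x. \<Sum>k\<in>K. (emode (- k) x *s u x) \<bullet> c k)"
    by (simp add: inner_sum_right inner_vsmult_left emode_minus)
  also have "\<dots> = (\<Sum>k\<in>K. integral cell (\<lambda>x. (emode (- k) x *s u x) \<bullet> c k))"
    by (rule Henstock_Kurzweil_Integration.integral_sum[OF K])
      (use integrable_linear[OF e bounded_linear_inner_left] in \<open>simp add: o_def\<close>)
  also have "\<dots> = (\<Sum>k\<in>K. integral cell (\<lambda>x. emode (- k) x *s u x) \<bullet> c k)"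
    using integral_linear[OF e bounded_linear_inner_left] by (simp add: o_def)
  also have "\<dots> = (2 * pi) ^ CARD('d) * (\<Sum>k\<in>K. fourier_coeff u k \<bullet> c k)"
    by (simp add: fourier_coeff_cont[OF c] sum_distrib_left)
  finally show ?thesis .
qed

text \<open>Positivity of the square norm of \<open>u - p\<close>, where \<open>p\<close> is the partial Fourier sum.\<close>

lemma Bessel_inequality:
  fixes u :: "real ^ 'd \<Rightarrow> complex ^ 'n"
  assumes u: "u \<in> CP" and B: "\<And>x. norm (u x) \<le> B" and K: "finite K"
  shows "(\<Sum>k\<in>K. (norm (fourier_coeff u k))\<^sup>2) \<le> B\<^sup>2"
proof -
  define p where "p x = (\<Sum>k\<in>K. emode k x *s fourier_coeff u k)" for x
  let ?S = "\<Sum>k\<in>K. (norm (fourier_coeff u k))\<^sup>2"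
  let ?V = "(2 * pi) ^ CARD('d)"
  have modeCP: "(\<lambda>x. emode k x *s fourier_coeff u k) \<in> CP" for k by (intro CP_vsmult CP_emode CP_const)
  have p: "p \<in> CP" unfolding p_def by (intro CP_sum modeCP)
  have pc: "fourier_coeff p k = fourier_coeff u k" if "k \<in> K" for k
    unfolding p_def using that K
    by (subst fourier_coeff_sum[OF modeCP K]) (simp add: fourier_coeff_mode)
  have up: "integral cell (\<lambda>x. u x \<bullet> p x) = ?V * ?S"
    unfolding p_def by (simp add: integral_inner_trig_polynomial[OF u K] power2_norm_eq_inner)
  have pp: "integral cell (\<lambda>x. p x \<bullet> p x) = ?V * ?S"
    using integral_inner_trig_polynomial[OF p K, of "fourier_coeff u"] pc
    by (simp add: p_def[symmetric] power2_norm_eq_inner)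
  have I: "(\<lambda>x. f x \<bullet> g x) integrable_on cell" if "f \<in> CP" "g \<in> CP" for f g :: "real ^ 'd \<Rightarrow> complex ^ 'n"
    by (rule CP_integrable_on[OF CP_inner[OF that]])
  have uu: "integral cell (\<lambda>x. u x \<bullet> u x) \<le> ?V * B\<^sup>2"
  proof -
    have "integral cell (\<lambda>x. u x \<bullet> u x) \<le> integral (cell :: (real ^ 'd) set) (\<lambda>x. B\<^sup>2)"
    proof (rule integral_le[OF I[OF u u] CP_integrable_on[OF CP_const]])
      fix x
      show "u x \<bullet> u x \<le> B\<^sup>2" using B[of x] by (simp add: power2_norm_eq_inner[symmetric] power_mono)
    qed
    also have "\<dots> = ?V * B\<^sup>2"
      using integral_const[of 0 "\<chi> j. 2 * pi" "B\<^sup>2"] content_cell[where 'd='d] by (simp add: cell_def)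
    finally show ?thesis .
  qed
  have "0 \<le> integral cell (\<lambda>x. (u x - p x) \<bullet> (u x - p x))"
    by (rule integral_nonneg[OF I[OF CP_diff[OF u p] CP_diff[OF u p]]]) simp
  also have "(\<lambda>x. (u x - p x) \<bullet> (u x - p x)) = (\<lambda>x. (u x \<bullet> u x - (u x \<bullet> p x + u x \<bullet> p x)) + p x \<bullet> p x)"
    by (simp add: inner_diff_left inner_diff_right inner_commute algebra_simps)
  also have "integral cell \<dots> = (integral cell (\<lambda>x. u x \<bullet> u x) - (integral cell (\<lambda>x. u x \<bullet> p x) + integral cell (\<lambda>x. u x \<bullet> p x))) + integral cell (\<lambda>x. p x \<bullet> p x)"
    by (simp only: Henstock_Kurzweil_Integration.integral_add Henstock_Kurzweil_Integration.integral_diff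
        integrable_add integrable_diff I u p)
  finally have "?V * ?S \<le> ?V * B\<^sup>2" using up pp uu by linarith
  then show ?thesis by (simp add: mult_le_cancel_left_pos)
qed

subsection \<open>Absolutely convergent Fourier series\<close>

definition syn :: "(int ^ 'd \<Rightarrow> complex ^ 'n) \<Rightarrow> real ^ 'd \<Rightarrow> complex ^ 'n" where
  "syn a x = (\<Sum>\<^sub>\<infinity>k. emode k x *s a k)"

lemma syn_has_sum:
  fixes a :: "int ^ 'd \<Rightarrow> complex ^ 'n"
  assumes "in_l1 a"
  shows "((\<lambda>k. emode k x *s a k) has_sum syn a x) UNIV"
proof -
  have "in_l1 (\<lambda>k. emode k x *s a k)" using assms by (simp add: norm_vector_smult)
  then show ?thesis unfolding syn_def by (rule has_sum_infsum[OF Infinite_Sum.abs_summable_summable])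
qed

lemma norm_syn_le:
  fixes a :: "int ^ 'd \<Rightarrow> complex ^ 'n"
  assumes "in_l1 a"
  shows "norm (syn a x) \<le> (\<Sum>\<^sub>\<infinity>k. norm (a k))"
  by (rule norm_infsum_le[OF syn_has_sum[OF assms] has_sum_infsum[OF assms]]) (simp add: norm_vector_smult)

lemma syn_CP:
  fixes a :: "int ^ 'd \<Rightarrow> complex ^ 'n"
  assumes "in_l1 a"
  shows "syn a \<in> CP"
proof -
  have "continuous_on UNIV (syn a)"
    by (rule fourier_coeff_series(1)[OF _ _ assms syn_has_sum[OF assms]])
      (auto simp: norm_vector_smult intro!: vsmult_continuous_on continuous_intros)
  moreover have "periodic (syn a)" by (simp add: periodic_def syn_def emode_shift)
  ultimately show ?thesis by (simp add: CP_def)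
qed

lemma fourier_coeff_syn:
  fixes a :: "int ^ 'd \<Rightarrow> complex ^ 'n"
  assumes "in_l1 a"
  shows "fourier_coeff (syn a) k = a k"
proof -
  have "((\<lambda>l. fourier_coeff (\<lambda>x. emode l x *s a l) k) has_sum fourier_coeff (syn a) k) UNIV"
    by (rule fourier_coeff_series(2)[OF _ _ assms syn_has_sum[OF assms]])
      (auto simp: norm_vector_smult intro!: vsmult_continuous_on continuous_intros)
  then have "((\<lambda>l. if k = l then a l else 0) has_sum fourier_coeff (syn a) k) UNIV"
    by (simp add: fourier_coeff_mode)
  moreover have "((\<lambda>l. if k = l then a l else 0) has_sum a k) UNIV"
    using has_sum_finite_neutralI[of "{k}" UNIV "\<lambda>l. if k = l then a l else 0" "a k"] by auto
  ultimately show ?thesis by (rule has_sum_unique)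
qed

lemma syn_diff:
  fixes a b :: "int ^ 'd \<Rightarrow> complex ^ 'n"
  assumes "in_l1 a" "in_l1 b"
  shows "syn (\<lambda>k. a k - b k) x = syn a x - syn b x"
proof -
  have "((\<lambda>k. emode k x *s a k - emode k x *s b k) has_sum syn a x - syn b x) UNIV"
    using has_sum_diff[OF syn_has_sum[OF assms(1)] syn_has_sum[OF assms(2)]] .
  then show ?thesis by (simp add: syn_def infsumI)
qed

text \<open>If the first factor has an absolutely convergent Fourier series, the coefficients of a product are
  the convolution: the series can be integrated term by term.\<close>

lemma fourier_coeff_product:
  fixes g :: "real ^ 'd \<Rightarrow> complex ^ 'n" and p :: "int ^ 'd \<Rightarrow> complex"
  assumes p: "in_l1 p" and P: "\<And>x. ((\<lambda>l. p l * emode l x) has_sum P x) UNIV" and g: "g \<in> CP"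
  shows "((\<lambda>l. p l *s fourier_coeff g (k - l)) has_sum fourier_coeff (\<lambda>x. P x *s g x) k) UNIV"
proof -
  obtain B where B: "\<And>x. norm (g x) \<le> B" using CP_bounded[OF g] by blast
  have eg: "(\<lambda>x. emode l x *s g x) \<in> CP" for l by (intro CP_vsmult CP_emode g)
  have "((\<lambda>l. fourier_coeff (\<lambda>x. p l *s (emode l x *s g x)) k) has_sum fourier_coeff (\<lambda>x. P x *s g x) k) UNIV"
  proof (rule fourier_coeff_series(2)[where b = "\<lambda>l. cmod (p l) * B"])
    show "continuous_on UNIV (\<lambda>x. p l *s (emode l x *s g x))" for l
      using CP_vsmult[OF CP_const eg, of "p l" l] by (simp only: CP_def mem_Collect_eq)
    show "norm (p l *s (emode l x *s g x)) \<le> cmod (p l) * B" for l x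
      using B[of x] by (simp add: norm_vector_smult norm_mult mult_left_mono)
    show "(\<lambda>l. cmod (p l) * B) summable_on UNIV" by (rule summable_on_cmult_left[OF p])
    show "((\<lambda>l. p l *s (emode l x *s g x)) has_sum P x *s g x) UNIV" for x
      using has_sum_bounded_linear[OF vsmult_linear_left[of "g x"] P[of x]] by simp
  qed
  then show ?thesis by (simp only: fourier_coeff_vsmult[OF eg] fourier_coeff_emode_mult)
qed

lemma cmod_cis_minus_1_le: "cmod (cis \<theta> - 1) \<le> \<bar>\<theta>\<bar>"
proof -
  have "norm (cis \<theta> - cis 0) \<le> 1 * \<bar>\<theta>\<bar> - 1 * 0"
    by (rule norm_diff_le_of_derivative_le[where g = "\<lambda>u. \<i> * cis u" and \<phi>' = "\<lambda>_. 1"])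
      (auto simp: cis_conv_exp norm_mult intro!: derivative_eq_intros has_vector_derivative_real_field)
  then show ?thesis by simp
qed

lemma cmod_cis_taylor_le: "cmod (cis \<theta> - 1 - \<i> * of_real \<theta>) \<le> \<theta>\<^sup>2"
proof -
  have "norm ((cis \<theta> - \<i> * of_real \<theta>) - (cis 0 - \<i> * of_real 0)) \<le> \<bar>\<theta>\<bar> * \<bar>\<theta>\<bar> - 0 * 0"
  proof (rule norm_diff_le_of_derivative_le[where g = "\<lambda>u. \<i> * cis u - \<i>" and \<phi> = "\<lambda>u. u * u" and \<phi>' = "\<lambda>u. 2 * u"])
    fix u :: real
    show "((\<lambda>u. cis u - \<i> * of_real u) has_vector_derivative \<i> * cis u - \<i>) (at u)"
      unfolding cis_conv_exp by (auto intro!: derivative_eq_intros has_vector_derivative_real_field)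
    have "\<i> * cis u - \<i> = \<i> * (cis u - 1)" by (simp add: algebra_simps)
    then show "norm (\<i> * cis u - \<i>) \<le> 2 * \<bar>u\<bar>" using cmod_cis_minus_1_le[of u] by (simp add: norm_mult)
    show "((\<lambda>u. u * u) has_vector_derivative 2 * u) (at u)"
      by (auto intro!: derivative_eq_intros simp: has_real_derivative_iff_has_vector_derivative[symmetric])
  qed
  then show ?thesis by (simp add: power2_eq_square algebra_simps)
qed

text \<open>The second order Taylor remainder of each mode is at most \<open>t\<^sup>2 (1 + \<bar>k\<bar>\<^sup>2)\<close>, uniformly in \<open>x\<close>, so that
  the difference quotients of the series converge.\<close>

lemma syn_has_partial:
  fixes a :: "int ^ 'd \<Rightarrow> complex ^ 'n"
  assumes s: "(\<lambda>k. (1 + (norm (freq k))\<^sup>2) * norm (a k)) summable_on UNIV"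
  shows "in_l1 (\<lambda>k. (\<i> * of_int (k $ j)) *s a k)"
    and "has_partial (syn a) j (syn (\<lambda>k. (\<i> * of_int (k $ j)) *s a k))"
proof -
  have kj: "\<bar>of_int (k $ j)\<bar> \<le> norm (freq k)" for k :: "int ^ 'd"
    using component_le_norm_cart[of "freq k" j] by simp
  have k1: "norm (freq k) \<le> 1 + (norm (freq k))\<^sup>2" for k :: "int ^ 'd"
    using sum_power2_ge_zero[of "norm (freq k) - 1/2" 0] by (simp add: power2_eq_square algebra_simps)
  have a: "in_l1 a"
    by (rule summable_on_comparison_test[OF s]) (auto simp: algebra_simps)
  have "norm ((\<i> * of_int (k $ j)) *s a k) \<le> (1 + (norm (freq k))\<^sup>2) * norm (a k)" for k
    using kj[of k] k1[of k] by (simp add: norm_vector_smult norm_mult mult_right_mono)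
  then show b: "in_l1 (\<lambda>k. (\<i> * of_int (k $ j)) *s a k)"
    by (intro summable_on_comparison_test[OF s]) auto
  define C where "C = (\<Sum>\<^sub>\<infinity>k. (1 + (norm (freq k))\<^sup>2) * norm (a k))"
  let ?a' = "syn (\<lambda>k. (\<i> * of_int (k $ j)) *s a k)"
  have est: "norm (syn a (x + axis j t) - syn a x - t *\<^sub>R ?a' x) \<le> t\<^sup>2 * C" for x t
  proof -
    have 1: "((\<lambda>k. emode k (x + axis j t) *s a k - emode k x *s a k - t *\<^sub>R (emode k x *s ((\<i> * of_int (k $ j)) *s a k)))
       has_sum (syn a (x + axis j t) - syn a x - t *\<^sub>R ?a' x)) UNIV"
      by (intro has_sum_diff syn_has_sum has_sum_scaleR a b)
    have 2: "((\<lambda>k. t\<^sup>2 * ((1 + (norm (freq k))\<^sup>2) * norm (a k))) has_sum t\<^sup>2 * C) UNIV"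
      unfolding C_def by (intro has_sum_cmult_right has_sum_infsum s)
    show ?thesis
    proof (rule norm_infsum_le[OF 1 2])
      fix k
      have "emode k (x + axis j t) = emode k x * cis (of_int (k $ j) * t)"
        by (simp add: emode_def inner_right_distrib inner_axis cis_mult)
      then have "emode k (x + axis j t) *s a k - emode k x *s a k - t *\<^sub>R (emode k x *s ((\<i> * of_int (k $ j)) *s a k))
         = (emode k x * (cis (of_int (k $ j) * t) - 1 - \<i> * of_real (of_int (k $ j) * t))) *s a k"
        by (simp add: vec_eq_iff algebra_simps scaleR_conv_of_real[where 'a=complex])
      also have "norm \<dots> \<le> (of_int (k $ j) * t)\<^sup>2 * norm (a k)"
        using cmod_cis_taylor_le[of "of_int (k $ j) * t"] by (simp add: norm_vector_smult norm_mult mult_right_mono)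
      also have "\<dots> \<le> t\<^sup>2 * ((1 + (norm (freq k))\<^sup>2) * norm (a k))"
      proof -
        have "(of_int (k $ j))\<^sup>2 \<le> (norm (freq k))\<^sup>2" using kj[of k] by (simp add: abs_le_square_iff[symmetric])
        then have "(of_int (k $ j))\<^sup>2 \<le> 1 + (norm (freq k))\<^sup>2" by simp
        then have "t\<^sup>2 * norm (a k) * (of_int (k $ j))\<^sup>2 \<le> t\<^sup>2 * norm (a k) * (1 + (norm (freq k))\<^sup>2)"
          by (intro mult_left_mono) auto
        then show ?thesis by (simp only: power_mult_distrib mult_ac)
      qed
      finally show "norm (emode k (x + axis j t) *s a k - emode k x *s a k - t *\<^sub>R (emode k x *s ((\<i> * of_int (k $ j)) *s a k)))
          \<le> t\<^sup>2 * ((1 + (norm (freq k))\<^sup>2) * norm (a k))" .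
    qed
  qed
  show "has_partial (syn a) j ?a'"
    unfolding has_partial_def has_vector_derivative_def has_derivative_at
  proof (intro allI conjI bounded_linear_scaleR_left)
    fix x
    show "((\<lambda>h. norm (syn a (x + axis j (0 + h)) - syn a (x + axis j 0) - h *\<^sub>R ?a' x) / norm h) \<longlongrightarrow> 0) (at 0)"
    proof (rule Lim_null_comparison)
      show "((\<lambda>h. \<bar>h\<bar> * C) \<longlongrightarrow> 0) (at 0)" by (auto intro!: tendsto_eq_intros)
      show "\<forall>\<^sub>F h in at 0. norm (norm (syn a (x + axis j (0 + h)) - syn a (x + axis j 0) - h *\<^sub>R ?a' x) / norm h) \<le> \<bar>h\<bar> * C"
        unfolding eventually_at_topological
      proof (intro exI[of _ UNIV] conjI ballI impI)
        fix h :: real assume "h \<noteq> 0"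
        then have "norm (syn a (x + axis j h) - syn a x - h *\<^sub>R ?a' x) / \<bar>h\<bar> \<le> (h\<^sup>2 * C) / \<bar>h\<bar>"
          using est[of x h] by (intro divide_right_mono) auto
        also have "\<dots> = \<bar>h\<bar> * C"
          using \<open>h \<noteq> 0\<close> by (cases "h > 0") (simp_all add: power2_eq_square)
        finally show "norm (norm (syn a (x + axis j (0 + h)) - syn a (x + axis j 0) - h *\<^sub>R ?a' x) / norm h) \<le> \<bar>h\<bar> * C"
          by (simp only: axis_zero add_0_left add_0_right real_norm_def abs_divide abs_norm_cancel abs_abs)
      qed auto
    qed
  qed
qed

subsection \<open>Uniqueness of Fourier coefficients\<close>

text \<open>
  The point \<open>circ x\<close> of the torus in \<open>\<complex>\<^sup>d\<close>. Polynomials in its real and imaginary parts are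
  trigonometric polynomials, and they approximate continuous functions by Stone-Weierstrass.
\<close>

definition circ :: "real ^ 'd \<Rightarrow> complex ^ 'd" where
  "circ x = (\<chi> j. cis (x $ j))"

definition no_coeffs :: "(real ^ 'd \<Rightarrow> complex ^ 'n) set" where
  "no_coeffs = {u. set_integrable lebesgue cell u \<and> (\<forall>k. fourier_coeff u k = 0)}"

lemma borel_measurable_lebesgue_continuous:
  "continuous_on UNIV (f :: 'a::euclidean_space \<Rightarrow> 'b::euclidean_space) \<Longrightarrow> f \<in> borel_measurable lebesgue"
  by (intro measurable_completion) (simp add: borel_measurable_continuous_onI)

lemma set_integrable_emode:
  fixes u :: "real ^ 'd \<Rightarrow> complex ^ 'n"
  assumes "set_integrable lebesgue cell u"
  shows "set_integrable lebesgue cell (\<lambda>x. emode k x *s u x)"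
  unfolding set_integrable_def
proof (rule Bochner_Integration.integrable_bound[OF assms[unfolded set_integrable_def]])
  have 1: "(\<lambda>x. indicat_real cell x *\<^sub>R u x) \<in> borel_measurable lebesgue"
    using assms unfolding set_integrable_def by (rule borel_measurable_integrable)
  have 2: "emode k \<in> borel_measurable lebesgue"
    by (rule borel_measurable_lebesgue_continuous[OF continuous_on_emode])
  have "(\<lambda>x. emode k x *s (indicat_real cell x *\<^sub>R u x)) \<in> borel_measurable lebesgue"
  proof (rule borel_measurable_continuous_Pair[OF 2 1, where H = "\<lambda>c v. c *s v"])
    show "continuous_on UNIV (\<lambda>x :: complex \<times> (complex ^ 'n). fst x *s snd x)"
      by (intro vsmult_continuous_on continuous_intros)
  qed
  moreover have "(\<lambda>x. emode k x *s (indicat_real cell x *\<^sub>R u x)) = (\<lambda>x. indicat_real cell x *\<^sub>R (emode k x *s u x))"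
    by (auto simp: indicator_def)
  ultimately show "(\<lambda>x. indicat_real cell x *\<^sub>R (emode k x *s u x)) \<in> borel_measurable lebesgue" by simp
qed (auto simp: norm_vector_smult norm_mult)

lemma fourier_coeff_add_integrable:
  fixes u v :: "real ^ 'd \<Rightarrow> complex ^ 'n"
  assumes "set_integrable lebesgue cell u" "set_integrable lebesgue cell v"
  shows "fourier_coeff (\<lambda>x. u x + v x) k = fourier_coeff u k + fourier_coeff v k"
  using set_integral_add(2)[OF set_integrable_emode[OF assms(1)] set_integrable_emode[OF assms(2)], of "- k" "- k"]
  by (simp add: fourier_coeff_emode scaleR_add_right[symmetric] del: scaleR_add_right)

lemma fourier_coeff_linear_integrable:
  fixes u :: "real ^ 'd \<Rightarrow> complex ^ 'n"
  assumes "set_integrable lebesgue cell u"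
  shows "set_integrable lebesgue cell (\<lambda>x. c *s u x)" "fourier_coeff (\<lambda>x. c *s u x) k = c *s fourier_coeff u k"
proof -
  have eq: "(\<lambda>x. indicat_real cell x *\<^sub>R (d *s v x)) = (\<lambda>x. d *s (indicat_real cell x *\<^sub>R v x))"
    for d and v :: "real ^ 'd \<Rightarrow> complex ^ 'n" by (auto simp: indicator_def)
  show "set_integrable lebesgue cell (\<lambda>x. c *s u x)"
    unfolding set_integrable_def eq
    by (rule integrable_bounded_linear[OF vsmult_linear_right assms[unfolded set_integrable_def]])
  have "(LINT x:cell|lebesgue. c *s (emode (- k) x *s u x)) = c *s (LINT x:cell|lebesgue. emode (- k) x *s u x)"
    unfolding set_lebesgue_integral_def eq[of c]
    by (rule integral_bounded_linear[OF vsmult_linear_right])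
      (use set_integrable_emode[OF assms] in \<open>simp only: set_integrable_def\<close>)
  then show "fourier_coeff (\<lambda>x. c *s u x) k = c *s fourier_coeff u k"
    by (simp add: fourier_coeff_emode mult.commute)
qed

lemma fourier_coeff_diff_integrable:
  fixes u v :: "real ^ 'd \<Rightarrow> complex ^ 'n"
  assumes "set_integrable lebesgue cell u" "set_integrable lebesgue cell v"
  shows "set_integrable lebesgue cell (\<lambda>x. u x - v x)"
    and "fourier_coeff (\<lambda>x. u x - v x) k = fourier_coeff u k - fourier_coeff v k"
  using fourier_coeff_add_integrable[OF assms(1) fourier_coeff_linear_integrable(1)[OF assms(2), of "- 1"], of k]
    fourier_coeff_linear_integrable(2)[OF assms(2), of "- 1"] set_integral_diff(1)[OF assms]
  by simp_all

lemma no_coeffs_add: "u \<in> no_coeffs \<Longrightarrow> v \<in> no_coeffs \<Longrightarrow> (\<lambda>x. u x + v x) \<in> no_coeffs"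
  by (simp add: no_coeffs_def set_integral_add(1) fourier_coeff_add_integrable)

lemma no_coeffs_vsmult: "u \<in> no_coeffs \<Longrightarrow> (\<lambda>x. c *s u x) \<in> no_coeffs"
  by (simp add: no_coeffs_def fourier_coeff_linear_integrable)

lemma no_coeffs_emode: "u \<in> no_coeffs \<Longrightarrow> (\<lambda>x. emode l x *s u x) \<in> no_coeffs"
  by (simp add: no_coeffs_def fourier_coeff_emode_mult set_integrable_emode)

lemma no_coeffs_0: "(\<lambda>x. 0) \<in> no_coeffs"
  by (simp add: no_coeffs_def fourier_coeff_emode set_integrable_def)

lemma no_coeffs_sum:
  "finite A \<Longrightarrow> (\<And>i. i \<in> A \<Longrightarrow> u i \<in> no_coeffs) \<Longrightarrow> (\<lambda>x. \<Sum>i\<in>A. u i x) \<in> no_coeffs"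
proof (induction A rule: finite_induct)
  case empty
  then show ?case by (simp add: no_coeffs_0)
next
  case (insert a A)
  then show ?case using no_coeffs_add[of "u a" "\<lambda>x. \<Sum>i\<in>A. u i x"] by simp
qed

lemma bounded_linear_circ:
  fixes f :: "complex ^ 'd \<Rightarrow> real"
  assumes "bounded_linear f"
  shows "f (circ x) = (\<Sum>j\<in>UNIV. cos (x $ j) * f (axis j 1) + sin (x $ j) * f (axis j \<i>))"
proof -
  have "circ x = (\<Sum>j\<in>UNIV. cos (x $ j) *\<^sub>R axis j 1 + sin (x $ j) *\<^sub>R axis j \<i>)"
  proof (unfold vec_eq_iff, rule allI)
    fix i
    have "(\<Sum>j\<in>UNIV. cos (x $ j) *\<^sub>R axis j 1 + sin (x $ j) *\<^sub>R axis j \<i>) $ i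
       = (\<Sum>j\<in>UNIV. if j = i then complex_of_real (cos (x $ j)) + of_real (sin (x $ j)) * \<i> else 0)"
      unfolding sum_component by (rule sum.cong) (auto simp: axis_def scaleR_conv_of_real[where 'a=complex])
    then show "circ x $ i = (\<Sum>j\<in>UNIV. cos (x $ j) *\<^sub>R axis j 1 + sin (x $ j) *\<^sub>R axis j \<i>) $ i"
      by (simp add: circ_def complex_eq_iff)
  qed
  then show ?thesis
    using assms by (simp add: bounded_linear.linear linear_sum linear_add linear_scale)
qed

text \<open>Multiplication by a mode shifts the coefficients, so that functions without Fourier coefficients are
  stable under multiplication by trigonometric polynomials.\<close>

lemma no_coeffs_polynomial:
  fixes q :: "complex ^ 'd \<Rightarrow> real" and u :: "real ^ 'd \<Rightarrow> complex ^ 'n"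
  assumes "real_polynomial_function q" "u \<in> no_coeffs"
  shows "(\<lambda>x. q (circ x) *\<^sub>R u x) \<in> no_coeffs"
  using assms
proof (induction arbitrary: u rule: real_polynomial_function.induct)
  case (linear f)
  have e: "emode (axis j 1) x = cis (x $ j)" "emode (axis j (- 1)) x = cnj (cis (x $ j))" for j and x :: "real ^ 'd"
  proof -
    have "freq (axis j (c :: int)) = axis j (of_int c)" for c by (simp add: freq_def axis_def vec_eq_iff)
    then show "emode (axis j 1) x = cis (x $ j)" "emode (axis j (- 1)) x = cnj (cis (x $ j))"
      by (simp_all add: emode_def inner_axis' cis_cnj)
  qed
  have "cos t * \<alpha> + sin t * \<beta> = ((\<alpha> - \<i> * \<beta>) / 2) * cis t + ((\<alpha> + \<i> * \<beta>) / 2) * cnj (cis t)" for t \<alpha> \<beta> :: real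
    by (simp add: complex_eq_iff field_simps)
  then have "complex_of_real (f (circ x)) = (\<Sum>j\<in>UNIV. ((f (axis j 1) - \<i> * f (axis j \<i>)) / 2) * emode (axis j 1) x
      + ((f (axis j 1) + \<i> * f (axis j \<i>)) / 2) * emode (axis j (- 1)) x)" for x
    unfolding e bounded_linear_circ[OF linear(1)] of_real_sum by (intro sum.cong refl) simp
  then have "of_real (f (circ x)) *s u x = (\<Sum>j\<in>UNIV. ((f (axis j 1) - \<i> * f (axis j \<i>)) / 2) *s (emode (axis j 1) x *s u x)
      + ((f (axis j 1) + \<i> * f (axis j \<i>)) / 2) *s (emode (axis j (- 1)) x *s u x))" for x
    by (simp add: bounded_bilinear.sum_left[OF bounded_bilinear_vector_smult])
  then show ?case
    unfolding vsmult_of_real by (simp only:) (intro no_coeffs_sum no_coeffs_add no_coeffs_vsmult no_coeffs_emode linear finite)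
next
  case (const c)
  then show ?case using no_coeffs_vsmult[OF const, of "of_real c"] by (simp only: vsmult_of_real)
next
  case (add f g)
  then show ?case using no_coeffs_add[OF add.IH(1)[OF add.prems] add.IH(2)[OF add.prems]]
    by (simp add: scaleR_add_left)
next
  case (mult f g)
  then show ?case using mult.IH(1)[OF mult.IH(2)[OF mult.prems]] by simp
qed

lemma continuous_on_circ: "continuous_on S circ"
  unfolding circ_def by (intro continuous_on_vec_lambda continuous_intros)

lemma set_integrable_bounded_scaleR:
  fixes u :: "real ^ 'd \<Rightarrow> complex ^ 'n"
  assumes u: "set_integrable lebesgue cell u" and \<phi>: "\<phi> \<in> borel_measurable lebesgue" "\<And>x. x \<in> cell \<Longrightarrow> \<bar>\<phi> x\<bar> \<le> B"
  shows "set_integrable lebesgue cell (\<lambda>x. \<phi> x *\<^sub>R u x)"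
  unfolding set_integrable_def
proof (rule Bochner_Integration.integrable_bound)
  show "integrable lebesgue (\<lambda>x. \<bar>B\<bar> *\<^sub>R (indicat_real cell x *\<^sub>R u x))"
    by (intro integrable_scaleR_right) (rule u[unfolded set_integrable_def])
  have 1: "(\<lambda>x. indicat_real cell x *\<^sub>R u x) \<in> borel_measurable lebesgue"
    using u unfolding set_integrable_def by (rule borel_measurable_integrable)
  have "(\<lambda>x. \<phi> x *\<^sub>R (indicat_real cell x *\<^sub>R u x)) \<in> borel_measurable lebesgue"
    by (rule borel_measurable_scaleR[OF \<phi>(1) 1])
  then show "(\<lambda>x. indicat_real cell x *\<^sub>R (\<phi> x *\<^sub>R u x)) \<in> borel_measurable lebesgue"
    by (simp add: mult.commute)
  show "AE x in lebesgue. norm (indicat_real cell x *\<^sub>R (\<phi> x *\<^sub>R u x)) \<le> norm (\<bar>B\<bar> *\<^sub>R (indicat_real cell x *\<^sub>R u x))"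
  proof (rule AE_I2)
    fix x
    show "norm (indicat_real cell x *\<^sub>R (\<phi> x *\<^sub>R u x)) \<le> norm (\<bar>B\<bar> *\<^sub>R (indicat_real cell x *\<^sub>R u x))"
      using \<phi>(2)[of x] by (cases "x \<in> cell") (auto intro!: mult_right_mono)
  qed
qed

text \<open>By the Stone-Weierstrass theorem on the image of the cell under \<open>circ\<close>, a continuous function is a
  uniform limit of polynomials.\<close>

lemma no_coeffs_integral_continuous:
  fixes u :: "real ^ 'd \<Rightarrow> complex ^ 'n" and f :: "complex ^ 'd \<Rightarrow> real"
  assumes u: "u \<in> no_coeffs" and f: "continuous_on UNIV f"
  shows "(LINT x:cell|lebesgue. f (circ x) *\<^sub>R u x) = 0"
proof -
  have ui: "set_integrable lebesgue cell u" using u by (simp add: no_coeffs_def)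
  have cc: "compact (circ ` (cell :: (real ^ 'd) set))"
    by (intro compact_continuous_image continuous_on_circ compact_cell)
  have int: "set_integrable lebesgue cell (\<lambda>x. g (circ x) *\<^sub>R u x)" if g: "continuous_on UNIV g" for g
  proof -
    have "bounded (g ` circ ` (cell :: (real ^ 'd) set))"
      by (intro compact_imp_bounded compact_continuous_image[OF _ cc] continuous_on_subset[OF g]) auto
    then obtain B where "\<forall>x\<in>cell. \<bar>g (circ (x :: real ^ 'd))\<bar> \<le> B" by (auto simp: bounded_iff)
    then show ?thesis
      by (intro set_integrable_bounded_scaleR[OF ui, of _ B] borel_measurable_lebesgue_continuous
          continuous_on_compose2[OF g continuous_on_circ]) auto
  qed
  define N where "N = (LINT x:cell|lebesgue. norm (u x))"
  have N: "N \<ge> 0" unfolding N_def set_lebesgue_integral_def by (rule Bochner_Integration.integral_nonneg) auto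
  have "norm (LINT x:cell|lebesgue. f (circ x) *\<^sub>R u x) \<le> 0 + e" if e: "e > 0" for e
  proof -
    define d where "d = e / (N + 1)"
    have d: "d > 0" "d * N \<le> e" using e N by (auto simp: d_def field_simps)
    obtain q where q: "real_polynomial_function q" "\<And>z. z \<in> circ ` (cell :: (real ^ 'd) set) \<Longrightarrow> \<bar>f z - q z\<bar> < d"
      using Stone_Weierstrass_real_polynomial_function[OF cc continuous_on_subset[OF f subset_UNIV] d(1)] by blast
    have qc: "continuous_on UNIV q"
      using q(1) by (intro continuous_at_imp_continuous_on ballI continuous_real_polymonial_function)
    have "(\<lambda>x. q (circ x) *\<^sub>R u x) \<in> no_coeffs" by (rule no_coeffs_polynomial[OF q(1) u])
    then have "fourier_coeff (\<lambda>x. q (circ x) *\<^sub>R u x) 0 = 0" by (simp add: no_coeffs_def)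
    then have q0: "(LINT x:cell|lebesgue. q (circ x) *\<^sub>R u x) = 0"
      by (simp add: fourier_coeff_emode vsmult_of_real)
    have "(LINT x:cell|lebesgue. f (circ x) *\<^sub>R u x) = (LINT x:cell|lebesgue. f (circ x) *\<^sub>R u x - q (circ x) *\<^sub>R u x)"
      using set_integral_diff(2)[OF int[OF f] int[OF qc]] q0 by simp
    also have "norm \<dots> \<le> (LINT x:cell|lebesgue. norm (f (circ x) *\<^sub>R u x - q (circ x) *\<^sub>R u x))"
      by (rule set_integral_norm_bound[OF set_integral_diff(1)[OF int[OF f] int[OF qc]]])
    also have "\<dots> \<le> (LINT x:cell|lebesgue. d * norm (u x))"
    proof (rule set_integral_mono)
      show "set_integrable lebesgue cell (\<lambda>x. norm (f (circ x) *\<^sub>R u x - q (circ x) *\<^sub>R u x))"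
        by (intro set_integrable_norm set_integral_diff(1) int f qc)
      show "set_integrable lebesgue cell (\<lambda>x. d * norm (u x))"
        by (intro set_integrable_mult_right set_integrable_norm ui)
      fix x :: "real ^ 'd" assume "x \<in> cell"
      then have "\<bar>f (circ x) - q (circ x)\<bar> \<le> d" using q(2)[of "circ x"] by (simp add: less_imp_le)
      then show "norm (f (circ x) *\<^sub>R u x - q (circ x) *\<^sub>R u x) \<le> d * norm (u x)"
        by (simp add: scaleR_diff_left[symmetric] mult_right_mono)
    qed
    also have "\<dots> = d * N" by (simp add: N_def)
    finally show ?thesis using d(2) by simp
  qed
  then have "norm (LINT x:cell|lebesgue. f (circ x) *\<^sub>R u x) \<le> 0" by (rule field_le_epsilon)
  then show ?thesis by simp
qed

text \<open>Away from the null set of points with a coordinate \<open>2\<pi>\<close>, \<open>circ\<close> is injective on the cell, so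
  that compact subsets of the cell are approximated by continuous functions on the torus.\<close>

lemma negligible_cell_face: "negligible {x. \<exists>j. (x :: real ^ 'd) $ j = 0 \<or> x $ j = 2 * pi}"
proof -
  have "negligible ((\<Union>j\<in>UNIV. {x :: real ^ 'd. x \<bullet> axis j 1 = 2 * pi}) \<union> (\<Union>j\<in>UNIV. {x :: real ^ 'd. x \<bullet> axis j 1 = 0}))"
    by (intro negligible_Un negligible_Union) (auto intro!: negligible_standard_hyperplane simp: Basis_real_def)
  then show ?thesis
    by (rule negligible_subset) (auto simp: inner_axis)
qed

lemma circ_inj:
  assumes "circ x = circ y" "x \<in> cell" "y \<in> cell" "\<And>j. x $ j \<noteq> 0 \<and> x $ j \<noteq> 2 * pi"
  shows "x = y"
proof (unfold vec_eq_iff, rule allI)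
  fix j
  have "cis (x $ j) = cis (y $ j)" using assms(1) by (simp add: circ_def vec_eq_iff)
  then have "sin (x $ j) = sin (y $ j) \<and> cos (x $ j) = cos (y $ j)" by (simp add: cis.ctr)
  then obtain n :: int where n: "x $ j = y $ j + 2 * pi * n" using sin_cos_eq_iff by blast
  have "0 < x $ j" "x $ j < 2 * pi" "0 \<le> y $ j" "y $ j \<le> 2 * pi"
    using assms(2,3) assms(4)[of j] by (auto simp: cell_def mem_box_cart less_le)
  then have "\<bar>2 * pi * n\<bar> < 2 * pi * 1" using n by linarith
  then have "n = 0" by (simp add: abs_mult)
  then show "x $ j = y $ j" using n by simp
qed

lemma no_coeffs_integral_compact:
  fixes u :: "real ^ 'd \<Rightarrow> complex ^ 'n"
  assumes u: "u \<in> no_coeffs" and C: "compact C"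
  shows "(LINT x:C|lebesgue. indicat_real cell x *\<^sub>R u x) = 0"
proof (cases "C \<inter> cell = {}")
  case True
  then have "(\<lambda>x. indicat_real C x *\<^sub>R (indicat_real cell x *\<^sub>R u x)) = (\<lambda>x. 0)"
    by (auto simp: indicator_def fun_eq_iff)
  then show ?thesis by (simp add: set_lebesgue_integral_def)
next
  case False
  define K where "K = circ ` (C \<inter> cell)"
  have K: "compact K" "K \<noteq> {}" unfolding K_def using False C compact_cell
    by (auto intro!: compact_continuous_image continuous_on_circ compact_Int)
  \<comment> \<open>continuous functions that decrease to the indicator function of \<open>K\<close>\<close>
  define f where "f n z = max 0 (1 - real n * infdist z K)" for n z
  have fc: "continuous_on UNIV (f n)" for n unfolding f_def by (intro continuous_intros)
  have f01: "0 \<le> f n z" "f n z \<le> 1" for n z by (auto simp: f_def infdist_nonneg)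
  have lim: "(\<lambda>n. f n z) \<longlonglongrightarrow> (if z \<in> K then 1 else 0)" for z
  proof (cases "z \<in> K")
    case True
    then show ?thesis by (simp add: f_def)
  next
    case False
    then have pos: "infdist z K > 0"
      using K infdist_pos_not_in_closed[OF compact_imp_closed[OF K(1)]] by simp
    have "\<forall>\<^sub>F n in sequentially. f n z = 0"
    proof (rule eventually_sequentiallyI)
      fix n assume "n \<ge> nat \<lceil>1 / infdist z K\<rceil>"
      then have "real n \<ge> 1 / infdist z K" by linarith
      then show "f n z = 0" using pos by (simp add: f_def field_simps)
    qed
    then show ?thesis using False by (simp add: tendsto_eventually)
  qed
  have ui: "integrable lebesgue (\<lambda>x. indicat_real cell x *\<^sub>R u x)"
    using u by (simp add: no_coeffs_def set_integrable_def)
  have um: "(\<lambda>x. indicat_real cell x *\<^sub>R u x) \<in> borel_measurable lebesgue"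
    by (rule borel_measurable_integrable[OF ui])
  have "(\<lambda>n. LINT x|lebesgue. f n (circ x) *\<^sub>R (indicat_real cell x *\<^sub>R u x)) \<longlonglongrightarrow>
      (LINT x|lebesgue. indicat_real C x *\<^sub>R (indicat_real cell x *\<^sub>R u x))"
  proof (rule integral_dominated_convergence[where w = "\<lambda>x. norm (indicat_real cell x *\<^sub>R u x)"])
    have "C \<in> sets lebesgue" using C by (simp add: compact_imp_closed)
    then show "(\<lambda>x. indicat_real C x *\<^sub>R (indicat_real cell x *\<^sub>R u x)) \<in> borel_measurable lebesgue"
      by (intro borel_measurable_scaleR um) simp
    show "(\<lambda>x. f n (circ x) *\<^sub>R (indicat_real cell x *\<^sub>R u x)) \<in> borel_measurable lebesgue" for n
      by (intro borel_measurable_scaleR um borel_measurable_lebesgue_continuous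
          continuous_on_compose2[OF fc continuous_on_circ]) auto
    show "integrable lebesgue (\<lambda>x. norm (indicat_real cell x *\<^sub>R u x))" using ui by (rule integrable_norm)
    show "AE x in lebesgue. norm (f n (circ x) *\<^sub>R (indicat_real cell x *\<^sub>R u x)) \<le> norm (indicat_real cell x *\<^sub>R u x)" for n
    proof (rule AE_I2)
      fix x
      show "norm (f n (circ x) *\<^sub>R (indicat_real cell x *\<^sub>R u x)) \<le> norm (indicat_real cell x *\<^sub>R u x)"
        using mult_right_mono[OF f01(2) norm_ge_zero, of n "circ x" "indicat_real cell x *\<^sub>R u x"] f01(1)[of n "circ x"]
        by (simp only: norm_scaleR abs_of_nonneg mult_1)
    qed
    have face: "{x. \<exists>j. (x :: real ^ 'd) $ j = 0 \<or> x $ j = 2 * pi} \<in> null_sets lebesgue"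
      using negligible_cell_face negligible_iff_null_sets by blast
    have "AE x in lebesgue. \<not> (\<exists>j. (x :: real ^ 'd) $ j = 0 \<or> x $ j = 2 * pi)"
      using AE_not_in[OF face] by simp
    then show "AE x in lebesgue. (\<lambda>n. f n (circ x) *\<^sub>R (indicat_real cell x *\<^sub>R u x)) \<longlonglongrightarrow>
        indicat_real C x *\<^sub>R (indicat_real cell x *\<^sub>R u x)"
    proof (rule AE_mp, intro AE_I2 impI)
      fix x :: "real ^ 'd" assume x: "\<not> (\<exists>j. x $ j = 0 \<or> x $ j = 2 * pi)"
      show "(\<lambda>n. f n (circ x) *\<^sub>R (indicat_real cell x *\<^sub>R u x)) \<longlonglongrightarrow> indicat_real C x *\<^sub>R (indicat_real cell x *\<^sub>R u x)"
      proof (cases "x \<in> cell")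
        case True
        have "circ x \<in> K \<longleftrightarrow> x \<in> C"
          unfolding K_def using circ_inj[of x] x True by auto
        then have "(\<lambda>n. f n (circ x)) \<longlonglongrightarrow> indicat_real C x"
          using lim[of "circ x"] by (cases "x \<in> C") (auto simp: indicator_def)
        then show ?thesis by (intro tendsto_scaleR tendsto_const)
      qed simp
    qed
  qed
  moreover have "(LINT x|lebesgue. f n (circ x) *\<^sub>R (indicat_real cell x *\<^sub>R u x)) = 0" for n
    using no_coeffs_integral_continuous[OF u fc, of n]
    by (simp add: set_lebesgue_integral_def mult.commute)
  ultimately show ?thesis by (simp add: set_lebesgue_integral_def LIMSEQ_const_iff)
qed

lemma sigma_finite_lebesgue: "sigma_finite_measure (lebesgue :: 'a::euclidean_space measure)"
proof
  obtain A :: "'a set set" where A: "countable A" "A \<subseteq> sets lborel" "\<Union>A = space lborel" "\<forall>a\<in>A. emeasure lborel a \<noteq> \<infinity>"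
    using lborel.sigma_finite_countable by blast
  then show "\<exists>A :: 'a set set. countable A \<and> A \<subseteq> sets lebesgue \<and> \<Union>A = space lebesgue \<and> (\<forall>a\<in>A. emeasure lebesgue a \<noteq> \<infinity>)"
    by (intro exI[of _ A]) auto
qed

text \<open>Up to a null set, a measurable set is an increasing union of compact sets, over which the integrals of
  \<open>u\<close> vanish.\<close>

lemma no_coeffs_AE_cell:
  fixes u :: "real ^ 'd \<Rightarrow> complex ^ 'n"
  assumes u: "u \<in> no_coeffs"
  shows "AE x in lebesgue. indicat_real cell x *\<^sub>R u x = 0"
proof (rule sigma_finite_measure.density_zero[OF sigma_finite_lebesgue])
  show ui: "integrable lebesgue (\<lambda>x. indicat_real cell x *\<^sub>R u x)"
    using u by (simp add: no_coeffs_def set_integrable_def)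
  fix A :: "(real ^ 'd) set" assume A: "A \<in> sets lebesgue"
  obtain C T where CT: "fsigma C" "T \<in> null_sets lebesgue" "C \<union> T = A" "disjnt C T"
    using lebesgue_set_almost_fsigma[OF A] by metis
  obtain F :: "nat \<Rightarrow> (real ^ 'd) set" where F': "range F \<subseteq> Collect compact" and CF: "C = \<Union>(F ` UNIV)"
    using CT(1) fsigma_Union_compact by blast
  then have F: "compact (F n)" for n by blast
  define G where "G n = \<Union>(F ` {..n})" for n
  have G: "compact (G n)" for n unfolding G_def using F by (intro compact_UN) auto
  have Gm: "G n \<in> sets lebesgue" for n using G by (simp add: compact_imp_closed)
  have GC: "(\<Union>n. G n) = C" unfolding G_def CF by auto
  have Gi: "incseq G" unfolding G_def incseq_def by fastforce
  have "C \<in> sets lebesgue" using GC Gm by blast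
  then have si: "set_integrable lebesgue C (\<lambda>x. indicat_real cell x *\<^sub>R u x)"
    unfolding set_integrable_def by (intro integrable_mult_indicator ui)
  have "(\<lambda>n. LINT x:G n|lebesgue. indicat_real cell x *\<^sub>R u x) \<longlonglongrightarrow> (LINT x:(\<Union>n. G n)|lebesgue. indicat_real cell x *\<^sub>R u x)"
    by (rule set_integral_cont_up[OF Gm Gi]) (use si GC in simp)
  then have C0: "(LINT x:C|lebesgue. indicat_real cell x *\<^sub>R u x) = 0"
    using no_coeffs_integral_compact[OF u G] by (simp add: GC LIMSEQ_const_iff)
  have "(LINT x:A|lebesgue. indicat_real cell x *\<^sub>R u x) = (LINT x:C|lebesgue. indicat_real cell x *\<^sub>R u x)"
    unfolding set_lebesgue_integral_def
  proof (rule integral_cong_AE)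
    show "(\<lambda>x. indicat_real A x *\<^sub>R indicat_real cell x *\<^sub>R u x) \<in> borel_measurable lebesgue"
      using integrable_mult_indicator[OF A ui] by (rule borel_measurable_integrable)
    show "(\<lambda>x. indicat_real C x *\<^sub>R indicat_real cell x *\<^sub>R u x) \<in> borel_measurable lebesgue"
      using si unfolding set_integrable_def by (rule borel_measurable_integrable)
    show "AE x in lebesgue. indicat_real A x *\<^sub>R indicat_real cell x *\<^sub>R u x = indicat_real C x *\<^sub>R indicat_real cell x *\<^sub>R u x"
      using AE_not_in[OF CT(2)] by (rule AE_mp) (use CT(3) in \<open>auto intro!: AE_I2 simp: indicator_def\<close>)
  qed
  then show "(LINT x:A|lebesgue. indicat_real cell x *\<^sub>R u x) = 0" using C0 by simp
qed

text \<open>A null set in the cell propagates to the whole space along the countably many lattice shifts.\<close>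

theorem fourier_uniqueness:
  fixes u :: "real ^ 'd \<Rightarrow> complex ^ 'n"
  assumes u: "set_integrable lebesgue cell u" "periodic u" and c: "\<And>k. fourier_coeff u k = 0"
  shows "AE x in lebesgue. u x = 0"
proof -
  have "AE x in lebesgue. indicat_real cell x *\<^sub>R u x = 0"
    by (rule no_coeffs_AE_cell) (simp add: no_coeffs_def u c)
  then obtain N where N: "N \<in> null_sets lebesgue" "{x. \<not> indicat_real cell x *\<^sub>R u x = 0} \<subseteq> N"
    by (auto simp: eventually_ae_filter)
  then have "negligible N" by (simp add: negligible_iff_null_sets)
  then have neg: "negligible ((+) ((2 * pi) *\<^sub>R freq z) ` N)" for z :: "int ^ 'd"
    by (rule negligible_translation)
  have "countable (UNIV :: (int ^ 'd) set)" by (rule countableI_type)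
  then have "negligible (\<Union>z \<in> (UNIV :: (int ^ 'd) set). (+) ((2 * pi) *\<^sub>R freq z) ` N)"
    by (intro negligible_countable_Union countable_image) (use neg in auto)
  moreover have "{x. u x \<noteq> 0} \<subseteq> (\<Union>z \<in> (UNIV :: (int ^ 'd) set). (+) ((2 * pi) *\<^sub>R freq z) ` N)"
  proof
    fix x assume x: "x \<in> {x. u x \<noteq> 0}"
    obtain z where z: "x + (2 * pi) *\<^sub>R freq z \<in> cell" using cell_representative by blast
    have "u (x + (2 * pi) *\<^sub>R freq z) \<noteq> 0" using periodic_shift[OF u(2)] x by simp
    then have "x + (2 * pi) *\<^sub>R freq z \<in> N" using N(2) z by auto
    then have "(2 * pi) *\<^sub>R freq (- z) + (x + (2 * pi) *\<^sub>R freq z) \<in> (+) ((2 * pi) *\<^sub>R freq (- z)) ` N" by blast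
    moreover have "(2 * pi) *\<^sub>R freq (- z) + (x + (2 * pi) *\<^sub>R freq z) = x" by simp
    ultimately show "x \<in> (\<Union>z \<in> (UNIV :: (int ^ 'd) set). (+) ((2 * pi) *\<^sub>R freq z) ` N)"
      by (intro UN_I[of "- z"]) (simp_all only: UNIV_I)
  qed
  ultimately have "negligible {x. u x \<noteq> 0}" by (rule negligible_subset)
  then have "{x. u x \<noteq> 0} \<in> null_sets lebesgue" by (simp add: negligible_iff_null_sets)
  then show ?thesis by (simp add: AE_iff_null_sets AE_not_in[THEN AE_mp] eventually_ae_filter) blast
qed

lemma L2_set_integrable:
  fixes u :: "real ^ 'd \<Rightarrow> complex ^ 'n"
  assumes "u \<in> L2"
  shows "set_integrable lebesgue cell u"
  unfolding set_integrable_def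
proof (rule Bochner_Integration.integrable_bound)
  have 1: "set_integrable lebesgue cell (\<lambda>x :: real ^ 'd. 1 :: real)" by (rule set_integrable_cell) simp
  have 2: "set_integrable lebesgue cell (\<lambda>x. (norm (u x))\<^sup>2)" using assms by (simp add: L2_def)
  show "integrable lebesgue (\<lambda>x. indicat_real cell x *\<^sub>R (1 + (norm (u x))\<^sup>2))"
    using set_integral_add(1)[OF 1 2] by (simp add: set_integrable_def)
  have cm: "(cell :: (real ^ 'd) set) \<in> sets lebesgue" by (simp add: compact_cell compact_imp_closed)
  show "(\<lambda>x. indicat_real cell x *\<^sub>R u x) \<in> borel_measurable lebesgue"
    by (intro borel_measurable_scaleR borel_measurable_indicator cm) (use assms in \<open>simp add: L2_def\<close>)
  show "AE x in lebesgue. norm (indicat_real cell x *\<^sub>R u x) \<le> norm (indicat_real cell x *\<^sub>R (1 + (norm (u x))\<^sup>2))"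
  proof (intro AE_I2)
    fix x
    have "norm (u x) \<le> 1 + (norm (u x))\<^sup>2"
      using sum_power2_ge_zero[of "norm (u x) - 1/2" 0] by (simp add: power2_eq_square algebra_simps)
    then show "norm (indicat_real cell x *\<^sub>R u x) \<le> norm (indicat_real cell x *\<^sub>R (1 + (norm (u x))\<^sup>2))"
      by (simp add: indicator_def)
  qed
qed

lemma CP_L2:
  fixes u :: "real ^ 'd \<Rightarrow> complex ^ 'n"
  assumes "u \<in> CP"
  shows "u \<in> L2"
proof -
  have "set_integrable lebesgue cell (\<lambda>x. (norm (u x))\<^sup>2)"
    by (rule set_integrable_cell) (use assms in \<open>auto simp: CP_def intro!: continuous_intros\<close>)
  moreover have "u \<in> borel_measurable lebesgue"
    using assms by (intro borel_measurable_lebesgue_continuous) (simp add: CP_def)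
  ultimately show ?thesis using assms by (simp add: L2_def CP_def)
qed

corollary L2_eq_of_fourier_coeff_eq:
  fixes u v :: "real ^ 'd \<Rightarrow> complex ^ 'n"
  assumes "u \<in> L2" "v \<in> L2" "\<And>k. fourier_coeff u k = fourier_coeff v k"
  shows "AE x in lebesgue. u x = v x"
proof -
  note i = L2_set_integrable[OF assms(1)] L2_set_integrable[OF assms(2)]
  have "periodic (\<lambda>x. u x - v x)" using assms(1,2) by (simp add: L2_def periodic_def)
  then have "AE x in lebesgue. u x - v x = 0"
    using fourier_uniqueness[OF fourier_coeff_diff_integrable(1)[OF i]] fourier_coeff_diff_integrable(2)[OF i] assms(3)
    by simp
  then show ?thesis by simp
qed

section \<open>Sobolev norms of sequences\<close>

text \<open>The Japanese bracket \<open>\<langle>k\<rangle> = (1 + \<bar>k\<bar>\<^sup>2)\<^sup>1\<^sup>/\<^sup>2\<close> of a frequency.\<close>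

definition jap :: "int ^ 'd \<Rightarrow> real" where
  "jap k = sqrt (1 + (norm (freq k))\<^sup>2)"

definition wt :: "real \<Rightarrow> int ^ 'd \<Rightarrow> real" where
  "wt r k = jap k powr r"

lemma jap_ge_1: "1 \<le> jap k" by (simp add: jap_def)

lemma jap_pos [simp]: "0 < jap k" using jap_ge_1[of k] by linarith

lemma jap_simps [simp]: "jap k \<noteq> 0" "0 \<le> jap k" "\<bar>jap k\<bar> = jap k"
  using jap_ge_1[of k] by auto

lemma wt_pos [simp]: "0 < wt r k" by (simp add: wt_def)

lemma wt_0 [simp]: "wt 0 k = 1" by (simp add: wt_def)

lemma wt_nonneg [simp]: "0 \<le> wt r k" using wt_pos[of r k] by linarith

lemma wt_add: "wt (r + t) k = wt r k * wt t k" by (simp add: wt_def powr_add)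

lemma wt_minus: "wt (- r) k = 1 / wt r k" by (simp add: wt_def powr_minus_divide)

lemma wt_mono: "r \<le> t \<Longrightarrow> wt r k \<le> wt t k"
  unfolding wt_def by (rule powr_mono) (auto simp: jap_ge_1)

lemma wt_ge_1: "0 \<le> r \<Longrightarrow> 1 \<le> wt r k" using wt_mono[of 0 r k] by simp

lemma wt_1: "wt 1 k = jap k" by (simp add: wt_def)

lemma wt_2: "wt 2 k = 1 + (norm (freq k))\<^sup>2"
proof -
  have "wt 2 k = (jap k)\<^sup>2" using powr_realpow[OF jap_pos[of k], of 2] by (simp add: wt_def)
  then show ?thesis by (simp add: jap_def)
qed

lemma jap_minus [simp]: "jap (- k) = jap k" by (simp add: jap_def)

lemma wt_uminus [simp]: "wt r (- k) = wt r k" by (simp add: wt_def)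

lemma norm_freq_le_jap: "norm (freq k) \<le> jap k"
  unfolding jap_def by (rule real_le_rsqrt) simp

lemma jap_triangle: "jap k \<le> jap l + jap (k - l)"
proof -
  have "jap k = norm (1 :: real, freq k)" by (simp add: jap_def norm_Pair)
  also have "(1 :: real, freq k) = (1, freq l) + (0, freq (k - l))" by simp
  also have "norm \<dots> \<le> norm (1 :: real, freq l) + norm (0 :: real, freq (k - l))" by (rule norm_triangle_ineq)
  also have "norm (1 :: real, freq l) = jap l" by (simp add: jap_def norm_Pair)
  also have "norm (0 :: real, freq (k - l)) \<le> jap (k - l)" using norm_freq_le_jap[of "k - l"] by (simp add: norm_Pair)
  finally show ?thesis by simp
qed

text \<open>The larger one of \<open>\<langle>l\<rangle>\<close> and \<open>\<langle>k - l\<rangle>\<close> is at least \<open>\<langle>k\<rangle> / 2\<close>: derivatives fall on one of the two factors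
  of a product.\<close>

lemma wt_quasi_triangle:
  assumes "0 \<le> r"
  shows "wt r k \<le> 2 powr r * (wt r l + wt r (k - l))"
proof -
  let ?M = "max (jap l) (jap (k - l))"
  have "jap k \<le> 2 * ?M" using jap_triangle[of k l] by linarith
  then have "wt r k \<le> (2 * ?M) powr r" unfolding wt_def using assms by (intro powr_mono2) (auto simp: less_imp_le)
  also have "\<dots> = 2 powr r * ?M powr r" using jap_pos[of l] by (intro powr_mult)
  also have "?M powr r \<le> wt r l + wt r (k - l)" unfolding wt_def max_def by auto
  finally show ?thesis by simp
qed

lemma wt_quasi_submultiplicative:
  assumes "0 \<le> r"
  shows "wt r k \<le> 2 * 2 powr r * (wt r l * wt r (k - l))"
proof -
  have "wt r l \<le> wt r l * wt r (k - l)" "wt r (k - l) \<le> wt r l * wt r (k - l)"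
    using wt_ge_1[OF assms, of l] wt_ge_1[OF assms, of "k - l"] by (simp_all add: mult_le_cancel_left1 mult_le_cancel_right1)
  then have "wt r l + wt r (k - l) \<le> 2 * (wt r l * wt r (k - l))" by linarith
  then have "2 powr r * (wt r l + wt r (k - l)) \<le> 2 powr r * (2 * (wt r l * wt r (k - l)))"
    by (intro mult_left_mono) auto
  from order_trans[OF wt_quasi_triangle[OF assms] this] show ?thesis by (simp only: mult_ac)
qed

lemma sobolev_weight_eq: "sobolev_weight r k = (wt r k)\<^sup>2"
proof -
  have n: "(norm (freq k))\<^sup>2 = (\<Sum>j\<in>UNIV. (of_int (k $ j))\<^sup>2)"
    unfolding power2_norm_eq_inner inner_vec_def by (simp add: power2_eq_square)
  have "1 + (\<Sum>j\<in>UNIV. (of_int (k $ j))\<^sup>2) = (jap k)\<^sup>2" unfolding n[symmetric] by (simp add: jap_def)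
  also have "\<dots> = jap k powr 2" using powr_realpow[OF jap_pos[of k], of 2] by simp
  finally have "sobolev_weight r k = jap k powr (2 * r)" by (simp only: sobolev_weight_def powr_powr)
  also have "\<dots> = wt r k * wt r k" unfolding wt_add[symmetric] by (simp add: wt_def)
  finally show ?thesis by (simp add: power2_eq_square)
qed

text \<open>Sobolev regularity of a family of coefficients: \<open>hs r a\<close> is membership in the sequence space of
  \<open>H\<^sup>r\<close>, and \<open>hn r a\<close> is the norm. The isometries \<open>enc r\<close> and \<open>dec r\<close> between this space and \<open>\<ell>\<^sup>2\<close> multiply
  and divide by the weight.\<close>

definition hs :: "real \<Rightarrow> (int ^ 'd \<Rightarrow> 'v::real_normed_vector) \<Rightarrow> bool" where
  "hs r a \<longleftrightarrow> in_l2 (\<lambda>k. wt r k *\<^sub>R a k)"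

definition enc :: "real \<Rightarrow> (int ^ 'd \<Rightarrow> 'v::real_normed_vector) \<Rightarrow> (int ^ 'd, 'v) l2" where
  "enc r a = Abs_l2 (\<lambda>k. wt r k *\<^sub>R a k)"

definition dec :: "real \<Rightarrow> (int ^ 'd, 'v::real_normed_vector) l2 \<Rightarrow> int ^ 'd \<Rightarrow> 'v" where
  "dec r x k = (1 / wt r k) *\<^sub>R coord x k"

definition hn :: "real \<Rightarrow> (int ^ 'd \<Rightarrow> 'v::real_normed_vector) \<Rightarrow> real" where
  "hn r a = norm (enc r a)"

lemma coord_enc: "hs r a \<Longrightarrow> coord (enc r a) k = wt r k *\<^sub>R a k"
  by (simp add: hs_def enc_def coord_Abs_l2)

lemma wt_neq_0 [simp]: "wt r k \<noteq> 0" using wt_pos[of r k] by linarith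

lemma hs_dec [simp]: "hs r (dec r x)"
  using in_l2_coord[of x] by (simp add: hs_def dec_def)

lemma enc_dec [simp]: "enc r (dec r x) = x"
  by (rule l2_eqI) (simp add: coord_enc dec_def)

lemma dec_enc: "hs r a \<Longrightarrow> dec r (enc r a) = a"
  by (simp add: dec_def fun_eq_iff coord_enc)

lemma hn_dec [simp]: "hn r (dec r x) = norm x" by (simp add: hn_def)

lemma hn_nonneg [simp]: "0 \<le> hn r a" by (simp add: hn_def)

lemma dec_simps: "dec r (x + y) k = dec r x k + dec r y k" "dec r (x - y) k = dec r x k - dec r y k"
    "dec r (c *\<^sub>R x) k = c *\<^sub>R dec r x k"
  by (simp_all add: dec_def algebra_simps)

lemma hs_mono:
  assumes "hs r a" "\<And>k. norm (wt t k *\<^sub>R b k) \<le> norm (c *\<^sub>R (wt r k *\<^sub>R a k))"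
  shows "hs t b" "hn t b \<le> \<bar>c\<bar> * hn r a"
proof -
  have *: "norm (wt t k *\<^sub>R b k) \<le> norm (coord (c *\<^sub>R enc r a) k)" for k
    using assms(2)[of k] by (simp add: coord_enc[OF assms(1)])
  show "hs t b" unfolding hs_def by (rule in_l2_le(1)[OF *])
  show "hn t b \<le> \<bar>c\<bar> * hn r a"
    using in_l2_le(2)[of "\<lambda>k. wt t k *\<^sub>R b k" "c *\<^sub>R enc r a", OF *] by (simp add: hn_def enc_def)
qed

lemma hs_bound:
  assumes "hs r a" "\<And>k. norm (b k) \<le> c * norm (a k)"
  shows "hs r b" "hn r b \<le> \<bar>c\<bar> * hn r a"
proof -
  have "norm (wt r k *\<^sub>R b k) \<le> norm (c *\<^sub>R (wt r k *\<^sub>R a k))" for k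
  proof -
    have "norm (b k) \<le> \<bar>c\<bar> * norm (a k)"
      using assms(2)[of k] by (rule order_trans) (simp add: mult_right_mono)
    then have "wt r k * norm (b k) \<le> wt r k * (\<bar>c\<bar> * norm (a k))" by (intro mult_left_mono) auto
    then show ?thesis by (simp add: abs_mult mult_ac)
  qed
  from hs_mono[OF assms(1) this] show "hs r b" "hn r b \<le> \<bar>c\<bar> * hn r a" by auto
qed

lemma hs_le:
  assumes "hs r a" "t \<le> r"
  shows "hs t a" "hn t a \<le> hn r a"
proof -
  have "norm (wt t k *\<^sub>R a k) \<le> norm (1 *\<^sub>R (wt r k *\<^sub>R a k))" for k
    using wt_mono[OF assms(2), of k] by (simp add: mult_right_mono)
  from hs_mono[OF assms(1) this] show "hs t a" "hn t a \<le> hn r a" by auto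
qed

lemma hs_add:
  assumes "hs r a" "hs r b"
  shows "hs r (\<lambda>k. a k + b k)" "hn r (\<lambda>k. a k + b k) \<le> hn r a + hn r b"
proof -
  have c: "wt r k *\<^sub>R (a k + b k) = coord (enc r a + enc r b) k" for k
    using assms by (simp add: coord_enc algebra_simps)
  show "hs r (\<lambda>k. a k + b k)" unfolding hs_def c by (rule in_l2_coord)
  have "enc r (\<lambda>k. a k + b k) = enc r a + enc r b" unfolding enc_def[of r "\<lambda>k. a k + b k"] c by (rule coord_inverse)
  then show "hn r (\<lambda>k. a k + b k) \<le> hn r a + hn r b" unfolding hn_def by (simp add: norm_triangle_ineq)
qed

lemma enc_diff:
  assumes "hs r a" "hs r b"
  shows "hs r (\<lambda>k. a k - b k)" "enc r (\<lambda>k. a k - b k) = enc r a - enc r b"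
proof -
  have c: "wt r k *\<^sub>R (a k - b k) = coord (enc r a - enc r b) k" for k
    using assms by (simp add: coord_enc algebra_simps)
  show "hs r (\<lambda>k. a k - b k)" unfolding hs_def c by (rule in_l2_coord)
  show "enc r (\<lambda>k. a k - b k) = enc r a - enc r b" unfolding enc_def[of r "\<lambda>k. a k - b k"] c by (rule coord_inverse)
qed

lemma hs_0: "hs r (\<lambda>k. 0 :: 'v::real_normed_vector)" "hn r (\<lambda>k. 0 :: 'v) = 0"
proof -
  show h: "hs r (\<lambda>k. 0 :: 'v)" by (simp add: hs_def in_l2_def)
  have "enc r (\<lambda>k. 0 :: 'v) = 0" by (intro l2_eqI) (simp add: coord_enc[OF h])
  then show "hn r (\<lambda>k. 0 :: 'v) = 0" by (simp add: hn_def)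
qed

lemma hs_sum:
  assumes "finite A" "\<And>i. i \<in> A \<Longrightarrow> hs r (a i)"
  shows "hs r (\<lambda>k. \<Sum>i\<in>A. a i k) \<and> hn r (\<lambda>k. \<Sum>i\<in>A. a i k) \<le> (\<Sum>i\<in>A. hn r (a i))"
  using assms
proof (induction A rule: finite_induct)
  case empty
  then show ?case by (simp add: hs_0)
next
  case (insert i A)
  then have "hs r (a i)" "hs r (\<lambda>k. \<Sum>i\<in>A. a i k)" "hn r (\<lambda>k. \<Sum>i\<in>A. a i k) \<le> (\<Sum>i\<in>A. hn r (a i))" by auto
  then show ?case using hs_add[of r "a i" "\<lambda>k. \<Sum>i\<in>A. a i k"] insert.hyps by simp
qed

lemma hs_norm: "hs r (\<lambda>k. norm (a k)) \<longleftrightarrow> hs r a"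
  by (simp add: hs_def in_l2_def power_mult_distrib)

lemma hn_norm: "hs r a \<Longrightarrow> hn r (\<lambda>k. norm (a k)) = hn r a"
  using hs_bound(2)[of r a "\<lambda>k. norm (a k)" 1] hs_bound(2)[of r "\<lambda>k. norm (a k)" a 1] hs_norm[of r a] by simp

lemma hs_reflect:
  assumes "hs r a"
  shows "hs r (\<lambda>k. a (- k))" "hn r (\<lambda>k. a (- k)) = hn r a"
proof -
  have s: "(\<lambda>k. (norm (wt r k *\<^sub>R a (- k)))\<^sup>2) summable_on UNIV \<longleftrightarrow> (\<lambda>k. (norm (wt r k *\<^sub>R a k))\<^sup>2) summable_on UNIV"
    by (rule summable_on_reindex_bij_witness[of UNIV uminus uminus UNIV]) auto
  then show h: "hs r (\<lambda>k. a (- k))" using assms by (simp add: hs_def in_l2_def)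
  have "(\<Sum>\<^sub>\<infinity>k. (norm (wt r k *\<^sub>R a (- k)))\<^sup>2) = (\<Sum>\<^sub>\<infinity>k. (norm (wt r k *\<^sub>R a k))\<^sup>2)"
    by (rule infsum_reindex_bij_witness[of UNIV uminus uminus UNIV]) auto
  then show "hn r (\<lambda>k. a (- k)) = hn r a"
    using h assms by (simp add: hn_def enc_def hs_def norm_Abs_l2)
qed

subsection \<open>Absolute summability\<close>

lemma l2_Cauchy_Schwarz:
  fixes f g :: "'k \<Rightarrow> real"
  assumes "in_l2 f" "in_l2 g"
  shows "(\<lambda>k. \<bar>f k * g k\<bar>) summable_on UNIV" "(\<Sum>\<^sub>\<infinity>k. \<bar>f k * g k\<bar>) \<le> norm (Abs_l2 f) * norm (Abs_l2 g)"
proof -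
  have b: "(\<Sum>k\<in>F. \<bar>f k * g k\<bar>) \<le> norm (Abs_l2 f) * norm (Abs_l2 g)" if "finite F" for F
  proof -
    have "(\<Sum>k\<in>F. \<bar>f k * g k\<bar>) \<le> L2_set f F * L2_set g F" using L2_set_mult_ineq[of f g F] by (simp add: abs_mult)
    also have "\<dots> \<le> norm (Abs_l2 f) * norm (Abs_l2 g)"
    proof (rule mult_mono)
      have "L2_set h F \<le> norm (Abs_l2 h)" if "in_l2 h" for h :: "'k \<Rightarrow> real"
        using L2_set_coord_le[OF \<open>finite F\<close>, of "Abs_l2 h"] by (simp add: coord_Abs_l2[OF that] L2_set_def)
      then show "L2_set f F \<le> norm (Abs_l2 f)" "L2_set g F \<le> norm (Abs_l2 g)" using assms by auto
    qed auto
    finally show ?thesis .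
  qed
  show s: "(\<lambda>k. \<bar>f k * g k\<bar>) summable_on UNIV"
    by (rule nonneg_bdd_above_summable_on) (auto intro!: bdd_aboveI b)
  show "(\<Sum>\<^sub>\<infinity>k. \<bar>f k * g k\<bar>) \<le> norm (Abs_l2 f) * norm (Abs_l2 g)"
    by (rule infsum_le_finite_sums[OF s]) (rule b)
qed

lemma summable_int_inverse_square: "(\<lambda>n :: int. 1 / (1 + (of_int n)\<^sup>2) :: real) summable_on UNIV"
proof -
  have "summable (\<lambda>n. inverse (real (Suc n) ^ 2))" using inverse_power_summable[of 2] by (subst summable_Suc_iff) auto
  then have nat: "(\<lambda>n :: nat. inverse (real (Suc n) ^ 2)) summable_on UNIV"
    by (subst summable_on_UNIV_nonneg_real_iff) auto
  have le: "1 / (1 + (real n)\<^sup>2) \<le> 2 * inverse (real (Suc n) ^ 2)" for n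
  proof -
    have "(real (Suc n))\<^sup>2 \<le> 2 * (1 + (real n)\<^sup>2)"
      using sum_power2_ge_zero[of "real n - 1" 0] by (simp add: power2_eq_square algebra_simps)
    then have "1 / (1 + (real n)\<^sup>2) \<le> 1 / ((real (Suc n))\<^sup>2 / 2)"
      by (intro divide_left_mono) (auto intro!: mult_pos_pos add_pos_nonneg)
    then show ?thesis by (simp add: field_simps)
  qed
  have N: "(\<lambda>n :: nat. 1 / (1 + (real n)\<^sup>2)) summable_on UNIV"
    by (rule summable_on_comparison_test[OF summable_on_cmult_right[OF nat, of 2]]) (use le in auto)
  have "(\<lambda>n :: int. 1 / (1 + (of_int n)\<^sup>2) :: real) summable_on (range int)"
    using N by (subst summable_on_reindex) (auto simp: o_def)
  moreover have "(\<lambda>n :: int. 1 / (1 + (of_int n)\<^sup>2) :: real) summable_on (range (\<lambda>n. - int n))"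
    using N by (subst summable_on_reindex) (auto simp: o_def inj_on_def)
  ultimately have "(\<lambda>n :: int. 1 / (1 + (of_int n)\<^sup>2) :: real) summable_on (range int \<union> range (\<lambda>n. - int n))"
    by (rule summable_on_union)
  moreover have "range int \<union> range (\<lambda>n. - int n) = UNIV"
  proof -
    have "n \<in> range int \<union> range (\<lambda>n. - int n)" for n :: int
      by (cases n rule: int_cases2) auto
    then show ?thesis by blast
  qed
  ultimately show ?thesis by simp
qed

text \<open>Since \<open>(1 + \<bar>k\<bar>\<^sup>2)\<^sup>d \<ge> \<Prod>\<^sub>j (1 + k\<^sub>j\<^sup>2)\<close>, the lattice sum is dominated by a product of
  one-dimensional sums.\<close>

lemma in_l2_wt: "in_l2 (\<lambda>k :: int ^ 'd. wt (- real CARD('d)) k)"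
proof -
  define S where "S = (\<Sum>\<^sub>\<infinity>n :: int. 1 / (1 + (of_int n)\<^sup>2) :: real)"
  have S0: "S \<ge> 0" unfolding S_def by (rule infsum_nonneg) (simp add: add_nonneg_nonneg)
  have le: "(norm (wt (- real CARD('d)) k))\<^sup>2 \<le> (\<Prod>j\<in>UNIV. 1 / (1 + (of_int (k $ j))\<^sup>2))" for k :: "int ^ 'd"
  proof -
    have "(\<Prod>j\<in>(UNIV :: 'd set). 1 + (of_int (k $ j))\<^sup>2) \<le> (\<Prod>j\<in>(UNIV :: 'd set). (jap k)\<^sup>2)"
    proof (rule prod_mono)
      fix j :: 'd
      have "\<bar>of_int (k $ j)\<bar> \<le> norm (freq k)" using component_le_norm_cart[of "freq k" j] by simp
      then have "(of_int (k $ j))\<^sup>2 \<le> (norm (freq k))\<^sup>2" by (simp add: abs_le_square_iff[symmetric])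
      then show "0 \<le> 1 + (real_of_int (k $ j))\<^sup>2 \<and> 1 + (real_of_int (k $ j))\<^sup>2 \<le> (jap k)\<^sup>2"
        by (simp add: jap_def add_nonneg_nonneg)
    qed
    also have "\<dots> = (wt (real CARD('d)) k)\<^sup>2"
      by (simp add: wt_def powr_realpow power_mult[symmetric] mult.commute)
    finally have "1 / (wt (real CARD('d)) k)\<^sup>2 \<le> 1 / (\<Prod>j\<in>(UNIV :: 'd set). 1 + (of_int (k $ j))\<^sup>2)"
      by (intro divide_left_mono) (auto intro!: prod_pos mult_pos_pos add_pos_nonneg)
    then show ?thesis by (simp add: wt_minus power_divide prod_dividef)
  qed
  have bd: "(\<Sum>k\<in>F. (norm (wt (- real CARD('d)) k))\<^sup>2) \<le> S ^ CARD('d)" if F: "finite F" for F :: "(int ^ 'd) set"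
  proof -
    define A where "A = (\<Union>j. (\<lambda>k. k $ j) ` F)"
    have A: "finite A" unfolding A_def using F by auto
    have "(\<Sum>k\<in>F. (norm (wt (- real CARD('d)) k))\<^sup>2) \<le> (\<Sum>k\<in>F. \<Prod>j\<in>UNIV. 1 / (1 + (of_int (k $ j))\<^sup>2))"
      by (rule sum_mono) (rule le)
    also have "\<dots> = (\<Sum>f\<in>vec_nth ` F. \<Prod>j\<in>(UNIV :: 'd set). 1 / (1 + (of_int (f j))\<^sup>2))"
      by (subst sum.reindex) (auto simp: inj_on_def vec_nth_inject)
    also have "\<dots> \<le> (\<Sum>f\<in>PiE (UNIV :: 'd set) (\<lambda>_. A). \<Prod>j\<in>UNIV. 1 / (1 + (of_int (f j))\<^sup>2))"
    proof (rule sum_mono2)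
      show "finite (PiE (UNIV :: 'd set) (\<lambda>_. A))" using A by (intro finite_PiE) auto
      show "vec_nth ` F \<subseteq> PiE UNIV (\<lambda>_. A)" by (auto simp: A_def PiE_def)
    qed (auto intro!: prod_nonneg add_nonneg_nonneg)
    also have "\<dots> = (\<Prod>j\<in>(UNIV :: 'd set). \<Sum>n\<in>A. 1 / (1 + (of_int n)\<^sup>2))"
      using prod_sum_PiE[of "UNIV :: 'd set" "\<lambda>_. A" "\<lambda>_ n. 1 / (1 + (real_of_int n)\<^sup>2)"] A by simp
    also have "\<dots> \<le> (\<Prod>j\<in>(UNIV :: 'd set). S)"
    proof (rule prod_mono)
      show "0 \<le> (\<Sum>n\<in>A. 1 / (1 + (real_of_int n)\<^sup>2)) \<and> (\<Sum>n\<in>A. 1 / (1 + (real_of_int n)\<^sup>2)) \<le> S"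
        unfolding S_def using A
        by (intro conjI sum_nonneg finite_sum_le_infsum summable_int_inverse_square) (auto simp: add_nonneg_nonneg)
    qed
    finally show ?thesis by simp
  qed
  show ?thesis unfolding in_l2_def
  proof (rule nonneg_bdd_above_summable_on)
    show "bdd_above (sum (\<lambda>k. (norm (wt (- real CARD('d)) k))\<^sup>2) ` {F. F \<subseteq> (UNIV :: (int ^ 'd) set) \<and> finite F})"
      by (rule bdd_aboveI[of _ "S ^ CARD('d)"], clarify, rule bd)
  qed simp
qed

text \<open>The constant of the embedding of the sequence space of \<open>H\<^sup>d\<close> into \<open>\<ell>\<^sup>1\<close>.\<close>

definition Kemb :: "'d::finite itself \<Rightarrow> real" where
  "Kemb _ = norm (Abs_l2 (\<lambda>k :: int ^ 'd. wt (- real CARD('d)) k))"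

text \<open>Cauchy-Schwarz: a loss of \<open>d\<close> derivatives makes the coefficients summable.\<close>

lemma l1_of_hs:
  fixes a :: "int ^ 'd \<Rightarrow> 'v::real_normed_vector"
  assumes "hs (r + real CARD('d)) a"
  shows "(\<lambda>k. wt r k * norm (a k)) summable_on UNIV"
    "(\<Sum>\<^sub>\<infinity>k. wt r k * norm (a k)) \<le> Kemb TYPE('d) * hn (r + real CARD('d)) a"
proof -
  let ?d = "real CARD('d)"
  have 1: "in_l2 (\<lambda>k. wt (r + ?d) k * norm (a k))"
    using assms by (simp add: hs_def in_l2_def)
  have eq: "wt r k * norm (a k) = \<bar>wt (- ?d) k * (wt (r + ?d) k * norm (a k))\<bar>" for k
    by (simp add: abs_mult mult.assoc[symmetric] wt_add[symmetric])
  have "norm (Abs_l2 (\<lambda>k. wt (r + ?d) k * norm (a k))) = hn (r + ?d) a"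
    using 1 assms by (simp add: norm_Abs_l2 hn_def enc_def hs_def)
  then show "(\<lambda>k. wt r k * norm (a k)) summable_on UNIV"
    "(\<Sum>\<^sub>\<infinity>k. wt r k * norm (a k)) \<le> Kemb TYPE('d) * hn (r + ?d) a"
    unfolding eq Kemb_def using l2_Cauchy_Schwarz[OF in_l2_wt 1] by simp_all
qed

lemma Kemb_nonneg [simp]: "0 \<le> Kemb T" by (simp add: Kemb_def)

subsection \<open>Convolution estimates\<close>

lemma Young_l1_l2_dominated:
  fixes p q :: "'k::ab_group_add \<Rightarrow> real" and z :: "'k \<Rightarrow> 'v::real_normed_vector"
  assumes p: "p summable_on UNIV" "\<And>l. 0 \<le> p l" and q: "in_l2 q"
    and z: "\<And>k S. ((\<lambda>l. p l * q (k - l)) has_sum S) UNIV \<Longrightarrow> norm (z k) \<le> S"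
  shows "in_l2 z" "norm (Abs_l2 z) \<le> (\<Sum>\<^sub>\<infinity>l. p l) * norm (Abs_l2 q)"
proof -
  obtain r where r: "norm r \<le> (\<Sum>\<^sub>\<infinity>l. p l) * norm (Abs_l2 q)"
    and rk: "\<And>k. ((\<lambda>l. p l * coord (Abs_l2 q) (k - l)) has_sum coord r k) UNIV"
    using Young_l1_l2[OF p, of "Abs_l2 q"] by blast
  have "norm (z k) \<le> norm (coord r k)" for k
    using z[of k "coord r k"] rk[of k] coord_Abs_l2[OF q] by simp
  from in_l2_le[of z r, OF this] r show "in_l2 z" "norm (Abs_l2 z) \<le> (\<Sum>\<^sub>\<infinity>l. p l) * norm (Abs_l2 q)" by auto
qed

lemma Young_l1_l2_symmetric:
  fixes p q P Q :: "'k::ab_group_add \<Rightarrow> real" and z :: "'k \<Rightarrow> 'v::real_normed_vector"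
  assumes p: "p summable_on UNIV" "\<And>l. 0 \<le> p l" and q: "q summable_on UNIV" "\<And>l. 0 \<le> q l"
    and P: "in_l2 P" and Q: "in_l2 Q"
    and z: "\<And>k S. ((\<lambda>l. P l * q (k - l) + p l * Q (k - l)) has_sum S) UNIV \<Longrightarrow> norm (z k) \<le> S"
  shows "in_l2 z" "norm (Abs_l2 z) \<le> norm (Abs_l2 P) * (\<Sum>\<^sub>\<infinity>l. q l) + (\<Sum>\<^sub>\<infinity>l. p l) * norm (Abs_l2 Q)"
proof -
  obtain r where r: "norm r \<le> (\<Sum>\<^sub>\<infinity>l. p l) * norm (Abs_l2 Q)"
    and rk: "\<And>k. ((\<lambda>l. p l * coord (Abs_l2 Q) (k - l)) has_sum coord r k) UNIV"
    using Young_l1_l2[OF p, of "Abs_l2 Q"] by blast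
  obtain t where t: "norm t \<le> (\<Sum>\<^sub>\<infinity>l. q l) * norm (Abs_l2 P)"
    and tk: "\<And>k. ((\<lambda>l. q l * coord (Abs_l2 P) (k - l)) has_sum coord t k) UNIV"
    using Young_l1_l2[OF q, of "Abs_l2 P"] by blast
  have tk': "((\<lambda>l. P l * q (k - l)) has_sum coord t k) UNIV" for k
    using tk[of k] unfolding coord_Abs_l2[OF P]
    by (rule has_sum_reindex_bij_witness[of UNIV "\<lambda>l. k - l" "\<lambda>l. k - l" UNIV, THEN iffD1, rotated -1]) (auto simp: mult.commute)
  have "norm (z k) \<le> norm (coord (t + r) k)" for k
    using z[OF has_sum_add[OF tk'[of k] rk[of k, unfolded coord_Abs_l2[OF Q]]]] by simp
  note * = in_l2_le[of z "t + r", OF this]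
  show "in_l2 z" by (rule *(1))
  show "norm (Abs_l2 z) \<le> norm (Abs_l2 P) * (\<Sum>\<^sub>\<infinity>l. q l) + (\<Sum>\<^sub>\<infinity>l. p l) * norm (Abs_l2 Q)"
    using *(2) r t norm_triangle_ineq[of t r] by (simp add: mult.commute)
qed

section \<open>Products and compositions in Sobolev spaces\<close>

definition cnjv :: "complex ^ 'n \<Rightarrow> complex ^ 'n" where
  "cnjv v = (\<chi> i. cnj (v $ i))"

lemma norm_cnjv [simp]: "norm (cnjv v) = norm v"
  by (simp add: cnjv_def norm_vec_def)

text \<open>
  For \<open>u = \<Sum>\<^sub>k a\<^sub>k e\<^sub>k\<close> the real function \<open>u \<bullet> b\<close> has the complex Fourier coefficients
  \<open>re_coord b (a k) (cnjv (a (- k)))\<close>.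
\<close>

definition re_coord :: "complex ^ 'n \<Rightarrow> complex ^ 'n \<Rightarrow> complex ^ 'n \<Rightarrow> complex" where
  "re_coord b v w = (\<Sum>i\<in>UNIV. v $ i * cnj (b $ i) + w $ i * b $ i) / 2"

lemma re_coord_cnjv: "re_coord b v (cnjv v) = of_real (v \<bullet> b)"
proof -
  have "(\<Sum>i\<in>UNIV. v $ i * cnj (b $ i) + cnjv v $ i * b $ i) = (\<Sum>i\<in>UNIV. of_real (2 * (v $ i \<bullet> b $ i)))"
    by (rule sum.cong) (auto simp: cnjv_def complex_eq_iff inner_complex_def algebra_simps)
  then show ?thesis by (simp add: re_coord_def inner_vec_def sum_distrib_left[symmetric])
qed

lemma norm_re_coord:
  fixes b v w :: "complex ^ 'n"
  shows "cmod (re_coord b v w) \<le> real CARD('n) * norm b * (norm v + norm w)"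
proof -
  have "cmod (\<Sum>i\<in>UNIV. v $ i * cnj (b $ i) + w $ i * b $ i) \<le> (\<Sum>i\<in>(UNIV :: 'n set). norm b * (norm v + norm w))"
  proof (rule sum_norm_le)
    fix i
    have "cmod (v $ i * cnj (b $ i) + w $ i * b $ i) \<le> cmod (v $ i) * cmod (b $ i) + cmod (w $ i) * cmod (b $ i)"
      by (rule order_trans[OF norm_triangle_ineq]) (simp add: norm_mult)
    also have "\<dots> \<le> norm v * norm b + norm w * norm b"
      by (intro add_mono mult_mono Finite_Cartesian_Product.norm_nth_le) auto
    finally show "cmod (v $ i * cnj (b $ i) + w $ i * b $ i) \<le> norm b * (norm v + norm w)" by (simp add: algebra_simps)
  qed
  also have "\<dots> = real CARD('n) * norm b * (norm v + norm w)" by simp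
  moreover have "cmod (re_coord b v w) \<le> cmod (\<Sum>i\<in>UNIV. v $ i * cnj (b $ i) + w $ i * b $ i)"
    by (simp add: re_coord_def norm_divide)
  ultimately show ?thesis by linarith
qed

lemma inner_syn_has_sum:
  fixes a :: "int ^ 'd \<Rightarrow> complex ^ 'n"
  assumes a: "in_l1 a"
  shows "((\<lambda>l. re_coord b (a l) (cnjv (a (- l))) * emode l x) has_sum of_real (syn a x \<bullet> b)) UNIV"
proof -
  have L1: "bounded_linear (\<lambda>v :: complex ^ 'n. \<Sum>i\<in>UNIV. v $ i * cnj (b $ i))"
    by (intro bounded_linear_sum bounded_linear_compose[OF bounded_linear_mult_left bounded_linear_vec_nth])
  have L2: "bounded_linear (\<lambda>v :: complex ^ 'n. \<Sum>i\<in>UNIV. cnj (v $ i) * b $ i)"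
    by (intro bounded_linear_sum bounded_linear_compose[OF bounded_linear_mult_left]
        bounded_linear_compose[OF bounded_linear_cnj bounded_linear_vec_nth])
  have 1: "((\<lambda>l. \<Sum>i\<in>UNIV. (emode l x *s a l) $ i * cnj (b $ i)) has_sum (\<Sum>i\<in>UNIV. syn a x $ i * cnj (b $ i))) UNIV"
    by (rule has_sum_bounded_linear[OF L1 syn_has_sum[OF a]])
  have "((\<lambda>l. \<Sum>i\<in>UNIV. cnj ((emode l x *s a l) $ i) * b $ i) has_sum (\<Sum>i\<in>UNIV. cnj (syn a x $ i) * b $ i)) UNIV"
    by (rule has_sum_bounded_linear[OF L2 syn_has_sum[OF a]])
  then have 2: "((\<lambda>l. \<Sum>i\<in>UNIV. cnj ((emode (- l) x *s a (- l)) $ i) * b $ i) has_sum (\<Sum>i\<in>UNIV. cnj (syn a x $ i) * b $ i)) UNIV"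
    by (subst has_sum_reindex_bij_witness[of UNIV uminus uminus UNIV]) auto
  have "((\<lambda>l. ((\<Sum>i\<in>UNIV. (emode l x *s a l) $ i * cnj (b $ i)) + (\<Sum>i\<in>UNIV. cnj ((emode (- l) x *s a (- l)) $ i) * b $ i)) * (1 / 2))
      has_sum ((\<Sum>i\<in>UNIV. syn a x $ i * cnj (b $ i)) + (\<Sum>i\<in>UNIV. cnj (syn a x $ i) * b $ i)) * (1 / 2)) UNIV"
    by (intro has_sum_cmult_left has_sum_add 1 2)
  moreover have "((\<Sum>i\<in>UNIV. syn a x $ i * cnj (b $ i)) + (\<Sum>i\<in>UNIV. cnj (syn a x $ i) * b $ i)) * (1 / 2) = of_real (syn a x \<bullet> b)"
    using re_coord_cnjv[of b "syn a x"] by (simp add: re_coord_def cnjv_def sum.distrib)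
  moreover have "((\<Sum>i\<in>UNIV. (emode l x *s a l) $ i * cnj (b $ i)) + (\<Sum>i\<in>UNIV. cnj ((emode (- l) x *s a (- l)) $ i) * b $ i)) * (1 / 2)
      = re_coord b (a l) (cnjv (a (- l))) * emode l x" for l
    by (simp add: re_coord_def cnjv_def emode_minus sum.distrib sum_distrib_left sum_distrib_right algebra_simps)
  ultimately show ?thesis by simp
qed

lemma hs_l1:
  fixes a :: "int ^ 'd \<Rightarrow> 'v::real_normed_vector"
  assumes "hs r a" "real CARD('d) \<le> r"
  shows "in_l1 a" "(\<Sum>\<^sub>\<infinity>k. norm (a k)) \<le> Kemb TYPE('d) * hn r a"
proof -
  have h: "hs (0 + real CARD('d)) a" "hn (0 + real CARD('d)) a \<le> hn r a" using hs_le[OF assms] by auto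
  show "in_l1 a" using l1_of_hs(1)[OF h(1)] by simp
  have "(\<Sum>\<^sub>\<infinity>k. norm (a k)) \<le> Kemb TYPE('d) * hn (0 + real CARD('d)) a" using l1_of_hs(2)[OF h(1)] by simp
  also have "\<dots> \<le> Kemb TYPE('d) * hn r a" by (intro mult_left_mono h(2)) simp
  finally show "(\<Sum>\<^sub>\<infinity>k. norm (a k)) \<le> Kemb TYPE('d) * hn r a" .
qed

text \<open>
  The product of an \<open>H\<^sup>t\<close> function with an \<open>H\<^sup>r\<close> function is in \<open>H\<^sup>r\<close>, for \<open>0 \<le> r \<le> t\<close> and \<open>t \<ge> 2 d\<close>:
  if \<open>r + d \<le> t\<close>, all \<open>r\<close> derivatives of the first factor have summable coefficients; otherwise
  \<open>r \<ge> d\<close>, and the derivatives fall on either factor while the other one has summable coefficients.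
\<close>

lemma Sobolev_product:
  fixes r t :: real
  assumes r: "0 \<le> r" "r \<le> t" and t: "2 * real CARD('d::finite) \<le> t"
  shows "\<exists>K\<ge>0. \<forall>(a :: int ^ 'd \<Rightarrow> complex ^ 'n) g b. hs t a \<longrightarrow> g \<in> CP \<longrightarrow> hs r (fourier_coeff g) \<longrightarrow> b \<in> Basis \<longrightarrow>
     hs r (fourier_coeff (\<lambda>x. (syn a x \<bullet> b) *\<^sub>R g x)) \<and>
     hn r (fourier_coeff (\<lambda>x. (syn a x \<bullet> b) *\<^sub>R g x)) \<le> K * hn t a * hn r (fourier_coeff (g :: real ^ 'd \<Rightarrow> complex ^ 'n))"
proof -
  let ?d = "real CARD('d)" and ?n = "real CARD('n)"
  define K where "K = 4 * (2 powr r * ?n) * Kemb TYPE('d)"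
  have K: "K \<ge> 0" by (simp add: K_def)
  have main: "hs r (fourier_coeff (\<lambda>x. (syn a x \<bullet> b) *\<^sub>R g x)) \<and>
     hn r (fourier_coeff (\<lambda>x. (syn a x \<bullet> b) *\<^sub>R g x)) \<le> K * hn t a * hn r (fourier_coeff g)"
    if a: "hs t a" and g: "g \<in> CP" "hs r (fourier_coeff g)" and b: "b \<in> Basis"
    for a :: "int ^ 'd \<Rightarrow> complex ^ 'n" and g :: "real ^ 'd \<Rightarrow> complex ^ 'n" and b
  proof -
    have al1: "in_l1 a" using hs_l1(1)[OF a] t by simp
    define \<alpha> where "\<alpha> l = norm (a l) + norm (a (- l))" for l
    define \<beta> where "\<beta> l = norm (fourier_coeff g l)" for l
    define z where "z = fourier_coeff (\<lambda>x. (syn a x \<bullet> b) *\<^sub>R g x)"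
    have \<alpha>0: "\<alpha> l \<ge> 0" and \<beta>0: "\<beta> l \<ge> 0" for l by (auto simp: \<alpha>_def \<beta>_def)
    have n0: "hs t (\<lambda>l. norm (a l))" using a by (simp add: hs_norm)
    have \<alpha>t: "hs t \<alpha>" "hn t \<alpha> \<le> 2 * hn t a"
      using hs_add[OF n0 hs_reflect(1)[OF n0]] hs_reflect(2)[OF n0] hn_norm[OF a] unfolding \<alpha>_def by auto
    have \<beta>r: "hs r \<beta>" "hn r \<beta> = hn r (fourier_coeff g)"
      using g(2) hn_norm[OF g(2)] unfolding \<beta>_def by (simp_all add: hs_norm)
    have re: "cmod (re_coord b (a l) (cnjv (a (- l)))) \<le> ?n * \<alpha> l" for l
      using norm_re_coord[of b "a l" "cnjv (a (- l))"] b by (simp add: \<alpha>_def)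
    have pl1: "in_l1 (\<lambda>l. re_coord b (a l) (cnjv (a (- l))))"
    proof (rule summable_on_comparison_test)
      show "(\<lambda>l. ?n * \<alpha> l) summable_on UNIV"
        using hs_l1(1)[OF \<alpha>t(1)] t \<alpha>0 by (intro summable_on_cmult_right) simp
    qed (use re in auto)
    have zk: "((\<lambda>l. re_coord b (a l) (cnjv (a (- l))) *s fourier_coeff g (k - l)) has_sum z k) UNIV" for k
      using fourier_coeff_product[OF pl1 inner_syn_has_sum[OF al1] g(1), of k] by (simp add: z_def vsmult_of_real)
    have zle: "norm (wt r k *\<^sub>R z k) \<le> S"
      if S: "(A has_sum S) UNIV" and A: "\<And>l. wt r k * (?n * (\<alpha> l * \<beta> (k - l))) \<le> A l" for k A S
    proof (rule norm_infsum_le[OF has_sum_scaleR[OF zk[of k], of "wt r k"] S])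
      fix l
      have "norm (re_coord b (a l) (cnjv (a (- l))) *s fourier_coeff g (k - l)) \<le> ?n * \<alpha> l * \<beta> (k - l)"
        unfolding norm_vector_smult \<beta>_def[symmetric] by (intro mult_right_mono re \<beta>0)
      then have "wt r k * norm (re_coord b (a l) (cnjv (a (- l))) *s fourier_coeff g (k - l)) \<le> wt r k * (?n * (\<alpha> l * \<beta> (k - l)))"
        by (intro mult_left_mono) (simp_all add: mult_ac)
      then show "norm (wt r k *\<^sub>R (re_coord b (a l) (cnjv (a (- l))) *s fourier_coeff g (k - l))) \<le> A l"
        using A[of l] by (simp only: norm_scaleR abs_of_nonneg[OF wt_nonneg])
    qed
    have enc: "norm (Abs_l2 (\<lambda>k. wt r k * \<gamma> k)) = hn r \<gamma>" "hs r \<gamma> \<Longrightarrow> in_l2 (\<lambda>k. wt r k * \<gamma> k)" for \<gamma> :: "int ^ 'd \<Rightarrow> real"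
      by (simp_all add: hn_def enc_def hs_def)
    have zhs: "hs r z \<longleftrightarrow> in_l2 (\<lambda>k. wt r k *\<^sub>R z k)" "hn r z = norm (Abs_l2 (\<lambda>k. wt r k *\<^sub>R z k))"
      by (simp_all add: hs_def hn_def enc_def)
    have "hs r z \<and> hn r z \<le> K * hn t a * hn r (fourier_coeff g)"
    proof (cases "r + ?d \<le> t")
      case True
      define C where "C = 2 * 2 powr r * ?n"
      have C: "C \<ge> 0" by (simp add: C_def)
      have \<alpha>r: "hs (r + ?d) \<alpha>" "hn (r + ?d) \<alpha> \<le> hn t \<alpha>" using hs_le[OF \<alpha>t(1) True] by auto
      have s1: "(\<lambda>l. wt r l * \<alpha> l) summable_on UNIV" "(\<Sum>\<^sub>\<infinity>l. wt r l * \<alpha> l) \<le> Kemb TYPE('d) * hn (r + ?d) \<alpha>"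
        using l1_of_hs[OF \<alpha>r(1)] \<alpha>0 by simp_all
      have p: "(\<lambda>l. C * (wt r l * \<alpha> l)) summable_on UNIV" by (intro summable_on_cmult_right s1)
      have est: "norm (wt r k *\<^sub>R z k) \<le> S" if "((\<lambda>l. C * (wt r l * \<alpha> l) * (wt r (k - l) * \<beta> (k - l))) has_sum S) UNIV" for k S
      proof (rule zle[OF that])
        fix l
        have "wt r k * (?n * (\<alpha> l * \<beta> (k - l))) \<le> (2 * 2 powr r * (wt r l * wt r (k - l))) * (?n * (\<alpha> l * \<beta> (k - l)))"
          by (intro mult_right_mono wt_quasi_submultiplicative r(1)) (simp add: \<alpha>0 \<beta>0)
        then show "wt r k * (?n * (\<alpha> l * \<beta> (k - l))) \<le> C * (wt r l * \<alpha> l) * (wt r (k - l) * \<beta> (k - l))"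
          by (simp add: C_def mult_ac)
      qed
      have Y: "in_l2 (\<lambda>k. wt r k *\<^sub>R z k)" "norm (Abs_l2 (\<lambda>k. wt r k *\<^sub>R z k)) \<le> (\<Sum>\<^sub>\<infinity>l. C * (wt r l * \<alpha> l)) * norm (Abs_l2 (\<lambda>k. wt r k * \<beta> k))"
        by (rule Young_l1_l2_dominated[OF p _ enc(2)[OF \<beta>r(1)] est]; simp add: C \<alpha>0)+
      have "(\<Sum>\<^sub>\<infinity>l. C * (wt r l * \<alpha> l)) = C * (\<Sum>\<^sub>\<infinity>l. wt r l * \<alpha> l)" by (rule infsum_cmult_right[OF s1(1)])
      also have "\<dots> \<le> C * (Kemb TYPE('d) * hn (r + ?d) \<alpha>)" by (intro mult_left_mono s1 C)
      also have "\<dots> \<le> C * (Kemb TYPE('d) * (2 * hn t a))"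
        using \<alpha>r(2) \<alpha>t(2) by (intro mult_left_mono C) auto
      also have "\<dots> = K * hn t a" by (simp add: C_def K_def)
      finally have "(\<Sum>\<^sub>\<infinity>l. C * (wt r l * \<alpha> l)) * hn r \<beta> \<le> K * hn t a * hn r \<beta>" by (intro mult_right_mono) auto
      then show ?thesis using Y unfolding zhs enc(1) \<beta>r(2) by linarith
    next
      case False
      then have rd: "?d \<le> r" using t by linarith
      define C where "C = 2 powr r * ?n"
      have C: "C \<ge> 0" by (simp add: C_def)
      have \<alpha>r: "hs r \<alpha>" "hn r \<alpha> \<le> hn t \<alpha>" using hs_le[OF \<alpha>t(1) r(2)] by auto
      have sa: "\<alpha> summable_on UNIV" "(\<Sum>\<^sub>\<infinity>l. \<alpha> l) \<le> Kemb TYPE('d) * hn r \<alpha>"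
        using hs_l1[OF \<alpha>r(1) rd] \<alpha>0 by simp_all
      have sb: "\<beta> summable_on UNIV" "(\<Sum>\<^sub>\<infinity>l. \<beta> l) \<le> Kemb TYPE('d) * hn r \<beta>"
        using hs_l1[OF \<beta>r(1) rd] \<beta>0 by simp_all
      have p: "(\<lambda>l. C * \<alpha> l) summable_on UNIV" by (intro summable_on_cmult_right sa)
      have q: "(\<lambda>l. C * \<beta> l) summable_on UNIV" by (intro summable_on_cmult_right sb)
      have est: "norm (wt r k *\<^sub>R z k) \<le> S"
        if "((\<lambda>l. wt r l * \<alpha> l * (C * \<beta> (k - l)) + C * \<alpha> l * (wt r (k - l) * \<beta> (k - l))) has_sum S) UNIV" for k S
      proof (rule zle[OF that])
        fix l
        have "wt r k * (?n * (\<alpha> l * \<beta> (k - l))) \<le> (2 powr r * (wt r l + wt r (k - l))) * (?n * (\<alpha> l * \<beta> (k - l)))"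
          by (intro mult_right_mono wt_quasi_triangle r(1)) (simp add: \<alpha>0 \<beta>0)
        then show "wt r k * (?n * (\<alpha> l * \<beta> (k - l))) \<le> wt r l * \<alpha> l * (C * \<beta> (k - l)) + C * \<alpha> l * (wt r (k - l) * \<beta> (k - l))"
          by (simp add: C_def algebra_simps)
      qed
      have Y: "in_l2 (\<lambda>k. wt r k *\<^sub>R z k)" "norm (Abs_l2 (\<lambda>k. wt r k *\<^sub>R z k)) \<le>
          norm (Abs_l2 (\<lambda>k. wt r k * \<alpha> k)) * (\<Sum>\<^sub>\<infinity>l. C * \<beta> l) + (\<Sum>\<^sub>\<infinity>l. C * \<alpha> l) * norm (Abs_l2 (\<lambda>k. wt r k * \<beta> k))"
        by (rule Young_l1_l2_symmetric[OF p _ q _ enc(2)[OF \<alpha>r(1)] enc(2)[OF \<beta>r(1)] est]; simp add: C \<alpha>0 \<beta>0)+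
      have "hn r \<alpha> * (\<Sum>\<^sub>\<infinity>l. C * \<beta> l) + (\<Sum>\<^sub>\<infinity>l. C * \<alpha> l) * hn r \<beta>
          = hn r \<alpha> * (C * (\<Sum>\<^sub>\<infinity>l. \<beta> l)) + (C * (\<Sum>\<^sub>\<infinity>l. \<alpha> l)) * hn r \<beta>"
        by (simp only: infsum_cmult_right[OF sa(1)] infsum_cmult_right[OF sb(1)])
      also have "\<dots> \<le> hn r \<alpha> * (C * (Kemb TYPE('d) * hn r \<beta>)) + (C * (Kemb TYPE('d) * hn r \<alpha>)) * hn r \<beta>"
        by (intro add_mono mult_left_mono mult_right_mono sa sb C) auto
      also have "\<dots> = 2 * C * Kemb TYPE('d) * hn r \<beta> * hn r \<alpha>" by simp
      also have "\<dots> \<le> 2 * C * Kemb TYPE('d) * hn r \<beta> * (2 * hn t a)"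
        using \<alpha>r(2) \<alpha>t(2) C by (intro mult_left_mono) auto
      also have "\<dots> = K * hn t a * hn r \<beta>" by (simp add: C_def K_def)
      finally show ?thesis using Y unfolding zhs enc(1) \<beta>r(2) by linarith
    qed
    then show ?thesis by (simp add: z_def)
  qed
  show ?thesis using K main by blast
qed

text \<open>The partial derivative on the Fourier side.\<close>

definition dpart :: "'d \<Rightarrow> (int ^ 'd \<Rightarrow> complex ^ 'n) \<Rightarrow> int ^ 'd \<Rightarrow> complex ^ 'n" where
  "dpart j a k = (\<i> * of_int (k $ j)) *s a k"

lemma abs_freq_le_jap: "\<bar>of_int (k $ j)\<bar> \<le> jap k"
  using component_le_norm_cart[of "freq k" j] norm_freq_le_jap[of k] by simp

lemma hs_dpart:
  assumes "hs r a"
  shows "hs (r - 1) (dpart j a)" "hn (r - 1) (dpart j a) \<le> hn r a"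
proof -
  have "norm (wt (r - 1) k *\<^sub>R dpart j a k) \<le> norm (1 *\<^sub>R (wt r k *\<^sub>R a k))" for k
  proof -
    have "wt (r - 1) k * (\<bar>of_int (k $ j)\<bar> * norm (a k)) \<le> wt (r - 1) k * (jap k * norm (a k))"
      by (intro mult_left_mono mult_right_mono abs_freq_le_jap) auto
    also have "\<dots> = wt r k * norm (a k)" using wt_add[of "r - 1" 1 k] by (simp add: wt_1)
    finally show ?thesis by (simp add: dpart_def norm_vector_smult norm_mult)
  qed
  from hs_mono[OF assms this] show "hs (r - 1) (dpart j a)" "hn (r - 1) (dpart j a) \<le> hn r a" by auto
qed

text \<open>\<open>\<langle>k\<rangle> \<le> 1 + \<Sum>\<^sub>j \<bar>k\<^sub>j\<bar>\<close>: this is how estimates of first derivatives are turned into a gain of one order.\<close>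

lemma hs_gain_derivative:
  fixes c :: "int ^ 'd \<Rightarrow> complex ^ 'n"
  assumes c: "hs r c" and dc: "\<And>j. hs r (dpart j c)"
  shows "hs (r + 1) c" "hn (r + 1) c \<le> hn r c + (\<Sum>j\<in>UNIV. hn r (dpart j c))"
proof -
  define e where "e k = norm (c k) + (\<Sum>j\<in>UNIV. norm (dpart j c k))" for k
  have 1: "hs r (\<lambda>k. \<Sum>j\<in>UNIV. norm (dpart j c k)) \<and> hn r (\<lambda>k. \<Sum>j\<in>UNIV. norm (dpart j c k)) \<le> (\<Sum>j\<in>UNIV. hn r (\<lambda>k. norm (dpart j c k)))"
    by (rule hs_sum) (use dc in \<open>auto simp: hs_norm\<close>)
  have 2: "hs r (\<lambda>k. norm (c k))" using c by (simp add: hs_norm)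
  have e: "hs r e" "hn r e \<le> hn r c + (\<Sum>j\<in>UNIV. hn r (dpart j c))"
    using hs_add[OF 2 conjunct1[OF 1]] 1 unfolding e_def by (auto simp: hn_norm c dc)
  have "norm (wt (r + 1) k *\<^sub>R c k) \<le> norm (1 *\<^sub>R (wt r k *\<^sub>R e k))" for k
  proof -
    have "norm (freq k) \<le> (\<Sum>j\<in>UNIV. \<bar>of_int (k $ j)\<bar>)" using norm_le_l1_cart[of "freq k"] by simp
    moreover have "jap k \<le> 1 + norm (freq k)" unfolding jap_def
      by (rule real_le_lsqrt) (auto simp: power2_eq_square algebra_simps)
    ultimately have "jap k * norm (c k) \<le> (1 + (\<Sum>j\<in>UNIV. \<bar>of_int (k $ j)\<bar>)) * norm (c k)"
      by (intro mult_right_mono) auto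
    also have "\<dots> = e k"
      by (simp add: e_def dpart_def norm_vector_smult norm_mult algebra_simps sum_distrib_right sum_distrib_left)
    finally have "wt r k * (jap k * norm (c k)) \<le> wt r k * e k" by (intro mult_left_mono) auto
    moreover have "e k \<ge> 0" unfolding e_def by (intro add_nonneg_nonneg sum_nonneg) auto
    ultimately show ?thesis by (simp add: wt_add wt_1 mult_ac)
  qed
  from hs_mono[OF e(1) this] e(2) show "hs (r + 1) c" "hn (r + 1) c \<le> hn r c + (\<Sum>j\<in>UNIV. hn r (dpart j c))" by auto
qed

lemma hs_Bessel:
  fixes g :: "real ^ 'd \<Rightarrow> complex ^ 'n"
  assumes g: "g \<in> CP" and B: "\<And>x. norm (g x) \<le> B"
  shows "hs 0 (fourier_coeff g)" "hn 0 (fourier_coeff g) \<le> B"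
proof -
  have B0: "B \<ge> 0" using order_trans[OF norm_ge_zero B] .
  have L: "L2_set (\<lambda>k. norm (fourier_coeff g k)) F \<le> B" if "finite F" for F
    unfolding L2_set_def using Bessel_inequality[OF g B that] B0 by (simp add: real_le_lsqrt sum_nonneg)
  then show h: "hs 0 (fourier_coeff g)" unfolding hs_def in_l2_def sqsum_iff_L2_set_bounded by auto
  show "hn 0 (fourier_coeff g) \<le> B" unfolding hn_def
    by (rule norm_l2_leI) (use L in \<open>simp add: coord_enc[OF h]\<close>)
qed

subsection \<open>Calculus of smooth maps\<close>

text \<open>The directional derivative \<open>D\<^sub>v G\<close> as a function of the point; smooth maps are closed under it.\<close>

definition dd :: "('a::real_normed_vector \<Rightarrow> 'b::real_normed_vector) \<Rightarrow> 'a \<Rightarrow> 'a \<Rightarrow> 'b" where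
  "dd G v = (\<lambda>z. frechet_derivative G (at z) v)"

lemma smooth_dd: "smooth G \<Longrightarrow> smooth (dd G v)"
  unfolding smooth_def dd_def by (metis Ck.simps(2))

lemma smooth_continuous: "smooth G \<Longrightarrow> continuous_on UNIV G"
  unfolding smooth_def by (metis Ck.simps(1))

lemma smooth_has_derivative: "smooth G \<Longrightarrow> (G has_derivative (\<lambda>v. dd G v z)) (at z)"
  unfolding smooth_def dd_def using Ck.simps(2) frechet_derivative_works by blast

lemma dd_expand:
  fixes G :: "'a::euclidean_space \<Rightarrow> 'b::real_normed_vector"
  assumes "smooth G"
  shows "dd G v z = (\<Sum>b\<in>Basis. (v \<bullet> b) *\<^sub>R dd G b z)"
proof -
  have l: "linear (\<lambda>v. dd G v z)" using has_derivative_linear[OF smooth_has_derivative[OF assms]] .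
  have "dd G (\<Sum>b\<in>Basis. (v \<bullet> b) *\<^sub>R b) z = (\<Sum>b\<in>Basis. (v \<bullet> b) *\<^sub>R dd G b z)"
    using linear_sum[OF l, of "\<lambda>b. (v \<bullet> b) *\<^sub>R b" Basis] linear_scale[OF l] by simp
  then show ?thesis by (simp add: euclidean_representation)
qed

lemma dd_bound:
  fixes G :: "'a::euclidean_space \<Rightarrow> 'b::real_normed_vector"
  assumes "smooth G"
  shows "norm (dd G v z) \<le> norm v * (\<Sum>b\<in>Basis. norm (dd G b z))"
  unfolding dd_expand[OF assms, of v z] sum_distrib_left
  by (rule sum_norm_le) (simp add: Basis_le_norm mult_right_mono)

lemma smooth_bounded_cball:
  fixes G :: "'a::euclidean_space \<Rightarrow> 'b::real_normed_vector"
  assumes "smooth G"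
  shows "\<exists>B\<ge>0. \<forall>z. norm z \<le> R \<longrightarrow> norm (G z) \<le> B"
proof -
  have "bounded (G ` cball 0 R)"
    by (intro compact_imp_bounded compact_continuous_image continuous_on_subset[OF smooth_continuous[OF assms]]) auto
  then obtain B where "\<forall>z\<in>cball 0 R. norm (G z) \<le> B" by (auto simp: bounded_iff)
  then show ?thesis by (intro exI[of _ "\<bar>B\<bar>"]) (auto simp: dist_norm intro: order_trans[OF _ abs_ge_self])
qed

lemma smooth_Lipschitz_cball:
  fixes G :: "'a::euclidean_space \<Rightarrow> 'b::real_normed_vector"
  assumes "smooth G" and B: "\<And>z. norm z \<le> R \<Longrightarrow> (\<Sum>b\<in>Basis. norm (dd G b z)) \<le> B" and z: "norm z \<le> R" "norm w \<le> R"
  shows "norm (G z - G w) \<le> B * norm (z - w)"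
proof (rule differentiable_bound[of "cball 0 R" G "\<lambda>z v. dd G v z"])
  show "(G has_derivative (\<lambda>v. dd G v x)) (at x within cball 0 R)" for x
    using smooth_has_derivative[OF assms(1), of x] by (rule has_derivative_at_withinI)
  show "onorm (\<lambda>v. dd G v x) \<le> B" if "x \<in> cball 0 R" for x
  proof (rule onorm_le)
    fix v :: 'a
    have "norm v * (\<Sum>b\<in>Basis. norm (dd G b x)) \<le> norm v * B" using B[of x] that by (intro mult_left_mono) auto
    then show "norm (dd G v x) \<le> B * norm v" using dd_bound[OF assms(1), of v x] by (simp add: mult.commute)
  qed
qed (use z in auto)

text \<open>Vanishing to order \<open>k\<close> at the origin, in the form that passes to directional derivatives.\<close>

fun vanishes :: "nat \<Rightarrow> ('a::real_normed_vector \<Rightarrow> 'b::real_normed_vector) \<Rightarrow> bool" where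
  "vanishes 0 G \<longleftrightarrow> True"
| "vanishes (Suc k) G \<longleftrightarrow> G 0 = 0 \<and> (\<forall>v. vanishes k (dd G v))"

lemma vanishes_bound:
  fixes G :: "'a::euclidean_space \<Rightarrow> 'b::real_normed_vector"
  assumes "smooth G" "vanishes k G"
  shows "\<exists>C\<ge>0. \<forall>z. norm z \<le> R \<longrightarrow> norm (G z) \<le> C * norm z ^ k"
  using assms
proof (induction k arbitrary: G)
  case 0
  then show ?case using smooth_bounded_cball[of G R] by simp
next
  case (Suc k)
  have "\<forall>b. \<exists>C\<ge>0. \<forall>z. norm z \<le> R \<longrightarrow> norm (dd G b z) \<le> C * norm z ^ k"
    using Suc.IH smooth_dd[OF Suc.prems(1)] Suc.prems(2) by simp
  then obtain C where C: "\<And>b. C b \<ge> 0" "\<And>b z. norm z \<le> R \<Longrightarrow> norm (dd G b z) \<le> C b * norm z ^ k" by metis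
  have "norm (G z) \<le> (\<Sum>b\<in>Basis. C b) * norm z ^ Suc k" if z: "norm z \<le> R" for z
  proof -
    have "norm (G z - G 0) \<le> ((\<Sum>b\<in>Basis. C b) * norm z ^ k) * norm (z - 0)"
    proof (rule smooth_Lipschitz_cball[OF Suc.prems(1), of "norm z"])
      fix y :: 'a assume y: "norm y \<le> norm z"
      have "(\<Sum>b\<in>Basis. norm (dd G b y)) \<le> (\<Sum>b\<in>Basis. C b * norm z ^ k)"
      proof (rule sum_mono)
        fix b :: 'a
        have "norm (dd G b y) \<le> C b * norm y ^ k" using C(2)[of y b] y z by simp
        also have "\<dots> \<le> C b * norm z ^ k" by (intro mult_left_mono power_mono y C) auto
        finally show "norm (dd G b y) \<le> C b * norm z ^ k" .
      qed
      then show "(\<Sum>b\<in>Basis. norm (dd G b y)) \<le> (\<Sum>b\<in>Basis. C b) * norm z ^ k" by (simp add: sum_distrib_right)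
    qed auto
    then show ?thesis using Suc.prems(2) by (simp add: mult_ac)
  qed
  then show ?case using C(1) by (intro exI[of _ "\<Sum>b\<in>Basis. C b"]) (auto intro: sum_nonneg)
qed

lemma has_partial_compose:
  fixes u :: "real ^ 'd \<Rightarrow> 'a::euclidean_space"
  assumes u: "has_partial u j u'" and G: "smooth G"
  shows "has_partial (\<lambda>x. G (u x)) j (\<lambda>x. \<Sum>b\<in>Basis. (u' x \<bullet> b) *\<^sub>R dd G b (u x))"
  unfolding has_partial_def
proof
  fix x
  have "((\<lambda>t. u (x + axis j t)) has_derivative (\<lambda>h. h *\<^sub>R u' x)) (at 0)"
    using u by (simp add: has_partial_def has_vector_derivative_def)
  from has_derivative_compose[OF this, of G "\<lambda>v. dd G v (u x)"]
  have "((\<lambda>t. G (u (x + axis j t))) has_derivative (\<lambda>h. dd G (h *\<^sub>R u' x) (u x))) (at 0)"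
    using smooth_has_derivative[OF G, of "u x"] by (simp add: axis_zero)
  moreover have "dd G (h *\<^sub>R u' x) (u x) = h *\<^sub>R (\<Sum>b\<in>Basis. (u' x \<bullet> b) *\<^sub>R dd G b (u x))" for h
    unfolding dd_expand[OF G, of "h *\<^sub>R u' x"] by (simp add: scaleR_sum_right)
  ultimately show "((\<lambda>t. G (u (x + axis j t))) has_vector_derivative (\<Sum>b\<in>Basis. (u' x \<bullet> b) *\<^sub>R dd G b (u x))) (at 0)"
    by (simp add: has_vector_derivative_def)
qed

subsection \<open>Composition with smooth maps\<close>

text \<open>The superposition operator \<open>u \<mapsto> G(u)\<close> on the Fourier side.\<close>

definition comp_coeff :: "(complex ^ 'n \<Rightarrow> complex ^ 'n) \<Rightarrow> (int ^ 'd \<Rightarrow> complex ^ 'n) \<Rightarrow> int ^ 'd \<Rightarrow> complex ^ 'n" where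
  "comp_coeff G a = fourier_coeff (\<lambda>x. G (syn a x))"

lemma hs_syn_CP: "hs s a \<Longrightarrow> real CARD('d) \<le> s \<Longrightarrow> syn (a :: int ^ 'd \<Rightarrow> complex ^ 'n) \<in> CP"
  by (intro syn_CP hs_l1(1))

lemma norm_syn_le_hn:
  fixes a :: "int ^ 'd \<Rightarrow> complex ^ 'n"
  assumes "hs s a" "real CARD('d) \<le> s"
  shows "norm (syn a x) \<le> Kemb TYPE('d) * hn s a"
  using norm_syn_le[OF hs_l1(1)[OF assms], of x] hs_l1(2)[OF assms] by linarith

lemma syn_dpart:
  fixes a :: "int ^ 'd \<Rightarrow> complex ^ 'n"
  assumes "hs s a" "real CARD('d) + 2 \<le> s"
  shows "in_l1 (dpart j a)" "has_partial (syn a) j (syn (dpart j a))"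
proof -
  have "hs (2 + real CARD('d)) a" using hs_le(1)[OF assms(1)] assms(2) by simp
  from l1_of_hs(1)[OF this] have "(\<lambda>k. (1 + (norm (freq k))\<^sup>2) * norm (a k)) summable_on UNIV" by (simp only: wt_2)
  from syn_has_partial[OF this, of j] show "in_l1 (dpart j a)" "has_partial (syn a) j (syn (dpart j a))"
    unfolding dpart_def[abs_def] by simp_all
qed

lemma smooth_syn_CP:
  fixes a :: "int ^ 'd \<Rightarrow> complex ^ 'n" and G :: "complex ^ 'n \<Rightarrow> complex ^ 'n"
  assumes "hs s a" "real CARD('d) \<le> s" "smooth G"
  shows "(\<lambda>x. G (syn a x)) \<in> CP"
  by (rule CP_compose[OF hs_syn_CP[OF assms(1,2)] smooth_continuous[OF assms(3)]])

lemma partial_inner_CP: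
  fixes a :: "int ^ 'd \<Rightarrow> complex ^ 'n" and g :: "real ^ 'd \<Rightarrow> complex ^ 'n"
  assumes "in_l1 a" "g \<in> CP"
  shows "(\<lambda>x. (syn a x \<bullet> b) *\<^sub>R g x) \<in> CP"
  by (intro CP_scaleR CP_inner syn_CP CP_const assms)

text \<open>The chain rule on the Fourier side.\<close>

lemma dpart_comp_coeff:
  fixes a :: "int ^ 'd \<Rightarrow> complex ^ 'n" and G :: "complex ^ 'n \<Rightarrow> complex ^ 'n"
  assumes a: "hs s a" "real CARD('d) + 2 \<le> s" and G: "smooth G"
  shows "dpart j (comp_coeff G a) k = (\<Sum>b\<in>Basis. fourier_coeff (\<lambda>x. (syn (dpart j a) x \<bullet> b) *\<^sub>R dd G b (syn a x)) k)"
proof -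
  have s: "real CARD('d) \<le> s" using a(2) by simp
  have CPb: "(\<lambda>x. (syn (dpart j a) x \<bullet> b) *\<^sub>R dd G b (syn a x)) \<in> CP" for b
    by (intro partial_inner_CP syn_dpart(1)[OF a] smooth_syn_CP[OF a(1) s] smooth_dd G)
  have "fourier_coeff (\<lambda>x. \<Sum>b\<in>Basis. (syn (dpart j a) x \<bullet> b) *\<^sub>R dd G b (syn a x)) k = (\<i> * of_int (k $ j)) *s comp_coeff G a k"
    unfolding comp_coeff_def
    by (rule fourier_coeff_partial[OF smooth_syn_CP[OF a(1) s G] CP_sum[OF CPb] has_partial_compose[OF syn_dpart(2)[OF a] G]])
  then show ?thesis
    unfolding dpart_def[of j "comp_coeff G a"] using fourier_coeff_sum[where k = k and A = Basis and u = "\<lambda>b x. (syn (dpart j a) x \<bullet> b) *\<^sub>R dd G b (syn a x)", OF CPb finite_Basis] by simp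
qed

text \<open>The first argument fixes the dimension of the torus, which does not show in the type of \<open>G\<close>.\<close>

definition comp_bound :: "'d::finite itself \<Rightarrow> real \<Rightarrow> real \<Rightarrow> real \<Rightarrow> nat \<Rightarrow> (complex ^ 'n \<Rightarrow> complex ^ 'n) \<Rightarrow> bool" where
  "comp_bound _ s M r k G \<longleftrightarrow> (\<exists>C\<ge>0. \<forall>a :: int ^ 'd \<Rightarrow> complex ^ 'n. hs s a \<longrightarrow> hn s a \<le> M \<longrightarrow>
     hs r (comp_coeff G a) \<and> hn r (comp_coeff G a) \<le> C * hn s a ^ k)"

definition lip_bound :: "'d::finite itself \<Rightarrow> real \<Rightarrow> real \<Rightarrow> real \<Rightarrow> (complex ^ 'n \<Rightarrow> complex ^ 'n) \<Rightarrow> bool" where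
  "lip_bound _ s M r G \<longleftrightarrow> (\<exists>C\<ge>0. \<forall>a a' :: int ^ 'd \<Rightarrow> complex ^ 'n. hs s a \<longrightarrow> hs s a' \<longrightarrow> hn s a \<le> M \<longrightarrow> hn s a' \<le> M \<longrightarrow>
     hs r (\<lambda>k. comp_coeff G a k - comp_coeff G a' k) \<and> hn r (\<lambda>k. comp_coeff G a k - comp_coeff G a' k) \<le> C * hn s (\<lambda>k. a k - a' k))"

lemma comp_bound_0:
  fixes G :: "complex ^ 'n \<Rightarrow> complex ^ 'n"
  assumes s: "real CARD('d::finite) \<le> s" and G: "smooth G" "vanishes k G"
  shows "comp_bound TYPE('d) s M 0 k G"
proof -
  let ?K = "Kemb TYPE('d)"
  obtain C where C: "C \<ge> 0" "\<And>z. norm z \<le> ?K * M \<Longrightarrow> norm (G z) \<le> C * norm z ^ k"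
    using vanishes_bound[OF G, of "?K * M"] by blast
  have "hs 0 (comp_coeff G a) \<and> hn 0 (comp_coeff G a) \<le> C * ?K ^ k * hn s a ^ k"
    if a: "hs s a" "hn s a \<le> M" for a :: "int ^ 'd \<Rightarrow> complex ^ 'n"
  proof -
    have "norm (G (syn a x)) \<le> C * ?K ^ k * hn s a ^ k" for x
    proof -
      have u: "norm (syn a x) \<le> ?K * hn s a" by (rule norm_syn_le_hn[OF a(1) s])
      also have "\<dots> \<le> ?K * M" by (intro mult_left_mono a) simp
      finally have "norm (G (syn a x)) \<le> C * norm (syn a x) ^ k" by (rule C(2))
      also have "\<dots> \<le> C * (?K * hn s a) ^ k" by (intro mult_left_mono power_mono u C) auto
      finally show ?thesis by (simp add: power_mult_distrib mult.assoc)
    qed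
    from hs_Bessel[OF smooth_syn_CP[OF a(1) s G(1)] this] show ?thesis unfolding comp_coeff_def by simp
  qed
  then show ?thesis unfolding comp_bound_def using C(1) by (intro exI[of _ "C * ?K ^ k"]) auto
qed

lemma comp_bound_mono:
  fixes G :: "complex ^ 'n \<Rightarrow> complex ^ 'n" and T :: "'d::finite itself"
  assumes "comp_bound T s M r k G" "r' \<le> r"
  shows "comp_bound T s M r' k G"
proof -
  obtain C where C: "C \<ge> 0" "\<And>a :: int ^ 'd \<Rightarrow> complex ^ 'n. hs s a \<Longrightarrow> hn s a \<le> M \<Longrightarrow> hs r (comp_coeff G a) \<and> hn r (comp_coeff G a) \<le> C * hn s a ^ k"
    using assms(1) unfolding comp_bound_def by blast
  have "hs r' (comp_coeff G a) \<and> hn r' (comp_coeff G a) \<le> C * hn s a ^ k" if "hs s a" "hn s a \<le> M" for a :: "int ^ 'd \<Rightarrow> complex ^ 'n"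
    using C(2)[OF that] hs_le[OF _ assms(2), of "comp_coeff G a"] by auto
  then show ?thesis unfolding comp_bound_def using C(1) by blast
qed

text \<open>By the chain rule the derivatives of \<open>G(u)\<close> are products of derivatives of \<open>u\<close>, which are in
  \<open>H\<^sup>s\<^sup>-\<^sup>1\<close>, with \<open>D\<^sub>b G(u)\<close>, which is in \<open>H\<^sup>r\<close> by induction. The induction runs over all smooth maps at once
  because \<open>G\<close> is replaced by its derivatives.\<close>

lemma comp_bound_step:
  fixes G :: "complex ^ 'n \<Rightarrow> complex ^ 'n"
  assumes s: "2 * real CARD('d::finite) + 2 \<le> s" and r: "0 \<le> r" "r \<le> s - 1" and M: "M \<ge> 0"
    and IH: "\<And>k (G :: complex ^ 'n \<Rightarrow> complex ^ 'n). smooth G \<Longrightarrow> vanishes k G \<Longrightarrow> comp_bound TYPE('d) s M r k G"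
    and G: "smooth G" "vanishes k G"
  shows "comp_bound TYPE('d) s M (r + 1) k G"
proof -
  have s': "real CARD('d) \<le> s" "real CARD('d) + 2 \<le> s" "2 * real CARD('d) \<le> s - 1" using s by auto
  \<comment> \<open>For \<open>k = 0\<close> also \<open>k' = 0\<close>; the factor that is missing in this case is bounded by \<open>1 + M\<close>.\<close>
  define k' where "k' = k - 1"
  have "vanishes k' (dd G b)" for b using G(2) by (cases k) (auto simp: k'_def)
  then have "\<forall>b. \<exists>C\<ge>0. \<forall>a :: int ^ 'd \<Rightarrow> complex ^ 'n. hs s a \<longrightarrow> hn s a \<le> M \<longrightarrow>
      hs r (comp_coeff (dd G b) a) \<and> hn r (comp_coeff (dd G b) a) \<le> C * hn s a ^ k'"
    using IH[OF smooth_dd[OF G(1)]] unfolding comp_bound_def by blast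
  then obtain C where C: "\<And>b. C b \<ge> 0" "\<And>b (a :: int ^ 'd \<Rightarrow> complex ^ 'n). hs s a \<Longrightarrow> hn s a \<le> M \<Longrightarrow>
      hs r (comp_coeff (dd G b) a) \<and> hn r (comp_coeff (dd G b) a) \<le> C b * hn s a ^ k'" by metis
  obtain C0 where C0: "C0 \<ge> 0" "\<And>a :: int ^ 'd \<Rightarrow> complex ^ 'n. hs s a \<Longrightarrow> hn s a \<le> M \<Longrightarrow>
      hs r (comp_coeff G a) \<and> hn r (comp_coeff G a) \<le> C0 * hn s a ^ k" using IH[OF G] unfolding comp_bound_def by blast
  obtain K where K: "K \<ge> 0" "\<And>(a :: int ^ 'd \<Rightarrow> complex ^ 'n) g b. hs (s - 1) a \<Longrightarrow> g \<in> CP \<Longrightarrow> hs r (fourier_coeff g) \<Longrightarrow> b \<in> Basis \<Longrightarrow>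
     hs r (fourier_coeff (\<lambda>x. (syn a x \<bullet> b) *\<^sub>R g x)) \<and>
     hn r (fourier_coeff (\<lambda>x. (syn a x \<bullet> b) *\<^sub>R g x)) \<le> K * hn (s - 1) a * hn r (fourier_coeff (g :: real ^ 'd \<Rightarrow> complex ^ 'n))"
    using Sobolev_product[OF r s'(3)] by blast
  define D where "D = (\<Sum>b\<in>(Basis :: (complex ^ 'n) set). K * (1 + M) * C b)"
  have D: "D \<ge> 0" unfolding D_def using K C M by (intro sum_nonneg mult_nonneg_nonneg) auto
  have "hs (r + 1) (comp_coeff G a) \<and> hn (r + 1) (comp_coeff G a) \<le> (C0 + real CARD('d) * D) * hn s a ^ k"
    if a: "hs s a" "hn s a \<le> M" for a :: "int ^ 'd \<Rightarrow> complex ^ 'n"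
  proof -
    have part: "hs r (dpart j (comp_coeff G a)) \<and> hn r (dpart j (comp_coeff G a)) \<le> D * hn s a ^ k" for j
    proof -
      let ?F = "\<lambda>b. fourier_coeff (\<lambda>x. (syn (dpart j a) x \<bullet> b) *\<^sub>R dd G b (syn a x))"
      have eq: "dpart j (comp_coeff G a) = (\<lambda>k. \<Sum>b\<in>Basis. ?F b k)"
        using dpart_comp_coeff[OF a(1) s'(2) G(1), of j] by (rule ext)
      have b: "hs r (?F b) \<and> hn r (?F b) \<le> K * (1 + M) * C b * hn s a ^ k" if "b \<in> Basis" for b
      proof -
        have h: "hs r (fourier_coeff (\<lambda>x. dd G b (syn a x)))" "hn r (fourier_coeff (\<lambda>x. dd G b (syn a x))) \<le> C b * hn s a ^ k'"
          using C(2)[OF a, of b] by (simp_all add: comp_coeff_def)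
        have 1: "hs r (?F b)" "hn r (?F b) \<le> K * hn (s - 1) (dpart j a) * hn r (fourier_coeff (\<lambda>x. dd G b (syn a x)))"
          using K(2)[OF hs_dpart(1)[OF a(1)] smooth_syn_CP[OF a(1) s'(1) smooth_dd[OF G(1)]] h(1) that] by auto
        have "K * hn (s - 1) (dpart j a) * hn r (fourier_coeff (\<lambda>x. dd G b (syn a x))) \<le> K * hn s a * (C b * hn s a ^ k')"
          by (intro mult_mono mult_left_mono hs_dpart(2)[OF a(1)] h K mult_nonneg_nonneg) auto
        also have "\<dots> = K * C b * (hn s a * hn s a ^ k')" by simp
        also have "\<dots> \<le> K * C b * ((1 + M) * hn s a ^ k)"
        proof (intro mult_left_mono mult_nonneg_nonneg K C)
          show "hn s a * hn s a ^ k' \<le> (1 + M) * hn s a ^ k"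
          proof (cases k)
            case 0
            then show ?thesis using a(2) by (simp add: k'_def)
          next
            case (Suc n)
            then have "hn s a * hn s a ^ k' = 1 * hn s a ^ k" by (simp add: k'_def)
            also have "\<dots> \<le> (1 + M) * hn s a ^ k" using M by (intro mult_right_mono) auto
            finally show ?thesis .
          qed
        qed
        also have "\<dots> = K * (1 + M) * C b * hn s a ^ k" by simp
        finally show ?thesis using 1 by linarith
      qed
      have "hs r (\<lambda>k. \<Sum>b\<in>Basis. ?F b k) \<and> hn r (\<lambda>k. \<Sum>b\<in>Basis. ?F b k) \<le> (\<Sum>b\<in>Basis. hn r (?F b))"
        by (rule hs_sum) (use b in auto)
      moreover have "(\<Sum>b\<in>Basis. hn r (?F b)) \<le> D * hn s a ^ k"
        unfolding D_def sum_distrib_right using b by (intro sum_mono) auto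
      ultimately show ?thesis unfolding eq by linarith
    qed
    have "(\<Sum>j\<in>(UNIV :: 'd set). hn r (dpart j (comp_coeff G a))) \<le> (\<Sum>j\<in>(UNIV :: 'd set). D * hn s a ^ k)"
      using part by (intro sum_mono) auto
    then have "(\<Sum>j\<in>(UNIV :: 'd set). hn r (dpart j (comp_coeff G a))) \<le> real CARD('d) * D * hn s a ^ k" by simp
    then show ?thesis
      using hs_gain_derivative[of r "comp_coeff G a"] part C0(2)[OF a] by (auto simp: algebra_simps)
  qed
  moreover have "C0 + real CARD('d) * D \<ge> 0" using C0 D by simp
  ultimately show ?thesis unfolding comp_bound_def by blast
qed

text \<open>
  Start from \<open>r = 0\<close> (Bessel's inequality), go to \<open>r = 1\<close>, descend to the fractional part of \<open>s\<close>, and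
  climb to \<open>s\<close> in unit steps: this treats real exponents without fractional derivatives.
\<close>

lemma climb_to_real_exponent:
  fixes P :: "real \<Rightarrow> bool"
  assumes P0: "P 0" and step: "\<And>r. 0 \<le> r \<Longrightarrow> r \<le> s - 1 \<Longrightarrow> P r \<Longrightarrow> P (r + 1)"
    and down: "\<And>r r'. P r \<Longrightarrow> r' \<le> r \<Longrightarrow> P r'" and s: "s \<ge> 1"
  shows "P s"
proof -
  define n where "n = nat \<lfloor>s\<rfloor>"
  define r0 where "r0 = s - real n"
  have n: "real n = of_int \<lfloor>s\<rfloor>" using s by (simp add: n_def)
  have "of_int \<lfloor>s\<rfloor> \<le> s \<and> s < of_int \<lfloor>s\<rfloor> + 1" using floor_correct[of s] by simp
  then have r0: "0 \<le> r0 \<and> r0 \<le> 1" unfolding r0_def n by linarith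
  have "P 1" using step[of 0] P0 s by simp
  then have "P r0" using r0 by (intro down[of 1 r0]) auto
  have "P (r0 + real i)" if "i \<le> n" for i
    using that
  proof (induction i)
    case 0
    then show ?case using \<open>P r0\<close> by simp
  next
    case (Suc i)
    then have "r0 + real i \<le> s - 1" by (simp add: r0_def)
    then have "P (r0 + real i + 1)" using Suc r0 by (intro step) auto
    then show ?case by (simp add: algebra_simps)
  qed
  from this[of n] show ?thesis by (simp add: r0_def)
qed

theorem composition_bound:
  fixes G :: "complex ^ 'n \<Rightarrow> complex ^ 'n"
  assumes s: "2 * real CARD('d::finite) + 2 \<le> s" and M: "M \<ge> 0" and G: "smooth G" "vanishes k G"
  shows "\<exists>C\<ge>0. \<forall>a :: int ^ 'd \<Rightarrow> complex ^ 'n. hs s a \<longrightarrow> hn s a \<le> M \<longrightarrow>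
     hs s (comp_coeff G a) \<and> hn s (comp_coeff G a) \<le> C * hn s a ^ k"
proof -
  define P where "P r \<longleftrightarrow> (\<forall>k (G :: complex ^ 'n \<Rightarrow> complex ^ 'n). smooth G \<longrightarrow> vanishes k G \<longrightarrow> comp_bound TYPE('d) s M r k G)" for r
  have "P s"
  proof (rule climb_to_real_exponent)
    show "P 0" unfolding P_def by (intro allI impI comp_bound_0) (use s in auto)
    show "P (r + 1)" if "0 \<le> r" "r \<le> s - 1" "P r" for r
      unfolding P_def using comp_bound_step[where 'd='d, OF s that(1,2) M] that(3) unfolding P_def by blast
    show "P r'" if "P r" "r' \<le> r" for r r'
      using that comp_bound_mono unfolding P_def by blast
    show "1 \<le> s" using s by simp
  qed
  then show ?thesis using G unfolding P_def comp_bound_def by blast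
qed

lemma lip_bound_0:
  fixes G :: "complex ^ 'n \<Rightarrow> complex ^ 'n"
  assumes s: "real CARD('d::finite) \<le> s" and G: "smooth G"
  shows "lip_bound TYPE('d) s M 0 G"
proof -
  let ?K = "Kemb TYPE('d)"
  have "\<forall>b. \<exists>B\<ge>0. \<forall>z. norm z \<le> ?K * M \<longrightarrow> norm (dd G b z) \<le> B"
    using smooth_bounded_cball[OF smooth_dd[OF G]] by blast
  then obtain B where B: "\<And>b. B b \<ge> 0" "\<And>b z. norm z \<le> ?K * M \<Longrightarrow> norm (dd G b z) \<le> B b" by metis
  define L where "L = (\<Sum>b\<in>Basis. B b)"
  have L: "L \<ge> 0" unfolding L_def by (intro sum_nonneg B)
  have "hs 0 (\<lambda>k. comp_coeff G a k - comp_coeff G a' k) \<and> hn 0 (\<lambda>k. comp_coeff G a k - comp_coeff G a' k) \<le> L * ?K * hn s (\<lambda>k. a k - a' k)"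
    if a: "hs s a" "hs s a'" "hn s a \<le> M" "hn s a' \<le> M" for a a' :: "int ^ 'd \<Rightarrow> complex ^ 'n"
  proof -
    have u: "norm (syn a x) \<le> ?K * M" if "hs s a" "hn s a \<le> M" for a :: "int ^ 'd \<Rightarrow> complex ^ 'n" and x
      using norm_syn_le_hn[OF that(1) s, of x] mult_left_mono[OF that(2), of ?K] by simp
    have "norm (G (syn a x) - G (syn a' x)) \<le> L * ?K * hn s (\<lambda>k. a k - a' k)" for x
    proof -
      have "norm (G (syn a x) - G (syn a' x)) \<le> L * norm (syn a x - syn a' x)"
        by (rule smooth_Lipschitz_cball[OF G, of "?K * M"]) (use u a B in \<open>auto simp: L_def intro: sum_mono\<close>)
      also have "syn a x - syn a' x = syn (\<lambda>k. a k - a' k) x"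
        by (rule syn_diff[symmetric]) (use a s hs_l1(1) in auto)
      also have "L * norm \<dots> \<le> L * (?K * hn s (\<lambda>k. a k - a' k))"
        by (intro mult_left_mono norm_syn_le_hn enc_diff(1) a s L)
      finally show ?thesis by simp
    qed
    from hs_Bessel[OF CP_diff[OF smooth_syn_CP[OF a(1) s G] smooth_syn_CP[OF a(2) s G]] this]
    show ?thesis
      unfolding comp_coeff_def by (simp add: fourier_coeff_diff[OF smooth_syn_CP[OF a(1) s G] smooth_syn_CP[OF a(2) s G], symmetric])
  qed
  moreover have "L * ?K \<ge> 0" using L by simp
  ultimately show ?thesis unfolding lip_bound_def by blast
qed

lemma lip_bound_mono:
  fixes G :: "complex ^ 'n \<Rightarrow> complex ^ 'n" and T :: "'d::finite itself"
  assumes "lip_bound T s M r G" "r' \<le> r"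
  shows "lip_bound T s M r' G"
proof -
  obtain C where C: "C \<ge> 0" "\<And>a a' :: int ^ 'd \<Rightarrow> complex ^ 'n. hs s a \<Longrightarrow> hs s a' \<Longrightarrow> hn s a \<le> M \<Longrightarrow> hn s a' \<le> M \<Longrightarrow>
     hs r (\<lambda>k. comp_coeff G a k - comp_coeff G a' k) \<and> hn r (\<lambda>k. comp_coeff G a k - comp_coeff G a' k) \<le> C * hn s (\<lambda>k. a k - a' k)"
    using assms(1) unfolding lip_bound_def by blast
  have "hs r' (\<lambda>k. comp_coeff G a k - comp_coeff G a' k) \<and> hn r' (\<lambda>k. comp_coeff G a k - comp_coeff G a' k) \<le> C * hn s (\<lambda>k. a k - a' k)"
    if "hs s a" "hs s a'" "hn s a \<le> M" "hn s a' \<le> M" for a a' :: "int ^ 'd \<Rightarrow> complex ^ 'n"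
    using C(2)[OF that] hs_le[OF _ assms(2), of "\<lambda>k. comp_coeff G a k - comp_coeff G a' k"] by auto
  then show ?thesis unfolding lip_bound_def using C(1) by blast
qed

lemma dpart_diff: "dpart j (\<lambda>k. a k - b k) = (\<lambda>k. dpart j a k - dpart j b k)"
  by (auto simp: dpart_def)

text \<open>The derivative of \<open>G(u) - G(v)\<close> is \<open>(\<partial>u) \<cdot> (G'(u) - G'(v)) + \<partial>(u - v) \<cdot> G'(v)\<close>: the induction hypothesis
  applies to the first term and the bound for \<open>G'(v)\<close> to the second one.\<close>

lemma lip_bound_step:
  fixes G :: "complex ^ 'n \<Rightarrow> complex ^ 'n"
  assumes s: "2 * real CARD('d::finite) + 2 \<le> s" and r: "0 \<le> r" "r \<le> s - 1" and M: "M \<ge> 0"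
    and IH: "\<And>G :: complex ^ 'n \<Rightarrow> complex ^ 'n. smooth G \<Longrightarrow> lip_bound TYPE('d) s M r G"
    and G: "smooth G"
  shows "lip_bound TYPE('d) s M (r + 1) G"
proof -
  have s': "real CARD('d) \<le> s" "real CARD('d) + 2 \<le> s" "2 * real CARD('d) \<le> s - 1" using s by auto
  have "\<forall>b. \<exists>C\<ge>0. \<forall>a :: int ^ 'd \<Rightarrow> complex ^ 'n. hs s a \<longrightarrow> hn s a \<le> M \<longrightarrow>
      hs s (comp_coeff (dd G b) a) \<and> hn s (comp_coeff (dd G b) a) \<le> C * hn s a ^ 0"
    using composition_bound[OF s M smooth_dd[OF G], of 0] by simp
  then obtain C1 where C1: "\<And>b. C1 b \<ge> 0" "\<And>b (a :: int ^ 'd \<Rightarrow> complex ^ 'n). hs s a \<Longrightarrow> hn s a \<le> M \<Longrightarrow>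
      hs s (comp_coeff (dd G b) a) \<and> hn s (comp_coeff (dd G b) a) \<le> C1 b" by (metis power_0 mult.right_neutral)
  define Q where "Q b C \<longleftrightarrow> C \<ge> 0 \<and> (\<forall>a a' :: int ^ 'd \<Rightarrow> complex ^ 'n. hs s a \<longrightarrow> hs s a' \<longrightarrow> hn s a \<le> M \<longrightarrow> hn s a' \<le> M \<longrightarrow>
     hs r (\<lambda>k. comp_coeff (dd G b) a k - comp_coeff (dd G b) a' k) \<and> hn r (\<lambda>k. comp_coeff (dd G b) a k - comp_coeff (dd G b) a' k) \<le> C * hn s (\<lambda>k. a k - a' k))" for b C
  have "\<forall>b. \<exists>C. Q b C"
    using IH[OF smooth_dd[OF G]] unfolding lip_bound_def Q_def by blast
  then obtain C where Q: "\<And>b. Q b (C b)" by metis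
  have C: "C b \<ge> 0" "hs s a \<Longrightarrow> hs s a' \<Longrightarrow> hn s a \<le> M \<Longrightarrow> hn s a' \<le> M \<Longrightarrow>
      hs r (\<lambda>k. comp_coeff (dd G b) a k - comp_coeff (dd G b) a' k) \<and> hn r (\<lambda>k. comp_coeff (dd G b) a k - comp_coeff (dd G b) a' k) \<le> C b * hn s (\<lambda>k. a k - a' k)"
    for b and a a' :: "int ^ 'd \<Rightarrow> complex ^ 'n"
    using Q[of b] unfolding Q_def by auto
  obtain C0 where C0: "C0 \<ge> 0" "\<And>a a' :: int ^ 'd \<Rightarrow> complex ^ 'n. hs s a \<Longrightarrow> hs s a' \<Longrightarrow> hn s a \<le> M \<Longrightarrow> hn s a' \<le> M \<Longrightarrow>
      hs r (\<lambda>k. comp_coeff G a k - comp_coeff G a' k) \<and> hn r (\<lambda>k. comp_coeff G a k - comp_coeff G a' k) \<le> C0 * hn s (\<lambda>k. a k - a' k)"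
    using IH[OF G] unfolding lip_bound_def by blast
  obtain K where K: "K \<ge> 0" "\<And>(a :: int ^ 'd \<Rightarrow> complex ^ 'n) g b. hs (s - 1) a \<Longrightarrow> g \<in> CP \<Longrightarrow> hs r (fourier_coeff g) \<Longrightarrow> b \<in> Basis \<Longrightarrow>
     hs r (fourier_coeff (\<lambda>x. (syn a x \<bullet> b) *\<^sub>R g x)) \<and>
     hn r (fourier_coeff (\<lambda>x. (syn a x \<bullet> b) *\<^sub>R g x)) \<le> K * hn (s - 1) a * hn r (fourier_coeff (g :: real ^ 'd \<Rightarrow> complex ^ 'n))"
    using Sobolev_product[OF r s'(3)] by blast
  define D where "D = (\<Sum>b\<in>(Basis :: (complex ^ 'n) set). K * (M * C b + C1 b))"
  have D: "D \<ge> 0" unfolding D_def using K C C1 M by (intro sum_nonneg mult_nonneg_nonneg add_nonneg_nonneg) auto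
  have "hs (r + 1) (\<lambda>k. comp_coeff G a k - comp_coeff G a' k) \<and> hn (r + 1) (\<lambda>k. comp_coeff G a k - comp_coeff G a' k) \<le> (C0 + real CARD('d) * D) * hn s (\<lambda>k. a k - a' k)"
    if a: "hs s a" "hs s a'" "hn s a \<le> M" "hn s a' \<le> M" for a a' :: "int ^ 'd \<Rightarrow> complex ^ 'n"
  proof -
    define \<delta> where "\<delta> k = a k - a' k" for k
    have \<delta>: "hs s \<delta>" unfolding \<delta>_def by (rule enc_diff(1)[OF a(1,2)])
    have part: "hs r (dpart j (\<lambda>k. comp_coeff G a k - comp_coeff G a' k)) \<and> hn r (dpart j (\<lambda>k. comp_coeff G a k - comp_coeff G a' k)) \<le> D * hn s \<delta>" for j
    proof -
      let ?X = "\<lambda>b x. (syn (dpart j a) x \<bullet> b) *\<^sub>R (dd G b (syn a x) - dd G b (syn a' x))"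
      let ?Y = "\<lambda>b x. (syn (dpart j \<delta>) x \<bullet> b) *\<^sub>R dd G b (syn a' x)"
      have ddCP: "(\<lambda>x. dd G b (syn a x)) \<in> CP" "(\<lambda>x. dd G b (syn a' x)) \<in> CP" for b
        by (intro smooth_syn_CP[OF _ s'(1)] a smooth_dd G)+
      note l1 = syn_dpart(1)[OF a(1) s'(2), of j] syn_dpart(1)[OF a(2) s'(2), of j] syn_dpart(1)[OF \<delta> s'(2), of j]
      have XY: "?X b \<in> CP" "?Y b \<in> CP" for b by (intro partial_inner_CP l1 CP_diff ddCP)+
      have orig: "(\<lambda>x. (syn (dpart j a) x \<bullet> b) *\<^sub>R dd G b (syn a x)) \<in> CP" "(\<lambda>x. (syn (dpart j a') x \<bullet> b) *\<^sub>R dd G b (syn a' x)) \<in> CP" for b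
        by (intro partial_inner_CP l1 ddCP)+
      have syn\<delta>: "syn (dpart j \<delta>) x = syn (dpart j a) x - syn (dpart j a') x" for x
        unfolding \<delta>_def[abs_def] dpart_diff by (rule syn_diff[OF l1(1,2)])
      have "dpart j (\<lambda>k. comp_coeff G a k - comp_coeff G a' k) k = (\<Sum>b\<in>Basis. fourier_coeff (?X b) k + fourier_coeff (?Y b) k)" for k
      proof -
        have "dpart j (\<lambda>k. comp_coeff G a k - comp_coeff G a' k) k = dpart j (comp_coeff G a) k - dpart j (comp_coeff G a') k" by (simp add: dpart_diff)
        also have "\<dots> = (\<Sum>b\<in>Basis. fourier_coeff (\<lambda>x. (syn (dpart j a) x \<bullet> b) *\<^sub>R dd G b (syn a x)) k
            - fourier_coeff (\<lambda>x. (syn (dpart j a') x \<bullet> b) *\<^sub>R dd G b (syn a' x)) k)"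
          by (simp add: dpart_comp_coeff[OF a(1) s'(2) G] dpart_comp_coeff[OF a(2) s'(2) G] sum_subtractf)
        also have "\<dots> = (\<Sum>b\<in>Basis. fourier_coeff (\<lambda>x. ?X b x + ?Y b x) k)"
          by (intro sum.cong refl) (simp add: fourier_coeff_diff[OF orig, symmetric] syn\<delta> inner_diff_left algebra_simps)
        finally show ?thesis by (simp add: fourier_coeff_add[OF XY])
      qed
      then have eq: "dpart j (\<lambda>k. comp_coeff G a k - comp_coeff G a' k) = (\<lambda>k. \<Sum>b\<in>Basis. fourier_coeff (?X b) k + fourier_coeff (?Y b) k)" by (rule ext)
      have b: "hs r (\<lambda>k. fourier_coeff (?X b) k + fourier_coeff (?Y b) k) \<and>
          hn r (\<lambda>k. fourier_coeff (?X b) k + fourier_coeff (?Y b) k) \<le> K * (M * C b + C1 b) * hn s \<delta>" if b: "b \<in> Basis" for b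
      proof -
        have hX: "hs r (fourier_coeff (\<lambda>x. dd G b (syn a x) - dd G b (syn a' x)))"
          "hn r (fourier_coeff (\<lambda>x. dd G b (syn a x) - dd G b (syn a' x))) \<le> C b * hn s \<delta>"
        proof -
          have "fourier_coeff (\<lambda>x. dd G b (syn a x) - dd G b (syn a' x)) = (\<lambda>k. comp_coeff (dd G b) a k - comp_coeff (dd G b) a' k)"
            by (rule ext) (simp add: comp_coeff_def fourier_coeff_diff[OF ddCP])
          then show "hs r (fourier_coeff (\<lambda>x. dd G b (syn a x) - dd G b (syn a' x)))"
            "hn r (fourier_coeff (\<lambda>x. dd G b (syn a x) - dd G b (syn a' x))) \<le> C b * hn s \<delta>"
            using C(2)[OF a, of b] by (simp_all add: \<delta>_def[abs_def])
        qed
        have hY: "hs r (fourier_coeff (\<lambda>x. dd G b (syn a' x)))" "hn r (fourier_coeff (\<lambda>x. dd G b (syn a' x))) \<le> C1 b"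
        proof -
          have "hs s (fourier_coeff (\<lambda>x. dd G b (syn a' x)))" "hn s (fourier_coeff (\<lambda>x. dd G b (syn a' x))) \<le> C1 b"
            using C1(2)[OF a(2,4), of b] by (simp_all add: comp_coeff_def)
          then show "hs r (fourier_coeff (\<lambda>x. dd G b (syn a' x)))" "hn r (fourier_coeff (\<lambda>x. dd G b (syn a' x))) \<le> C1 b"
            using hs_le[of s "fourier_coeff (\<lambda>x. dd G b (syn a' x))" r] r(2) by auto
        qed
        have X: "hs r (fourier_coeff (?X b))" "hn r (fourier_coeff (?X b)) \<le> K * hn (s - 1) (dpart j a) * hn r (fourier_coeff (\<lambda>x. dd G b (syn a x) - dd G b (syn a' x)))"
          using K(2)[OF hs_dpart(1)[OF a(1)] CP_diff[OF ddCP] hX(1) b] by auto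
        have Y: "hs r (fourier_coeff (?Y b))" "hn r (fourier_coeff (?Y b)) \<le> K * hn (s - 1) (dpart j \<delta>) * hn r (fourier_coeff (\<lambda>x. dd G b (syn a' x)))"
          using K(2)[OF hs_dpart(1)[OF \<delta>] ddCP(2) hY(1) b] by auto
        have "K * hn (s - 1) (dpart j a) * hn r (fourier_coeff (\<lambda>x. dd G b (syn a x) - dd G b (syn a' x))) \<le> K * M * (C b * hn s \<delta>)"
          using hs_dpart(2)[OF a(1), of j] a(3) M K(1) by (intro mult_mono mult_left_mono hX mult_nonneg_nonneg) auto
        moreover have "K * hn (s - 1) (dpart j \<delta>) * hn r (fourier_coeff (\<lambda>x. dd G b (syn a' x))) \<le> K * hn s \<delta> * C1 b"
          using K(1) by (intro mult_mono mult_left_mono hY hs_dpart(2)[OF \<delta>] mult_nonneg_nonneg) auto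
        moreover have "K * M * (C b * hn s \<delta>) + K * hn s \<delta> * C1 b = K * (M * C b + C1 b) * hn s \<delta>" by (simp add: algebra_simps)
        ultimately show ?thesis using hs_add[OF X(1) Y(1)] X(2) Y(2) by linarith
      qed
      have "hs r (\<lambda>k. \<Sum>b\<in>Basis. fourier_coeff (?X b) k + fourier_coeff (?Y b) k) \<and>
         hn r (\<lambda>k. \<Sum>b\<in>Basis. fourier_coeff (?X b) k + fourier_coeff (?Y b) k) \<le> (\<Sum>b\<in>Basis. hn r (\<lambda>k. fourier_coeff (?X b) k + fourier_coeff (?Y b) k))"
        by (rule hs_sum) (use b in auto)
      moreover have "(\<Sum>b\<in>Basis. hn r (\<lambda>k. fourier_coeff (?X b) k + fourier_coeff (?Y b) k)) \<le> D * hn s \<delta>"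
        unfolding D_def sum_distrib_right using b by (intro sum_mono) auto
      ultimately show ?thesis unfolding eq by linarith
    qed
    have "(\<Sum>j\<in>(UNIV :: 'd set). hn r (dpart j (\<lambda>k. comp_coeff G a k - comp_coeff G a' k))) \<le> (\<Sum>j\<in>(UNIV :: 'd set). D * hn s \<delta>)"
      using part by (intro sum_mono) auto
    then have "(\<Sum>j\<in>(UNIV :: 'd set). hn r (dpart j (\<lambda>k. comp_coeff G a k - comp_coeff G a' k))) \<le> real CARD('d) * D * hn s \<delta>" by simp
    then show ?thesis
      using hs_gain_derivative[of r "\<lambda>k. comp_coeff G a k - comp_coeff G a' k"] part C0(2)[OF a] by (auto simp: algebra_simps \<delta>_def[abs_def])
  qed
  moreover have "C0 + real CARD('d) * D \<ge> 0" using C0 D by simp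
  ultimately show ?thesis unfolding lip_bound_def by blast
qed

theorem composition_Lipschitz:
  fixes G :: "complex ^ 'n \<Rightarrow> complex ^ 'n"
  assumes s: "2 * real CARD('d::finite) + 2 \<le> s" and M: "M \<ge> 0" and G: "smooth G"
  shows "\<exists>C\<ge>0. \<forall>a a' :: int ^ 'd \<Rightarrow> complex ^ 'n. hs s a \<longrightarrow> hs s a' \<longrightarrow> hn s a \<le> M \<longrightarrow> hn s a' \<le> M \<longrightarrow>
     hs s (\<lambda>k. comp_coeff G a k - comp_coeff G a' k) \<and> hn s (\<lambda>k. comp_coeff G a k - comp_coeff G a' k) \<le> C * hn s (\<lambda>k. a k - a' k)"
proof -
  define P where "P r \<longleftrightarrow> (\<forall>G :: complex ^ 'n \<Rightarrow> complex ^ 'n. smooth G \<longrightarrow> lip_bound TYPE('d) s M r G)" for r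
  have "P s"
  proof (rule climb_to_real_exponent)
    show "P 0" unfolding P_def by (intro allI impI lip_bound_0) (use s in auto)
    show "P (r + 1)" if "0 \<le> r" "r \<le> s - 1" "P r" for r
      unfolding P_def using lip_bound_step[where 'd='d, OF s that(1,2) M] that(3) unfolding P_def by blast
    show "P r'" if "P r" "r' \<le> r" for r r'
      using that lip_bound_mono unfolding P_def by blast
    show "1 \<le> s" using s by simp
  qed
  then show ?thesis using G unfolding P_def lip_bound_def by blast
qed

section \<open>Second order Taylor expansion of the nonlinearity\<close>

lemma dd_line:
  assumes "smooth G"
  shows "((\<lambda>t. G (p + t *\<^sub>R v)) has_vector_derivative dd G v (p + t *\<^sub>R v)) (at t)"
proof -
  have "((\<lambda>t. p + t *\<^sub>R v) has_derivative (\<lambda>h. h *\<^sub>R v)) (at t)" by (auto intro!: derivative_eq_intros)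
  from has_derivative_compose[OF this smooth_has_derivative[OF assms]]
  have "((\<lambda>t. G (p + t *\<^sub>R v)) has_derivative (\<lambda>h. dd G (h *\<^sub>R v) (p + t *\<^sub>R v))) (at t)" .
  moreover have "dd G (h *\<^sub>R v) z = h *\<^sub>R dd G v z" for h z
    using linear_scale[OF has_derivative_linear[OF smooth_has_derivative[OF assms]]] .
  ultimately show ?thesis by (simp add: has_vector_derivative_def)
qed

text \<open>The mean value theorem, once in each of the two directions.\<close>

lemma second_difference_mean_value:
  fixes G :: "'a::real_normed_vector \<Rightarrow> 'b::real_inner"
  assumes G: "smooth G" and h: "h > 0"
  shows "\<exists>\<xi> \<eta>. 0 < \<xi> \<and> \<xi> < h \<and> 0 < \<eta> \<and> \<eta> < h \<and>
    (G (h *\<^sub>R v + h *\<^sub>R w) - G (h *\<^sub>R v) - G (h *\<^sub>R w) + G 0) \<bullet> b = h\<^sup>2 * (dd (dd G v) w (\<xi> *\<^sub>R v + \<eta> *\<^sub>R w) \<bullet> b)"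
proof -
  have D: "DERIV (\<lambda>t. H (p + t *\<^sub>R u) \<bullet> b) t :> dd H u (p + t *\<^sub>R u) \<bullet> b"
    if "smooth H" for H :: "'a \<Rightarrow> 'b" and p u t
    using bounded_linear.has_vector_derivative[OF bounded_linear_inner_left dd_line[OF that]]
    by (simp add: has_real_derivative_iff_has_vector_derivative)
  have "\<exists>\<xi>>0. \<xi> < h \<and> (G (h *\<^sub>R w + h *\<^sub>R v) \<bullet> b - G (0 + h *\<^sub>R v) \<bullet> b) - (G (h *\<^sub>R w + 0 *\<^sub>R v) \<bullet> b - G (0 + 0 *\<^sub>R v) \<bullet> b)
     = (h - 0) * (dd G v (h *\<^sub>R w + \<xi> *\<^sub>R v) \<bullet> b - dd G v (0 + \<xi> *\<^sub>R v) \<bullet> b)"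
    by (rule MVT2[OF h, where f = "\<lambda>t. G (h *\<^sub>R w + t *\<^sub>R v) \<bullet> b - G (0 + t *\<^sub>R v) \<bullet> b"]) (intro DERIV_diff D G)
  then obtain \<xi> where \<xi>: "0 < \<xi>" "\<xi> < h" and eq1: "(G (h *\<^sub>R w + h *\<^sub>R v) \<bullet> b - G (0 + h *\<^sub>R v) \<bullet> b) - (G (h *\<^sub>R w + 0 *\<^sub>R v) \<bullet> b - G (0 + 0 *\<^sub>R v) \<bullet> b)
     = (h - 0) * (dd G v (h *\<^sub>R w + \<xi> *\<^sub>R v) \<bullet> b - dd G v (0 + \<xi> *\<^sub>R v) \<bullet> b)" by blast
  have "\<exists>\<eta>>0. \<eta> < h \<and> dd G v (\<xi> *\<^sub>R v + h *\<^sub>R w) \<bullet> b - dd G v (\<xi> *\<^sub>R v + 0 *\<^sub>R w) \<bullet> b = (h - 0) * (dd (dd G v) w (\<xi> *\<^sub>R v + \<eta> *\<^sub>R w) \<bullet> b)"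
    by (rule MVT2[OF h]) (intro D smooth_dd G)
  then obtain \<eta> where \<eta>: "0 < \<eta>" "\<eta> < h" and eq2: "dd G v (\<xi> *\<^sub>R v + h *\<^sub>R w) \<bullet> b - dd G v (\<xi> *\<^sub>R v + 0 *\<^sub>R w) \<bullet> b = (h - 0) * (dd (dd G v) w (\<xi> *\<^sub>R v + \<eta> *\<^sub>R w) \<bullet> b)" by blast
  have "(G (h *\<^sub>R v + h *\<^sub>R w) - G (h *\<^sub>R v) - G (h *\<^sub>R w) + G 0) \<bullet> b = h * (dd G v (\<xi> *\<^sub>R v + h *\<^sub>R w) \<bullet> b - dd G v (\<xi> *\<^sub>R v) \<bullet> b)"
    using eq1 by (simp add: inner_diff_left inner_add_left add.commute)
  also have "\<dots> = h\<^sup>2 * (dd (dd G v) w (\<xi> *\<^sub>R v + \<eta> *\<^sub>R w) \<bullet> b)"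
    using eq2 by (simp add: power2_eq_square)
  finally show ?thesis using \<xi> \<eta> by blast
qed

text \<open>The second difference quotient is symmetric in the two directions, and it converges to the mixed
  derivative by the mean value theorem and continuity.\<close>

lemma second_derivative_symmetric:
  fixes G :: "'a::real_normed_vector \<Rightarrow> 'b::euclidean_space"
  assumes G: "smooth G"
  shows "dd (dd G v) w 0 = dd (dd G w) v 0"
proof (rule euclidean_eqI)
  fix b :: 'b assume "b \<in> Basis"
  define \<Delta> where "\<Delta> h = (G (h *\<^sub>R v + h *\<^sub>R w) - G (h *\<^sub>R v) - G (h *\<^sub>R w) + G 0) \<bullet> b / h\<^sup>2" for h
  have lim: "(\<lambda>n. (G (inverse (real (Suc n)) *\<^sub>R v + inverse (real (Suc n)) *\<^sub>R w) - G (inverse (real (Suc n)) *\<^sub>R v)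
      - G (inverse (real (Suc n)) *\<^sub>R w) + G 0) \<bullet> b / (inverse (real (Suc n)))\<^sup>2) \<longlonglongrightarrow> dd (dd G v) w 0 \<bullet> b" for v w
  proof -
    have "\<forall>n. \<exists>\<xi> \<eta>. 0 < \<xi> \<and> \<xi> < inverse (real (Suc n)) \<and> 0 < \<eta> \<and> \<eta> < inverse (real (Suc n)) \<and>
      (G (inverse (real (Suc n)) *\<^sub>R v + inverse (real (Suc n)) *\<^sub>R w) - G (inverse (real (Suc n)) *\<^sub>R v)
      - G (inverse (real (Suc n)) *\<^sub>R w) + G 0) \<bullet> b = (inverse (real (Suc n)))\<^sup>2 * (dd (dd G v) w (\<xi> *\<^sub>R v + \<eta> *\<^sub>R w) \<bullet> b)"
      using second_difference_mean_value[OF G] by simp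
    then obtain \<xi> \<eta> where \<xi>: "\<And>n. 0 < \<xi> n" "\<And>n. \<xi> n < inverse (real (Suc n))" and \<eta>: "\<And>n. 0 < \<eta> n" "\<And>n. \<eta> n < inverse (real (Suc n))"
      and eq: "\<And>n. (G (inverse (real (Suc n)) *\<^sub>R v + inverse (real (Suc n)) *\<^sub>R w) - G (inverse (real (Suc n)) *\<^sub>R v)
      - G (inverse (real (Suc n)) *\<^sub>R w) + G 0) \<bullet> b = (inverse (real (Suc n)))\<^sup>2 * (dd (dd G v) w (\<xi> n *\<^sub>R v + \<eta> n *\<^sub>R w) \<bullet> b)"
      by metis
    have sq: "r \<longlonglongrightarrow> 0" if "\<And>n. 0 < r n" "\<And>n. r n < inverse (real (Suc n))" for r :: "nat \<Rightarrow> real"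
      by (rule tendsto_sandwich[OF _ _ tendsto_const LIMSEQ_inverse_real_of_nat]) (use that in \<open>auto intro!: always_eventually less_imp_le\<close>)
    have "(\<lambda>n. \<xi> n *\<^sub>R v + \<eta> n *\<^sub>R w) \<longlonglongrightarrow> 0 *\<^sub>R v + 0 *\<^sub>R w"
      by (intro tendsto_intros sq \<xi> \<eta>)
    then have l: "(\<lambda>n. \<xi> n *\<^sub>R v + \<eta> n *\<^sub>R w) \<longlonglongrightarrow> 0" by simp
    have "continuous_on UNIV (dd (dd G v) w)" by (intro smooth_continuous smooth_dd G)
    from continuous_on_tendsto_compose[OF this l]
    have "(\<lambda>n. dd (dd G v) w (\<xi> n *\<^sub>R v + \<eta> n *\<^sub>R w)) \<longlonglongrightarrow> dd (dd G v) w 0" by simp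
    then have "(\<lambda>n. dd (dd G v) w (\<xi> n *\<^sub>R v + \<eta> n *\<^sub>R w) \<bullet> b) \<longlonglongrightarrow> dd (dd G v) w 0 \<bullet> b"
      by (intro tendsto_intros)
    then show ?thesis unfolding eq by simp
  qed
  have "(\<lambda>n. (G (inverse (real (Suc n)) *\<^sub>R v + inverse (real (Suc n)) *\<^sub>R w) - G (inverse (real (Suc n)) *\<^sub>R v)
      - G (inverse (real (Suc n)) *\<^sub>R w) + G 0) \<bullet> b / (inverse (real (Suc n)))\<^sup>2) \<longlonglongrightarrow> dd (dd G w) v 0 \<bullet> b"
  proof -
    have sw: "G (h *\<^sub>R w + h *\<^sub>R v) - G (h *\<^sub>R w) - G (h *\<^sub>R v) + G 0 = G (h *\<^sub>R v + h *\<^sub>R w) - G (h *\<^sub>R v) - G (h *\<^sub>R w) + G 0" for h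
      by (simp add: add.commute)
    show ?thesis using lim[of w v] unfolding sw .
  qed
  then show "dd (dd G v) w 0 \<bullet> b = dd (dd G w) v 0 \<bullet> b"
    using LIMSEQ_unique[OF lim[of v w]] by simp
qed

lemma dd_eqI: "(G has_derivative D) (at z) \<Longrightarrow> dd G v z = D v"
  unfolding dd_def using frechet_derivative_at by metis

lemma Ck_const: "Ck k (\<lambda>x. c)"
proof (induction k arbitrary: c)
  case (Suc k)
  have "(\<lambda>x. frechet_derivative (\<lambda>x. c) (at x) v) = (\<lambda>x. 0)" for v by auto
  then show ?case using Suc by simp
qed simp

lemma Ck_linear:
  assumes "bounded_linear L"
  shows "Ck k L"
proof (cases k)
  case 0
  then show ?thesis using assms by (simp add: linear_continuous_on)
next
  case (Suc n)
  have d: "(L has_derivative L) (at x)" for x by (rule bounded_linear_imp_has_derivative[OF assms])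
  have "(\<lambda>x. frechet_derivative L (at x) v) = (\<lambda>x. L v)" for v using frechet_derivative_at[OF d] by metis
  then show ?thesis using d Suc by (auto simp: Ck_const differentiable_def)
qed

lemma Ck_diff: "Ck k f \<Longrightarrow> Ck k g \<Longrightarrow> Ck k (\<lambda>x. f x - g x)"
proof (induction k arbitrary: f g)
  case 0
  then show ?case by (simp add: continuous_on_diff)
next
  case (Suc k)
  have d: "((\<lambda>x. f x - g x) has_derivative (\<lambda>v. frechet_derivative f (at x) v - frechet_derivative g (at x) v)) (at x)" for x
    using Suc.prems by (intro has_derivative_diff) (auto simp: frechet_derivative_works[symmetric])
  have eq: "(\<lambda>x. frechet_derivative (\<lambda>x. f x - g x) (at x) v) = (\<lambda>x. frechet_derivative f (at x) v - frechet_derivative g (at x) v)" for v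
    using frechet_derivative_at[OF d] by metis
  have "(\<lambda>x. f x - g x) differentiable (at x)" for x using d by (auto simp: differentiable_def)
  then show ?case using Suc.IH Suc.prems by (simp add: eq)
qed

lemma Ck_linear_comp:
  assumes L: "bounded_linear L"
  shows "Ck k f \<Longrightarrow> Ck k (\<lambda>x. L (f x))"
proof (induction k arbitrary: f)
  case 0
  then show ?case by (simp add: bounded_linear.continuous_on[OF L])
next
  case (Suc k)
  have d: "((\<lambda>x. L (f x)) has_derivative (\<lambda>v. L (frechet_derivative f (at x) v))) (at x)" for x
    using Suc.prems by (intro bounded_linear.has_derivative[OF L]) (auto simp: frechet_derivative_works[symmetric])
  have "(\<lambda>x. frechet_derivative (\<lambda>x. L (f x)) (at x) v) = (\<lambda>x. L (frechet_derivative f (at x) v))" for v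
    using frechet_derivative_at[OF d] by metis
  then show ?case using Suc d by (auto simp: differentiable_def)
qed

lemma quadratic_dd:
  assumes "bounded_bilinear B"
  shows "((\<lambda>z. B z z) has_derivative (\<lambda>v. B z v + B v z)) (at z)"
  using bounded_bilinear.FDERIV[OF assms has_derivative_ident has_derivative_ident] .

lemma smooth_quadratic:
  assumes B: "bounded_bilinear B"
  shows "smooth (\<lambda>z. B z z)"
  unfolding smooth_def
proof
  fix k
  show "Ck k (\<lambda>z. B z z)"
  proof (cases k)
    case 0
    then show ?thesis by (simp add: bounded_bilinear.continuous_on[OF B] continuous_on_id)
  next
    case (Suc n)
    have "(\<lambda>x. frechet_derivative (\<lambda>z. B z z) (at x) v) = (\<lambda>x. B x v + B v x)" for v
      using frechet_derivative_at[OF quadratic_dd[OF B]] by metis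
    moreover have "bounded_linear (\<lambda>x. B x v + B v x)" for v
      by (intro bounded_linear_add bounded_bilinear.bounded_linear_left[OF B] bounded_bilinear.bounded_linear_right[OF B])
    ultimately show ?thesis
      using Suc quadratic_dd[OF B] by (auto simp: differentiable_def Ck_linear)
  qed
qed

lemma smooth_diff: "smooth f \<Longrightarrow> smooth g \<Longrightarrow> smooth (\<lambda>x. f x - g x)"
  by (simp add: smooth_def Ck_diff)

lemma smooth_linear_comp: "bounded_linear L \<Longrightarrow> smooth f \<Longrightarrow> smooth (\<lambda>x. L (f x))"
  by (simp add: smooth_def Ck_linear_comp)

text \<open>Half of the second derivative at the origin, so that \<open>hess G z z\<close> is the quadratic Taylor polynomial.
  The expansion in a basis makes it bilinear by construction.\<close>

definition hess :: "('a::euclidean_space \<Rightarrow> 'b::real_normed_vector) \<Rightarrow> 'a \<Rightarrow> 'a \<Rightarrow> 'b" where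
  "hess G v w = (\<Sum>b\<in>Basis. \<Sum>b'\<in>Basis. ((v \<bullet> b) * (w \<bullet> b')) *\<^sub>R (1 / 2) *\<^sub>R dd (dd G b) b' 0)"

lemma hess_eq:
  fixes G :: "'a::euclidean_space \<Rightarrow> 'b::euclidean_space"
  assumes "smooth G"
  shows "hess G v w = (1 / 2) *\<^sub>R dd (dd G v) w 0"
proof -
  have "dd (dd G v) w 0 = (\<Sum>b'\<in>Basis. (w \<bullet> b') *\<^sub>R dd (dd G b') v 0)"
    unfolding dd_expand[OF smooth_dd[OF assms], of v w 0] by (simp add: second_derivative_symmetric[OF assms, of v])
  also have "\<dots> = (\<Sum>b'\<in>Basis. (w \<bullet> b') *\<^sub>R (\<Sum>b\<in>Basis. (v \<bullet> b) *\<^sub>R dd (dd G b) b' 0))"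
    by (intro sum.cong refl arg_cong2[where f = scaleR])
      (simp add: dd_expand[OF smooth_dd[OF assms], of _ v 0] second_derivative_symmetric[OF assms, of _ "_ :: 'a"])
  also have "\<dots> = (\<Sum>b\<in>Basis. \<Sum>b'\<in>Basis. ((v \<bullet> b) * (w \<bullet> b')) *\<^sub>R dd (dd G b) b' 0)"
    unfolding scaleR_sum_right by (subst sum.swap) (simp add: mult.commute)
  finally show ?thesis by (simp add: hess_def scaleR_sum_right mult.commute)
qed

lemma bounded_bilinear_hess:
  fixes G :: "'a::euclidean_space \<Rightarrow> 'b::euclidean_space"
  shows "bounded_bilinear (hess G)"
proof
  show "\<exists>K. \<forall>v w. norm (hess G v w) \<le> norm v * norm w * K"
  proof (intro exI allI)
    fix v w
    have "norm (hess G v w) \<le> (\<Sum>b\<in>Basis. \<Sum>b'\<in>Basis. norm v * norm w * norm ((1 / 2) *\<^sub>R dd (dd G b) b' 0))"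
      unfolding hess_def
    proof (intro sum_norm_le)
      fix b b' :: 'a assume "b \<in> Basis" "b' \<in> Basis"
      then have "\<bar>v \<bullet> b\<bar> * \<bar>w \<bullet> b'\<bar> \<le> norm v * norm w" by (intro mult_mono Basis_le_norm) auto
      then have "\<bar>(v \<bullet> b) * (w \<bullet> b')\<bar> * norm ((1 / 2) *\<^sub>R dd (dd G b) b' 0) \<le> norm v * norm w * norm ((1 / 2) *\<^sub>R dd (dd G b) b' 0)"
        by (intro mult_right_mono) (auto simp: abs_mult)
      then show "norm (((v \<bullet> b) * (w \<bullet> b')) *\<^sub>R (1 / 2) *\<^sub>R dd (dd G b) b' 0) \<le> norm v * norm w * norm ((1 / 2) *\<^sub>R dd (dd G b) b' 0)"
        by (simp only: norm_scaleR)
    qed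
    then show "norm (hess G v w) \<le> norm v * norm w * (\<Sum>b\<in>Basis. \<Sum>b'\<in>Basis. norm ((1 / 2) *\<^sub>R dd (dd G b) b' 0))"
      by (simp only: sum_distrib_left)
  qed
qed (simp_all add: hess_def inner_add_left algebra_simps sum.distrib scaleR_sum_right)

lemma Taylor_remainder_vanishes:
  fixes G :: "'a::euclidean_space \<Rightarrow> 'b::euclidean_space"
  assumes G: "smooth G" and unit_gen: "G 0 = 0" "\<And>v. dd G v 0 = 0"
  shows "smooth (\<lambda>z. G z - hess G z z)" "vanishes 3 (\<lambda>z. G z - hess G z z)"
proof -
  note B = bounded_bilinear_hess[of G]
  show "smooth (\<lambda>z. G z - hess G z z)" by (intro smooth_diff G smooth_quadratic B)
  have d1: "dd (\<lambda>z. G z - hess G z z) v = (\<lambda>z. dd G v z - (hess G z v + hess G v z))" for v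
    by (rule ext, rule dd_eqI) (intro has_derivative_diff smooth_has_derivative G quadratic_dd B)
  have d2: "dd (\<lambda>z. dd G v z - (hess G z v + hess G v z)) w z = dd (dd G v) w z - (hess G w v + hess G v w)" for v w z
    by (rule dd_eqI)
      (intro has_derivative_diff has_derivative_add smooth_has_derivative smooth_dd G bounded_linear_imp_has_derivative
        bounded_bilinear.bounded_linear_left[OF B] bounded_bilinear.bounded_linear_right[OF B])
  have z: "hess G 0 v = 0" "hess G v 0 = 0" for v
    using bounded_bilinear.zero_left[OF B] bounded_bilinear.zero_right[OF B] by auto
  have sym: "hess G w v + hess G v w = dd (dd G v) w 0" for v w
    unfolding hess_eq[OF G] second_derivative_symmetric[OF G, of w v] by (simp add: scaleR_add_left[symmetric])
  show "vanishes 3 (\<lambda>z. G z - hess G z z)"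
    unfolding numeral_3_eq_3 vanishes.simps d1 d2 by (simp add: z unit_gen sym)
qed

lemma vanishes_2:
  fixes G :: "'a::real_normed_vector \<Rightarrow> 'b::real_normed_vector"
  assumes "G 0 = 0" "\<And>v. dd G v 0 = 0"
  shows "vanishes 2 G"
  by (simp add: numeral_2_eq_2 assms)

subsection \<open>The quadratic part on the Fourier side\<close>

text \<open>A real-bilinear expression in \<open>u\<close> involves \<open>u\<close> and its complex conjugate, and hence at
  frequency \<open>l\<close> the pair of \<open>a\<^sub>l\<close> and the conjugate of \<open>a\<^sub>-\<^sub>l\<close>.\<close>

definition mode_pair :: "(int ^ 'd \<Rightarrow> complex ^ 'n) \<Rightarrow> int ^ 'd \<Rightarrow> (complex ^ 'n) \<times> (complex ^ 'n)" where
  "mode_pair a l = (a l, cnjv (a (- l)))"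

text \<open>The coefficient of the real function \<open>u \<bullet> b\<close>, as a function of the pair of modes.\<close>

definition rc :: "complex ^ 'n \<Rightarrow> (complex ^ 'n) \<times> (complex ^ 'n) \<Rightarrow> complex" where
  "rc b w = re_coord b (fst w) (snd w)"

definition quad :: "(complex ^ 'n \<Rightarrow> complex ^ 'n) \<Rightarrow> (complex ^ 'n) \<times> (complex ^ 'n) \<Rightarrow> (complex ^ 'n) \<times> (complex ^ 'n) \<Rightarrow> complex ^ 'n" where
  "quad G w w' = (\<Sum>b\<in>Basis. \<Sum>b'\<in>Basis. (rc b w * rc b' w') *s ((1 / 2) *\<^sub>R dd (dd G b) b' 0))"

lemma rc_linear: "rc b (w + w') = rc b w + rc b w'" "rc b (r *\<^sub>R w) = of_real r * rc b w"
  by (simp_all add: rc_def re_coord_def sum.distrib algebra_simps sum_distrib_left scaleR_conv_of_real[where 'a=complex] add_divide_distrib)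

lemma norm_rc_le: "cmod (rc b w) \<le> 2 * real CARD('n) * norm b * norm w" for b :: "complex ^ 'n"
proof -
  have "norm (fst w) + norm (snd w) \<le> 2 * norm w" using norm_fst_le[of "fst w" "snd w"] norm_snd_le[of "snd w" "fst w"] by simp
  then have "real CARD('n) * norm b * (norm (fst w) + norm (snd w)) \<le> real CARD('n) * norm b * (2 * norm w)"
    by (intro mult_left_mono) auto
  then show ?thesis using norm_re_coord[of b "fst w" "snd w"] unfolding rc_def by linarith
qed

lemma bounded_bilinear_quad:
  fixes G :: "complex ^ 'n \<Rightarrow> complex ^ 'n"
  shows "bounded_bilinear (quad G)"
proof
  show "\<exists>K. \<forall>v w. norm (quad G v w) \<le> norm v * norm w * K"
  proof (intro exI allI)
    fix v w
    have "norm (quad G v w) \<le> (\<Sum>b\<in>(Basis :: (complex ^ 'n) set). \<Sum>b'\<in>Basis. norm v * norm w * ((2 * real CARD('n)) * (2 * real CARD('n)) * norm ((1 / 2) *\<^sub>R dd (dd G b) b' 0)))"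
      unfolding quad_def
    proof (intro sum_norm_le)
      fix b b' :: "complex ^ 'n" assume b: "b \<in> Basis" "b' \<in> Basis"
      have "cmod (rc b v) * cmod (rc b' w) \<le> (2 * real CARD('n) * norm v) * (2 * real CARD('n) * norm w)"
        using norm_rc_le[of b v] norm_rc_le[of b' w] b by (intro mult_mono) auto
      then have "cmod (rc b v * rc b' w) * norm ((1 / 2) *\<^sub>R dd (dd G b) b' 0) \<le> (2 * real CARD('n) * norm v) * (2 * real CARD('n) * norm w) * norm ((1 / 2) *\<^sub>R dd (dd G b) b' 0)"
        by (intro mult_right_mono) (auto simp: norm_mult)
      then show "norm ((rc b v * rc b' w) *s ((1 / 2) *\<^sub>R dd (dd G b) b' 0)) \<le> norm v * norm w * ((2 * real CARD('n)) * (2 * real CARD('n)) * norm ((1 / 2) *\<^sub>R dd (dd G b) b' 0))"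
        unfolding norm_vector_smult by (simp only: mult_ac)
    qed
    then show "norm (quad G v w) \<le> norm v * norm w * (\<Sum>b\<in>(Basis :: (complex ^ 'n) set). \<Sum>b'\<in>Basis. (2 * real CARD('n)) * (2 * real CARD('n)) * norm ((1 / 2) *\<^sub>R dd (dd G b) b' 0))"
      by (simp only: sum_distrib_left)
  qed
qed (simp_all add: quad_def rc_linear algebra_simps sum.distrib scaleR_sum_right)

lemma has_sum_finite_sum:
  fixes f :: "'i \<Rightarrow> 'k \<Rightarrow> 'v::real_normed_vector"
  assumes "finite I" "\<And>i. i \<in> I \<Longrightarrow> (f i has_sum S i) A"
  shows "((\<lambda>k. \<Sum>i\<in>I. f i k) has_sum (\<Sum>i\<in>I. S i)) A"
  using assms by (induction I rule: finite_induct) (auto intro!: has_sum_add)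

text \<open>Each real component of \<open>u\<close> has an absolutely convergent Fourier series, so that the coefficients of
  a quadratic polynomial in \<open>u\<close> are convolutions.\<close>

lemma comp_coeff_hess_has_sum:
  fixes a :: "int ^ 'd \<Rightarrow> complex ^ 'n" and G :: "complex ^ 'n \<Rightarrow> complex ^ 'n"
  assumes a: "in_l1 a"
  shows "((\<lambda>l. quad G (mode_pair a l) (mode_pair a (k - l))) has_sum comp_coeff (\<lambda>z. hess G z z) a k) UNIV"
proof -
  let ?u = "syn a"
  have rcE: "rc b (mode_pair a l) = re_coord b (a l) (cnjv (a (- l)))" for b l by (simp add: rc_def mode_pair_def)
  have P: "((\<lambda>l. rc b (mode_pair a l) * emode l x) has_sum of_real (?u x \<bullet> b)) UNIV" for b x
    unfolding rcE by (rule inner_syn_has_sum[OF a])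
  have l1: "in_l1 (\<lambda>l. rc b (mode_pair a l))" for b
  proof (rule summable_on_comparison_test)
    have "(\<lambda>l. norm (a (- l))) summable_on UNIV"
      using a by (subst summable_on_reindex_bij_witness[of UNIV uminus uminus UNIV]) auto
    then show "(\<lambda>l. real CARD('n) * norm b * (norm (a l) + norm (a (- l)))) summable_on UNIV"
      by (intro summable_on_cmult_right summable_on_add a)
    show "norm (rc b (mode_pair a l)) \<le> real CARD('n) * norm b * (norm (a l) + norm (a (- l)))" for l
      unfolding rcE using norm_re_coord[of b "a l" "cnjv (a (- l))"] by simp
  qed simp
  have lin: "(\<lambda>x. of_real (?u x \<bullet> b) *s q) \<in> CP" for b and q :: "complex ^ 'n"
    unfolding vsmult_of_real by (rule partial_inner_CP[OF a CP_const])
  have co: "fourier_coeff (\<lambda>x. of_real (?u x \<bullet> b) *s q) k = rc b (mode_pair a k) *s q" for b k and q :: "complex ^ 'n"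
  proof -
    have "((\<lambda>l. rc b (mode_pair a l) *s fourier_coeff (\<lambda>x. q) (k - l)) has_sum fourier_coeff (\<lambda>x. of_real (?u x \<bullet> b) *s q) k) UNIV"
      by (rule fourier_coeff_product[OF l1 P CP_const])
    moreover have "((\<lambda>l. rc b (mode_pair a l) *s fourier_coeff (\<lambda>x :: real ^ 'd. q) (k - l)) has_sum rc b (mode_pair a k) *s q) UNIV"
      by (rule has_sum_finite_neutralI[of "{k}"]) (auto simp: fourier_coeff_const)
    ultimately show ?thesis by (rule has_sum_unique)
  qed
  have 2: "((\<lambda>l. (rc b (mode_pair a l) * rc b' (mode_pair a (k - l))) *s q) has_sum
      fourier_coeff (\<lambda>x. of_real (?u x \<bullet> b) *s (of_real (?u x \<bullet> b') *s q)) k) UNIV" for b b' and q :: "complex ^ 'n"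
    using fourier_coeff_product[OF l1[of b] P lin[of b' q], of k] unfolding co by simp
  have CP2: "(\<lambda>x. of_real (?u x \<bullet> b) *s (of_real (?u x \<bullet> b') *s q)) \<in> CP" for b b' and q :: "complex ^ 'n"
    unfolding vsmult_of_real[of "_ \<bullet> b"] by (rule partial_inner_CP[OF a lin])
  have "comp_coeff (\<lambda>z. hess G z z) a k = fourier_coeff (\<lambda>x. \<Sum>b\<in>Basis. \<Sum>b'\<in>Basis. of_real (?u x \<bullet> b) *s (of_real (?u x \<bullet> b') *s ((1 / 2) *\<^sub>R dd (dd G b) b' 0))) k"
    unfolding comp_coeff_def hess_def by (simp only: vsmult_of_real scaleR_scaleR mult.assoc)
  also have "\<dots> = (\<Sum>b\<in>Basis. \<Sum>b'\<in>Basis. fourier_coeff (\<lambda>x. of_real (?u x \<bullet> b) *s (of_real (?u x \<bullet> b') *s ((1 / 2) *\<^sub>R dd (dd G b) b' 0))) k)"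
  proof (subst fourier_coeff_sum)
    show "(\<Sum>b\<in>Basis. fourier_coeff (\<lambda>x. \<Sum>b'\<in>Basis. of_real (?u x \<bullet> b) *s (of_real (?u x \<bullet> b') *s ((1 / 2) *\<^sub>R dd (dd G b) b' 0))) k)
      = (\<Sum>b\<in>Basis. \<Sum>b'\<in>Basis. fourier_coeff (\<lambda>x. of_real (?u x \<bullet> b) *s (of_real (?u x \<bullet> b') *s ((1 / 2) *\<^sub>R dd (dd G b) b' 0))) k)"
      by (intro sum.cong refl fourier_coeff_sum CP2 finite_Basis)
  qed (rule CP_sum CP2 finite_Basis)+
  finally have eq: "comp_coeff (\<lambda>z. hess G z z) a k = \<dots>" .
  show ?thesis unfolding eq quad_def
    by (intro has_sum_finite_sum 2 finite_Basis)
qed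

section \<open>Klein-Gordon symbols, their flow, and the normal form\<close>

text \<open>The Klein-Gordon frequency.\<close>

definition dispersion :: "real \<Rightarrow> 'a::real_normed_vector \<Rightarrow> real" where
  "dispersion m p = sqrt (m\<^sup>2 + (norm p)\<^sup>2)"

lemma dispersion_ge: "m \<le> dispersion m p" "norm p \<le> dispersion m p"
  unfolding dispersion_def by (auto intro: real_le_rsqrt)

lemma dispersion_pos: "m > 0 \<Longrightarrow> 0 < dispersion m p" using dispersion_ge(1)[of m p] by linarith

lemma dispersion_minus [simp]: "dispersion m (- p) = dispersion m p" by (simp add: dispersion_def)

lemma dispersion_sq: "(dispersion m p)\<^sup>2 = m\<^sup>2 + (norm p)\<^sup>2" by (simp add: dispersion_def)

lemma dispersion_eq_norm: "dispersion m p = norm (m, p)" by (simp add: dispersion_def norm_Pair)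

text \<open>The reverse triangle inequality for the vectors \<open>(m, p)\<close> and \<open>(m, q)\<close> gains because the first
  components add up to \<open>2 m\<close> and not to \<open>m\<close>.\<close>

lemma dispersion_gap_left:
  assumes m: "m > 0"
  shows "m\<^sup>2 / (2 * dispersion m p) \<le> dispersion m p + dispersion m q - dispersion m (p + q)"
proof -
  have "dispersion m (p + q) = norm ((0 :: real, p) + (m, q))" by (simp add: dispersion_eq_norm)
  also have "\<dots> \<le> norm p + dispersion m q" using norm_triangle_ineq[of "(0 :: real, p)" "(m, q)"] by (simp add: dispersion_eq_norm norm_Pair)
  finally have 1: "dispersion m p - norm p \<le> dispersion m p + dispersion m q - dispersion m (p + q)" by simp
  have P: "dispersion m p > 0" by (rule dispersion_pos[OF m])
  have "m\<^sup>2 = (dispersion m p - norm p) * (dispersion m p + norm p)" using dispersion_sq[of m p] by (simp add: power2_eq_square algebra_simps)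
  also have "\<dots> \<le> (dispersion m p - norm p) * (2 * dispersion m p)"
    using dispersion_ge(2)[where m = m and p = p] by (intro mult_left_mono) auto
  finally have "m\<^sup>2 / (2 * dispersion m p) \<le> dispersion m p - norm p" using P by (simp add: pos_divide_le_eq)
  then show ?thesis using 1 by linarith
qed

lemma dispersion_gap_right: "m > 0 \<Longrightarrow> m\<^sup>2 / (2 * dispersion m q) \<le> dispersion m p + dispersion m q - dispersion m (p + q)"
  using dispersion_gap_left[of m q p] by (simp add: add.commute)

lemma dispersion_half_gap: "m > 0 \<Longrightarrow> m\<^sup>2 / (2 * dispersion m p) \<le> dispersion m p"
proof -
  assume m: "m > 0"
  have "m * m \<le> dispersion m p * (2 * dispersion m p)" using dispersion_ge(1)[of m p] m by (intro mult_mono) auto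
  then show ?thesis using dispersion_pos[OF m, of p] by (simp add: pos_divide_le_eq power2_eq_square)
qed

text \<open>If the output frequency is below \<open>\<omega>(p)\<close>, the gap is at least \<open>\<omega>(q) \<ge> m\<close>; otherwise the bound in terms of
  \<open>\<omega>(p)\<close> is stronger.\<close>

lemma dispersion_gap_sum:
  assumes m: "m > 0"
  shows "m\<^sup>2 / (2 * dispersion m (p + q)) \<le> dispersion m p + dispersion m q - dispersion m (p + q)"
proof (cases "dispersion m (p + q) \<le> dispersion m p")
  case True
  have "m \<le> dispersion m q" by (rule dispersion_ge)
  moreover have "m\<^sup>2 / (2 * dispersion m (p + q)) \<le> m"
  proof -
    have "m * m \<le> m * (2 * dispersion m (p + q))" using dispersion_ge(1)[of m "p + q"] m by (intro mult_left_mono) auto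
    then show ?thesis using dispersion_pos[OF m, of "p + q"] by (simp add: pos_divide_le_eq power2_eq_square)
  qed
  ultimately show ?thesis using True by linarith
next
  case False
  then have "m\<^sup>2 / (2 * dispersion m (p + q)) \<le> m\<^sup>2 / (2 * dispersion m p)"
    using dispersion_pos[OF m, of p] by (intro divide_left_mono mult_pos_pos) auto
  then show ?thesis using dispersion_gap_left[OF m, of p q] by linarith
qed

text \<open>No quadratic resonances: all the phases \<open>\<omega>(p + q) \<plusminus> \<omega>(p) \<plusminus> \<omega>(q)\<close> are bounded below in terms of
  the smaller of the two input frequencies.\<close>

lemma phase_bounds:
  fixes p q :: "'a::real_normed_vector"
  assumes m: "m > 0"
  defines "a \<equiv> dispersion m (p + q)" and "b \<equiv> dispersion m p" and "c \<equiv> dispersion m q"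
  shows "m\<^sup>2 / (2 * min b c) \<le> a + b + c" "m\<^sup>2 / (2 * min b c) \<le> a + b - c"
    "m\<^sup>2 / (2 * min b c) \<le> a - b + c" "m\<^sup>2 / (2 * min b c) \<le> - (a - b - c)"
proof -
  have pos: "a > 0" "b > 0" "c > 0" unfolding a_def b_def c_def by (rule dispersion_pos[OF m])+
  have mn: "m\<^sup>2 / (2 * min b c) \<le> y" if "m\<^sup>2 / (2 * b) \<le> y" "m\<^sup>2 / (2 * c) \<le> y" for y
    using that by (cases "b \<le> c") (simp_all add: min_def)
  have "m\<^sup>2 / (2 * b) \<le> b" "m\<^sup>2 / (2 * c) \<le> c" unfolding b_def c_def by (rule dispersion_half_gap[OF m])+
  then show "m\<^sup>2 / (2 * min b c) \<le> a + b + c" using pos by (intro mn) auto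
  show "m\<^sup>2 / (2 * min b c) \<le> a + b - c"
    using dispersion_gap_right[OF m, of "- p" "p + q"] dispersion_gap_sum[OF m, of "p + q" "- p"] by (intro mn) (auto simp: a_def b_def c_def)
  show "m\<^sup>2 / (2 * min b c) \<le> a - b + c"
    using dispersion_gap_right[OF m, of "- q" "p + q"] dispersion_gap_sum[OF m, of "p + q" "- q"] by (intro mn) (auto simp: a_def b_def c_def)
  show "m\<^sup>2 / (2 * min b c) \<le> - (a - b - c)"
    using dispersion_gap_left[OF m, of p q] dispersion_gap_right[OF m, of q p] by (intro mn) (auto simp: a_def b_def c_def)
qed

text \<open>
  Let \<open>X\<close>, \<open>Y\<close>, \<open>Z\<close> be commuting operators with square \<open>- 1\<close>. On the joint eigenspace where
  \<open>X Y = \<alpha>\<close> and \<open>X Z = \<beta>\<close>, with \<open>\<alpha>, \<beta> = \<plusminus> 1\<close>, the operator \<open>b Y + c Z - a X\<close> is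
  \<open>- (a + \<alpha> b + \<beta> c) X\<close>. Its inverse, summed over the four eigenspaces, is
  \<open>k\<^sub>0 X - k\<^sub>1 Y - k\<^sub>2 Z - k\<^sub>3 X Y Z\<close> with the following coefficients.
\<close>

definition phase_coeff0 :: "real \<Rightarrow> real \<Rightarrow> real \<Rightarrow> real" where
  "phase_coeff0 a b c = (1 / (a + b + c) + 1 / (a + b - c) + 1 / (a - b + c) + 1 / (a - b - c)) / 4"
definition phase_coeff1 :: "real \<Rightarrow> real \<Rightarrow> real \<Rightarrow> real" where
  "phase_coeff1 a b c = (1 / (a + b + c) + 1 / (a + b - c) - 1 / (a - b + c) - 1 / (a - b - c)) / 4"
definition phase_coeff2 :: "real \<Rightarrow> real \<Rightarrow> real \<Rightarrow> real" where
  "phase_coeff2 a b c = (1 / (a + b + c) - 1 / (a + b - c) + 1 / (a - b + c) - 1 / (a - b - c)) / 4"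
definition phase_coeff3 :: "real \<Rightarrow> real \<Rightarrow> real \<Rightarrow> real" where
  "phase_coeff3 a b c = (1 / (a + b + c) - 1 / (a + b - c) - 1 / (a - b + c) + 1 / (a - b - c)) / 4"

text \<open>These are the four components of the equation for the inverse in the basis \<open>1\<close>, \<open>X Y\<close>, \<open>X Z\<close>, \<open>Y Z\<close>.\<close>

lemma phase_coeff_identities:
  assumes "a + b + c \<noteq> 0" "a + b - c \<noteq> 0" "a - b + c \<noteq> 0" "a - b - c \<noteq> 0"
  shows "b * phase_coeff1 a b c + c * phase_coeff2 a b c + a * phase_coeff0 a b c = 1" "b * phase_coeff0 a b c + c * phase_coeff3 a b c + a * phase_coeff1 a b c = 0"
    "b * phase_coeff3 a b c + c * phase_coeff0 a b c + a * phase_coeff2 a b c = 0" "b * phase_coeff2 a b c + c * phase_coeff1 a b c + a * phase_coeff3 a b c = 0"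
proof -
  define p q r s where "p = 1 / (a + b + c)" and "q = 1 / (a + b - c)" and "r = 1 / (a - b + c)" and "s = 1 / (a - b - c)"
  have 1: "p * (a + b + c) = 1" "q * (a + b - c) = 1" "r * (a - b + c) = 1" "s * (a - b - c) = 1"
    using assms by (simp_all add: p_def q_def r_def s_def)
  have k: "phase_coeff0 a b c = (p + q + r + s) / 4" "phase_coeff1 a b c = (p + q - r - s) / 4" "phase_coeff2 a b c = (p - q + r - s) / 4" "phase_coeff3 a b c = (p - q - r + s) / 4"
    by (simp_all add: phase_coeff0_def phase_coeff1_def phase_coeff2_def phase_coeff3_def p_def q_def r_def s_def)
  have "b * ((p + q - r - s) / 4) + c * ((p - q + r - s) / 4) + a * ((p + q + r + s) / 4)
      = (p * (a + b + c) + q * (a + b - c) + r * (a - b + c) + s * (a - b - c)) / 4" by (simp add: field_simps)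
  then show "b * phase_coeff1 a b c + c * phase_coeff2 a b c + a * phase_coeff0 a b c = 1" unfolding k 1 by simp
  have "b * ((p + q + r + s) / 4) + c * ((p - q - r + s) / 4) + a * ((p + q - r - s) / 4)
      = (p * (a + b + c) + q * (a + b - c) - r * (a - b + c) - s * (a - b - c)) / 4" by (simp add: field_simps)
  then show "b * phase_coeff0 a b c + c * phase_coeff3 a b c + a * phase_coeff1 a b c = 0" unfolding k 1 by simp
  have "b * ((p - q - r + s) / 4) + c * ((p + q + r + s) / 4) + a * ((p - q + r - s) / 4)
      = (p * (a + b + c) - q * (a + b - c) + r * (a - b + c) - s * (a - b - c)) / 4" by (simp add: field_simps)
  then show "b * phase_coeff3 a b c + c * phase_coeff0 a b c + a * phase_coeff2 a b c = 0" unfolding k 1 by simp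
  have "b * ((p - q + r - s) / 4) + c * ((p + q - r - s) / 4) + a * ((p - q - r + s) / 4)
      = (p * (a + b + c) - q * (a + b - c) - r * (a - b + c) + s * (a - b - c)) / 4" by (simp add: field_simps)
  then show "b * phase_coeff2 a b c + c * phase_coeff1 a b c + a * phase_coeff3 a b c = 0" unfolding k 1 by simp
qed

lemma phase_coeff_bounds:
  fixes p q :: "'a::real_normed_vector"
  assumes m: "m > 0"
  defines "a \<equiv> dispersion m (p + q)" and "b \<equiv> dispersion m p" and "c \<equiv> dispersion m q"
  defines "B \<equiv> 2 / m\<^sup>2 * min b c"
  shows "\<bar>phase_coeff0 a b c\<bar> \<le> B" "\<bar>phase_coeff1 a b c\<bar> \<le> B" "\<bar>phase_coeff2 a b c\<bar> \<le> B" "\<bar>phase_coeff3 a b c\<bar> \<le> B"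
    and "a + b + c \<noteq> 0" "a + b - c \<noteq> 0" "a - b + c \<noteq> 0" "a - b - c \<noteq> 0"
proof -
  have bc: "min b c > 0" using dispersion_pos[OF m, of p] dispersion_pos[OF m, of q] by (simp add: b_def c_def)
  define e where "e = m\<^sup>2 / (2 * min b c)"
  have e: "e > 0" "1 / e = B" using m bc by (simp_all add: e_def B_def field_simps)
  note ph = phase_bounds[OF m, of p q, folded a_def b_def c_def, folded e_def]
  show "a + b + c \<noteq> 0" "a + b - c \<noteq> 0" "a - b + c \<noteq> 0" "a - b - c \<noteq> 0" using ph e by auto
  have inv: "\<bar>1 / x\<bar> \<le> B" if "e \<le> \<bar>x\<bar>" for x :: real
    unfolding e(2)[symmetric] abs_divide using that e(1) by (simp add: frac_le)
  have b: "\<bar>1 / (a + b + c)\<bar> \<le> B" "\<bar>1 / (a + b - c)\<bar> \<le> B" "\<bar>1 / (a - b + c)\<bar> \<le> B" "\<bar>1 / (a - b - c)\<bar> \<le> B"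
    by (rule inv, use ph in linarith)+
  have avg: "\<bar>(x + y + z + w) / 4\<bar> \<le> B" "\<bar>(x + y - z - w) / 4\<bar> \<le> B" "\<bar>(x - y + z - w) / 4\<bar> \<le> B" "\<bar>(x - y - z + w) / 4\<bar> \<le> B"
    if "\<bar>x\<bar> \<le> B" "\<bar>y\<bar> \<le> B" "\<bar>z\<bar> \<le> B" "\<bar>w\<bar> \<le> B" for x y z w
    using that by (simp_all add: abs_le_iff)
  show "\<bar>phase_coeff0 a b c\<bar> \<le> B" "\<bar>phase_coeff1 a b c\<bar> \<le> B" "\<bar>phase_coeff2 a b c\<bar> \<le> B" "\<bar>phase_coeff3 a b c\<bar> \<le> B"
    unfolding phase_coeff0_def phase_coeff1_def phase_coeff2_def phase_coeff3_def by (rule avg[OF b])+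
qed

lemma cnjv_simps [simp]: "cnjv (cnjv v) = v" "cnjv (v + w) = cnjv v + cnjv w" "cnjv (r *\<^sub>R v) = r *\<^sub>R cnjv v"
    "cnjv (- v) = - cnjv v" "cnjv (v - w) = cnjv v - cnjv w"
  by (simp_all add: cnjv_def vec_eq_iff)

lemma dispersion_freq_le_jap:
  assumes "m > 0"
  shows "dispersion m (freq k) \<le> (1 + m) * jap k"
proof -
  have "dispersion m (freq k) \<le> m + norm (freq k)"
    unfolding dispersion_def using assms by (intro real_le_lsqrt) (auto simp: power2_eq_square algebra_simps)
  also have "\<dots> \<le> m * jap k + jap k"
    using jap_ge_1[of k] norm_freq_le_jap[of k] assms by (intro add_mono) auto
  finally show ?thesis by (simp add: algebra_simps)
qed

text \<open>A system \<open>a'(k) = g(k) a(k)\<close> of first order each of whose components satisfies the Klein-Gordon equation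
  \<open>a'' = - \<omega>\<^sup>2 a\<close>.\<close>

locale kg_symbol =
  fixes m :: real and g :: "int ^ 'd \<Rightarrow> complex ^ 'n \<Rightarrow> complex ^ 'n" and \<kappa> :: real
  assumes m: "m > 0" and lin: "\<And>k. linear (g k)"
    and sq: "\<And>k v. g k (g k v) = - ((dispersion m (freq k))\<^sup>2) *\<^sub>R v"
    and bd: "\<And>k v. norm (g k v) \<le> \<kappa> * dispersion m (freq k) * norm v" and \<kappa>: "\<kappa> \<ge> 1"
begin

abbreviation \<omega> :: "int ^ 'd \<Rightarrow> real" where "\<omega> k \<equiv> dispersion m (freq k)"

lemma \<omega>_pos [simp]: "0 < \<omega> k" "\<omega> k \<noteq> 0" "0 \<le> \<omega> k" using dispersion_pos[OF m, of "freq k"] by auto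

lemma g_simps: "g k (v + w) = g k v + g k w" "g k (v - w) = g k v - g k w" "g k (r *\<^sub>R v) = r *\<^sub>R g k v" "g k 0 = 0" "g k (- v) = - g k v"
  using linear_add[OF lin] linear_diff[OF lin] linear_scale[OF lin] linear_0[OF lin] linear_neg[OF lin] by auto

lemma bounded_linear_g: "bounded_linear (g k)"
  using lin linear_conv_bounded_linear by blast

subsection \<open>The linear flow\<close>

text \<open>The exponential of \<open>t g(k)\<close>, in closed form because of \<open>g(k)\<^sup>2 = - \<omega>(k)\<^sup>2\<close>.\<close>

definition U :: "real \<Rightarrow> int ^ 'd \<Rightarrow> complex ^ 'n \<Rightarrow> complex ^ 'n" where
  "U t k v = cos (t * \<omega> k) *\<^sub>R v + (sin (t * \<omega> k) / \<omega> k) *\<^sub>R g k v"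

lemma U_0 [simp]: "U 0 k v = v" by (simp add: U_def)

lemma U_linear: "U t k (v + w) = U t k v + U t k w" "U t k (v - w) = U t k v - U t k w" "U t k (r *\<^sub>R v) = r *\<^sub>R U t k v"
  by (simp_all add: U_def g_simps algebra_simps)

lemma g_U: "g k (U t k v) = U t k (g k v)" "g k (U t k v) = (- \<omega> k * sin (t * \<omega> k)) *\<^sub>R v + cos (t * \<omega> k) *\<^sub>R g k v"
  by (simp_all add: U_def g_simps sq power2_eq_square)

lemma U_add: "U (s + t) k v = U s k (U t k v)"
proof -
  have "U s k (U t k v) = cos (s * \<omega> k) *\<^sub>R U t k v + (sin (s * \<omega> k) / \<omega> k) *\<^sub>R g k (U t k v)" by (simp only: U_def[of s])
  also have "\<dots> = (cos (s * \<omega> k) * cos (t * \<omega> k) - sin (s * \<omega> k) * sin (t * \<omega> k)) *\<^sub>R v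
      + ((cos (s * \<omega> k) * sin (t * \<omega> k) + sin (s * \<omega> k) * cos (t * \<omega> k)) / \<omega> k) *\<^sub>R g k v"
    unfolding g_U(2) by (simp add: U_def[of t] algebra_simps add_divide_distrib)
  also have "\<dots> = U (s + t) k v" by (simp add: U_def distrib_right cos_add sin_add add.commute)
  finally show ?thesis by simp
qed

lemma U_inverse [simp]: "U (- t) k (U t k v) = v" "U t k (U (- t) k v) = v"
  using U_add[of "- t" t k v] U_add[of t "- t" k v] by simp_all

lemma norm_U_le: "norm (U t k v) \<le> (1 + \<kappa>) * norm v"
proof -
  have "norm (U t k v) \<le> \<bar>cos (t * \<omega> k)\<bar> * norm v + \<bar>sin (t * \<omega> k)\<bar> / \<omega> k * norm (g k v)"
    unfolding U_def by (rule order_trans[OF norm_triangle_ineq]) simp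
  also have "\<dots> \<le> 1 * norm v + 1 / \<omega> k * (\<kappa> * \<omega> k * norm v)"
    using \<kappa> by (intro add_mono mult_mono bd divide_right_mono) auto
  finally show ?thesis by (simp add: algebra_simps)
qed

lemma U_continuous: "continuous_on UNIV (\<lambda>t. U t k v)"
  unfolding U_def by (intro continuous_intros) auto

lemma U_has_vector_derivative:
  assumes "(v has_vector_derivative v') (at t)"
  shows "((\<lambda>t. U t k (v t)) has_vector_derivative U t k v' + g k (U t k (v t))) (at t)"
proof -
  have c: "((\<lambda>t. cos (t * \<omega> k)) has_real_derivative - (\<omega> k * sin (t * \<omega> k))) (at t)"
    by (auto intro!: derivative_eq_intros)
  have s: "((\<lambda>t. sin (t * \<omega> k) / \<omega> k) has_real_derivative cos (t * \<omega> k)) (at t)"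
    by (auto intro!: derivative_eq_intros)
  have "((\<lambda>t. U t k (v t)) has_vector_derivative
      (cos (t * \<omega> k) *\<^sub>R v' + (- (\<omega> k * sin (t * \<omega> k))) *\<^sub>R v t) + ((sin (t * \<omega> k) / \<omega> k) *\<^sub>R g k v' + cos (t * \<omega> k) *\<^sub>R g k (v t))) (at t)"
    unfolding U_def
    by (intro has_vector_derivative_add has_vector_derivative_scaleR c s assms bounded_linear.has_vector_derivative[OF bounded_linear_g])
  then show ?thesis unfolding g_U(2) by (simp add: U_def algebra_simps)
qed

text \<open>In the profile, the linear part of the equation disappears.\<close>

lemma U_backward_derivative:
  assumes "(v has_vector_derivative g k (v t) + n) (at t)"
  shows "((\<lambda>t. U (- t) k (v t)) has_vector_derivative U (- t) k n) (at t)"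
proof -
  have c: "((\<lambda>t. cos (- t * \<omega> k)) has_real_derivative \<omega> k * sin (- t * \<omega> k)) (at t)"
    by (auto intro!: derivative_eq_intros)
  have s: "((\<lambda>t. sin (- t * \<omega> k) / \<omega> k) has_real_derivative - cos (- t * \<omega> k)) (at t)"
    by (auto intro!: derivative_eq_intros)
  have "((\<lambda>t. U (- t) k (v t)) has_vector_derivative
      (cos (- t * \<omega> k) *\<^sub>R (g k (v t) + n) + (\<omega> k * sin (- t * \<omega> k)) *\<^sub>R v t)
      + ((sin (- t * \<omega> k) / \<omega> k) *\<^sub>R g k (g k (v t) + n) + (- cos (- t * \<omega> k)) *\<^sub>R g k (v t))) (at t)"
    unfolding U_def
    by (intro has_vector_derivative_add has_vector_derivative_scaleR c s assms bounded_linear.has_vector_derivative[OF bounded_linear_g])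
  then show ?thesis by (simp add: U_def g_simps sq power2_eq_square algebra_simps)
qed

definition flow :: "real \<Rightarrow> (int ^ 'd, complex ^ 'n) l2 \<Rightarrow> (int ^ 'd, complex ^ 'n) l2" where
  "flow t x = Abs_l2 (\<lambda>k. U t k (coord x k))"

lemma coord_flow: "coord (flow t x) k = U t k (coord x k)" and norm_flow_le: "norm (flow t x) \<le> (1 + \<kappa>) * norm x"
proof -
  have "norm (U t k (coord x k)) \<le> norm (coord ((1 + \<kappa>) *\<^sub>R x) k)" for k
    using norm_U_le[of t k "coord x k"] \<kappa> by simp
  note * = in_l2_le[of "\<lambda>k. U t k (coord x k)" "(1 + \<kappa>) *\<^sub>R x", OF this]
  show "coord (flow t x) k = U t k (coord x k)" unfolding flow_def by (simp add: coord_Abs_l2[OF *(1)])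
  show "norm (flow t x) \<le> (1 + \<kappa>) * norm x" using *(2) \<kappa> by (simp add: flow_def)
qed

lemma flow_simps [simp]: "flow (- t) (flow t x) = x" "flow t (flow (- t) x) = x" "flow 0 x = x"
  by (rule l2_eqI, simp add: coord_flow)+

lemma flow_diff: "flow t (x - y) = flow t x - flow t y"
  by (rule l2_eqI) (simp add: coord_flow U_linear)

lemma flow_continuous: "continuous_on UNIV (\<lambda>(t, x). flow t x)"
  by (rule coordwise_flow_continuous[OF coord_flow U_linear(2) norm_U_le U_continuous])

lemma flow_continuous_compose:
  assumes "continuous_on S f" "continuous_on S h"
  shows "continuous_on S (\<lambda>y. flow (f y) (h y))"
  using continuous_on_compose2[OF flow_continuous continuous_on_Pair[OF assms]] by simp

subsection \<open>The normal form transformation\<close>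

text \<open>The action of the linear equation on pairs of modes.\<close>

definition pair_gen :: "int ^ 'd \<Rightarrow> (complex ^ 'n) \<times> (complex ^ 'n) \<Rightarrow> (complex ^ 'n) \<times> (complex ^ 'n)" where
  "pair_gen l w = (g l (fst w), cnjv (g (- l) (cnjv (snd w))))"

lemma pair_gen_mode_pair: "mode_pair (\<lambda>k. g k (a k)) l = pair_gen l (mode_pair a l)"
  by (simp add: mode_pair_def pair_gen_def)

lemma pair_gen_simps: "pair_gen l (v + w) = pair_gen l v + pair_gen l w" "pair_gen l (r *\<^sub>R w) = r *\<^sub>R pair_gen l w"
  by (simp_all add: pair_gen_def g_simps)

lemma pair_gen_sq: "pair_gen l (pair_gen l w) = - ((\<omega> l)\<^sup>2) *\<^sub>R w"
  by (cases w) (simp add: pair_gen_def sq)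

lemma norm_pair_gen_le: "norm (pair_gen l w) \<le> 2 * \<kappa> * \<omega> l * norm w"
proof -
  have "norm (pair_gen l w) \<le> norm (g l (fst w)) + norm (g (- l) (cnjv (snd w)))"
    unfolding pair_gen_def by (rule order_trans[OF norm_Pair_le]) simp
  also have "\<dots> \<le> \<kappa> * \<omega> l * norm (fst w) + \<kappa> * \<omega> l * norm (snd w)"
    using bd[of l "fst w"] bd[of "- l" "cnjv (snd w)"] by (intro add_mono) auto
  also have "\<dots> \<le> \<kappa> * \<omega> l * norm w + \<kappa> * \<omega> l * norm w"
    using norm_fst_le[of "fst w" "snd w"] norm_snd_le[of "snd w" "fst w"] \<kappa> by (intro add_mono mult_left_mono) auto
  finally show ?thesis by (simp add: algebra_simps)
qed

text \<open>Both generators are rescaled to have square \<open>- 1\<close>.\<close>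

definition unit_gen :: "int ^ 'd \<Rightarrow> complex ^ 'n \<Rightarrow> complex ^ 'n" where "unit_gen k v = (1 / \<omega> k) *\<^sub>R g k v"
definition unit_pair_gen :: "int ^ 'd \<Rightarrow> (complex ^ 'n) \<times> (complex ^ 'n) \<Rightarrow> (complex ^ 'n) \<times> (complex ^ 'n)" where "unit_pair_gen l w = (1 / \<omega> l) *\<^sub>R pair_gen l w"

lemma unit_gen_simps: "unit_gen k (v + w) = unit_gen k v + unit_gen k w" "unit_gen k (v - w) = unit_gen k v - unit_gen k w" "unit_gen k (r *\<^sub>R v) = r *\<^sub>R unit_gen k v" "unit_gen k (- v) = - unit_gen k v"
    "unit_gen k (unit_gen k v) = - v" "g k v = \<omega> k *\<^sub>R unit_gen k v"
  by (simp_all add: unit_gen_def g_simps sq algebra_simps power2_eq_square)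

lemma unit_pair_gen_simps: "unit_pair_gen k (v + w) = unit_pair_gen k v + unit_pair_gen k w" "unit_pair_gen k (r *\<^sub>R v) = r *\<^sub>R unit_pair_gen k v"
    "unit_pair_gen k (unit_pair_gen k w) = - w" "pair_gen k w = \<omega> k *\<^sub>R unit_pair_gen k w"
  by (simp_all add: unit_pair_gen_def pair_gen_simps pair_gen_sq algebra_simps power2_eq_square)

lemma norm_unit_gen_le: "norm (unit_gen k v) \<le> \<kappa> * norm v"
  using bd[of k v] by (simp add: unit_gen_def pos_divide_le_eq mult_ac)

lemma norm_unit_pair_gen_le: "norm (unit_pair_gen k w) \<le> 2 * \<kappa> * norm w"
  using norm_pair_gen_le[of k w] by (simp add: unit_pair_gen_def pos_divide_le_eq mult_ac)

end

locale kg_quadratic = kg_symbol m g \<kappa>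
  for m :: real and g :: "int ^ 'd \<Rightarrow> complex ^ 'n \<Rightarrow> complex ^ 'n" and \<kappa> :: real +
  fixes Q :: "(complex ^ 'n) \<times> (complex ^ 'n) \<Rightarrow> (complex ^ 'n) \<times> (complex ^ 'n) \<Rightarrow> complex ^ 'n"
  assumes Q: "bounded_bilinear Q"
begin

lemmas Q_simps = bounded_bilinear.add_left[OF Q] bounded_bilinear.add_right[OF Q] bounded_bilinear.scaleR_left[OF Q]
  bounded_bilinear.scaleR_right[OF Q] bounded_bilinear.minus_left[OF Q] bounded_bilinear.minus_right[OF Q]

text \<open>The inverse described above, where \<open>X\<close> acts on the value of the bilinear form \<open>Q\<close>, and \<open>Y\<close> and \<open>Z\<close>
  act on its arguments.\<close>

definition nf_symbol :: "int ^ 'd \<Rightarrow> int ^ 'd \<Rightarrow> (complex ^ 'n) \<times> (complex ^ 'n) \<Rightarrow> (complex ^ 'n) \<times> (complex ^ 'n) \<Rightarrow> complex ^ 'n" where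
  "nf_symbol k l w w' = phase_coeff0 (\<omega> k) (\<omega> l) (\<omega> (k - l)) *\<^sub>R unit_gen k (Q w w') - phase_coeff1 (\<omega> k) (\<omega> l) (\<omega> (k - l)) *\<^sub>R Q (unit_pair_gen l w) w'
     - phase_coeff2 (\<omega> k) (\<omega> l) (\<omega> (k - l)) *\<^sub>R Q w (unit_pair_gen (k - l) w') - phase_coeff3 (\<omega> k) (\<omega> l) (\<omega> (k - l)) *\<^sub>R unit_gen k (Q (unit_pair_gen l w) (unit_pair_gen (k - l) w'))"

lemma nf_symbol_simps: "nf_symbol k l (v + w) w' = nf_symbol k l v w' + nf_symbol k l w w'" "nf_symbol k l w (v' + w') = nf_symbol k l w v' + nf_symbol k l w w'"
    "nf_symbol k l (r *\<^sub>R w) w' = r *\<^sub>R nf_symbol k l w w'" "nf_symbol k l w (r *\<^sub>R w') = r *\<^sub>R nf_symbol k l w w'"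
  by (simp_all add: nf_symbol_def Q_simps unit_gen_simps unit_pair_gen_simps algebra_simps)

text \<open>Expansion in the four terms \<open>Q(w, w')\<close>, \<open>X Q(Y w, w')\<close>, \<open>X Q(w, Z w')\<close>, \<open>Q(Y w, Z w')\<close>; the coefficients are
  \<open>1\<close>, \<open>0\<close>, \<open>0\<close>, \<open>0\<close> by the identities for the phases.\<close>

lemma nf_symbol_homological: "nf_symbol k l (pair_gen l w) w' + nf_symbol k l w (pair_gen (k - l) w') - g k (nf_symbol k l w w') = Q w w'"
proof -
  define a b c where "a = \<omega> k" and "b = \<omega> l" and "c = \<omega> (k - l)"
  define x y z u where "x = unit_gen k (Q (unit_pair_gen l w) w')" and "y = unit_gen k (Q w (unit_pair_gen (k - l) w'))" and "z = Q (unit_pair_gen l w) (unit_pair_gen (k - l) w')" and "u = Q w w'"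
  have "a = dispersion m (freq l + freq (k - l))" by (simp add: a_def)
  note id = phase_coeff_identities[OF phase_coeff_bounds(5-8)[OF m, of "freq l" "freq (k - l)"], folded this b_def c_def]
  have "nf_symbol k l (unit_pair_gen l w) w' = phase_coeff0 a b c *\<^sub>R x + phase_coeff1 a b c *\<^sub>R u - phase_coeff2 a b c *\<^sub>R z + phase_coeff3 a b c *\<^sub>R y"
    by (simp add: nf_symbol_def unit_pair_gen_simps(3) Q_simps(5) unit_gen_simps(4) x_def y_def z_def u_def a_def b_def c_def)
  then have 1: "nf_symbol k l (pair_gen l w) w' = b *\<^sub>R (phase_coeff0 a b c *\<^sub>R x + phase_coeff1 a b c *\<^sub>R u - phase_coeff2 a b c *\<^sub>R z + phase_coeff3 a b c *\<^sub>R y)"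
    by (simp only: unit_pair_gen_simps(4) nf_symbol_simps b_def)
  have "nf_symbol k l w (unit_pair_gen (k - l) w') = phase_coeff0 a b c *\<^sub>R y - phase_coeff1 a b c *\<^sub>R z + phase_coeff2 a b c *\<^sub>R u + phase_coeff3 a b c *\<^sub>R x"
    by (simp add: nf_symbol_def unit_pair_gen_simps(3) Q_simps(6) unit_gen_simps(4) x_def y_def z_def u_def a_def b_def c_def)
  then have 2: "nf_symbol k l w (pair_gen (k - l) w') = c *\<^sub>R (phase_coeff0 a b c *\<^sub>R y - phase_coeff1 a b c *\<^sub>R z + phase_coeff2 a b c *\<^sub>R u + phase_coeff3 a b c *\<^sub>R x)"
    by (simp only: unit_pair_gen_simps(4) nf_symbol_simps c_def)
  have "unit_gen k (nf_symbol k l w w') = - (phase_coeff0 a b c *\<^sub>R u) - phase_coeff1 a b c *\<^sub>R x - phase_coeff2 a b c *\<^sub>R y + phase_coeff3 a b c *\<^sub>R z"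
    by (simp add: nf_symbol_def unit_gen_simps(1-5) x_def y_def z_def u_def a_def b_def c_def)
  then have 3: "g k (nf_symbol k l w w') = a *\<^sub>R (- (phase_coeff0 a b c *\<^sub>R u) - phase_coeff1 a b c *\<^sub>R x - phase_coeff2 a b c *\<^sub>R y + phase_coeff3 a b c *\<^sub>R z)"
    by (simp only: unit_gen_simps(6) a_def)
  have "nf_symbol k l (pair_gen l w) w' + nf_symbol k l w (pair_gen (k - l) w') - g k (nf_symbol k l w w')
      = (b * phase_coeff1 a b c + c * phase_coeff2 a b c + a * phase_coeff0 a b c) *\<^sub>R u + (b * phase_coeff0 a b c + c * phase_coeff3 a b c + a * phase_coeff1 a b c) *\<^sub>R x
      + (b * phase_coeff3 a b c + c * phase_coeff0 a b c + a * phase_coeff2 a b c) *\<^sub>R y - (b * phase_coeff2 a b c + c * phase_coeff1 a b c + a * phase_coeff3 a b c) *\<^sub>R z"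
    unfolding 1 2 3 by (simp add: algebra_simps)
  then show ?thesis unfolding id u_def by simp
qed

lemma nf_symbol_bound: "\<exists>C\<ge>0. \<forall>k l w w'. norm (nf_symbol k l w w') \<le> C * min (jap l) (jap (k - l)) * (norm w * norm w')"
proof -
  obtain CQ where CQ: "CQ \<ge> 0" "\<And>w w'. norm (Q w w') \<le> norm w * norm w' * CQ"
    using bounded_bilinear.nonneg_bounded[OF Q] by blast
  define C where "C = 2 / m\<^sup>2 * (1 + m) * (CQ * (5 * \<kappa> + 4 * \<kappa> ^ 3))"
  have "norm (nf_symbol k l w w') \<le> C * min (jap l) (jap (k - l)) * (norm w * norm w')" for k l w w'
  proof -
    define B where "B = 2 / m\<^sup>2 * min (\<omega> l) (\<omega> (k - l))"
    define N where "N = norm w * norm w' * CQ"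
    have N0: "N \<ge> 0" using CQ by (simp add: N_def)
    have fk: "freq l + freq (k - l) = freq k" by simp
    note kb = phase_coeff_bounds(1-4)[OF m, of "freq l" "freq (k - l)", unfolded fk, folded B_def]
    have k0: "0 \<le> \<kappa>" using \<kappa> by simp
    have "0 \<le> min (\<omega> l) (\<omega> (k - l))" by (rule min.boundedI; rule \<omega>_pos)
    then have B0: "B \<ge> 0" unfolding B_def by (intro mult_nonneg_nonneg) auto
    have q0: "norm (unit_gen k (Q w w')) \<le> \<kappa> * N"
      using norm_unit_gen_le[of k "Q w w'"] mult_left_mono[OF CQ(2)[of w w'] k0] unfolding N_def by linarith
    have q1: "norm (Q (unit_pair_gen l w) w') \<le> 2 * \<kappa> * N"
    proof -
      have "norm (Q (unit_pair_gen l w) w') \<le> (2 * \<kappa> * norm w) * norm w' * CQ"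
        by (rule order_trans[OF CQ(2)]) (intro mult_right_mono norm_unit_pair_gen_le CQ(1) norm_ge_zero)
      then show ?thesis by (simp add: N_def mult_ac)
    qed
    have q2: "norm (Q w (unit_pair_gen (k - l) w')) \<le> 2 * \<kappa> * N"
    proof -
      have "norm (Q w (unit_pair_gen (k - l) w')) \<le> norm w * (2 * \<kappa> * norm w') * CQ"
        by (rule order_trans[OF CQ(2)]) (intro mult_right_mono mult_left_mono norm_unit_pair_gen_le CQ(1) norm_ge_zero)
      then show ?thesis by (simp add: N_def mult_ac)
    qed
    have q3: "norm (unit_gen k (Q (unit_pair_gen l w) (unit_pair_gen (k - l) w'))) \<le> 4 * \<kappa> ^ 3 * N"
    proof -
      have "norm (Q (unit_pair_gen l w) (unit_pair_gen (k - l) w')) \<le> (2 * \<kappa> * norm w) * (2 * \<kappa> * norm w') * CQ"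
        using \<kappa> by (intro order_trans[OF CQ(2)] mult_right_mono mult_mono norm_unit_pair_gen_le CQ(1)) auto
      from mult_left_mono[OF this k0]
      have "\<kappa> * norm (Q (unit_pair_gen l w) (unit_pair_gen (k - l) w')) \<le> 4 * \<kappa> ^ 3 * N" by (simp add: N_def power3_eq_cube mult_ac)
      then show ?thesis using norm_unit_gen_le[of k "Q (unit_pair_gen l w) (unit_pair_gen (k - l) w')"] by linarith
    qed
    have sc: "norm (c *\<^sub>R v) \<le> B * y" if "\<bar>c\<bar> \<le> B" "norm v \<le> y" for c y and v :: "complex ^ 'n"
      using mult_mono[OF that B0 norm_ge_zero] by simp
    have "norm (nf_symbol k l w w') \<le> B * (\<kappa> * N) + B * (2 * \<kappa> * N) + B * (2 * \<kappa> * N) + B * (4 * \<kappa> ^ 3 * N)"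
      unfolding nf_symbol_def by (intro order_trans[OF norm_triangle_ineq4] add_mono sc kb q0 q1 q2 q3)
    also have "\<dots> = B * (N * (5 * \<kappa> + 4 * \<kappa> ^ 3))" by (simp add: algebra_simps)
    also have "\<dots> \<le> (2 / m\<^sup>2 * ((1 + m) * min (jap l) (jap (k - l)))) * (N * (5 * \<kappa> + 4 * \<kappa> ^ 3))"
    proof (intro mult_right_mono)
      have "min (\<omega> l) (\<omega> (k - l)) \<le> (1 + m) * min (jap l) (jap (k - l))"
        using dispersion_freq_le_jap[OF m, of l] dispersion_freq_le_jap[OF m, of "k - l"] by (simp add: min_def)
      then show "B \<le> 2 / m\<^sup>2 * ((1 + m) * min (jap l) (jap (k - l)))" unfolding B_def by (intro mult_left_mono) auto
    qed (use N0 \<kappa> in auto)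
    also have "\<dots> = C * min (jap l) (jap (k - l)) * (norm w * norm w')" unfolding C_def N_def by (simp only: mult_ac)
    finally show ?thesis .
  qed
  moreover have "C \<ge> 0" unfolding C_def using m \<kappa> CQ by simp
  ultimately show ?thesis by blast
qed

text \<open>The normal form transformation as a bilinear convolution of families of modes.\<close>

definition nf :: "(int ^ 'd \<Rightarrow> complex ^ 'n) \<Rightarrow> (int ^ 'd \<Rightarrow> complex ^ 'n) \<Rightarrow> int ^ 'd \<Rightarrow> complex ^ 'n" where
  "nf a c k = (\<Sum>\<^sub>\<infinity>l. nf_symbol k l (mode_pair a l) (mode_pair c (k - l)))"

lemma norm_mode_pair_le: "norm (mode_pair a l) \<le> norm (a l) + norm (a (- l))"
  unfolding mode_pair_def by (rule order_trans[OF norm_Pair_le]) simp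

text \<open>The loss in the small divisors falls on the lower of the two frequencies, so that \<open>nf\<close> is
  bounded on \<open>H\<^sup>r\<close>.\<close>

lemma nf_bound:
  assumes r: "real CARD('d) + 1 \<le> r"
  shows "\<exists>K\<ge>0. \<forall>a c. hs r a \<longrightarrow> hs r c \<longrightarrow>
    (\<forall>k. ((\<lambda>l. nf_symbol k l (mode_pair a l) (mode_pair c (k - l))) has_sum nf a c k) UNIV) \<and>
    hs r (nf a c) \<and> hn r (nf a c) \<le> K * hn r a * hn r c"
proof -
  obtain C where C: "C \<ge> 0" "\<And>k l w w'. norm (nf_symbol k l w w') \<le> C * min (jap l) (jap (k - l)) * (norm w * norm w')"
    using nf_symbol_bound by blast
  let ?Ke = "Kemb TYPE('d)"
  define D where "D = 2 powr r * C"
  have D0: "D \<ge> 0" using C by (simp add: D_def)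
  define K where "K = 8 * D * ?Ke"
  have main: "(\<forall>k. ((\<lambda>l. nf_symbol k l (mode_pair a l) (mode_pair c (k - l))) has_sum nf a c k) UNIV) \<and>
    hs r (nf a c) \<and> hn r (nf a c) \<le> K * hn r a * hn r c" if a: "hs r a" and c: "hs r c" for a c
  proof -
    define \<alpha> where "\<alpha> b l = norm (b l) + norm (b (- l))" for b :: "int ^ 'd \<Rightarrow> complex ^ 'n" and l
    have \<alpha>0: "\<alpha> b l \<ge> 0" for b l by (simp add: \<alpha>_def)
    have \<alpha>h: "hs r (\<alpha> b) \<and> hn r (\<alpha> b) \<le> 2 * hn r b" if "hs r b" for b
    proof -
      have n0: "hs r (\<lambda>l. norm (b l))" using that by (simp add: hs_norm)
      show ?thesis
        using hs_add[OF n0 hs_reflect(1)[OF n0]] hs_reflect(2)[OF n0] hn_norm[OF that] unfolding \<alpha>_def by auto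
    qed
    have jl: "(\<lambda>l. jap l * \<alpha> b l) summable_on UNIV \<and> (\<Sum>\<^sub>\<infinity>l. jap l * \<alpha> b l) \<le> ?Ke * (2 * hn r b)" if "hs r b" for b
    proof -
      have h: "hs (1 + real CARD('d)) (\<alpha> b)" "hn (1 + real CARD('d)) (\<alpha> b) \<le> hn r (\<alpha> b)"
        using hs_le[of r "\<alpha> b" "1 + real CARD('d)"] \<alpha>h[OF that] r by auto
      have "(\<lambda>l. jap l * \<alpha> b l) summable_on UNIV" "(\<Sum>\<^sub>\<infinity>l. jap l * \<alpha> b l) \<le> ?Ke * hn (1 + real CARD('d)) (\<alpha> b)"
        using l1_of_hs[OF h(1)] \<alpha>0 by (simp_all add: wt_1)
      moreover have "?Ke * hn (1 + real CARD('d)) (\<alpha> b) \<le> ?Ke * (2 * hn r b)"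
        using h(2) \<alpha>h[OF that] by (intro mult_left_mono) auto
      ultimately show ?thesis by linarith
    qed
    have tm: "norm (nf_symbol k l (mode_pair a l) (mode_pair c (k - l))) \<le> C * min (jap l) (jap (k - l)) * (\<alpha> a l * \<alpha> c (k - l))" for k l
    proof (rule order_trans[OF C(2)], intro mult_left_mono mult_mono)
      show "norm (mode_pair a l) \<le> \<alpha> a l" "norm (mode_pair c (k - l)) \<le> \<alpha> c (k - l)"
        unfolding \<alpha>_def by (rule norm_mode_pair_le)+
    qed (use C \<alpha>0 in \<open>auto simp: min_def\<close>)
    have hsum: "((\<lambda>l. nf_symbol k l (mode_pair a l) (mode_pair c (k - l))) has_sum nf a c k) UNIV" for k
    proof -
      obtain B where B: "\<And>l. \<alpha> c l \<le> B"
      proof -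
        have "\<alpha> c l \<le> norm (enc r (\<alpha> c))" for l
        proof -
          have "1 * \<alpha> c l \<le> wt r l * \<alpha> c l" using wt_ge_1[of r l] r \<alpha>0 by (intro mult_right_mono) auto
          also have "\<dots> = norm (coord (enc r (\<alpha> c)) l)" using \<alpha>h[OF c] \<alpha>0[of c l] by (simp add: coord_enc)
          also have "\<dots> \<le> norm (enc r (\<alpha> c))" by (rule norm_coord_le)
          finally show ?thesis by simp
        qed
        then show ?thesis using that by blast
      qed
      have "(\<lambda>l. norm (nf_symbol k l (mode_pair a l) (mode_pair c (k - l)))) summable_on UNIV"
      proof (rule summable_on_comparison_test)
        show "(\<lambda>l. C * B * (jap l * \<alpha> a l)) summable_on UNIV" using jl[OF a] by (intro summable_on_cmult_right) auto
        show "norm (nf_symbol k l (mode_pair a l) (mode_pair c (k - l))) \<le> C * B * (jap l * \<alpha> a l)" for l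
        proof -
          have "C * min (jap l) (jap (k - l)) * (\<alpha> a l * \<alpha> c (k - l)) \<le> C * jap l * (\<alpha> a l * B)"
            using B C \<alpha>0 by (intro mult_mono mult_left_mono mult_nonneg_nonneg) auto
          then show ?thesis using tm[of k l] by (simp add: mult_ac)
        qed
      qed simp
      then show ?thesis unfolding nf_def by (rule has_sum_infsum[OF Infinite_Sum.abs_summable_summable])
    qed
    have enc: "norm (Abs_l2 (\<lambda>k. wt r k * \<gamma> k)) = hn r \<gamma>" "hs r \<gamma> \<Longrightarrow> in_l2 (\<lambda>k. wt r k * \<gamma> k)" for \<gamma> :: "int ^ 'd \<Rightarrow> real"
      by (simp_all add: hn_def enc_def hs_def)
    have est: "norm (wt r k *\<^sub>R nf a c k) \<le> S"
      if S: "((\<lambda>l. wt r l * \<alpha> a l * (D * (jap (k - l) * \<alpha> c (k - l))) + D * (jap l * \<alpha> a l) * (wt r (k - l) * \<alpha> c (k - l))) has_sum S) UNIV" for k S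
    proof (rule norm_infsum_le[OF has_sum_scaleR[OF hsum[of k], of "wt r k"] S])
      fix l
      define A where "A = C * (\<alpha> a l * \<alpha> c (k - l))"
      have A: "A \<ge> 0" using C \<alpha>0 by (simp add: A_def)
      have "norm (wt r k *\<^sub>R nf_symbol k l (mode_pair a l) (mode_pair c (k - l))) \<le> wt r k * (C * min (jap l) (jap (k - l)) * (\<alpha> a l * \<alpha> c (k - l)))"
        using tm[of k l] by (simp add: mult_left_mono)
      also have "\<dots> = wt r k * (min (jap l) (jap (k - l)) * A)" by (simp add: A_def)
      also have "\<dots> \<le> (2 powr r * (wt r l + wt r (k - l))) * (min (jap l) (jap (k - l)) * A)"
        using r A by (intro mult_right_mono wt_quasi_triangle mult_nonneg_nonneg) (auto simp: min_def)
      also have "\<dots> = 2 powr r * (wt r l * (min (jap l) (jap (k - l)) * A) + wt r (k - l) * (min (jap l) (jap (k - l)) * A))"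
        by (simp add: algebra_simps)
      also have "\<dots> \<le> 2 powr r * (wt r l * (jap (k - l) * A) + wt r (k - l) * (jap l * A))"
        using A by (intro mult_left_mono add_mono mult_right_mono) auto
      also have "\<dots> = wt r l * \<alpha> a l * (D * (jap (k - l) * \<alpha> c (k - l))) + D * (jap l * \<alpha> a l) * (wt r (k - l) * \<alpha> c (k - l))"
        by (simp add: A_def D_def algebra_simps)
      finally show "norm (wt r k *\<^sub>R nf_symbol k l (mode_pair a l) (mode_pair c (k - l)))
        \<le> wt r l * \<alpha> a l * (D * (jap (k - l) * \<alpha> c (k - l))) + D * (jap l * \<alpha> a l) * (wt r (k - l) * \<alpha> c (k - l))" .
    qed
    have p: "(\<lambda>l. D * (jap l * \<alpha> b l)) summable_on UNIV" "(\<Sum>\<^sub>\<infinity>l. D * (jap l * \<alpha> b l)) \<le> D * (?Ke * (2 * hn r b))" if "hs r b" for b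
    proof -
      show "(\<lambda>l. D * (jap l * \<alpha> b l)) summable_on UNIV" using jl[OF that] by (intro summable_on_cmult_right) auto
      have "(\<Sum>\<^sub>\<infinity>l. D * (jap l * \<alpha> b l)) = D * (\<Sum>\<^sub>\<infinity>l. jap l * \<alpha> b l)" using jl[OF that] by (intro infsum_cmult_right) auto
      also have "\<dots> \<le> D * (?Ke * (2 * hn r b))" using jl[OF that] by (intro mult_left_mono D0) auto
      finally show "(\<Sum>\<^sub>\<infinity>l. D * (jap l * \<alpha> b l)) \<le> D * (?Ke * (2 * hn r b))" .
    qed
    have nn: "0 \<le> D * (jap l * \<alpha> b l)" for b l using D0 \<alpha>0 by simp
    have Y: "in_l2 (\<lambda>k. wt r k *\<^sub>R nf a c k)" "norm (Abs_l2 (\<lambda>k. wt r k *\<^sub>R nf a c k)) \<le>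
        norm (Abs_l2 (\<lambda>k. wt r k * \<alpha> a k)) * (\<Sum>\<^sub>\<infinity>l. D * (jap l * \<alpha> c l)) + (\<Sum>\<^sub>\<infinity>l. D * (jap l * \<alpha> a l)) * norm (Abs_l2 (\<lambda>k. wt r k * \<alpha> c k))"
      using Young_l1_l2_symmetric[OF p(1)[OF a] nn p(1)[OF c] nn enc(2)[OF conjunct1[OF \<alpha>h[OF a]]] enc(2)[OF conjunct1[OF \<alpha>h[OF c]]],
          of "\<lambda>k. wt r k *\<^sub>R nf a c k"] est by auto
    have "hn r (\<alpha> a) * (\<Sum>\<^sub>\<infinity>l. D * (jap l * \<alpha> c l)) + (\<Sum>\<^sub>\<infinity>l. D * (jap l * \<alpha> a l)) * hn r (\<alpha> c)
        \<le> (2 * hn r a) * (D * (?Ke * (2 * hn r c))) + (D * (?Ke * (2 * hn r a))) * (2 * hn r c)"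
      using \<alpha>h[OF a] \<alpha>h[OF c] p(2)[OF a] p(2)[OF c] D0 by (intro add_mono mult_mono) (auto intro!: infsum_nonneg nn)
    also have "\<dots> = K * hn r a * hn r c" by (simp add: K_def)
    finally show ?thesis using Y hsum unfolding enc(1) by (simp add: hs_def hn_def enc_def)
  qed
  moreover have "K \<ge> 0" using D0 by (simp add: K_def)
  ultimately show ?thesis by blast
qed

lemma nf_has_sum:
  assumes "real CARD('d) + 1 \<le> r" "hs r a" "hs r c"
  shows "((\<lambda>l. nf_symbol k l (mode_pair a l) (mode_pair c (k - l))) has_sum nf a c k) UNIV" "hs r (nf a c)"
proof -
  have "(\<forall>k. ((\<lambda>l. nf_symbol k l (mode_pair a l) (mode_pair c (k - l))) has_sum nf a c k) UNIV) \<and> hs r (nf a c)"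
    using nf_bound[OF assms(1)] assms(2,3) by blast
  then show "((\<lambda>l. nf_symbol k l (mode_pair a l) (mode_pair c (k - l))) has_sum nf a c k) UNIV" "hs r (nf a c)" by auto
qed

lemma mode_pair_simps: "mode_pair (\<lambda>k. a k + b k) l = mode_pair a l + mode_pair b l"
    "mode_pair (\<lambda>k. r *\<^sub>R a k) l = r *\<^sub>R mode_pair a l"
  by (simp_all add: mode_pair_def)

text \<open>The same transformation on \<open>\<ell>\<^sup>2\<close>, to have the calculus of bounded bilinear maps at hand.\<close>

definition nf_bilinear :: "real \<Rightarrow> (int ^ 'd, complex ^ 'n) l2 \<Rightarrow> (int ^ 'd, complex ^ 'n) l2 \<Rightarrow> (int ^ 'd, complex ^ 'n) l2" where
  "nf_bilinear r x y = enc r (nf (dec r x) (dec r y))"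

lemma dec_fun: "dec r (x + y) = (\<lambda>k. dec r x k + dec r y k)" "dec r (c *\<^sub>R x) = (\<lambda>k. c *\<^sub>R dec r x k)"
  by (auto simp: dec_simps)

lemma bounded_bilinear_nf_bilinear:
  assumes r: "real CARD('d) + 1 \<le> r"
  shows "bounded_bilinear (nf_bilinear r)"
proof
  fix x x' y y' :: "(int ^ 'd, complex ^ 'n) l2" and t :: real
  note hsm = nf_has_sum(1)[OF r hs_dec hs_dec]
  have c: "coord (nf_bilinear r x y) k = wt r k *\<^sub>R nf (dec r x) (dec r y) k" for x y k
    unfolding nf_bilinear_def by (intro coord_enc nf_has_sum(2)[OF r] hs_dec)
  have "nf (dec r (x + x')) (dec r y) k = nf (dec r x) (dec r y) k + nf (dec r x') (dec r y) k" for k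
  proof (rule has_sum_unique)
    show "((\<lambda>l. nf_symbol k l (mode_pair (dec r (x + x')) l) (mode_pair (dec r y) (k - l))) has_sum nf (dec r (x + x')) (dec r y) k) UNIV"
      by (rule hsm)
    show "((\<lambda>l. nf_symbol k l (mode_pair (dec r (x + x')) l) (mode_pair (dec r y) (k - l))) has_sum nf (dec r x) (dec r y) k + nf (dec r x') (dec r y) k) UNIV"
      unfolding dec_fun mode_pair_simps nf_symbol_simps by (intro has_sum_add hsm)
  qed
  then show "nf_bilinear r (x + x') y = nf_bilinear r x y + nf_bilinear r x' y" by (intro l2_eqI) (simp add: c algebra_simps)
  have "nf (dec r x) (dec r (y + y')) k = nf (dec r x) (dec r y) k + nf (dec r x) (dec r y') k" for k
  proof (rule has_sum_unique)
    show "((\<lambda>l. nf_symbol k l (mode_pair (dec r x) l) (mode_pair (dec r (y + y')) (k - l))) has_sum nf (dec r x) (dec r (y + y')) k) UNIV"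
      by (rule hsm)
    show "((\<lambda>l. nf_symbol k l (mode_pair (dec r x) l) (mode_pair (dec r (y + y')) (k - l))) has_sum nf (dec r x) (dec r y) k + nf (dec r x) (dec r y') k) UNIV"
      unfolding dec_fun mode_pair_simps nf_symbol_simps by (intro has_sum_add hsm)
  qed
  then show "nf_bilinear r x (y + y') = nf_bilinear r x y + nf_bilinear r x y'" by (intro l2_eqI) (simp add: c algebra_simps)
  have "nf (dec r (t *\<^sub>R x)) (dec r y) k = t *\<^sub>R nf (dec r x) (dec r y) k" for k
  proof (rule has_sum_unique)
    show "((\<lambda>l. nf_symbol k l (mode_pair (dec r (t *\<^sub>R x)) l) (mode_pair (dec r y) (k - l))) has_sum nf (dec r (t *\<^sub>R x)) (dec r y) k) UNIV"
      by (rule hsm)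
    show "((\<lambda>l. nf_symbol k l (mode_pair (dec r (t *\<^sub>R x)) l) (mode_pair (dec r y) (k - l))) has_sum t *\<^sub>R nf (dec r x) (dec r y) k) UNIV"
      unfolding dec_fun mode_pair_simps nf_symbol_simps by (intro has_sum_scaleR hsm)
  qed
  then show "nf_bilinear r (t *\<^sub>R x) y = t *\<^sub>R nf_bilinear r x y" by (intro l2_eqI) (simp add: c algebra_simps)
  have "nf (dec r x) (dec r (t *\<^sub>R y)) k = t *\<^sub>R nf (dec r x) (dec r y) k" for k
  proof (rule has_sum_unique)
    show "((\<lambda>l. nf_symbol k l (mode_pair (dec r x) l) (mode_pair (dec r (t *\<^sub>R y)) (k - l))) has_sum nf (dec r x) (dec r (t *\<^sub>R y)) k) UNIV"
      by (rule hsm)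
    show "((\<lambda>l. nf_symbol k l (mode_pair (dec r x) l) (mode_pair (dec r (t *\<^sub>R y)) (k - l))) has_sum t *\<^sub>R nf (dec r x) (dec r y) k) UNIV"
      unfolding dec_fun mode_pair_simps nf_symbol_simps by (intro has_sum_scaleR hsm)
  qed
  then show "nf_bilinear r x (t *\<^sub>R y) = t *\<^sub>R nf_bilinear r x y" by (intro l2_eqI) (simp add: c algebra_simps)
next
  obtain K where K: "\<And>a c. hs r a \<Longrightarrow> hs r c \<Longrightarrow> hn r (nf a c) \<le> K * hn r a * hn r c"
    using nf_bound[OF r] by blast
  have "norm (nf_bilinear r x y) \<le> norm x * norm y * K" for x y
    using K[of "dec r x" "dec r y"] by (simp add: nf_bilinear_def hn_def[symmetric] mult_ac)
  then show "\<exists>K. \<forall>x y. norm (nf_bilinear r x y) \<le> norm x * norm y * K" by blast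
qed

text \<open>The unbounded operator \<open>g\<close> only acts on families for which \<open>g a\<close> is still in the sequence space; the
  equation is used one order below the regularity of the solution.\<close>

lemma nf_homological:
  assumes r: "real CARD('d) + 1 \<le> r" and a: "hs r a" "hs r (\<lambda>k. g k (a k))" and c: "hs r c" "hs r (\<lambda>k. g k (c k))"
  shows "((\<lambda>l. Q (mode_pair a l) (mode_pair c (k - l))) has_sum
     nf (\<lambda>k. g k (a k)) c k + nf a (\<lambda>k. g k (c k)) k - g k (nf a c k)) UNIV"
proof -
  have "((\<lambda>l. nf_symbol k l (mode_pair (\<lambda>k. g k (a k)) l) (mode_pair c (k - l)) + nf_symbol k l (mode_pair a l) (mode_pair (\<lambda>k. g k (c k)) (k - l))
      - g k (nf_symbol k l (mode_pair a l) (mode_pair c (k - l)))) has_sum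
     nf (\<lambda>k. g k (a k)) c k + nf a (\<lambda>k. g k (c k)) k - g k (nf a c k)) UNIV"
    by (intro has_sum_diff has_sum_add has_sum_bounded_linear[OF bounded_linear_g] nf_has_sum(1)[OF r] a c)
  then show ?thesis by (simp only: pair_gen_mode_pair nf_symbol_homological)
qed

end

section \<open>Long time existence for Klein-Gordon systems\<close>

lemma continuous_on_of_Lipschitz:
  fixes f :: "'a::real_normed_vector \<Rightarrow> 'b::real_normed_vector"
  assumes "\<And>x y. norm (f x - f y) \<le> L * norm (x - y)"
  shows "continuous_on S f"
proof -
  have "norm (f x - f y) \<le> \<bar>L\<bar> * norm (x - y)" for x y
    using assms[of x y] by (rule order_trans) (simp add: mult_right_mono)
  then have "\<bar>L\<bar>-lipschitz_on S f" by (intro lipschitz_onI) (auto simp: dist_norm)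
  then show ?thesis by (rule lipschitz_on_continuous_on)
qed

text \<open>The first time at which \<open>q\<close> could reach \<open>B\<close> satisfies the hypothesis of \<open>step\<close>.\<close>

lemma bootstrap:
  fixes q :: "real \<Rightarrow> real"
  assumes q: "continuous_on {0..T} q" "q 0 < B"
    and step: "\<And>t. t \<in> {0..T} \<Longrightarrow> (\<And>u. u \<in> {0..t} \<Longrightarrow> q u \<le> B) \<Longrightarrow> q t < B"
    and t: "t \<in> {0..T}"
  shows "q t < B"
proof (rule ccontr)
  assume n: "\<not> q t < B"
  define S where "S = {u \<in> {0..T}. B \<le> q u}"
  have "S = q -` {B..} \<inter> {0..T}" by (auto simp: S_def)
  then have "closed S" using continuous_on_closed_vimage[OF closed_atLeastAtMost, of 0 T q] q(1) closed_atLeast by blast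
  moreover have "S \<noteq> {}" "bdd_below S" using n t by (auto simp: S_def intro!: bdd_belowI[of _ 0])
  ultimately have inS: "Inf S \<in> S" by (intro closed_contains_Inf)
  define r where "r = Inf S"
  have r: "r \<in> {0..T}" "B \<le> q r" using inS by (auto simp: S_def r_def)
  have min: "r \<le> u" if "u \<in> S" for u unfolding r_def using that \<open>bdd_below S\<close> by (rule cInf_lower)
  have "\<exists>x. 0 \<le> x \<and> x \<le> r \<and> q x = B"
    by (rule IVT') (use q r in \<open>auto intro: continuous_on_subset\<close>)
  then obtain x where x: "0 \<le> x" "x \<le> r" "q x = B" by blast
  then have "x \<in> S" using r by (auto simp: S_def)
  then have "q r = B" using min[of x] x by auto
  moreover have "q u \<le> B" if "u \<in> {0..r}" for u
  proof (cases "u = r")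
    case False
    then have "u \<notin> S" using min[of u] that by auto
    then show ?thesis using that r by (auto simp: S_def)
  qed (use \<open>q r = B\<close> in simp)
  ultimately show False using step[OF r(1)] by auto
qed

text \<open>The order \<open>2 d + 2\<close> makes the product estimate available after the loss of one derivative, and makes
  solutions differentiable in the classical sense.\<close>

locale kg_system = kg_symbol m g \<kappa>
  for m :: real and g :: "int ^ 'd \<Rightarrow> complex ^ 'n \<Rightarrow> complex ^ 'n" and \<kappa> :: real +
  fixes G :: "complex ^ 'n \<Rightarrow> complex ^ 'n" and s :: real
  assumes G: "smooth G" "G 0 = 0" "\<And>v. dd G v 0 = 0" and s: "2 * real CARD('d) + 2 \<le> s"
begin

sublocale kg_quadratic m g \<kappa> "quad G"
  by (intro kg_quadratic.intro kg_symbol_axioms kg_quadratic_axioms.intro bounded_bilinear_quad)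

lemma s_simps: "real CARD('d) + 1 \<le> s - 1" "real CARD('d) + 1 \<le> s" "real CARD('d) \<le> s" "real CARD('d) + 2 \<le> s" "real CARD('d) \<le> s - 1"
  using s by auto

text \<open>The superposition operator, as a map of \<open>\<ell>\<^sup>2\<close>.\<close>

definition nemytskii :: "(complex ^ 'n \<Rightarrow> complex ^ 'n) \<Rightarrow> (int ^ 'd, complex ^ 'n) l2 \<Rightarrow> (int ^ 'd, complex ^ 'n) l2" where
  "nemytskii H x = enc s (comp_coeff H (dec s x))"

abbreviation "nonlin \<equiv> nemytskii G"

lemma hs_comp_coeff:
  fixes a :: "int ^ 'd \<Rightarrow> complex ^ 'n"
  assumes "smooth H" "hs s a"
  shows "hs s (comp_coeff H a)"
  using composition_bound[OF s hn_nonneg assms(1), of 0 s a] assms(2) by auto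

lemma coord_nemytskii: "smooth H \<Longrightarrow> coord (nemytskii H x) k = wt s k *\<^sub>R comp_coeff H (dec s x) k"
  unfolding nemytskii_def by (intro coord_enc hs_comp_coeff hs_dec)

lemma dec_nemytskii: "smooth H \<Longrightarrow> dec s (nemytskii H x) = comp_coeff H (dec s x)"
  unfolding nemytskii_def by (intro dec_enc hs_comp_coeff hs_dec)

lemma nemytskii_bound:
  assumes "smooth H" "vanishes k H" "M \<ge> 0"
  shows "\<exists>C\<ge>0. \<forall>x. norm x \<le> M \<longrightarrow> norm (nemytskii H x) \<le> C * norm x ^ k"
proof -
  obtain C where "C \<ge> 0" "\<And>a :: int ^ 'd \<Rightarrow> complex ^ 'n. hs s a \<Longrightarrow> hn s a \<le> M \<Longrightarrow> hs s (comp_coeff H a) \<and> hn s (comp_coeff H a) \<le> C * hn s a ^ k"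
    using composition_bound[OF s assms(3,1,2)] by blast
  then show ?thesis unfolding nemytskii_def hn_def[symmetric]
    by (intro exI[of _ C]) (metis hn_dec hs_dec)
qed

lemma nemytskii_Lipschitz:
  assumes "smooth H" "M \<ge> 0"
  shows "\<exists>L\<ge>0. \<forall>x y. norm x \<le> M \<longrightarrow> norm y \<le> M \<longrightarrow> norm (nemytskii H x - nemytskii H y) \<le> L * norm (x - y)"
proof -
  obtain L where L: "L \<ge> 0" "\<And>a a' :: int ^ 'd \<Rightarrow> complex ^ 'n. hs s a \<Longrightarrow> hs s a' \<Longrightarrow> hn s a \<le> M \<Longrightarrow> hn s a' \<le> M \<Longrightarrow>
     hs s (\<lambda>k. comp_coeff H a k - comp_coeff H a' k) \<and> hn s (\<lambda>k. comp_coeff H a k - comp_coeff H a' k) \<le> L * hn s (\<lambda>k. a k - a' k)"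
    using composition_Lipschitz[OF s assms(2,1)] by blast
  have "norm (nemytskii H x - nemytskii H y) \<le> L * norm (x - y)" if "norm x \<le> M" "norm y \<le> M" for x y
  proof -
    have "nemytskii H x - nemytskii H y = enc s (\<lambda>k. comp_coeff H (dec s x) k - comp_coeff H (dec s y) k)"
      unfolding nemytskii_def by (rule enc_diff(2)[symmetric]; intro hs_comp_coeff assms hs_dec)
    moreover have "(\<lambda>k. dec s x k - dec s y k) = dec s (x - y)" by (auto simp: dec_simps)
    ultimately show ?thesis using L(2)[OF hs_dec hs_dec, of x y] that by (simp add: hn_def[symmetric])
  qed
  then show ?thesis using L(1) by blast
qed

lemma continuous_on_nemytskii:
  assumes "smooth H"
  shows "continuous_on S (nemytskii H)"
proof -
  have "isCont (nemytskii H) x" for x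
  proof -
    obtain L where L: "L \<ge> 0" "\<And>y z. norm y \<le> norm x + 1 \<Longrightarrow> norm z \<le> norm x + 1 \<Longrightarrow> norm (nemytskii H y - nemytskii H z) \<le> L * norm (y - z)"
      using nemytskii_Lipschitz[OF assms, of "norm x + 1"] by auto
    have "L-lipschitz_on (ball x 1) (nemytskii H)"
    proof (rule lipschitz_onI)
      fix y z assume "y \<in> ball x 1" "z \<in> ball x 1"
      then have "norm y \<le> norm x + 1" "norm z \<le> norm x + 1"
        using norm_triangle_ineq[of x "y - x"] norm_triangle_ineq[of x "z - x"] by (auto simp: dist_norm norm_minus_commute)
      then show "dist (nemytskii H y) (nemytskii H z) \<le> L * dist y z" using L(2) by (simp add: dist_norm)
    qed (rule L)
    then have "continuous_on (ball x 1) (nemytskii H)" by (rule lipschitz_on_continuous_on)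
    then show ?thesis by (rule continuous_on_interior) simp
  qed
  then show ?thesis by (simp add: continuous_at_imp_continuous_on)
qed

subsection \<open>Passing between \<open>H\<^sup>s\<close> and \<open>H\<^sup>s\<^sup>-\<^sup>1\<close>\<close>

text \<open>The embedding of \<open>H\<^sup>s\<close> into \<open>H\<^sup>s\<^sup>-\<^sup>1\<close>, and the generator as a bounded operator between these spaces.\<close>

definition emb :: "(int ^ 'd, complex ^ 'n) l2 \<Rightarrow> (int ^ 'd, complex ^ 'n) l2" where
  "emb x = enc (s - 1) (dec s x)"

definition gen :: "(int ^ 'd, complex ^ 'n) l2 \<Rightarrow> (int ^ 'd, complex ^ 'n) l2" where
  "gen x = enc (s - 1) (\<lambda>k. g k (dec s x k))"

lemma hs_low: "hs (s - 1) (dec s x)" by (rule hs_le(1)[OF hs_dec]) simp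

lemma hs_gen: "hs (s - 1) (\<lambda>k. g k (dec s x k))" and norm_gen_le: "norm (gen x) \<le> \<kappa> * (1 + m) * norm x"
proof -
  have le: "norm (wt (s - 1) k *\<^sub>R g k (dec s x k)) \<le> norm ((\<kappa> * (1 + m)) *\<^sub>R (wt s k *\<^sub>R dec s x k))" for k
  proof -
    have "norm (g k (dec s x k)) \<le> \<kappa> * ((1 + m) * jap k) * norm (dec s x k)"
      using \<kappa> by (intro order_trans[OF bd] mult_right_mono mult_left_mono dispersion_freq_le_jap m) auto
    then have "wt (s - 1) k * norm (g k (dec s x k)) \<le> wt (s - 1) k * (\<kappa> * ((1 + m) * jap k) * norm (dec s x k))"
      by (intro mult_left_mono) auto
    also have "\<dots> = \<kappa> * (1 + m) * (wt (s - 1) k * wt 1 k * norm (dec s x k))" by (simp add: wt_1)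
    also have "wt (s - 1) k * wt 1 k = wt s k" unfolding wt_add[symmetric] by simp
    finally show ?thesis using \<kappa> m by (simp add: abs_mult)
  qed
  from hs_mono[OF hs_dec this] show "hs (s - 1) (\<lambda>k. g k (dec s x k))" "norm (gen x) \<le> \<kappa> * (1 + m) * norm x"
    using \<kappa> m by (simp_all add: gen_def hn_def[symmetric] abs_mult)
qed

lemma coord_emb: "coord (emb x) k = wt (s - 1) k *\<^sub>R dec s x k"
  unfolding emb_def by (rule coord_enc[OF hs_low])

lemma coord_gen: "coord (gen x) k = wt (s - 1) k *\<^sub>R g k (dec s x k)"
  unfolding gen_def by (rule coord_enc[OF hs_gen])

lemma bounded_linear_emb: "bounded_linear emb"
proof (rule bounded_linear_intro[where K = 1])
  show "norm (emb x) \<le> norm x * 1" for x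
    using hs_le(2)[OF hs_dec[of s x], of "s - 1"] by (simp add: emb_def hn_def[symmetric])
qed (rule l2_eqI, simp add: coord_emb dec_simps algebra_simps)+

lemma bounded_linear_gen: "bounded_linear gen"
proof (rule bounded_linear_intro[where K = "\<kappa> * (1 + m)"])
  show "norm (gen x) \<le> norm x * (\<kappa> * (1 + m))" for x using norm_gen_le[of x] by (simp add: mult_ac)
qed (rule l2_eqI, simp add: coord_gen dec_simps g_simps algebra_simps)+

lemma dec_emb: "dec (s - 1) (emb x) = dec s x" unfolding emb_def by (rule dec_enc[OF hs_low])

lemma dec_gen: "dec (s - 1) (gen x) = (\<lambda>k. g k (dec s x k))" unfolding gen_def by (rule dec_enc[OF hs_gen])

text \<open>A solution is differentiable with a loss of one derivative.\<close>

lemma emb_derivative: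
  assumes I: "open I" "convex I" and x: "continuous_on I x" and n: "continuous_on I n"
    and d: "\<And>t k. t \<in> I \<Longrightarrow> ((\<lambda>t. coord (x t) k) has_vector_derivative g k (coord (x t) k) + coord (n t) k) (at t)"
    and t: "t \<in> I"
  shows "((\<lambda>t. emb (x t)) has_vector_derivative gen (x t) + emb (n t)) (at t)"
proof (rule l2_has_vector_derivative_coordwise[OF _ _ I t])
  fix t k assume t: "t \<in> I"
  have "((\<lambda>t. (wt (s - 1) k / wt s k) *\<^sub>R coord (x t) k) has_vector_derivative (wt (s - 1) k / wt s k) *\<^sub>R (g k (coord (x t) k) + coord (n t) k)) (at t)"
    by (intro bounded_linear.has_vector_derivative[OF bounded_linear_scaleR_right] d t)
  then show "((\<lambda>t. coord (emb (x t)) k) has_vector_derivative coord (gen (x t) + emb (n t)) k) (at t)"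
    by (simp add: coord_emb coord_gen dec_def g_simps algebra_simps)
next
  show "continuous_on I (\<lambda>t. gen (x t) + emb (n t))"
    by (intro continuous_intros bounded_linear.continuous_on[OF bounded_linear_gen x] bounded_linear.continuous_on[OF bounded_linear_emb n])
qed

text \<open>If \<open>n\<close> is the full nonlinearity, the difference \<open>n - Q(x, x)\<close> is of third order, and so are the
  remaining terms: the transformed unknown is driven by cubic terms. The derivative is computed
  in \<open>H\<^sup>s\<^sup>-\<^sup>1\<close>, where \<open>x\<close> is differentiable; the homological equation cancels all the unbounded terms, and the
  result lies in \<open>H\<^sup>s\<close>.\<close>

lemma normal_form_derivative:
  assumes x: "continuous_on UNIV x" and n: "continuous_on UNIV n"
    and d: "\<And>t k. ((\<lambda>t. coord (x t) k) has_vector_derivative g k (coord (x t) k) + coord (n t) k) (at t)"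
  shows "((\<lambda>t. flow (- t) (x t - nf_bilinear s (x t) (x t))) has_vector_derivative
     flow (- t) (n t - nemytskii (\<lambda>z. hess G z z) (x t) - nf_bilinear s (n t) (x t) - nf_bilinear s (x t) (n t))) (at t)"
proof (rule l2_has_vector_derivative_coordwise[where I = UNIV])
  let ?B = "nf_bilinear (s - 1)"
  note bb = bounded_bilinear_nf_bilinear[OF s_simps(2)] and bb' = bounded_bilinear_nf_bilinear[OF s_simps(1)]
  have sh: "smooth (\<lambda>z. hess G z z)" by (rule smooth_quadratic[OF bounded_bilinear_hess])
  fix t k
  let ?a = "dec s (x t)" and ?N = "dec s (n t)"
  have y: "((\<lambda>t. emb (x t)) has_vector_derivative gen (x t) + emb (n t)) (at t)"
    by (rule emb_derivative[OF open_UNIV convex_UNIV x n d UNIV_I])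
  have cB: "coord (nf_bilinear s y z) k = wt s k *\<^sub>R nf (dec s y) (dec s z) k" for y z
    unfolding nf_bilinear_def by (intro coord_enc nf_has_sum(2)[OF s_simps(2)] hs_dec)
  have cB': "coord (?B y z) k = wt (s - 1) k *\<^sub>R nf (dec (s - 1) y) (dec (s - 1) z) k" for y z
    unfolding nf_bilinear_def by (intro coord_enc nf_has_sum(2)[OF s_simps(1)] hs_dec)
  have "((\<lambda>t. ?B (emb (x t)) (emb (x t))) has_vector_derivative ?B (emb (x t)) (gen (x t) + emb (n t)) + ?B (gen (x t) + emb (n t)) (emb (x t))) (at t)"
    by (rule bounded_bilinear.has_vector_derivative[OF bb' y y])
  also have "?B (emb (x t)) (gen (x t) + emb (n t)) + ?B (gen (x t) + emb (n t)) (emb (x t))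
     = ?B (gen (x t)) (emb (x t)) + ?B (emb (x t)) (gen (x t)) + ?B (emb (n t)) (emb (x t)) + ?B (emb (x t)) (emb (n t))"
    by (simp add: bounded_bilinear.add_left[OF bb'] bounded_bilinear.add_right[OF bb'])
  finally have "((\<lambda>t. (wt s k / wt (s - 1) k) *\<^sub>R coord (?B (emb (x t)) (emb (x t))) k) has_vector_derivative
     (wt s k / wt (s - 1) k) *\<^sub>R coord (?B (gen (x t)) (emb (x t)) + ?B (emb (x t)) (gen (x t)) + ?B (emb (n t)) (emb (x t)) + ?B (emb (x t)) (emb (n t))) k) (at t)"
    by (intro bounded_linear.has_vector_derivative[OF bounded_linear_scaleR_right] bounded_linear.has_vector_derivative[OF bounded_linear_coord])
  then have dB: "((\<lambda>t. coord (nf_bilinear s (x t) (x t)) k) has_vector_derivative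
     wt s k *\<^sub>R (nf (\<lambda>k. g k (?a k)) ?a k + nf ?a (\<lambda>k. g k (?a k)) k + nf ?N ?a k + nf ?a ?N k)) (at t)"
    by (simp add: cB cB' dec_emb dec_gen algebra_simps)
  have "((\<lambda>l. quad G (mode_pair ?a l) (mode_pair ?a (k - l))) has_sum nf (\<lambda>k. g k (?a k)) ?a k + nf ?a (\<lambda>k. g k (?a k)) k - g k (nf ?a ?a k)) UNIV"
    by (intro nf_homological[OF s_simps(1)] hs_low hs_gen)
  moreover have "((\<lambda>l. quad G (mode_pair ?a l) (mode_pair ?a (k - l))) has_sum comp_coeff (\<lambda>z. hess G z z) ?a k) UNIV"
    by (intro comp_coeff_hess_has_sum hs_l1(1)[OF hs_dec] s_simps)
  ultimately have hom: "nf (\<lambda>k. g k (?a k)) ?a k + nf ?a (\<lambda>k. g k (?a k)) k = comp_coeff (\<lambda>z. hess G z z) ?a k + g k (nf ?a ?a k)"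
    using has_sum_unique by fastforce
  have "((\<lambda>t. coord (x t) k - coord (nf_bilinear s (x t) (x t)) k) has_vector_derivative
      (g k (coord (x t) k) + coord (n t) k) - wt s k *\<^sub>R (comp_coeff (\<lambda>z. hess G z z) ?a k + g k (nf ?a ?a k) + nf ?N ?a k + nf ?a ?N k)) (at t)"
    using dB unfolding hom by (intro has_vector_derivative_diff d)
  also have "(g k (coord (x t) k) + coord (n t) k) - wt s k *\<^sub>R (comp_coeff (\<lambda>z. hess G z z) ?a k + g k (nf ?a ?a k) + nf ?N ?a k + nf ?a ?N k)
     = g k (coord (x t) k - coord (nf_bilinear s (x t) (x t)) k) + coord (n t - nemytskii (\<lambda>z. hess G z z) (x t) - nf_bilinear s (n t) (x t) - nf_bilinear s (x t) (n t)) k"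
    by (simp add: cB coord_nemytskii[OF sh] g_simps algebra_simps)
  finally show "((\<lambda>t. coord (flow (- t) (x t - nf_bilinear s (x t) (x t))) k) has_vector_derivative
     coord (flow (- t) (n t - nemytskii (\<lambda>z. hess G z z) (x t) - nf_bilinear s (n t) (x t) - nf_bilinear s (x t) (n t))) k) (at t)"
    unfolding coord_flow minus_l2.rep_eq by (rule U_backward_derivative)
next
  have sh: "smooth (\<lambda>z. hess G z z)" by (rule smooth_quadratic[OF bounded_bilinear_hess])
  show "continuous_on UNIV (\<lambda>t. flow (- t) (n t - nemytskii (\<lambda>z. hess G z z) (x t) - nf_bilinear s (n t) (x t) - nf_bilinear s (x t) (n t)))"
    by (intro flow_continuous_compose continuous_intros x n bounded_bilinear.continuous_on[OF bounded_bilinear_nf_bilinear[OF s_simps(2)]]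
        continuous_on_compose2[OF continuous_on_nemytskii[OF sh] x]) auto
qed auto

subsection \<open>The global truncated flow and the bootstrap\<close>

text \<open>The truncation at radius \<open>1\<close> does not affect solutions that stay in the unit ball.\<close>

lemma truncated_solution:
  "\<exists>b. b 0 = b0 \<and> (\<forall>t. (b has_vector_derivative flow (- t) (nonlin (retract_ball 1 (flow t (b t))))) (at t))"
proof -
  obtain L where L: "L \<ge> 0" "\<And>x y. norm x \<le> 1 \<Longrightarrow> norm y \<le> 1 \<Longrightarrow> norm (nonlin x - nonlin y) \<le> L * norm (x - y)"
    using nemytskii_Lipschitz[OF G(1), of 1] by auto
  obtain C where C: "C \<ge> 0" "\<And>x. norm x \<le> 1 \<Longrightarrow> norm (nonlin x) \<le> C"
    using nemytskii_bound[OF G(1), of 0 1] by auto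
  let ?k = "1 + \<kappa>"
  have k: "?k \<ge> 0" using \<kappa> by simp
  have lipR: "norm (nonlin (retract_ball 1 x) - nonlin (retract_ball 1 y)) \<le> 2 * L * norm (x - y)" for x y
  proof -
    have "norm (nonlin (retract_ball 1 x) - nonlin (retract_ball 1 y)) \<le> L * norm (retract_ball 1 x - retract_ball 1 y)"
      by (intro L(2) norm_retract_ball) auto
    also have "\<dots> \<le> L * (2 * norm (x - y))" by (intro mult_left_mono retract_ball_Lipschitz L) simp
    finally show ?thesis by simp
  qed
  show ?thesis
  proof (rule global_ode_solution[where L = "?k * (2 * L) * ?k + 1" and B = "?k * C"])
    have "continuous_on UNIV (\<lambda>p :: real \<times> (int ^ 'd, complex ^ 'n) l2. flow (- fst p) (nonlin (retract_ball 1 (flow (fst p) (snd p)))))"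
      by (intro flow_continuous_compose continuous_intros continuous_on_compose2[OF continuous_on_of_Lipschitz[OF lipR, of UNIV]]) auto
    then show "continuous_on UNIV (\<lambda>(t, x). flow (- t) (nonlin (retract_ball 1 (flow t x))))" by (simp add: case_prod_unfold)
    show "norm (flow (- t) (nonlin (retract_ball 1 (flow t x))) - flow (- t) (nonlin (retract_ball 1 (flow t y)))) \<le> (?k * (2 * L) * ?k + 1) * norm (x - y)" for t x y
    proof -
      have "norm (flow (- t) (nonlin (retract_ball 1 (flow t x))) - flow (- t) (nonlin (retract_ball 1 (flow t y)))) \<le> ?k * norm (nonlin (retract_ball 1 (flow t x)) - nonlin (retract_ball 1 (flow t y)))"
        unfolding flow_diff[symmetric] by (rule norm_flow_le)
      also have "\<dots> \<le> ?k * (2 * L * norm (flow t x - flow t y))" by (intro mult_left_mono lipR k)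
      also have "\<dots> \<le> ?k * (2 * L * (?k * norm (x - y)))"
        unfolding flow_diff[symmetric] using L(1) k by (intro mult_left_mono norm_flow_le) auto
      also have "\<dots> \<le> (?k * (2 * L) * ?k + 1) * norm (x - y)" by (simp add: algebra_simps)
      finally show ?thesis .
    qed
    show "0 < ?k * (2 * L) * ?k + 1" using L(1) k by (intro add_nonneg_pos mult_nonneg_nonneg) auto
    show "norm (flow (- t) (nonlin (retract_ball 1 (flow t x)))) \<le> ?k * C" for t x
      using norm_flow_le[of "- t" "nonlin (retract_ball 1 (flow t x))"] mult_left_mono[OF C(2)[OF norm_retract_ball[of 1 "flow t x"]] k] by simp
  qed
qed

text \<open>While \<open>\<parallel>b\<parallel> \<le> 2 \<epsilon>\<close>, the solution \<open>x\<close> has norm at most \<open>\<mu> \<epsilon>\<close>, the profile \<open>b\<close> differs from the profile \<open>w\<close>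
  of the transformed unknown by at most \<open>P \<epsilon>\<^sup>2 / 2\<close>, and \<open>w\<close> moves with speed at most \<open>R \<epsilon>\<^sup>3\<close>. Up to the time
  \<open>c \<epsilon>\<^sup>-\<^sup>2\<close> this gives \<open>\<parallel>b\<parallel> \<le> \<epsilon> + P \<epsilon>\<^sup>2 + R c \<epsilon> < 2 \<epsilon>\<close>, which closes the bootstrap.\<close>

theorem long_time_solution:
  "\<exists>\<epsilon>\<^sub>0>0. \<exists>c>0. \<forall>\<epsilon>\<in>{0<..\<epsilon>\<^sub>0}. \<forall>b0. norm b0 \<le> \<epsilon> \<longrightarrow>
    (\<exists>b. b 0 = b0 \<and> continuous_on UNIV b \<and> (\<forall>t. \<bar>t\<bar> \<le> c / \<epsilon>\<^sup>2 \<longrightarrow> (b has_vector_derivative flow (- t) (nonlin (flow t (b t)))) (at t)))"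
proof -
  define H where "H z = G z - hess G z z" for z
  have H: "smooth H" "vanishes 3 H" unfolding H_def[abs_def] by (rule Taylor_remainder_vanishes[OF G])+
  have sh: "smooth (\<lambda>z. hess G z z)" by (rule smooth_quadratic[OF bounded_bilinear_hess])
  obtain C2 where C2: "C2 \<ge> 0" "\<And>x. norm x \<le> 1 \<Longrightarrow> norm (nonlin x) \<le> C2 * norm x ^ 2"
    using nemytskii_bound[OF G(1) vanishes_2[OF G(2,3)], of 1] by auto
  obtain C3 where C3: "C3 \<ge> 0" "\<And>x. norm x \<le> 1 \<Longrightarrow> norm (nemytskii H x) \<le> C3 * norm x ^ 3"
    using nemytskii_bound[OF H, of 1] by auto
  obtain KB where KB: "KB \<ge> 0" "\<And>x y. norm (nf_bilinear s x y) \<le> norm x * norm y * KB"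
    using bounded_bilinear.nonneg_bounded[OF bounded_bilinear_nf_bilinear[OF s_simps(2)]] by blast
  have EEH: "nemytskii H x = nonlin x - nemytskii (\<lambda>z. hess G z z) x" for x
  proof (rule l2_eqI)
    fix k
    have e: "comp_coeff H (dec s x) k = comp_coeff G (dec s x) k - comp_coeff (\<lambda>z. hess G z z) (dec s x) k"
      unfolding comp_coeff_def H_def by (intro fourier_coeff_diff smooth_syn_CP[OF hs_dec s_simps(3)] G(1) sh)
    show "coord (nemytskii H x) k = coord (nonlin x - nemytskii (\<lambda>z. hess G z z) x) k"
      by (simp only: coord_nemytskii[OF H(1)] coord_nemytskii[OF G(1)] coord_nemytskii[OF sh] minus_l2.rep_eq e scaleR_diff_right)
  qed
  define \<mu> where "\<mu> = 2 * (1 + \<kappa>)"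
  have \<mu>: "\<mu> \<ge> 2" using \<kappa> by (simp add: \<mu>_def)
  define P where "P = 2 * (1 + \<kappa>) * KB * \<mu>\<^sup>2"
  define R where "R = (1 + \<kappa>) * (C3 + 2 * KB * C2) * \<mu> ^ 3"
  have P: "P \<ge> 0" and R: "R \<ge> 0" using \<kappa> \<mu> KB C2 C3 by (simp_all add: P_def R_def)
  \<comment> \<open>the first bound keeps \<open>x\<close> in the unit ball, the second one gives \<open>P \<epsilon>\<^sup>2 \<le> \<epsilon> / 4\<close>\<close>
  define \<epsilon>\<^sub>0 where "\<epsilon>\<^sub>0 = min (1 / \<mu>) (1 / (4 * (P + 1)))"
  define c where "c = 1 / (4 * (R + 1))"
  have e0: "\<epsilon>\<^sub>0 > 0" "\<epsilon>\<^sub>0 * \<mu> \<le> 1" "P * \<epsilon>\<^sub>0 \<le> 1 / 4"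
  proof -
    show "\<epsilon>\<^sub>0 > 0" using \<mu> P by (simp add: \<epsilon>\<^sub>0_def)
    have "\<epsilon>\<^sub>0 * \<mu> \<le> 1 / \<mu> * \<mu>" using \<mu> by (intro mult_right_mono) (auto simp: \<epsilon>\<^sub>0_def)
    then show "\<epsilon>\<^sub>0 * \<mu> \<le> 1" using \<mu> by simp
    have "P * \<epsilon>\<^sub>0 \<le> P * (1 / (4 * (P + 1)))" using P by (intro mult_left_mono) (auto simp: \<epsilon>\<^sub>0_def)
    also have "\<dots> \<le> 1 / 4" using P by (simp add: field_simps)
    finally show "P * \<epsilon>\<^sub>0 \<le> 1 / 4" .
  qed
  have c: "c > 0" "R * c \<le> 1 / 4" using R by (simp_all add: c_def field_simps)
  have main: "\<exists>b. b 0 = b0 \<and> continuous_on UNIV b \<and> (\<forall>t. \<bar>t\<bar> \<le> c / \<epsilon>\<^sup>2 \<longrightarrow> (b has_vector_derivative flow (- t) (nonlin (flow t (b t)))) (at t))"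
    if \<epsilon>: "\<epsilon> > 0" "\<epsilon> \<le> \<epsilon>\<^sub>0" and b0: "norm b0 \<le> \<epsilon>" for \<epsilon> b0
  proof -
    obtain b where b: "b 0 = b0" "\<And>t. (b has_vector_derivative flow (- t) (nonlin (retract_ball 1 (flow t (b t))))) (at t)"
      using truncated_solution[of b0] by blast
    have bc: "continuous_on UNIV b"
      using b(2) by (intro continuous_at_imp_continuous_on) (blast intro: has_vector_derivative_continuous)
    define x where "x t = flow t (b t)" for t
    define n where "n t = nonlin (retract_ball 1 (x t))" for t
    have xc: "continuous_on UNIV x" unfolding x_def by (intro flow_continuous_compose continuous_intros bc)
    have nc: "continuous_on UNIV n" unfolding n_def
      by (intro continuous_on_compose2[OF continuous_on_nemytskii[OF G(1), of UNIV]] continuous_on_compose2[OF continuous_on_of_Lipschitz[OF retract_ball_Lipschitz, of 1 UNIV] xc]) auto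
    have xd: "((\<lambda>t. coord (x t) k) has_vector_derivative g k (coord (x t) k) + coord (n t) k) (at t)" for t k
    proof -
      have "((\<lambda>t. coord (b t) k) has_vector_derivative coord (flow (- t) (n t)) k) (at t)"
        using bounded_linear.has_vector_derivative[OF bounded_linear_coord b(2)] unfolding n_def x_def .
      from U_has_vector_derivative[OF this, of k] show ?thesis by (simp add: x_def coord_flow add.commute)
    qed
    define w where "w t = flow (- t) (x t - nf_bilinear s (x t) (x t))" for t
    define w' where "w' t = flow (- t) (n t - nemytskii (\<lambda>z. hess G z z) (x t) - nf_bilinear s (n t) (x t) - nf_bilinear s (x t) (n t))" for t
    have wd: "(w has_vector_derivative w' t) (at t)" for t
      unfolding w_def w'_def by (rule normal_form_derivative[OF xc nc xd])
    have "\<epsilon> * \<mu> \<le> \<epsilon>\<^sub>0 * \<mu>" using \<mu> by (intro mult_right_mono \<epsilon>(2)) simp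
    then have \<epsilon>\<mu>: "\<mu> * \<epsilon> \<le> 1" using e0(2) by (simp add: mult.commute)
    have xle: "norm (x t) \<le> \<mu> * \<epsilon>" if "norm (b t) \<le> 2 * \<epsilon>" for t
      using norm_flow_le[of t "b t"] mult_left_mono[OF that, of "1 + \<kappa>"] \<kappa> by (simp add: x_def \<mu>_def algebra_simps)
    have small: "retract_ball 1 (x t) = x t" if "norm (b t) \<le> 2 * \<epsilon>" for t
      using xle[OF that] \<epsilon>\<mu> by (simp add: retract_ball_def)
    have w'le: "norm (w' t) \<le> R * \<epsilon> ^ 3" if bt: "norm (b t) \<le> 2 * \<epsilon>" for t
    proof -
      let ?y = "norm (x t)"
      have x1: "?y \<le> 1" using xle[OF bt] \<epsilon>\<mu> by linarith
      have n: "n t = nonlin (x t)" by (simp add: n_def small[OF bt])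
      have "norm (w' t) \<le> (1 + \<kappa>) * norm (nemytskii H (x t) - nf_bilinear s (n t) (x t) - nf_bilinear s (x t) (n t))"
        unfolding w'_def n EEH by (rule norm_flow_le)
      also have "norm (nemytskii H (x t) - nf_bilinear s (n t) (x t) - nf_bilinear s (x t) (n t)) \<le> norm (nemytskii H (x t)) + norm (nf_bilinear s (n t) (x t)) + norm (nf_bilinear s (x t) (n t))"
        by (intro order_trans[OF norm_triangle_ineq4] add_mono norm_triangle_ineq4 order_refl)
      also have "\<dots> \<le> C3 * ?y ^ 3 + norm (n t) * ?y * KB + ?y * norm (n t) * KB"
        by (intro add_mono C3 KB x1)
      also have "\<dots> \<le> C3 * ?y ^ 3 + (C2 * ?y\<^sup>2) * ?y * KB + ?y * (C2 * ?y\<^sup>2) * KB"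
        unfolding n using C2(2)[OF x1] KB by (intro add_mono mult_right_mono mult_left_mono) auto
      also have "\<dots> = (C3 + 2 * KB * C2) * ?y ^ 3" by (simp add: algebra_simps power2_eq_square power3_eq_cube)
      also have "\<dots> \<le> (C3 + 2 * KB * C2) * (\<mu> * \<epsilon>) ^ 3"
        using C3 KB C2 by (intro mult_left_mono power_mono xle bt) auto
      finally show ?thesis using \<kappa> by (simp add: R_def power_mult_distrib mult_ac)
    qed
    have Ble: "norm (flow (- t) (nf_bilinear s (x t) (x t))) \<le> P / 2 * \<epsilon>\<^sup>2" if bt: "norm (b t) \<le> 2 * \<epsilon>" for t
    proof -
      have "norm (flow (- t) (nf_bilinear s (x t) (x t))) \<le> (1 + \<kappa>) * (norm (x t) * norm (x t) * KB)"
        using \<kappa> by (intro order_trans[OF norm_flow_le] mult_left_mono KB) auto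
      also have "\<dots> \<le> (1 + \<kappa>) * ((\<mu> * \<epsilon>) * (\<mu> * \<epsilon>) * KB)"
        using \<kappa> KB xle[OF bt] \<mu> \<epsilon> by (intro mult_left_mono mult_right_mono mult_mono) auto
      also have "\<dots> = P / 2 * \<epsilon>\<^sup>2" by (simp add: P_def power2_eq_square)
      finally show ?thesis .
    qed
    have beq: "b t = w t + flow (- t) (nf_bilinear s (x t) (x t))" for t
      unfolding w_def flow_diff by (simp add: x_def)
    define T where "T = c / \<epsilon>\<^sup>2"
    have step: "norm (b t) < 2 * \<epsilon>" if t: "\<bar>t\<bar> \<le> T" and u: "\<And>u. \<bar>u\<bar> \<le> \<bar>t\<bar> \<Longrightarrow> norm (b u) \<le> 2 * \<epsilon>" for t
    proof -
      have "norm (w t - w 0) \<le> R * \<epsilon> ^ 3 * \<bar>t\<bar> - R * \<epsilon> ^ 3 * 0"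
      proof (rule norm_diff_le_of_derivative_le[where g = w' and \<phi> = "\<lambda>u. R * \<epsilon> ^ 3 * u" and \<phi>' = "\<lambda>_. R * \<epsilon> ^ 3"])
        show "((\<lambda>u. R * \<epsilon> ^ 3 * u) has_vector_derivative R * \<epsilon> ^ 3) (at u)" for u
          by (auto intro!: derivative_eq_intros simp: has_real_derivative_iff_has_vector_derivative[symmetric])
      qed (use wd w'le u in auto)
      also have "\<dots> \<le> R * \<epsilon> ^ 3 * T" using t R \<epsilon> by (simp add: mult_left_mono)
      also have "\<dots> = R * c * \<epsilon>" using \<epsilon> by (simp add: T_def power2_eq_square power3_eq_cube)
      also have "\<dots> \<le> 1 / 4 * \<epsilon>" using c \<epsilon> by (intro mult_right_mono) auto
      finally have 1: "norm (w t - w 0) \<le> \<epsilon> / 4" by simp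
      have "P * \<epsilon>\<^sup>2 \<le> (P * \<epsilon>\<^sub>0) * \<epsilon>"
        using mult_left_mono[OF mult_right_mono[OF \<epsilon>(2), of \<epsilon>] P] \<epsilon> by (simp add: power2_eq_square mult_ac)
      also have "\<dots> \<le> 1 / 4 * \<epsilon>" using e0 \<epsilon> by (intro mult_right_mono) auto
      finally have 2: "P * \<epsilon>\<^sup>2 \<le> \<epsilon> / 4" by simp
      have Bt: "norm (flow (- t) (nf_bilinear s (x t) (x t))) \<le> P / 2 * \<epsilon>\<^sup>2" and B0: "norm (flow (- 0) (nf_bilinear s (x 0) (x 0))) \<le> P / 2 * \<epsilon>\<^sup>2"
        by (rule Ble, rule u, simp)+
      have "norm (w 0) \<le> norm (b 0) + norm (flow (- 0) (nf_bilinear s (x 0) (x 0)))"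
        using beq[of 0] norm_triangle_ineq4[of "b 0" "flow (- 0) (nf_bilinear s (x 0) (x 0))"] by (simp add: algebra_simps)
      moreover have "norm (b t) \<le> norm (w t - w 0) + norm (w 0) + norm (flow (- t) (nf_bilinear s (x t) (x t)))"
        using norm_triangle_ineq[of "w t" "flow (- t) (nf_bilinear s (x t) (x t))"] norm_triangle_ineq[of "w t - w 0" "w 0"] beq[of t] by simp
      moreover have "P / 2 * \<epsilon>\<^sup>2 + P / 2 * \<epsilon>\<^sup>2 = P * \<epsilon>\<^sup>2" by simp
      moreover have "norm (b 0) \<le> \<epsilon>" using b0 b(1) by simp
      ultimately show ?thesis using 1 2 Bt B0 \<epsilon>(1) by linarith
    qed
    \<comment> \<open>both time directions in one continuity argument\<close>
    define q where "q t = max (norm (b t)) (norm (b (- t)))" for t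
    have q: "q t < 2 * \<epsilon>" if t: "t \<in> {0..T}" for t
    proof (rule bootstrap[OF _ _ _ t])
      have "continuous_on UNIV (\<lambda>t. b (- t))" by (intro continuous_on_compose2[OF bc] continuous_intros) auto
      then have "continuous_on UNIV q" unfolding q_def by (intro continuous_intros bc)
      then show "continuous_on {0..T} q" by (rule continuous_on_subset) auto
      show "q 0 < 2 * \<epsilon>" using b0 b(1) \<epsilon>(1) by (simp add: q_def)
      fix t assume t: "t \<in> {0..T}" and u: "\<And>u. u \<in> {0..t} \<Longrightarrow> q u \<le> 2 * \<epsilon>"
      have bu: "norm (b u) \<le> 2 * \<epsilon>" if "\<bar>u\<bar> \<le> t" for u
        using u[of "\<bar>u\<bar>"] that by (cases "u \<ge> 0") (auto simp: q_def)
      show "q t < 2 * \<epsilon>" unfolding q_def using step[of t] step[of "- t"] t bu by simp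
    qed
    have "norm (b t) \<le> 2 * \<epsilon>" if "\<bar>t\<bar> \<le> T" for t
      using q[of "\<bar>t\<bar>"] that by (cases "t \<ge> 0") (auto simp: q_def)
    then have "(b has_vector_derivative flow (- t) (nonlin (flow t (b t)))) (at t)" if "\<bar>t\<bar> \<le> T" for t
      using b(2)[of t] small[of t] that by (simp add: x_def)
    then show ?thesis using b(1) bc unfolding T_def by blast
  qed
  have "\<forall>\<epsilon>\<in>{0<..\<epsilon>\<^sub>0}. \<forall>b0. norm b0 \<le> \<epsilon> \<longrightarrow>
    (\<exists>b. b 0 = b0 \<and> continuous_on UNIV b \<and> (\<forall>t. \<bar>t\<bar> \<le> c / \<epsilon>\<^sup>2 \<longrightarrow> (b has_vector_derivative flow (- t) (nonlin (flow t (b t)))) (at t)))"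
    using main by simp
  then show ?thesis using e0(1) c(1) by blast
qed

end

section \<open>Sobolev curves and their Fourier coefficients\<close>

text \<open>The isometry from \<open>H\<^sup>r\<close>, modulo null sets, to \<open>\<ell>\<^sup>2\<close>. It translates curves in Sobolev spaces into curves
  in a Banach space.\<close>

definition fourier_l2 :: "real \<Rightarrow> (real ^ 'd \<Rightarrow> complex ^ 'n) \<Rightarrow> (int ^ 'd, complex ^ 'n) l2" where
  "fourier_l2 r u = enc r (fourier_coeff u)"

lemma Sobolev_iff: "u \<in> Sobolev r \<longleftrightarrow> u \<in> L2 \<and> hs r (fourier_coeff u)"
  by (simp add: Sobolev_def hs_def in_l2_def sobolev_weight_eq power_mult_distrib)

lemma Sobolev_norm_eq: "hs r (fourier_coeff u) \<Longrightarrow> Sobolev_norm r u = norm (fourier_l2 r u)"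
  by (simp add: Sobolev_norm_def fourier_l2_def enc_def norm_Abs_l2 hs_def sobolev_weight_eq power_mult_distrib)

lemma Sobolev_simps:
  assumes "u \<in> Sobolev r"
  shows "u \<in> L2" "set_integrable lebesgue cell u" "hs r (fourier_coeff u)"
    "coord (fourier_l2 r u) k = wt r k *\<^sub>R fourier_coeff u k" "dec r (fourier_l2 r u) = fourier_coeff u"
  using assms by (auto simp: Sobolev_iff L2_set_integrable fourier_l2_def coord_enc dec_enc)

lemma Sobolev_norm_combination:
  assumes u: "u \<in> Sobolev r" and v: "v \<in> Sobolev r" and w: "w \<in> Sobolev r"
  shows "Sobolev_norm r (\<lambda>x. h *\<^sub>R (u x - v x) - w x) = norm (h *\<^sub>R (fourier_l2 r u - fourier_l2 r v) - fourier_l2 r w)"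
proof -
  note i = Sobolev_simps(2)[OF u] Sobolev_simps(2)[OF v] Sobolev_simps(2)[OF w]
  note d = fourier_coeff_diff_integrable[OF i(1,2)]
  note e = fourier_coeff_linear_integrable[OF d(1), of "of_real h", unfolded vsmult_of_real]
  have c: "fourier_coeff (\<lambda>x. h *\<^sub>R (u x - v x) - w x) = dec r (h *\<^sub>R (fourier_l2 r u - fourier_l2 r v) - fourier_l2 r w)"
    using u v w by (intro ext) (simp add: fourier_coeff_diff_integrable(2)[OF e(1) i(3)] e(2) d(2) dec_simps Sobolev_simps)
  have "hs r (fourier_coeff (\<lambda>x. h *\<^sub>R (u x - v x) - w x))" unfolding c by simp
  from Sobolev_norm_eq[OF this] show ?thesis by (simp add: c fourier_l2_def)
qed

lemma Sobolev_zero: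
  "(\<lambda>x :: real ^ 'd. 0 :: complex ^ 'n) \<in> Sobolev r" "fourier_l2 r (\<lambda>x :: real ^ 'd. 0 :: complex ^ 'n) = 0"
proof -
  have c: "fourier_coeff (\<lambda>x. 0 :: complex ^ 'n) = (\<lambda>k :: int ^ 'd. 0)" by (simp add: fourier_coeff_emode fun_eq_iff)
  show "(\<lambda>x :: real ^ 'd. 0 :: complex ^ 'n) \<in> Sobolev r" by (simp add: Sobolev_iff c hs_0 CP_L2 CP_const)
  show "fourier_l2 r (\<lambda>x :: real ^ 'd. 0 :: complex ^ 'n) = 0"
    by (rule l2_eqI) (simp add: fourier_l2_def c coord_enc hs_0)
qed

lemma Sobolev_norm_diff:
  assumes "u \<in> Sobolev r" "v \<in> Sobolev r"
  shows "Sobolev_norm r (\<lambda>x. u x - v x) = norm (fourier_l2 r u - fourier_l2 r v)"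
  using Sobolev_norm_combination[OF assms Sobolev_zero(1), of 1] by (simp add: Sobolev_zero(2))

lemma Sobolev_continuous_on_iff:
  "Sobolev_continuous_on r I \<psi> \<longleftrightarrow> (\<forall>t\<in>I. \<psi> t \<in> Sobolev r) \<and> continuous_on I (\<lambda>t. fourier_l2 r (\<psi> t))"
proof -
  have "((\<lambda>\<tau>. Sobolev_norm r (\<lambda>x. \<psi> \<tau> x - \<psi> t x)) \<longlongrightarrow> 0) (at t within I) \<longleftrightarrow>
      ((\<lambda>\<tau>. fourier_l2 r (\<psi> \<tau>)) \<longlongrightarrow> fourier_l2 r (\<psi> t)) (at t within I)"
    if "\<forall>t\<in>I. \<psi> t \<in> Sobolev r" "t \<in> I" for t
  proof -
    have "\<forall>\<^sub>F \<tau> in at t within I. Sobolev_norm r (\<lambda>x. \<psi> \<tau> x - \<psi> t x) = norm (fourier_l2 r (\<psi> \<tau>) - fourier_l2 r (\<psi> t))"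
      unfolding eventually_at_filter using that by (auto intro!: always_eventually Sobolev_norm_diff)
    from tendsto_cong[OF this] show ?thesis
      by (simp add: tendsto_norm_zero_iff LIM_zero_iff)
  qed
  then show ?thesis unfolding Sobolev_continuous_on_def continuous_on_def by blast
qed

lemma Sobolev_has_derivative_on_iff:
  assumes "open I"
  shows "Sobolev_has_derivative_on r I \<psi> \<psi>' \<longleftrightarrow> (\<forall>t\<in>I. \<psi> t \<in> Sobolev r \<and> \<psi>' t \<in> Sobolev r) \<and>
    (\<forall>t\<in>I. ((\<lambda>t. fourier_l2 r (\<psi> t)) has_vector_derivative fourier_l2 r (\<psi>' t)) (at t))"
proof -
  have "((\<lambda>\<tau>. Sobolev_norm r (\<lambda>x. (1 / (\<tau> - t)) *\<^sub>R (\<psi> \<tau> x - \<psi> t x) - \<psi>' t x)) \<longlongrightarrow> 0) (at t within I) \<longleftrightarrow>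
      ((\<lambda>t. fourier_l2 r (\<psi> t)) has_vector_derivative fourier_l2 r (\<psi>' t)) (at t)"
    if "\<forall>t\<in>I. \<psi> t \<in> Sobolev r \<and> \<psi>' t \<in> Sobolev r" "t \<in> I" for t
  proof -
    have "\<forall>\<^sub>F \<tau> in at t within I. Sobolev_norm r (\<lambda>x. (1 / (\<tau> - t)) *\<^sub>R (\<psi> \<tau> x - \<psi> t x) - \<psi>' t x)
        = norm ((1 / (\<tau> - t)) *\<^sub>R (fourier_l2 r (\<psi> \<tau>) - fourier_l2 r (\<psi> t)) - fourier_l2 r (\<psi>' t))"
      unfolding eventually_at_filter using that by (auto intro!: always_eventually Sobolev_norm_combination)
    from tendsto_cong[OF this] show ?thesis
      unfolding at_within_open[OF that(2) assms, symmetric] by (simp only: has_vector_derivative_iff_quotient)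
  qed
  then show ?thesis unfolding Sobolev_has_derivative_on_def by blast
qed

lemma syn_Sobolev:
  fixes a :: "int ^ 'd \<Rightarrow> complex ^ 'n"
  assumes "hs r a" "real CARD('d) \<le> r"
  shows "syn a \<in> Sobolev r" "fourier_l2 r (syn a) = enc r a" "fourier_coeff (syn a) = a"
proof -
  show c: "fourier_coeff (syn a) = a" by (rule ext) (rule fourier_coeff_syn[OF hs_l1(1)[OF assms]])
  show "syn a \<in> Sobolev r" "fourier_l2 r (syn a) = enc r a"
    by (simp_all add: Sobolev_iff fourier_l2_def c assms CP_L2[OF hs_syn_CP[OF assms]])
qed

lemma fourier_coeff_cong_AE:
  fixes u v :: "real ^ 'd \<Rightarrow> complex ^ 'n"
  assumes u: "set_integrable lebesgue cell u" and v: "set_integrable lebesgue cell v" and e: "AE x in lebesgue. u x = v x"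
  shows "fourier_coeff u k = fourier_coeff v k"
proof -
  have m: "(\<lambda>x. indicat_real cell x *\<^sub>R (emode (- k) x *s w x)) \<in> borel_measurable lebesgue"
    if "set_integrable lebesgue cell w" for w :: "real ^ 'd \<Rightarrow> complex ^ 'n"
    using set_integrable_emode[OF that, of "- k"] unfolding set_integrable_def by (rule borel_measurable_integrable)
  show ?thesis unfolding fourier_coeff_emode set_lebesgue_integral_def
    by (intro arg_cong[where f = "scaleR _"] integral_cong_AE m u v) (use e in \<open>auto elim!: eventually_mono simp del: vsmult_algebra\<close>)
qed

lemma fourier_coeff_complex_linear:
  fixes u :: "real ^ 'd \<Rightarrow> complex ^ 'n"
  assumes L: "bounded_linear L" and c: "\<And>c v. L (c *s v) = c *s L v" and u: "set_integrable lebesgue cell u"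
  shows "set_integrable lebesgue cell (\<lambda>x. L (u x))" "fourier_coeff (\<lambda>x. L (u x)) k = L (fourier_coeff u k)"
proof -
  have s: "L (r *\<^sub>R v) = r *\<^sub>R L v" for r v using linear_scale[OF bounded_linear.linear[OF L]] .
  have i: "integrable lebesgue (\<lambda>x. indicat_real cell x *\<^sub>R (emode l x *s u x))" for l
    using set_integrable_emode[OF u] unfolding set_integrable_def .
  show "set_integrable lebesgue cell (\<lambda>x. L (u x))"
    using integrable_bounded_linear[OF L, of lebesgue "\<lambda>x. indicat_real cell x *\<^sub>R u x"] u unfolding set_integrable_def s by simp
  show "fourier_coeff (\<lambda>x. L (u x)) k = L (fourier_coeff u k)"
    using integral_bounded_linear[OF L i, of "- k"] unfolding fourier_coeff_emode set_lebesgue_integral_def s c by simp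
qed

subsection \<open>Weak derivatives\<close>

lemma has_partial_smooth:
  assumes "smooth \<phi>"
  shows "has_partial \<phi> j (dd \<phi> (axis j 1))"
  unfolding has_partial_def
proof
  fix x
  have "t *\<^sub>R axis j (1::real) = axis j t" for t by (simp add: vec_eq_iff axis_def)
  then show "((\<lambda>t. \<phi> (x + axis j t)) has_vector_derivative dd \<phi> (axis j 1) x) (at 0)"
    using dd_line[OF assms, of x "axis j 1" 0] by (simp add: axis_zero)
qed

text \<open>The derivative of a periodic function is periodic, as a derivative is unique.\<close>

lemma dd_CP:
  fixes \<phi> :: "real ^ 'd \<Rightarrow> 'b::real_normed_vector"
  assumes "smooth \<phi>" "periodic \<phi>"
  shows "dd \<phi> v \<in> CP"
proof -
  have "dd \<phi> v (x + axis j (2 * pi)) = dd \<phi> v x" for x j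
  proof -
    have "((\<lambda>y. y + axis j (2 * pi)) has_derivative (\<lambda>h. h)) (at x)" by (auto intro!: derivative_eq_intros)
    from has_derivative_compose[OF this smooth_has_derivative[OF assms(1)]]
    have "(\<phi> has_derivative (\<lambda>v. dd \<phi> v (x + axis j (2 * pi)))) (at x)"
      using assms(2) by (simp add: periodic_def)
    then show ?thesis by (rule dd_eqI[symmetric])
  qed
  then show ?thesis using smooth_continuous[OF smooth_dd[OF assms(1)]] by (simp add: CP_def periodic_def)
qed

text \<open>The integral of the derivative of the product with a test function vanishes.\<close>

lemma has_weak_partial_syn:
  fixes a :: "int ^ 'd \<Rightarrow> complex ^ 'n"
  assumes a: "hs s a" and s: "real CARD('d) + 2 \<le> s"
  shows "has_weak_partial (syn a) j (syn (dpart j a))"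
proof -
  let ?u = "syn a" and ?g = "syn (dpart j a)"
  have p: "has_partial ?u j ?g" and g: "?g \<in> CP" and u: "?u \<in> CP"
    using syn_dpart[OF a s] s by (auto intro: syn_CP hs_syn_CP[OF a])
  have "(LINT x:cell|lebesgue. dd \<phi> (axis j 1) x *\<^sub>R ?u x) = - (LINT x:cell|lebesgue. \<phi> x *\<^sub>R ?g x)"
    if \<phi>: "smooth \<phi>" "periodic \<phi>" for \<phi> :: "real ^ 'd \<Rightarrow> real"
  proof -
    have 1: "\<phi> \<in> CP" using \<phi> by (simp add: CP_def smooth_continuous)
    note 2 = dd_CP[OF \<phi>, of "axis j 1"]
    have c: "(\<lambda>x. \<phi> x *\<^sub>R ?g x) \<in> CP" "(\<lambda>x. dd \<phi> (axis j 1) x *\<^sub>R ?u x) \<in> CP" "(\<lambda>x. \<phi> x *\<^sub>R ?u x) \<in> CP"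
      by (intro CP_scaleR 1 2 u g)+
    have "has_partial (\<lambda>x. \<phi> x *\<^sub>R ?u x) j (\<lambda>x. \<phi> x *\<^sub>R ?g x + dd \<phi> (axis j 1) x *\<^sub>R ?u x)"
      unfolding has_partial_def
    proof
      fix x
      have "((\<lambda>t. \<phi> (x + axis j t)) has_real_derivative dd \<phi> (axis j 1) x) (at 0)"
        using has_partial_smooth[OF \<phi>(1)] by (simp add: has_partial_def has_real_derivative_iff_has_vector_derivative)
      from has_vector_derivative_scaleR[OF this, of "\<lambda>t. ?u (x + axis j t)" "?g x"] p
      show "((\<lambda>t. \<phi> (x + axis j t) *\<^sub>R ?u (x + axis j t)) has_vector_derivative \<phi> x *\<^sub>R ?g x + dd \<phi> (axis j 1) x *\<^sub>R ?u x) (at 0)"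
        by (simp add: axis_zero has_partial_def)
    qed
    from integral_cell_partial[OF c(3) CP_add[OF c(1,2)] this]
    have "integral cell (\<lambda>x. \<phi> x *\<^sub>R ?g x) + integral cell (\<lambda>x. dd \<phi> (axis j 1) x *\<^sub>R ?u x) = 0"
      by (simp add: Henstock_Kurzweil_Integration.integral_add[OF CP_integrable_on[OF c(1)] CP_integrable_on[OF c(2)]])
    then have "integral cell (\<lambda>x. dd \<phi> (axis j 1) x *\<^sub>R ?u x) = - integral cell (\<lambda>x. \<phi> x *\<^sub>R ?g x)"
      by (simp add: add_eq_0_iff)
    then show ?thesis using c by (simp add: LINT_cell_eq_integral CP_def)
  qed
  then show ?thesis unfolding has_weak_partial_def using CP_L2[OF u] CP_L2[OF g] by (simp add: dd_def)
qed

lemma trig_derivative: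
  "((\<lambda>x. c * cos (w \<bullet> x) + d * sin (w \<bullet> x)) has_derivative (\<lambda>v. ((w \<bullet> v) * d) * cos (w \<bullet> x) + (- (w \<bullet> v) * c) * sin (w \<bullet> x))) (at x)"
  for w x :: "'a::real_inner"
  by (auto intro!: derivative_eq_intros simp: algebra_simps)

lemma smooth_trig: "smooth (\<lambda>x. c * cos (w \<bullet> x) + d * sin (w \<bullet> x))" for w :: "'a::real_inner"
  unfolding smooth_def
proof
  fix k show "Ck k (\<lambda>x. c * cos (w \<bullet> x) + d * sin (w \<bullet> x))"
  proof (induction k arbitrary: c d)
    case 0
    show ?case by (auto intro!: continuous_intros)
  next
    case (Suc k)
    have fd: "(\<lambda>x. frechet_derivative (\<lambda>x. c * cos (w \<bullet> x) + d * sin (w \<bullet> x)) (at x) v) = (\<lambda>x. ((w \<bullet> v) * d) * cos (w \<bullet> x) + (- (w \<bullet> v) * c) * sin (w \<bullet> x))" for v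
      unfolding frechet_derivative_at[OF trig_derivative, symmetric] ..
    have "(\<lambda>x. c * cos (w \<bullet> x) + d * sin (w \<bullet> x)) differentiable at x" for x
      using trig_derivative by (rule differentiableI)
    then show ?case unfolding Ck.simps fd using Suc.IH by blast
  qed
qed

text \<open>The test functions \<open>cos (k \<bullet> x)\<close> and \<open>sin (k \<bullet> x)\<close> compute the coefficient at \<open>k\<close>.\<close>

lemma fourier_coeff_weak_partial:
  fixes u g :: "real ^ 'd \<Rightarrow> complex ^ 'n"
  assumes "has_weak_partial u j g"
  shows "fourier_coeff g k = (\<i> * of_int (k $ j)) *s fourier_coeff u k"
proof -
  define \<theta> where "\<theta> x = freq k \<bullet> x" for x
  define IC where "IC w = (LINT x:cell|lebesgue. cos (\<theta> x) *\<^sub>R w x)" for w :: "real ^ 'd \<Rightarrow> complex ^ 'n"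
  define IS where "IS w = (LINT x:cell|lebesgue. sin (\<theta> x) *\<^sub>R w x)" for w :: "real ^ 'd \<Rightarrow> complex ^ 'n"
  have u: "u \<in> L2" and g: "g \<in> L2" and weak: "\<And>\<phi> :: real ^ 'd \<Rightarrow> real. smooth \<phi> \<Longrightarrow> periodic \<phi> \<Longrightarrow>
        (LINT x:cell|lebesgue. dd \<phi> (axis j 1) x *\<^sub>R u x) = - (LINT x:cell|lebesgue. \<phi> x *\<^sub>R g x)"
    using assms by (auto simp: has_weak_partial_def dd_def)
  have i: "set_integrable lebesgue cell (\<lambda>x. cos (\<theta> x) *\<^sub>R w x)" "set_integrable lebesgue cell (\<lambda>x. sin (\<theta> x) *\<^sub>R w x)"
    if "w \<in> L2" for w :: "real ^ 'd \<Rightarrow> complex ^ 'n"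
    unfolding \<theta>_def
    by (rule set_integrable_bounded_scaleR[OF L2_set_integrable[OF that], where B = 1]; auto intro!: borel_measurable_lebesgue_continuous continuous_intros)+
  have F: "fourier_coeff w k = (1 / (2 * pi) ^ CARD('d)) *\<^sub>R (IC w - \<i> *s IS w)" if w: "w \<in> L2" for w :: "real ^ 'd \<Rightarrow> complex ^ 'n"
  proof -
    have "emode (- k) x *s w x = cos (\<theta> x) *\<^sub>R w x - \<i> *s (sin (\<theta> x) *\<^sub>R w x)" for x
    proof -
      have "emode (- k) x = of_real (cos (\<theta> x)) - \<i> * of_real (sin (\<theta> x))" by (simp add: emode_def \<theta>_def complex_eq_iff)
      then show ?thesis by (simp add: vsmult_of_real mult.commute)
    qed
    moreover have "set_integrable lebesgue cell (\<lambda>x. \<i> *s (sin (\<theta> x) *\<^sub>R w x))"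
      by (rule fourier_coeff_complex_linear(1)[OF vsmult_linear_right _ i(2)[OF w]]) (simp add: mult.commute)
    moreover have "(LINT x:cell|lebesgue. \<i> *s (sin (\<theta> x) *\<^sub>R w x)) = \<i> *s IS w"
      using integral_bounded_linear[OF vsmult_linear_right i(2)[OF w, unfolded set_integrable_def], of \<i>]
      by (simp add: IS_def set_lebesgue_integral_def mult_ac)
    ultimately show ?thesis using i(1)[OF w] unfolding fourier_coeff_emode IC_def by (simp add: set_integral_diff(2))
  qed
  have per: "periodic (\<lambda>x. c * cos (\<theta> x) + d * sin (\<theta> x))" for c d
  proof -
    have "cos (\<theta> (x + axis j (2 * pi))) = cos (\<theta> x)" "sin (\<theta> (x + axis j (2 * pi))) = sin (\<theta> x)" for x j
      using arg_cong[OF emode_shift[of k x j], of Re] arg_cong[OF emode_shift[of k x j], of Im] by (simp_all add: emode_def \<theta>_def)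
    then show ?thesis by (simp add: periodic_def)
  qed
  have dd: "dd (\<lambda>x. c * cos (\<theta> x) + d * sin (\<theta> x)) (axis j 1) x = of_int (k $ j) * (d * cos (\<theta> x) - c * sin (\<theta> x))" for c d x
    unfolding \<theta>_def dd_eqI[OF trig_derivative] by (simp add: inner_axis algebra_simps)
  have m: "of_int (k $ j) * (0 * cos y - 1 * sin y) = (- of_int (k $ j)) * sin y" for y :: real by simp
  have IC: "IC g = of_int (k $ j) *\<^sub>R IS u"
  proof -
    have "- IC g = (LINT x:cell|lebesgue. ((- of_int (k $ j)) * sin (\<theta> x)) *\<^sub>R u x)"
      using weak[OF smooth_trig[of 1 "freq k" 0, folded \<theta>_def] per] unfolding dd m by (simp add: IC_def)
    also have "\<dots> = (- of_int (k $ j)) *\<^sub>R IS u" unfolding IS_def scaleR_scaleR[symmetric] by (rule set_integral_scaleR_right)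
    finally show ?thesis by simp
  qed
  have IS: "IS g = - of_int (k $ j) *\<^sub>R IC u"
    using weak[OF smooth_trig[of 0 "freq k" 1, folded \<theta>_def] per] unfolding dd by (simp add: IC_def IS_def scaleR_scaleR[symmetric] del: scaleR_scaleR)
  show ?thesis unfolding F[OF u] F[OF g] IC IS
    by (simp add: vec_eq_iff complex_eq_iff algebra_simps)
qed

section \<open>The Dirac equation\<close>

lemma matrix_vector_mult_simps:
  fixes A :: "complex ^ 'n ^ 'm"
  shows "A *v (v + w) = A *v v + A *v w" "A *v (v - w) = A *v v - A *v w" "A *v (c *s v) = c *s (A *v v)"
    "A *v (r *\<^sub>R v) = r *\<^sub>R (A *v v)" "A *v (- v) = - (A *v v)" "A *v 0 = 0"
  by (auto simp: matrix_vector_mult_def vec_eq_iff algebra_simps sum.distrib sum_distrib_left sum_subtractf sum_negf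
      scaleR_sum_right scaleR_conv_of_real[where 'a = complex])

lemma bounded_linear_matrix_vector_mult: "bounded_linear ((*v) (A :: complex ^ 'n ^ 'm))"
  by (intro linear_conv_bounded_linear[THEN iffD1] linearI) (simp_all add: matrix_vector_mult_simps)

lemma matrix_vector_mult_sum: "A *v (\<Sum>i\<in>S. f i) = (\<Sum>i\<in>S. A *v f i)" for A :: "complex ^ 'n ^ 'm"
  by (rule linear_sum[OF bounded_linear.linear[OF bounded_linear_matrix_vector_mult]])

text \<open>In the profiles the equation has a locally Lipschitz right hand side, although the curves need not be
  differentiable in \<open>H\<^sup>s\<close>.\<close>

lemma (in kg_system) coordinate_solution_unique:
  assumes X: "continuous_on {-T<..<T} X" "\<And>t k. t \<in> {-T<..<T} \<Longrightarrow>
      ((\<lambda>t. coord (X t) k) has_vector_derivative g k (coord (X t) k) + coord (nonlin (X t)) k) (at t)"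
    and Y: "continuous_on {-T<..<T} Y" "\<And>t k. t \<in> {-T<..<T} \<Longrightarrow>
      ((\<lambda>t. coord (Y t) k) has_vector_derivative g k (coord (Y t) k) + coord (nonlin (Y t)) k) (at t)"
    and eq: "X 0 = Y 0" and t: "t \<in> {-T<..<T}"
  shows "X t = Y t"
proof -
  have d: "((\<lambda>t. flow (- t) (Z t)) has_vector_derivative flow (- t) (nonlin (Z t))) (at t)"
    if Z: "continuous_on {-T<..<T} Z" "\<And>t k. t \<in> {-T<..<T} \<Longrightarrow>
      ((\<lambda>t. coord (Z t) k) has_vector_derivative g k (coord (Z t) k) + coord (nonlin (Z t)) k) (at t)"
      and t: "t \<in> {-T<..<T}" for Z t
  proof (rule l2_has_vector_derivative_coordwise[where I = "{-T<..<T}"])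
    show "((\<lambda>t. coord (flow (- t) (Z t)) k) has_vector_derivative coord (flow (- t) (nonlin (Z t))) k) (at t)"
      if "t \<in> {-T<..<T}" for t k
      unfolding coord_flow by (rule U_backward_derivative[OF Z(2)[OF that]])
    show "continuous_on {-T<..<T} (\<lambda>t. flow (- t) (nonlin (Z t)))"
      by (intro flow_continuous_compose continuous_intros continuous_on_compose2[OF continuous_on_nemytskii[OF G(1), of UNIV] Z(1)]) auto
  qed (use t in auto)
  have sub: "{- \<bar>t\<bar>..\<bar>t\<bar>} \<subseteq> {-T<..<T}" using t by auto
  have "bounded (Z ` {- \<bar>t\<bar>..\<bar>t\<bar>})" if "continuous_on {-T<..<T} Z" for Z :: "real \<Rightarrow> (int ^ 'd, complex ^ 'n) l2"
    by (intro compact_imp_bounded compact_continuous_image continuous_on_subset[OF that sub]) auto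
  then have "bounded (X ` {- \<bar>t\<bar>..\<bar>t\<bar>} \<union> Y ` {- \<bar>t\<bar>..\<bar>t\<bar>})" using X(1) Y(1) by simp
  then obtain M where M: "M > 0" "\<And>u. u \<in> {- \<bar>t\<bar>..\<bar>t\<bar>} \<Longrightarrow> norm (X u) \<le> M \<and> norm (Y u) \<le> M"
    unfolding bounded_pos by auto
  obtain L where L: "L \<ge> 0" "\<And>x y. norm x \<le> M \<Longrightarrow> norm y \<le> M \<Longrightarrow> norm (nonlin x - nonlin y) \<le> L * norm (x - y)"
    using nemytskii_Lipschitz[OF G(1), of M] M(1) by auto
  have "flow (- t) (X t) - flow (- t) (Y t) = 0"
  proof (rule Gronwall_zero[where L = "(1 + \<kappa>) * L * (1 + \<kappa>)" and x = "\<lambda>t. flow (- t) (X t) - flow (- t) (Y t)" and y = "\<lambda>t. flow (- t) (nonlin (X t)) - flow (- t) (nonlin (Y t))"])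
    fix u assume u: "\<bar>u\<bar> \<le> \<bar>t\<bar>"
    then have uI: "u \<in> {-T<..<T}" "u \<in> {- \<bar>t\<bar>..\<bar>t\<bar>}" using t by auto
    show "((\<lambda>t. flow (- t) (X t) - flow (- t) (Y t)) has_vector_derivative flow (- u) (nonlin (X u)) - flow (- u) (nonlin (Y u))) (at u)"
      by (intro has_vector_derivative_diff d[OF X uI(1)] d[OF Y uI(1)])
    have "norm (flow (- u) (nonlin (X u)) - flow (- u) (nonlin (Y u))) \<le> (1 + \<kappa>) * norm (nonlin (X u) - nonlin (Y u))"
      unfolding flow_diff[symmetric] by (rule norm_flow_le)
    also have "\<dots> \<le> (1 + \<kappa>) * (L * norm (X u - Y u))"
      using \<kappa> M(2)[OF uI(2)] by (intro mult_left_mono L(2)) auto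
    also have "X u - Y u = flow u (flow (- u) (X u) - flow (- u) (Y u))" by (simp add: flow_diff)
    also have "(1 + \<kappa>) * (L * norm (flow u (flow (- u) (X u) - flow (- u) (Y u)))) \<le> (1 + \<kappa>) * (L * ((1 + \<kappa>) * norm (flow (- u) (X u) - flow (- u) (Y u))))"
      using \<kappa> L(1) by (intro mult_left_mono norm_flow_le) auto
    finally show "norm (flow (- u) (nonlin (X u)) - flow (- u) (nonlin (Y u))) \<le> (1 + \<kappa>) * L * (1 + \<kappa>) * norm (flow (- u) (X u) - flow (- u) (Y u))"
      by (simp only: mult.assoc)
  qed (use eq L(1) \<kappa> in auto)
  then have "flow t (flow (- t) (X t)) = flow t (flow (- t) (Y t))" by simp
  then show ?thesis by simp
qed

locale dirac_system =
  fixes \<gamma> :: "'d::finite option \<Rightarrow> complex ^ 'n::finite ^ 'n" and m :: real and F :: "complex ^ 'n \<Rightarrow> complex ^ 'n" and s :: real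
  assumes \<gamma>: "dirac_matrices \<gamma>" and mass: "m > 0"
    and F: "smooth F" "F 0 = 0" "(F has_derivative (\<lambda>h. 0)) (at 0)" and s2: "2 * real CARD('d) + 2 \<le> s"
begin

text \<open>The symbol of the space part of the Dirac operator, without its factor \<open>i\<close>.\<close>

definition space_symbol :: "int ^ 'd \<Rightarrow> complex ^ 'n \<Rightarrow> complex ^ 'n" where
  "space_symbol k v = (\<Sum>j\<in>UNIV. of_int (k $ j) *s (\<gamma> (Some j) *v v))"

definition gen_symbol :: "int ^ 'd \<Rightarrow> complex ^ 'n \<Rightarrow> complex ^ 'n" where
  "gen_symbol k v = (- \<i>) *s (\<gamma> None *v (space_symbol k v + of_real m *s v))"

definition source :: "complex ^ 'n \<Rightarrow> complex ^ 'n" where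
  "source z = \<i> *s (\<gamma> None *v F z)"

lemma anticommute: "\<gamma> \<mu> *v (\<gamma> \<nu> *v v) + \<gamma> \<nu> *v (\<gamma> \<mu> *v v) = (2 * minkowski \<mu> \<nu>) *s v"
proof -
  have "(\<gamma> \<mu> ** \<gamma> \<nu> + \<gamma> \<nu> ** \<gamma> \<mu>) *v v = mat (2 * minkowski \<mu> \<nu>) *v v"
    using \<gamma> by (simp add: dirac_matrices_def)
  moreover have "mat c *v v = c *s v" for c :: complex
    by (simp add: vec_eq_iff matrix_vector_mult_def mat_def if_distrib[of "\<lambda>x. x * _"] cong: if_cong)
  ultimately show ?thesis by (simp add: matrix_vector_mult_add_rdistrib matrix_vector_mul_assoc)
qed

lemma gamma0_sq [simp]: "\<gamma> None *v (\<gamma> None *v v) = v"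
proof -
  have "(2 :: complex) *s (\<gamma> None *v (\<gamma> None *v v)) = 2 *s v"
    using anticommute[of None None v] by (simp add: minkowski_def vec_eq_iff)
  then show ?thesis by (simp add: vec_eq_iff)
qed

lemma gamma0_anticommute: "\<gamma> None *v (\<gamma> (Some j) *v v) = - (\<gamma> (Some j) *v (\<gamma> None *v v))"
  using anticommute[of None "Some j" v] by (simp add: minkowski_def eq_neg_iff_add_eq_0)

lemma space_symbol_linear: "space_symbol k (v + w) = space_symbol k v + space_symbol k w" "space_symbol k (c *s v) = c *s space_symbol k v" "space_symbol k (- v) = - space_symbol k v"
  by (simp_all add: space_symbol_def matrix_vector_mult_simps sum.distrib vsmult_sum_right sum_negf mult.commute)

lemma gamma0_space_symbol: "\<gamma> None *v space_symbol k v = - space_symbol k (\<gamma> None *v v)"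
  by (simp add: space_symbol_def matrix_vector_mult_sum matrix_vector_mult_simps gamma0_anticommute sum_negf)

text \<open>In the double sum, the matrices with indices \<open>i\<close> and \<open>j\<close> may be symmetrised, and anticommute unless
  \<open>i = j\<close>.\<close>

lemma space_symbol_sq: "space_symbol k (space_symbol k v) = - (of_real ((norm (freq k))\<^sup>2) *s v)"
proof -
  let ?c = "\<lambda>i j. (of_int (k $ i) * of_int (k $ j) :: complex)"
  have s: "space_symbol k (space_symbol k v) = (\<Sum>i\<in>UNIV. \<Sum>j\<in>UNIV. ?c i j *s (\<gamma> (Some i) *v (\<gamma> (Some j) *v v)))"
    by (simp add: space_symbol_def matrix_vector_mult_sum matrix_vector_mult_simps vsmult_sum_right)
  also have "\<dots> = (\<Sum>i\<in>UNIV. \<Sum>j\<in>UNIV. ?c i j *s (\<gamma> (Some j) *v (\<gamma> (Some i) *v v)))"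
    by (subst sum.swap) (simp add: mult.commute)
  finally have "space_symbol k (space_symbol k v) + space_symbol k (space_symbol k v)
      = (\<Sum>i\<in>UNIV. \<Sum>j\<in>UNIV. ?c i j *s (\<gamma> (Some i) *v (\<gamma> (Some j) *v v) + \<gamma> (Some j) *v (\<gamma> (Some i) *v v)))"
    using s by (simp add: sum.distrib)
  also have "\<dots> = (\<Sum>i\<in>UNIV. \<Sum>j\<in>UNIV. if j = i then (- 2 * (of_int (k $ i))\<^sup>2) *s v else 0)"
    unfolding anticommute by (intro sum.cong refl) (auto simp: minkowski_def power2_eq_square mult_ac)
  also have "\<dots> = (\<Sum>i\<in>UNIV. (- 2 * (of_int (k $ i))\<^sup>2) *s v)" by simp
  also have "\<dots> = (\<Sum>i\<in>UNIV. - 2 * (of_int (k $ i))\<^sup>2) *s v"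
    by (rule linear_sum[OF bounded_linear.linear[OF vsmult_linear_left], symmetric])
  also have "(\<Sum>i\<in>UNIV. - 2 * (of_int (k $ i))\<^sup>2) = (- 2 * of_real ((norm (freq k))\<^sup>2) :: complex)"
  proof -
    have n: "(norm (freq k))\<^sup>2 = (\<Sum>i\<in>UNIV. (of_int (k $ i))\<^sup>2)"
      unfolding power2_norm_eq_inner inner_vec_def by (simp add: power2_eq_square)
    show ?thesis unfolding n of_real_sum sum_distrib_left by simp
  qed
  also have "(- 2 * c) *s v = - (c *s v) + - (c *s v)" for c
  proof -
    have "- 2 * c = - c + - c" by simp
    then show ?thesis by (simp only: vsmult_algebra)
  qed
  finally have e: "space_symbol k (space_symbol k v) + space_symbol k (space_symbol k v)
      = - (of_real ((norm (freq k))\<^sup>2) *s v) + - (of_real ((norm (freq k))\<^sup>2) *s v)" .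
  have "x = y" if "x + x = y + y" for x y :: "complex ^ 'n"
  proof -
    have "2 *\<^sub>R x = 2 *\<^sub>R y" using that by (simp only: scaleR_2)
    then show ?thesis by simp
  qed
  from this[OF e] show ?thesis .
qed

lemma gen_symbol_vsmult: "gen_symbol k (c *s v) = c *s gen_symbol k v"
  by (simp add: gen_symbol_def space_symbol_linear matrix_vector_mult_simps mult_ac)

text \<open>As \<open>\<gamma>\<^sup>0\<close> anticommutes with the space part \<open>D\<close>, the square is \<open>- \<gamma>\<^sup>0 (D + m) \<gamma>\<^sup>0 (D + m) = - (- D + m) (D + m)\<close>.\<close>

lemma gen_symbol_sq: "gen_symbol k (gen_symbol k v) = - ((dispersion m (freq k))\<^sup>2) *\<^sub>R v"
proof -
  let ?w = "space_symbol k v + of_real m *s v"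
  have "gen_symbol k (gen_symbol k v) = (- \<i>) *s gen_symbol k (\<gamma> None *v ?w)"
    unfolding gen_symbol_def[of k v] by (rule gen_symbol_vsmult)
  also have "\<dots> = - (\<gamma> None *v (space_symbol k (\<gamma> None *v ?w) + of_real m *s (\<gamma> None *v ?w)))"
    by (simp only: gen_symbol_def vsmult_algebra(1)) simp
  also have "space_symbol k (\<gamma> None *v ?w) = - (\<gamma> None *v space_symbol k ?w)" by (simp add: gamma0_space_symbol)
  also have "- (\<gamma> None *v (- (\<gamma> None *v space_symbol k ?w) + of_real m *s (\<gamma> None *v ?w))) = space_symbol k ?w - of_real m *s ?w"
    by (simp add: matrix_vector_mult_simps del: vsmult_algebra)
  also have "\<dots> = - (of_real ((norm (freq k))\<^sup>2 + m\<^sup>2) *s v)"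
    by (simp add: space_symbol_linear space_symbol_sq power2_eq_square)
  finally have "gen_symbol k (gen_symbol k v) = - (((norm (freq k))\<^sup>2 + m\<^sup>2) *\<^sub>R v)" by (simp only: vsmult_of_real)
  moreover have "(dispersion m (freq k))\<^sup>2 = (norm (freq k))\<^sup>2 + m\<^sup>2" by (simp add: dispersion_def add.commute)
  ultimately show ?thesis by (simp only: scaleR_minus_left)
qed

lemma gen_symbol_bound: "\<exists>\<kappa>\<ge>1. \<forall>k v. norm (gen_symbol k v) \<le> \<kappa> * dispersion m (freq k) * norm v"
proof -
  have "\<exists>K\<ge>0. \<forall>v. norm (\<gamma> \<mu> *v v) \<le> norm v * K" for \<mu>
    using bounded_linear.nonneg_bounded[OF bounded_linear_matrix_vector_mult] by blast
  then obtain K where K: "\<And>\<mu>. K \<mu> \<ge> 0" "\<And>\<mu> v. norm (\<gamma> \<mu> *v v) \<le> norm v * K \<mu>" by metis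
  define S where "S = (\<Sum>j\<in>UNIV. K (Some j)) + 1"
  have le: "norm (gen_symbol k v) \<le> max 1 (K None * S) * dispersion m (freq k) * norm v" for k v
  proof -
    have dispersion: "\<bar>of_int (k $ j)\<bar> \<le> dispersion m (freq k)" "m \<le> dispersion m (freq k)" for j
    proof -
      have "norm (freq k) \<le> dispersion m (freq k)" by (simp add: dispersion_def real_le_rsqrt)
      then show "\<bar>of_int (k $ j)\<bar> \<le> dispersion m (freq k)" using component_le_norm_cart[of "freq k" j] by simp
      show "m \<le> dispersion m (freq k)" by (simp add: dispersion_def real_le_rsqrt)
    qed
    have Om0: "0 \<le> dispersion m (freq k)" by (simp add: dispersion_def)
    have "norm (of_int (k $ j) *s (\<gamma> (Some j) *v v)) \<le> dispersion m (freq k) * (norm v * K (Some j))" for j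
      unfolding norm_vector_smult using dispersion(1)[of j] K Om0 by (intro mult_mono) auto
    then have "norm (space_symbol k v) \<le> (\<Sum>j\<in>UNIV. dispersion m (freq k) * (norm v * K (Some j)))"
      unfolding space_symbol_def by (intro sum_norm_le) auto
    moreover have "norm (of_real m *s v) \<le> dispersion m (freq k) * norm v"
      unfolding norm_vector_smult using dispersion(2) mass by (intro mult_right_mono) auto
    ultimately have "norm (space_symbol k v + of_real m *s v) \<le> S * (dispersion m (freq k) * norm v)"
      using norm_triangle_ineq[of "space_symbol k v" "of_real m *s v"] by (simp add: S_def sum_distrib_left sum_distrib_right algebra_simps)
    then have "norm (gen_symbol k v) \<le> S * (dispersion m (freq k) * norm v) * K None"
      unfolding gen_symbol_def norm_vector_smult using K by (simp add: order_trans[OF K(2)] mult_right_mono)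
    also have "\<dots> \<le> max 1 (K None * S) * (dispersion m (freq k) * norm v)"
      using mult_right_mono[of "K None * S" "max 1 (K None * S)" "dispersion m (freq k) * norm v"] Om0 by (simp add: mult_ac)
    finally show ?thesis by (simp add: mult.assoc)
  qed
  then show ?thesis by (intro exI[of _ "max 1 (K None * S)"]) auto
qed

definition gen_symbol_const :: real where "gen_symbol_const = (SOME \<kappa>. \<kappa> \<ge> 1 \<and> (\<forall>k v. norm (gen_symbol k v) \<le> \<kappa> * dispersion m (freq k) * norm v))"

lemma gen_symbol_const: "gen_symbol_const \<ge> 1 \<and> (\<forall>k v. norm (gen_symbol k v) \<le> gen_symbol_const * dispersion m (freq k) * norm v)"
  unfolding gen_symbol_const_def by (rule someI_ex[OF gen_symbol_bound])

lemma source_linear: "bounded_linear (\<lambda>v. \<i> *s (\<gamma> None *v v))"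
  by (intro bounded_linear_compose[OF vsmult_linear_right bounded_linear_matrix_vector_mult])

lemma source_smooth: "smooth source" "source 0 = 0" "dd source v 0 = 0"
proof -
  show "smooth source" unfolding source_def[abs_def] by (rule smooth_linear_comp[OF source_linear F(1)])
  show "source 0 = 0" by (simp add: source_def F(2) matrix_vector_mult_simps)
  have "(source has_derivative (\<lambda>v. \<i> *s (\<gamma> None *v 0))) (at 0)"
    unfolding source_def[abs_def] by (rule bounded_linear.has_derivative[OF source_linear F(3)])
  from dd_eqI[OF this] show "dd source v 0 = 0" by (simp add: matrix_vector_mult_simps)
qed

lemma linear_gen_symbol: "linear (gen_symbol k)"
  by (rule linearI) (simp_all add: gen_symbol_def space_symbol_linear matrix_vector_mult_simps vsmult_of_real[symmetric] mult_ac)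

sublocale kg_system m gen_symbol gen_symbol_const source s
  by (intro kg_system.intro kg_symbol.intro kg_system_axioms.intro mass linear_gen_symbol gen_symbol_sq source_smooth s2
      gen_symbol_const[THEN conjunct1] gen_symbol_const[THEN conjunct2, rule_format])

subsection \<open>Solutions and their Fourier coefficients\<close>

text \<open>Multiplication by \<open>i \<gamma>\<^sup>0\<close>, whose inverse is \<open>- i \<gamma>\<^sup>0\<close>, solves for the time derivative.\<close>

lemma dirac_mode_equation:
  assumes d: "\<And>j. d (Some j) = (\<i> * of_int (k $ j)) *s a"
  shows "(- \<i>) *s (\<Sum>\<mu>\<in>UNIV. \<gamma> \<mu> *v d \<mu>) + m *\<^sub>R a = f \<longleftrightarrow> d None = gen_symbol k a + \<i> *s (\<gamma> None *v f)"
proof -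
  have "(\<Sum>\<mu>\<in>UNIV. \<gamma> \<mu> *v d \<mu>) = \<gamma> None *v d None + (\<Sum>j\<in>UNIV. \<gamma> (Some j) *v d (Some j))"
    unfolding UNIV_option_conv by (subst sum.insert) (auto simp: sum.reindex)
  also have "(\<Sum>j\<in>UNIV. \<gamma> (Some j) *v d (Some j)) = \<i> *s space_symbol k a"
    by (simp add: d space_symbol_def matrix_vector_mult_simps vsmult_sum_right)
  finally have e: "(- \<i>) *s (\<Sum>\<mu>\<in>UNIV. \<gamma> \<mu> *v d \<mu>) + m *\<^sub>R a = (- \<i>) *s (\<gamma> None *v d None) + (space_symbol k a + of_real m *s a)"
    by (simp add: vsmult_of_real)
  show ?thesis
  proof
    assume "(- \<i>) *s (\<Sum>\<mu>\<in>UNIV. \<gamma> \<mu> *v d \<mu>) + m *\<^sub>R a = f"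
    then have "f = (- \<i>) *s (\<gamma> None *v d None) + (space_symbol k a + of_real m *s a)" using e by simp
    then show "d None = gen_symbol k a + \<i> *s (\<gamma> None *v f)"
      by (simp add: gen_symbol_def matrix_vector_mult_simps)
  next
    assume "d None = gen_symbol k a + \<i> *s (\<gamma> None *v f)"
    then show "(- \<i>) *s (\<Sum>\<mu>\<in>UNIV. \<gamma> \<mu> *v d \<mu>) + m *\<^sub>R a = f"
      unfolding e by (simp add: gen_symbol_def matrix_vector_mult_simps)
  qed
qed

lemma fourier_coeff_dirac:
  fixes D :: "'d option \<Rightarrow> real ^ 'd \<Rightarrow> complex ^ 'n"
  assumes D: "\<And>\<mu>. set_integrable lebesgue cell (D \<mu>)" and u: "set_integrable lebesgue cell u"
  shows "set_integrable lebesgue cell (\<lambda>x. (- \<i>) *s (\<Sum>\<mu>\<in>UNIV. \<gamma> \<mu> *v D \<mu> x) + m *\<^sub>R u x)"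
    "fourier_coeff (\<lambda>x. (- \<i>) *s (\<Sum>\<mu>\<in>UNIV. \<gamma> \<mu> *v D \<mu> x) + m *\<^sub>R u x) k
     = (- \<i>) *s (\<Sum>\<mu>\<in>UNIV. \<gamma> \<mu> *v fourier_coeff (D \<mu>) k) + m *\<^sub>R fourier_coeff u k"
proof -
  have g: "set_integrable lebesgue cell (\<lambda>x. \<gamma> \<mu> *v D \<mu> x)" "fourier_coeff (\<lambda>x. \<gamma> \<mu> *v D \<mu> x) k = \<gamma> \<mu> *v fourier_coeff (D \<mu>) k" for \<mu> k
    by (rule fourier_coeff_complex_linear[OF bounded_linear_matrix_vector_mult matrix_vector_mult_simps(3) D])+
  have s: "set_integrable lebesgue cell (\<lambda>x. \<Sum>\<mu>\<in>A. \<gamma> \<mu> *v D \<mu> x) \<and>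
      fourier_coeff (\<lambda>x. \<Sum>\<mu>\<in>A. \<gamma> \<mu> *v D \<mu> x) k = (\<Sum>\<mu>\<in>A. \<gamma> \<mu> *v fourier_coeff (D \<mu>) k)" if "finite A" for A
    using that
  proof (induction A rule: finite_induct)
    case empty
    then show ?case by (simp add: set_integrable_def fourier_coeff_emode)
  next
    case (insert \<mu> A)
    then show ?case using g[of \<mu>] fourier_coeff_add_integrable[of "\<lambda>x. \<gamma> \<mu> *v D \<mu> x" "\<lambda>x. \<Sum>\<mu>\<in>A. \<gamma> \<mu> *v D \<mu> x" k]
      by (simp add: set_integral_add(1))
  qed
  note i = fourier_coeff_linear_integrable[of "\<lambda>x. \<Sum>\<mu>\<in>UNIV. \<gamma> \<mu> *v D \<mu> x" "- \<i>"]
  note r = fourier_coeff_linear_integrable[OF u, of "of_real m", unfolded vsmult_of_real]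
  show "set_integrable lebesgue cell (\<lambda>x. (- \<i>) *s (\<Sum>\<mu>\<in>UNIV. \<gamma> \<mu> *v D \<mu> x) + m *\<^sub>R u x)"
    using s[of UNIV] by (intro set_integral_add(1) i r) simp
  show "fourier_coeff (\<lambda>x. (- \<i>) *s (\<Sum>\<mu>\<in>UNIV. \<gamma> \<mu> *v D \<mu> x) + m *\<^sub>R u x) k
     = (- \<i>) *s (\<Sum>\<mu>\<in>UNIV. \<gamma> \<mu> *v fourier_coeff (D \<mu>) k) + m *\<^sub>R fourier_coeff u k"
    using s[of UNIV] fourier_coeff_add_integrable[OF i(1) r(1), of k] i(2)[of k] r(2)[of k] by (simp del: vsmult_algebra)
qed

lemma comp_coeff_source:
  fixes a :: "int ^ 'd \<Rightarrow> complex ^ 'n"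
  assumes "hs s a"
  shows "comp_coeff source a k = \<i> *s (\<gamma> None *v comp_coeff F a k)"
proof -
  have "set_integrable lebesgue cell (\<lambda>x. F (syn a x))"
    using smooth_syn_CP[OF assms s_simps(3) F(1)] by (intro L2_set_integrable CP_L2)
  from fourier_coeff_complex_linear(2)[OF source_linear _ this, of k] show ?thesis
    by (simp add: comp_coeff_def source_def matrix_vector_mult_simps mult.commute)
qed

text \<open>The time derivative exists in \<open>H\<^sup>s\<^sup>-\<^sup>1\<close> only, which suffices for single coordinates. The
  equation holds almost everywhere, and Fourier coefficients do not see null sets.\<close>

lemma solution_coordinates:
  assumes sol: "dirac_solution \<gamma> m F s T \<psi>\<^sub>0 \<phi>" and T: "T > 0" and \<psi>\<^sub>0: "\<psi>\<^sub>0 \<in> Sobolev s"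
  defines "X \<equiv> \<lambda>t. fourier_l2 s (\<phi> t)"
  shows "continuous_on {-T<..<T} X" "X 0 = fourier_l2 s \<psi>\<^sub>0"
    "\<And>t k. t \<in> {-T<..<T} \<Longrightarrow> ((\<lambda>t. coord (X t) k) has_vector_derivative gen_symbol k (coord (X t) k) + coord (nonlin (X t)) k) (at t)"
    "\<And>t. t \<in> {-T<..<T} \<Longrightarrow> \<phi> t \<in> Sobolev s"
proof -
  let ?I = "{-T<..<T}"
  obtain D where \<phi>: "Sobolev_continuous_on s ?I \<phi>" and D0: "Sobolev_has_derivative_on (s - 1) ?I \<phi> (D None)"
    and Dj: "\<And>t j. t \<in> ?I \<Longrightarrow> has_weak_partial (\<phi> t) j (D (Some j) t)"
    and eq: "\<And>t. t \<in> ?I \<Longrightarrow> AE x in lebesgue. (- \<i>) *s (\<Sum>\<mu>\<in>UNIV. \<gamma> \<mu> *v D \<mu> t x) + m *\<^sub>R \<phi> t x = F (\<phi> t x)"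
    and init: "AE x in lebesgue. \<phi> 0 x = \<psi>\<^sub>0 x"
    using sol unfolding dirac_solution_def by blast
  show S: "\<phi> t \<in> Sobolev s" if "t \<in> ?I" for t using \<phi> that by (simp add: Sobolev_continuous_on_iff)
  show "continuous_on ?I X" using \<phi> by (simp add: Sobolev_continuous_on_iff X_def)
  show "X 0 = fourier_l2 s \<psi>\<^sub>0"
    unfolding X_def fourier_l2_def using S[of 0] T \<psi>\<^sub>0 init
    by (intro arg_cong[where f = "enc s"] ext fourier_coeff_cong_AE Sobolev_simps(2)) auto
  fix t k assume t: "t \<in> ?I"
  let ?c = "fourier_coeff (\<phi> t)"
  have X: "hs s ?c" "dec s (X t) = ?c" using Sobolev_simps[OF S[OF t]] by (simp_all add: X_def)
  have D0t: "D None t \<in> Sobolev (s - 1)" and der: "((\<lambda>t. fourier_l2 (s - 1) (\<phi> t)) has_vector_derivative fourier_l2 (s - 1) (D None t)) (at t)"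
    using D0 t by (auto simp: Sobolev_has_derivative_on_iff)
  have int: "set_integrable lebesgue cell (D \<mu> t)" for \<mu>
    using Sobolev_simps(2)[OF D0t] Dj[OF t] L2_set_integrable by (cases \<mu>) (auto simp: has_weak_partial_def)
  note fd = fourier_coeff_dirac[OF int Sobolev_simps(2)[OF S[OF t]]]
  have "AE x in lebesgue. \<phi> t x = syn ?c x"
    using Sobolev_simps(1)[OF S[OF t]] syn_Sobolev[OF X(1) s_simps(3)]
    by (intro L2_eq_of_fourier_coeff_eq) (auto simp: Sobolev_iff)
  then have AE: "AE x in lebesgue. (- \<i>) *s (\<Sum>\<mu>\<in>UNIV. \<gamma> \<mu> *v D \<mu> t x) + m *\<^sub>R \<phi> t x = F (syn ?c x)"
    using eq[OF t] by eventually_elim simp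
  have "set_integrable lebesgue cell (\<lambda>x. F (syn ?c x))"
    using smooth_syn_CP[OF X(1) s_simps(3) F(1)] by (intro L2_set_integrable CP_L2)
  from fourier_coeff_cong_AE[OF fd(1) this AE, of k]
  have "(- \<i>) *s (\<Sum>\<mu>\<in>UNIV. \<gamma> \<mu> *v fourier_coeff (D \<mu> t) k) + m *\<^sub>R ?c k = comp_coeff F ?c k"
    unfolding fd(2) comp_coeff_def .
  then have "fourier_coeff (D None t) k = gen_symbol k (?c k) + comp_coeff source ?c k"
    unfolding comp_coeff_source[OF X(1)]
    using dirac_mode_equation[of "\<lambda>\<mu>. fourier_coeff (D \<mu> t) k" k "?c k"] fourier_coeff_weak_partial[OF Dj[OF t]] by blast
  then have cd: "coord (fourier_l2 (s - 1) (D None t)) k = wt (s - 1) k *\<^sub>R (gen_symbol k (?c k) + comp_coeff source ?c k)"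
    using Sobolev_simps(4)[OF D0t] by simp
  have "((\<lambda>t. (wt s k / wt (s - 1) k) *\<^sub>R coord (fourier_l2 (s - 1) (\<phi> t)) k) has_vector_derivative
      (wt s k / wt (s - 1) k) *\<^sub>R coord (fourier_l2 (s - 1) (D None t)) k) (at t)"
    by (intro bounded_linear.has_vector_derivative[OF bounded_linear_scaleR_right] bounded_linear.has_vector_derivative[OF bounded_linear_coord] der)
  moreover have "(wt s k / wt (s - 1) k) *\<^sub>R coord (fourier_l2 (s - 1) (D None t)) k = gen_symbol k (coord (X t) k) + coord (nonlin (X t)) k"
    using Sobolev_simps(4)[OF S[OF t], of k]
    by (simp add: cd coord_nemytskii[OF source_smooth(1)] X(2) X_def[symmetric] g_simps algebra_simps) (simp add: X_def g_simps)
  moreover have "(wt s k / wt (s - 1) k) *\<^sub>R coord (fourier_l2 (s - 1) (\<phi> u)) k = coord (X u) k" if "u \<in> ?I" for u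
    using Sobolev_simps(4)[OF S[OF that], of k] D0 that Sobolev_simps(4)[of "\<phi> u" "s - 1" k]
    by (simp add: X_def Sobolev_has_derivative_on_iff)
  ultimately show "((\<lambda>t. coord (X t) k) has_vector_derivative gen_symbol k (coord (X t) k) + coord (nonlin (X t)) k) (at t)"
    using has_vector_derivative_transform_within_open[of _ _ t ?I "\<lambda>t. coord (X t) k"] t by (metis (no_types, lifting) open_greaterThanLessThan)
qed

text \<open>Both sides of the equation are continuous periodic functions, hence in \<open>L\<^sup>2\<close>, and it is enough to
  compare their Fourier coefficients.\<close>

lemma solution_of_coordinates:
  assumes x: "continuous_on UNIV x" and \<psi>\<^sub>0: "\<psi>\<^sub>0 \<in> Sobolev s" "x 0 = fourier_l2 s \<psi>\<^sub>0"
    and d: "\<And>t k. t \<in> {-T<..<T} \<Longrightarrow> ((\<lambda>t. coord (x t) k) has_vector_derivative gen_symbol k (coord (x t) k) + coord (nonlin (x t)) k) (at t)"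
  shows "dirac_solution \<gamma> m F s T \<psi>\<^sub>0 (\<lambda>t. syn (dec s (x t)))"
proof -
  let ?I = "{-T<..<T}"
  define V where "V t = gen (x t) + emb (nonlin (x t))" for t
  define D where "D \<mu> t = (case \<mu> of None \<Rightarrow> syn (dec (s - 1) (V t)) | Some j \<Rightarrow> syn (dpart j (dec s (x t))))" for \<mu> t
  have nx: "continuous_on UNIV (\<lambda>t. nonlin (x t))"
    by (intro continuous_on_compose2[OF continuous_on_nemytskii[OF source_smooth(1), of UNIV] x]) auto
  have V: "continuous_on UNIV V" unfolding V_def
    by (intro continuous_intros bounded_linear.continuous_on[OF bounded_linear_gen x] bounded_linear.continuous_on[OF bounded_linear_emb nx])
  note S = syn_Sobolev[OF hs_dec s_simps(3)] and S1 = syn_Sobolev[OF hs_dec s_simps(5)] and S' = syn_Sobolev[OF hs_low s_simps(5)]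
  have "Sobolev_continuous_on s ?I (\<lambda>t. syn (dec s (x t)))"
    using continuous_on_subset[OF x] by (simp add: Sobolev_continuous_on_iff S)
  moreover have "Sobolev_has_derivative_on (s - 1) ?I (\<lambda>t. syn (dec s (x t))) (D None)"
  proof -
    have "((\<lambda>t. emb (x t)) has_vector_derivative V t) (at t)" if "t \<in> ?I" for t
      unfolding V_def
      by (rule emb_derivative[OF _ _ continuous_on_subset[OF x] continuous_on_subset[OF nx] d that]) auto
    then show ?thesis by (simp add: Sobolev_has_derivative_on_iff D_def S1 S' emb_def[symmetric])
  qed
  moreover have "Sobolev_continuous_on (s - 1) ?I (D None)"
    using continuous_on_subset[OF V] by (simp add: Sobolev_continuous_on_iff D_def S1)
  moreover have w: "has_weak_partial (syn (dec s (x t))) j (D (Some j) t)" for t j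
    unfolding D_def by (simp add: has_weak_partial_syn[OF hs_dec s_simps(4)])
  moreover have "AE y in lebesgue. (- \<i>) *s (\<Sum>\<mu>\<in>UNIV. \<gamma> \<mu> *v D \<mu> t y) + m *\<^sub>R syn (dec s (x t)) y = F (syn (dec s (x t)) y)" for t
  proof -
    let ?a = "dec s (x t)"
    have CPD: "D \<mu> t \<in> CP" for \<mu>
      by (cases \<mu>) (auto simp: D_def intro!: hs_syn_CP[OF hs_dec s_simps(5)] syn_CP syn_dpart(1)[OF hs_dec s_simps(4)])
    have int: "set_integrable lebesgue cell (D \<mu> t)" for \<mu> by (intro L2_set_integrable CP_L2 CPD)
    have u: "syn ?a \<in> CP" by (rule hs_syn_CP[OF hs_dec s_simps(3)])
    note fd = fourier_coeff_dirac[OF int L2_set_integrable[OF CP_L2[OF u]]]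
    show ?thesis
    proof (rule L2_eq_of_fourier_coeff_eq)
      have "(\<lambda>y. (- \<i>) *s (\<Sum>\<mu>\<in>UNIV. \<gamma> \<mu> *v D \<mu> t y)) \<in> CP"
        by (intro CP_vsmult CP_const CP_sum CP_compose[OF CPD] bounded_linear.continuous_on[OF bounded_linear_matrix_vector_mult] continuous_intros)
      then show "(\<lambda>y. (- \<i>) *s (\<Sum>\<mu>\<in>UNIV. \<gamma> \<mu> *v D \<mu> t y) + m *\<^sub>R syn ?a y) \<in> L2"
        by (intro CP_L2 CP_add CP_scaleR CP_const u)
      show "(\<lambda>y. F (syn ?a y)) \<in> L2" by (intro CP_L2 smooth_syn_CP[OF hs_dec s_simps(3) F(1)])
      fix k
      have "fourier_coeff (D None t) k = gen_symbol k (?a k) + \<i> *s (\<gamma> None *v comp_coeff F ?a k)"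
        unfolding comp_coeff_source[OF hs_dec, symmetric] D_def option.case S1(3) by (simp add: V_def dec_simps dec_gen dec_emb dec_nemytskii[OF source_smooth(1)])
      moreover have "fourier_coeff (D (Some j) t) k = (\<i> * of_int (k $ j)) *s ?a k" for j
        using fourier_coeff_weak_partial[OF w] by (simp add: S(3))
      ultimately have "(- \<i>) *s (\<Sum>\<mu>\<in>UNIV. \<gamma> \<mu> *v fourier_coeff (D \<mu> t) k) + m *\<^sub>R ?a k = comp_coeff F ?a k"
        by (intro dirac_mode_equation[where d = "\<lambda>\<mu>. fourier_coeff (D \<mu> t) k" and k = k, THEN iffD2]; blast)
      then show "fourier_coeff (\<lambda>y. (- \<i>) *s (\<Sum>\<mu>\<in>UNIV. \<gamma> \<mu> *v D \<mu> t y) + m *\<^sub>R syn ?a y) k = fourier_coeff (\<lambda>y. F (syn ?a y)) k"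
        unfolding fd(2) S(3) comp_coeff_def .
    qed
  qed
  moreover have "AE y in lebesgue. syn (dec s (x 0)) y = \<psi>\<^sub>0 y"
    by (rule L2_eq_of_fourier_coeff_eq[OF Sobolev_simps(1)[OF S(1)] Sobolev_simps(1)[OF \<psi>\<^sub>0(1)]])
      (simp only: syn_Sobolev(3)[OF Sobolev_simps(3)[OF \<psi>\<^sub>0(1)] s_simps(3)] \<psi>\<^sub>0(2) Sobolev_simps(5)[OF \<psi>\<^sub>0(1)])
  ultimately show ?thesis unfolding dirac_solution_def by blast
qed

lemma long_time_dirac:
  "\<exists>\<epsilon>\<^sub>0>0. \<exists>c>0. \<forall>\<epsilon>\<in>{0<..\<epsilon>\<^sub>0}. \<exists>T. T \<ge> c * \<epsilon> powi (- 2) \<and>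
    (\<forall>\<psi>\<^sub>0. \<psi>\<^sub>0 \<in> Sobolev s \<and> Sobolev_norm s \<psi>\<^sub>0 \<le> \<epsilon> \<longrightarrow>
      (\<exists>\<psi>. dirac_solution \<gamma> m F s T \<psi>\<^sub>0 \<psi> \<and>
        (\<forall>\<phi>. dirac_solution \<gamma> m F s T \<psi>\<^sub>0 \<phi> \<longrightarrow> (\<forall>t\<in>{-T<..<T}. AE x in lebesgue. \<phi> t x = \<psi> t x))))"
proof -
  obtain \<epsilon>\<^sub>0 c where c: "\<epsilon>\<^sub>0 > 0" "c > 0" and main: "\<And>\<epsilon> b0. \<epsilon> \<in> {0<..\<epsilon>\<^sub>0} \<Longrightarrow> norm b0 \<le> \<epsilon> \<Longrightarrow>
      \<exists>b. b 0 = b0 \<and> continuous_on UNIV b \<and> (\<forall>t. \<bar>t\<bar> \<le> c / \<epsilon>\<^sup>2 \<longrightarrow> (b has_vector_derivative flow (- t) (nonlin (flow t (b t)))) (at t))"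
    using long_time_solution by blast
  have "\<exists>\<psi>. dirac_solution \<gamma> m F s (c / \<epsilon>\<^sup>2) \<psi>\<^sub>0 \<psi> \<and>
        (\<forall>\<phi>. dirac_solution \<gamma> m F s (c / \<epsilon>\<^sup>2) \<psi>\<^sub>0 \<phi> \<longrightarrow> (\<forall>t\<in>{- (c / \<epsilon>\<^sup>2)<..<c / \<epsilon>\<^sup>2}. AE x in lebesgue. \<phi> t x = \<psi> t x))"
    if \<epsilon>: "\<epsilon> \<in> {0<..\<epsilon>\<^sub>0}" and \<psi>\<^sub>0: "\<psi>\<^sub>0 \<in> Sobolev s" "Sobolev_norm s \<psi>\<^sub>0 \<le> \<epsilon>" for \<epsilon> \<psi>\<^sub>0
  proof -
    define T where "T = c / \<epsilon>\<^sup>2"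
    have T: "T > 0" using \<epsilon> c by (simp add: T_def)
    have "norm (fourier_l2 s \<psi>\<^sub>0) \<le> \<epsilon>" using \<psi>\<^sub>0 by (simp add: Sobolev_norm_eq[symmetric] Sobolev_simps(3))
    from main[OF \<epsilon> this] obtain b where b: "b 0 = fourier_l2 s \<psi>\<^sub>0" "continuous_on UNIV b"
      "\<And>t. \<bar>t\<bar> \<le> T \<Longrightarrow> (b has_vector_derivative flow (- t) (nonlin (flow t (b t)))) (at t)"
      unfolding T_def by blast
    define x where "x t = flow t (b t)" for t
    have x: "continuous_on UNIV x" unfolding x_def by (intro flow_continuous_compose continuous_intros b)
    have d: "((\<lambda>t. coord (x t) k) has_vector_derivative gen_symbol k (coord (x t) k) + coord (nonlin (x t)) k) (at t)"
      if "t \<in> {-T<..<T}" for t k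
    proof -
      have "((\<lambda>t. coord (b t) k) has_vector_derivative coord (flow (- t) (nonlin (x t))) k) (at t)"
        unfolding x_def by (rule bounded_linear.has_vector_derivative[OF bounded_linear_coord b(3)]) (use that in auto)
      from U_has_vector_derivative[OF this, of k] show ?thesis by (simp add: x_def coord_flow add.commute)
    qed
    have sol: "dirac_solution \<gamma> m F s T \<psi>\<^sub>0 (\<lambda>t. syn (dec s (x t)))"
      by (rule solution_of_coordinates[OF x \<psi>\<^sub>0(1) _ d]) (simp add: x_def b(1))
    have "AE y in lebesgue. \<phi> t y = syn (dec s (x t)) y" if \<phi>: "dirac_solution \<gamma> m F s T \<psi>\<^sub>0 \<phi>" and t: "t \<in> {-T<..<T}" for \<phi> t
    proof -
      note 1 = solution_coordinates[OF \<phi> T \<psi>\<^sub>0(1)] and 2 = solution_coordinates[OF sol T \<psi>\<^sub>0(1)]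
      have e: "fourier_l2 s (\<phi> t) = fourier_l2 s (syn (dec s (x t)))"
        by (rule coordinate_solution_unique[OF 1(1,3) 2(1,3) _ t]) (simp_all add: 1(2) 2(2))
      show ?thesis
        using Sobolev_simps(1,5)[OF 1(4)[OF t]] Sobolev_simps(1,5)[OF 2(4)[OF t]] e by (intro L2_eq_of_fourier_coeff_eq) auto
    qed
    then show ?thesis using sol unfolding T_def by blast
  qed
  moreover have "c * \<epsilon> powi (- 2) \<le> c / \<epsilon>\<^sup>2" for \<epsilon> :: real by (simp add: power_int_minus divide_inverse)
  ultimately show ?thesis using c by meson
qed

end

theorem theorem1p1:
  fixes \<gamma> :: "'d::finite option \<Rightarrow> complex ^ 'n::finite ^ 'n"
    and F :: "complex ^ 'n \<Rightarrow> complex ^ 'n"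
    and m s :: real
  assumes "CARD('n) = 2 ^ ((CARD('d) + 1) div 2)"
    and "dirac_matrices \<gamma>"
    and "m > 0"
    and "smooth F"
    and "F 0 = 0" and "(F has_derivative (\<lambda>h. 0)) (at 0)"
    and "s > 9 / 2 * real CARD('d) + 9"
  shows "\<exists>\<epsilon>\<^sub>0 > 0. \<exists>c > 0. \<forall>\<epsilon>\<in>{0<..\<epsilon>\<^sub>0}. \<exists>T. T \<ge> c * \<epsilon> powi (- 2) \<and>
    (\<forall>\<psi>\<^sub>0 :: real ^ 'd \<Rightarrow> complex ^ 'n. \<psi>\<^sub>0 \<in> Sobolev s \<and> Sobolev_norm s \<psi>\<^sub>0 \<le> \<epsilon> \<longrightarrow>
      (\<exists>\<psi>. dirac_solution \<gamma> m F s T \<psi>\<^sub>0 \<psi> \<and>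
        (\<forall>\<phi>. dirac_solution \<gamma> m F s T \<psi>\<^sub>0 \<phi> \<longrightarrow>
          (\<forall>t\<in>{-T<..<T}. AE x in lebesgue. \<phi> t x = \<psi> t x))))"
proof -
  have "2 * real CARD('d) + 2 \<le> s" using assms(7) by simp
  then interpret dirac_system \<gamma> m F s using assms(2-6) by unfold_locales
  show ?thesis by (rule long_time_dirac)
qed

end
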